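(* There exist a constant $\hat C>0$ and a family of constants $\hat\varepsilon_\delta>0$ ($0<\delta<2$) such that for all $\delta\in(0,2)$ and $0<\varepsilon<\hat\varepsilon_\delta$ $$\mathbb E\sup_{s\in[0,T]}\Upsilon^\varepsilon_s\le\hat C\Big(r\varepsilon^\delta\ln\Big(\frac{2T}{r\varepsilon^\delta}\Big)\Big)^{1/2},$$ and, with these constants, there exist two families of constants $\varepsilon_{a,C_{\mathfrak e},1}>0$, $\varepsilon_{a,C_{\mathfrak e},2}>0$ ($a\in[0,1)$, $C_{\mathfrak e}>0$) such that, given $C_{\mathfrak e}>0$, $a\in[0,1)$ and $\delta\in(2a,2)$, for all $0<\varepsilon<\min\{\hat\varepsilon_\delta,\varepsilon_{a,C_{\mathfrak e},1},\varepsilon_{a,C_{\mathfrak e},2}\}$ $$\mathbb P\Big[\sup_{t\in[0,T\wedge\mathfrak e^\varepsilon]}\alpha^\varepsilon_t\le\varepsilon^{a/2}\Big]\ge1-\hat C\varepsilon^{-a}\sqrt{r\varepsilon^\delta\ln\Big(\frac{T}{r\varepsilon^\delta}\Big)}=:p_\varepsilon,\qquad p_\varepsilon\to1\text{ as }\varepsilon\to0.$$ Here, for $a>0$ and as $C_{\mathfrak e}\to\infty$, $\varepsilon_{a,C_{\mathfrak e},1}$ is of the order $O\big(\min\{C_{\mathfrak e}^{-3/(2-a)},C_{\mathfrak e}^{-3/(2a)}\}\big)$ and $\varepsilon_{a,C_{\mathfrak e},2}$ is of the order $O\big(\exp(-30C_{\mathfrak e}^2T/a)\big)$.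
   Context: Equation. Let $r>0$ and $T>0$ be fixed and let $\mathcal C=C([-r,0];\mathbb R)$ with the sup norm $\|\cdot\|$; $\|\cdot\|_2$ is the Euclidean norm on $\mathbb R^2$. For $\varepsilon>0$ and a continuous function $f$ on $[-\varepsilon^2r,T]$ let $\Pi^\varepsilon_tf\in\mathcal C$ be $(\Pi^\varepsilon_tf)(\theta)=f(t+\varepsilon^2\theta)$. Let $L_0:\mathcal C\to\mathbb R$ be bounded linear, and assume that the characteristic equation $\lambda-L_0(e^{\lambda\,\cdot})=0$ has exactly two roots (counted with multiplicity) on the imaginary axis, $\pm i\omega_c$ with $\omega_c>0$, and that all other roots have negative real parts. Let $G(\eta)=\int_{-r}^0\eta(\theta)d\nu_1(\theta)+\int_{-r}^0\eta^3(\theta)d\nu_3(\theta)$, where $\nu_1,\nu_3:[-r,0]\to\mathbb R$ are functions of bounded variation, continuous from the left on $(-r,0)$, with $\nu_i(0)=0$. Let $\sigma\in\mathbb R$, $W$ a one-dimensional Wiener process, $\xi\in\mathcal C$ deterministic. $X^\varepsilon$ is the solution of $dX^\varepsilon(t)=\varepsilon^{-2}L_0(\Pi^\varepsilon_tX^\varepsilon)dt+G(\Pi^\varepsilon_tX^\varepsilon)dt+\sigma dW(t)$ for $t\in[0,T]$, $X^\varepsilon(t)=\xi(\varepsilon^{-2}t)$ for $t\in[-\varepsilon^2r,0]$. Splitting. Let $\hat{\mathcal C}$ be the space of bounded measurable functions $[-r,0]\to\mathbb R$ with sup norm; $L_0$ is extended to $\hat{\mathcal C}$ via its Riesz representation as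 integration against a finite signed measure. For $\phi\in\hat{\mathcal C}$, $\hat T(t)\phi\in\hat{\mathcal C}$ is $\theta\mapsto x(t+\theta)$, where $x=\phi$ on $[-r,0]$ and $x(t)=\phi(0)+\int_0^tL_0(x(s+\cdot))ds$ for $t\ge0$. Put $\Phi_1(\theta)=\cos(\omega_c\theta)$, $\Phi_2(\theta)=\sin(\omega_c\theta)$, $\Phi=[\Phi_1,\Phi_2]$, $\Phi v=v_1\Phi_1+v_2\Phi_2$ for $v\in\mathbb R^2$, $P=\mathrm{span}\{\Phi_1,\Phi_2\}$, $B=\begin{pmatrix}0&\omega_c\\-\omega_c&0\end{pmatrix}$. Then $\hat{\mathcal C}=P\oplus\hat Q$, where $\hat Q$ is the $\hat T$-invariant set of $\phi$ with $\hat T(t)\phi\to0$ as $t\to\infty$; $\hat\pi$ is the projection onto $P$ along $\hat Q$ and $\pi$ its restriction to $\mathcal C$. With $\mathbf 1_{\{0\}}$ the indicator function of $\{0\}$ on $[-r,0]$, $\tilde\Psi\in\mathbb R^2$ is defined by $\hat\pi\mathbf 1_{\{0\}}=\Phi\tilde\Psi$. Processes. Write $\Pi^\varepsilon_tX^\varepsilon=\Phi z^\varepsilon_t+y^\varepsilon_t$ with $\Phi z^\varepsilon_t=\pi\Pi^\varepsilon_tX^\varepsilon$, $y^\varepsilon_t=(1-\pi)\Pi^\varepsilon_tX^\varepsilon$; $\mathfrak Y^\varepsilon_t=\hat T(t/\varepsilon^2)y^\varepsilon_0$; $\mathfrak z^\varepsilon_t=e^{-tB/\varepsilon^2}z^\varepsilon_t$.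 The process $\widehat{\mathfrak z}^\varepsilon$ in $\mathbb R^2$ solves $d\widehat{\mathfrak z}^\varepsilon_t=e^{-tB/\varepsilon^2}\tilde\Psi\,G(\Phi e^{tB/\varepsilon^2}\widehat{\mathfrak z}^\varepsilon_t+\mathfrak Y^\varepsilon_t)dt+e^{-tB/\varepsilon^2}\tilde\Psi\sigma dW_t$, $\widehat{\mathfrak z}^\varepsilon_0=z^\varepsilon_0$. Put $\alpha^\varepsilon_t=\frac12\|\mathfrak z^\varepsilon_t-\widehat{\mathfrak z}^\varepsilon_t\|_2^2$, and $\Upsilon^\varepsilon_s=\sup_{\theta\in[-r,0]}\big|\int_0^s\big(\hat T(\tfrac{s-u}{\varepsilon^2})(1-\hat\pi)\mathbf 1_{\{0\}}\big)(\theta)\,\sigma dW_u\big|$. For a constant $C_{\mathfrak e}>0$ the stopping time is $\mathfrak e^\varepsilon=\inf\{t\ge0:\|\pi\Pi^\varepsilon_tX^\varepsilon\|\ge C_{\mathfrak e}\}$. Constants may depend on $T$ and on the data ($r,L_0,\nu_1,\nu_3,\sigma,\xi$) but not on $\varepsilon$; $\hat C,\hat\varepsilon_\delta$ do not depend on $C_{\mathfrak e}$ or $a$. *)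

theory Defs
  imports "HOL-Probability.Probability" "HOL-Complex_Analysis.Complex_Analysis"
    "HOL-Library.Landau_Symbols"
begin

section \<open>Function spaces on \<open>[-r,0]\<close>\<close>

text \<open>
  Functions on \<open>[-r,0]\<close> are represented by functions on the whole real line of which only the
  values on \<open>{-r..0}\<close> matter.
\<close>

definition Cspace :: "real \<Rightarrow> (real \<Rightarrow> real) set" where
  "Cspace r = {\<eta>. continuous_on {-r..0} \<eta>}"

definition Chat_space :: "real \<Rightarrow> (real \<Rightarrow> real) set" where
  "Chat_space r = {\<phi>. \<phi> \<in> borel_measurable (restrict_space borel {-r..0}) \<and> bounded (\<phi> ` {-r..0})}"

definition sup_norm :: "real \<Rightarrow> (real \<Rightarrow> real) \<Rightarrow> real" where
  "sup_norm r \<phi> = (SUP \<theta>\<in>{-r..0}. \<bar>\<phi> \<theta>\<bar>)"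

text \<open>
  The bound forces \<open>L \<eta>\<close> to depend only on the restriction of \<open>\<eta>\<close> to \<open>{-r..0}\<close>.
\<close>

definition bounded_linear_on_C :: "real \<Rightarrow> ((real \<Rightarrow> real) \<Rightarrow> real) \<Rightarrow> bool" where
  "bounded_linear_on_C r L \<longleftrightarrow>
     (\<forall>\<eta>\<in>Cspace r. \<forall>\<zeta>\<in>Cspace r. L (\<lambda>\<theta>. \<eta> \<theta> + \<zeta> \<theta>) = L \<eta> + L \<zeta>) \<and>
     (\<forall>c. \<forall>\<eta>\<in>Cspace r. L (\<lambda>\<theta>. c * \<eta> \<theta>) = c * L \<eta>) \<and>
     (\<exists>K. \<forall>\<eta>\<in>Cspace r. \<bar>L \<eta>\<bar> \<le> K * sup_norm r \<eta>)"

text \<open>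
  The finite signed measure representing \<open>L\<close> is given as a difference of two finite (positive)
  Borel measures on \<open>[-r,0]\<close>; the extension to bounded measurable functions does not depend on
  the choice of this decomposition.
\<close>

definition riesz_pair ::
    "real \<Rightarrow> ((real \<Rightarrow> real) \<Rightarrow> real) \<Rightarrow> real measure \<Rightarrow> real measure \<Rightarrow> bool" where
  "riesz_pair r L \<mu> \<mu>' \<longleftrightarrow>
     finite_measure \<mu> \<and> finite_measure \<mu>' \<and>
     sets \<mu> = sets (restrict_space borel {-r..0}) \<and>
     sets \<mu>' = sets (restrict_space borel {-r..0}) \<and>
     (\<forall>\<eta>\<in>Cspace r. L \<eta> = (LINT \<theta>|\<mu>. \<eta> \<theta>) - (LINT \<theta>|\<mu>'. \<eta> \<theta>))"

definition L_ext :: "real \<Rightarrow> ((real \<Rightarrow> real) \<Rightarrow> real) \<Rightarrow> (real \<Rightarrow> real) \<Rightarrow> real" where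
  "L_ext r L \<phi> =
     (THE x. \<exists>\<mu> \<mu>'. riesz_pair r L \<mu> \<mu>' \<and> x = (LINT \<theta>|\<mu>. \<phi> \<theta>) - (LINT \<theta>|\<mu>'. \<phi> \<theta>))"

section \<open>The characteristic equation\<close>

definition char_fun :: "((real \<Rightarrow> real) \<Rightarrow> real) \<Rightarrow> complex \<Rightarrow> complex" where
  "char_fun L \<zeta> =
     \<zeta> - Complex (L (\<lambda>\<theta>. Re (exp (\<zeta> * of_real \<theta>)))) (L (\<lambda>\<theta>. Im (exp (\<zeta> * of_real \<theta>))))"

definition char_condition :: "((real \<Rightarrow> real) \<Rightarrow> real) \<Rightarrow> real \<Rightarrow> bool" where
  "char_condition L \<omega> \<longleftrightarrow>
     {\<zeta>. char_fun L \<zeta> = 0 \<and> Re \<zeta> = 0} = {\<i> * of_real \<omega>, - \<i> * of_real \<omega>} \<and>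
     zorder (char_fun L) (\<i> * of_real \<omega>) = 1 \<and>
     zorder (char_fun L) (- \<i> * of_real \<omega>) = 1 \<and>
     (\<forall>\<zeta>. char_fun L \<zeta> = 0 \<and> \<zeta> \<noteq> \<i> * of_real \<omega> \<and> \<zeta> \<noteq> - \<i> * of_real \<omega> \<longrightarrow> Re \<zeta> < 0)"

section \<open>The nonlinearity\<close>

definition bounded_variation_on :: "real \<Rightarrow> real \<Rightarrow> (real \<Rightarrow> real) \<Rightarrow> bool" where
  "bounded_variation_on a b g \<longleftrightarrow>
     (\<exists>V. \<forall>d. d division_of {a..b} \<longrightarrow> (\<Sum>k\<in>d. \<bar>g (Sup k) - g (Inf k)\<bar>) \<le> V)"

definition integrator :: "real \<Rightarrow> (real \<Rightarrow> real) \<Rightarrow> bool" where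
  "integrator r \<nu> \<longleftrightarrow>
     bounded_variation_on (-r) 0 \<nu> \<and>
     (\<forall>\<theta>\<in>{-r<..<0}. continuous (at_left \<theta>) \<nu>) \<and> \<nu> 0 = 0"

text \<open>Riemann--Stieltjes integral: the gauge is constant, so fineness bounds the mesh.\<close>

definition has_rs_integral ::
    "real \<Rightarrow> real \<Rightarrow> (real \<Rightarrow> real) \<Rightarrow> (real \<Rightarrow> real) \<Rightarrow> real \<Rightarrow> bool" where
  "has_rs_integral a b f g I \<longleftrightarrow>
     (\<forall>e>0. \<exists>d>0. \<forall>p. p tagged_division_of {a..b} \<and> (\<lambda>x. ball x d) fine p \<longrightarrow>
        \<bar>(\<Sum>(x, k)\<in>p. f x * (g (Sup k) - g (Inf k))) - I\<bar> < e)"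

definition rs_integral :: "real \<Rightarrow> real \<Rightarrow> (real \<Rightarrow> real) \<Rightarrow> (real \<Rightarrow> real) \<Rightarrow> real" where
  "rs_integral a b f g = (THE I. has_rs_integral a b f g I)"

definition Gfun :: "real \<Rightarrow> (real \<Rightarrow> real) \<Rightarrow> (real \<Rightarrow> real) \<Rightarrow> (real \<Rightarrow> real) \<Rightarrow> real" where
  "Gfun r \<nu>1 \<nu>3 \<eta> =
     rs_integral (-r) 0 \<eta> \<nu>1 + rs_integral (-r) 0 (\<lambda>\<theta>. (\<eta> \<theta>) ^ 3) \<nu>3"

section \<open>The linear semigroup and the splitting\<close>

text \<open>
  The solution is determined by \<open>\<phi>\<close> on \<open>{-r..}\<close>, the only part that enters \<open>That\<close>.  The second
  clause makes it continuous on \<open>{0..}\<close>.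
\<close>

definition delay_solution ::
    "real \<Rightarrow> ((real \<Rightarrow> real) \<Rightarrow> real) \<Rightarrow> (real \<Rightarrow> real) \<Rightarrow> (real \<Rightarrow> real) \<Rightarrow> bool" where
  "delay_solution r L \<phi> x \<longleftrightarrow>
     (\<forall>\<theta>\<in>{-r..0}. x \<theta> = \<phi> \<theta>) \<and>
     (\<forall>t\<ge>0. ((\<lambda>s. L_ext r L (\<lambda>\<theta>. x (s + \<theta>))) has_integral (x t - \<phi> 0)) {0..t})"

definition That ::
    "real \<Rightarrow> ((real \<Rightarrow> real) \<Rightarrow> real) \<Rightarrow> real \<Rightarrow> (real \<Rightarrow> real) \<Rightarrow> real \<Rightarrow> real" where
  "That r L t \<phi> = (\<lambda>\<theta>. (SOME x. delay_solution r L \<phi> x) (t + \<theta>))"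

definition Phi :: "real \<Rightarrow> real^2 \<Rightarrow> real \<Rightarrow> real" where
  "Phi \<omega> v = (\<lambda>\<theta>. v $ 1 * cos (\<omega> * \<theta>) + v $ 2 * sin (\<omega> * \<theta>))"

definition Pspace :: "real \<Rightarrow> (real \<Rightarrow> real) set" where
  "Pspace \<omega> = range (Phi \<omega>)"

definition Qhat :: "real \<Rightarrow> ((real \<Rightarrow> real) \<Rightarrow> real) \<Rightarrow> (real \<Rightarrow> real) set" where
  "Qhat r L = {\<phi> \<in> Chat_space r. ((\<lambda>t. sup_norm r (That r L t \<phi>)) \<longlongrightarrow> 0) at_top}"

definition pihat ::
    "real \<Rightarrow> ((real \<Rightarrow> real) \<Rightarrow> real) \<Rightarrow> real \<Rightarrow> (real \<Rightarrow> real) \<Rightarrow> real \<Rightarrow> real" where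
  "pihat r L \<omega> \<phi> = (THE p. p \<in> Pspace \<omega> \<and> (\<lambda>\<theta>. \<phi> \<theta> - p \<theta>) \<in> Qhat r L)"

definition one_minus_pihat ::
    "real \<Rightarrow> ((real \<Rightarrow> real) \<Rightarrow> real) \<Rightarrow> real \<Rightarrow> (real \<Rightarrow> real) \<Rightarrow> real \<Rightarrow> real" where
  "one_minus_pihat r L \<omega> \<phi> = (\<lambda>\<theta>. \<phi> \<theta> - pihat r L \<omega> \<phi> \<theta>)"

definition P_coords ::
    "real \<Rightarrow> ((real \<Rightarrow> real) \<Rightarrow> real) \<Rightarrow> real \<Rightarrow> (real \<Rightarrow> real) \<Rightarrow> real^2" where
  "P_coords r L \<omega> \<phi> = (THE v. pihat r L \<omega> \<phi> = Phi \<omega> v)"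

definition Psi_tilde :: "real \<Rightarrow> ((real \<Rightarrow> real) \<Rightarrow> real) \<Rightarrow> real \<Rightarrow> real^2" where
  "Psi_tilde r L \<omega> = P_coords r L \<omega> (indicator {0})"

definition Bmat :: "real \<Rightarrow> real^2^2" where
  "Bmat \<omega> = vector [vector [0, \<omega>], vector [-\<omega>, 0]]"

definition mat_exp :: "real^'n^'n \<Rightarrow> real^'n^'n" where
  "mat_exp A = (\<Sum>n. (1 / fact n) *\<^sub>R ((\<lambda>M. A ** M) ^^ n) (mat 1))"

definition exp_tB :: "real \<Rightarrow> real \<Rightarrow> real^2^2" where
  "exp_tB \<omega> t = mat_exp (t *\<^sub>R Bmat \<omega>)"

section \<open>Wiener process and Wiener integral\<close>

locale wiener_process = prob_space M + filtration "space M" F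
  for M :: "'a measure" and F :: "real \<Rightarrow> 'a measure" +
  fixes W :: "real \<Rightarrow> 'a \<Rightarrow> real"
  assumes sub_F: "\<And>t. sets (F t) \<subseteq> sets M"
    and adapted: "\<And>t. 0 \<le> t \<Longrightarrow> W t \<in> borel_measurable (F t)"
    and start: "AE w in M. W 0 w = 0"
    and continuous_paths: "AE w in M. continuous_on {0..} (\<lambda>t. W t w)"
    and increment_distr: "\<And>s t. 0 \<le> s \<Longrightarrow> s < t \<Longrightarrow>
      distributed M lborel (\<lambda>w. W t w - W s w) (normal_density 0 (sqrt (t - s)))"
    and increment_indep: "\<And>s t. 0 \<le> s \<Longrightarrow> s < t \<Longrightarrow>
      indep_set (sets (F s)) (sets (vimage_algebra (space M) (\<lambda>w. W t w - W s w) borel))"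

text \<open>
  All stochastic integrals needed have deterministic integrands.  \<open>I\<close> is a version of
  \<open>\<integral>\<^sub>0\<^sup>s h dW\<close> if it is an \<open>L\<^sup>2(M)\<close>-limit of the elementary integrals of step functions converging
  to \<open>h\<close> in \<open>L\<^sup>2[0,s]\<close>; this determines \<open>I\<close> almost surely.
\<close>

definition step_partition :: "real \<Rightarrow> nat \<Rightarrow> (nat \<Rightarrow> real) \<Rightarrow> bool" where
  "step_partition s n t \<longleftrightarrow> t 0 = 0 \<and> t n = s \<and> (\<forall>i<n. t i \<le> t (Suc i))"

definition step_fun :: "nat \<Rightarrow> (nat \<Rightarrow> real) \<Rightarrow> (nat \<Rightarrow> real) \<Rightarrow> real \<Rightarrow> real" where
  "step_fun n t c u = (\<Sum>i<n. c i * indicator {t i<..t (Suc i)} u)"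

definition step_integral ::
    "(real \<Rightarrow> 'a \<Rightarrow> real) \<Rightarrow> nat \<Rightarrow> (nat \<Rightarrow> real) \<Rightarrow> (nat \<Rightarrow> real) \<Rightarrow> 'a \<Rightarrow> real" where
  "step_integral W n t c w = (\<Sum>i<n. c i * (W (t (Suc i)) w - W (t i) w))"

definition has_wiener_integral ::
    "'a measure \<Rightarrow> (real \<Rightarrow> 'a \<Rightarrow> real) \<Rightarrow> (real \<Rightarrow> real) \<Rightarrow> real \<Rightarrow> ('a \<Rightarrow> real) \<Rightarrow> bool" where
  "has_wiener_integral M W h s I \<longleftrightarrow>
     set_borel_measurable lborel {0..s} h \<and> I \<in> borel_measurable M \<and>
     (\<exists>n t c. (\<forall>k. step_partition s (n k) (t k)) \<and>
        ((\<lambda>k. \<integral>\<^sup>+u\<in>{0..s}. ennreal ((h u - step_fun (n k) (t k) (c k) u)\<^sup>2) \<partial>lborel)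
           \<longlonglongrightarrow> 0) \<and>
        ((\<lambda>k. \<integral>\<^sup>+w. ennreal ((I w - step_integral W (n k) (t k) (c k) w)\<^sup>2) \<partial>M) \<longlonglongrightarrow> 0))"

section \<open>The processes\<close>

definition Pi_seg :: "real \<Rightarrow> real \<Rightarrow> (real \<Rightarrow> real) \<Rightarrow> real \<Rightarrow> real" where
  "Pi_seg \<epsilon> t f = (\<lambda>\<theta>. f (t + \<epsilon>\<^sup>2 * \<theta>))"

text \<open>
  \<open>F t\<close> at negative times plays no role: the initial segment is required to be \<open>F 0\<close>-measurable.
\<close>

definition X_solution ::
    "'a measure \<Rightarrow> (real \<Rightarrow> 'a measure) \<Rightarrow> (real \<Rightarrow> 'a \<Rightarrow> real) \<Rightarrow> real \<Rightarrow> real \<Rightarrow>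
     ((real \<Rightarrow> real) \<Rightarrow> real) \<Rightarrow> (real \<Rightarrow> real) \<Rightarrow> (real \<Rightarrow> real) \<Rightarrow> real \<Rightarrow> (real \<Rightarrow> real) \<Rightarrow> real \<Rightarrow>
     (real \<Rightarrow> 'a \<Rightarrow> real) \<Rightarrow> bool" where
  "X_solution M F W r T L \<nu>1 \<nu>3 \<sigma> \<xi> \<epsilon> X \<longleftrightarrow>
     (\<forall>t\<in>{-(\<epsilon>\<^sup>2 * r)..T}. X t \<in> borel_measurable (F (max 0 t))) \<and>
     (\<forall>w\<in>space M. continuous_on {-(\<epsilon>\<^sup>2 * r)..T} (\<lambda>t. X t w)) \<and>
     (AE w in M.
        (\<forall>t\<in>{-(\<epsilon>\<^sup>2 * r)..0}. X t w = \<xi> (t / \<epsilon>\<^sup>2)) \<and>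
        (\<forall>t\<in>{0..T}.
           ((\<lambda>s. (1 / \<epsilon>\<^sup>2) * L (Pi_seg \<epsilon> s (\<lambda>u. X u w)) + Gfun r \<nu>1 \<nu>3 (Pi_seg \<epsilon> s (\<lambda>u. X u w)))
              has_integral (X t w - X 0 w - \<sigma> * W t w)) {0..t}))"

definition z_coord ::
    "real \<Rightarrow> ((real \<Rightarrow> real) \<Rightarrow> real) \<Rightarrow> real \<Rightarrow> real \<Rightarrow> (real \<Rightarrow> real) \<Rightarrow> real \<Rightarrow> real^2" where
  "z_coord r L \<omega> \<epsilon> x t = P_coords r L \<omega> (Pi_seg \<epsilon> t x)"

definition y_part ::
    "real \<Rightarrow> ((real \<Rightarrow> real) \<Rightarrow> real) \<Rightarrow> real \<Rightarrow> real \<Rightarrow> (real \<Rightarrow> real) \<Rightarrow> real \<Rightarrow> real \<Rightarrow> real" where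
  "y_part r L \<omega> \<epsilon> x t = one_minus_pihat r L \<omega> (Pi_seg \<epsilon> t x)"

definition Y_frak ::
    "real \<Rightarrow> ((real \<Rightarrow> real) \<Rightarrow> real) \<Rightarrow> real \<Rightarrow> real \<Rightarrow> (real \<Rightarrow> real) \<Rightarrow> real \<Rightarrow> real \<Rightarrow> real" where
  "Y_frak r L \<omega> \<epsilon> x t = That r L (t / \<epsilon>\<^sup>2) (y_part r L \<omega> \<epsilon> x 0)"

definition z_frak ::
    "real \<Rightarrow> ((real \<Rightarrow> real) \<Rightarrow> real) \<Rightarrow> real \<Rightarrow> real \<Rightarrow> (real \<Rightarrow> real) \<Rightarrow> real \<Rightarrow> real^2" where
  "z_frak r L \<omega> \<epsilon> x t = exp_tB \<omega> (- t / \<epsilon>\<^sup>2) *v z_coord r L \<omega> \<epsilon> x t"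

text \<open>\<open>N t\<close> is the stochastic integral of \<open>exp(-sB/\<epsilon>\<^sup>2) \<Psi> \<sigma>\<close> over \<open>[0,t]\<close>, taken componentwise.\<close>

definition zhat_solution ::
    "'a measure \<Rightarrow> (real \<Rightarrow> 'a measure) \<Rightarrow> (real \<Rightarrow> 'a \<Rightarrow> real) \<Rightarrow> real \<Rightarrow> real \<Rightarrow>
     ((real \<Rightarrow> real) \<Rightarrow> real) \<Rightarrow> real \<Rightarrow> (real \<Rightarrow> real) \<Rightarrow> (real \<Rightarrow> real) \<Rightarrow> real \<Rightarrow> real \<Rightarrow>
     (real \<Rightarrow> 'a \<Rightarrow> real) \<Rightarrow> (real \<Rightarrow> 'a \<Rightarrow> real^2) \<Rightarrow> bool" where
  "zhat_solution M F W r T L \<omega> \<nu>1 \<nu>3 \<sigma> \<epsilon> X zh \<longleftrightarrow>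
     (\<forall>t\<in>{0..T}. zh t \<in> borel_measurable (F t)) \<and>
     (\<forall>w\<in>space M. continuous_on {0..T} (\<lambda>t. zh t w)) \<and>
     (AE w in M. zh 0 w = z_coord r L \<omega> \<epsilon> (\<lambda>u. X u w) 0) \<and>
     (\<exists>N :: real \<Rightarrow> 'a \<Rightarrow> real^2.
        (\<forall>t\<in>{0..T}. \<forall>i. has_wiener_integral M W
           (\<lambda>s. (exp_tB \<omega> (- s / \<epsilon>\<^sup>2) *v (\<sigma> *\<^sub>R Psi_tilde r L \<omega>)) $ i) t (\<lambda>w. N t w $ i)) \<and>
        (AE w in M. \<forall>t\<in>{0..T}.
           ((\<lambda>s. Gfun r \<nu>1 \<nu>3 (\<lambda>\<theta>. Phi \<omega> (exp_tB \<omega> (s / \<epsilon>\<^sup>2) *v zh s w) \<theta>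
                                   + Y_frak r L \<omega> \<epsilon> (\<lambda>u. X u w) s \<theta>)
                   *\<^sub>R (exp_tB \<omega> (- s / \<epsilon>\<^sup>2) *v Psi_tilde r L \<omega>))
              has_integral (zh t w - zh 0 w - N t w)) {0..t}))"

definition alpha ::
    "real \<Rightarrow> ((real \<Rightarrow> real) \<Rightarrow> real) \<Rightarrow> real \<Rightarrow> real \<Rightarrow> (real \<Rightarrow> real) \<Rightarrow> (real \<Rightarrow> real^2) \<Rightarrow>
     real \<Rightarrow> real" where
  "alpha r L \<omega> \<epsilon> x zh t = (1 / 2) * (norm (z_frak r L \<omega> \<epsilon> x t - zh t))\<^sup>2"

text \<open>
  Infinite if the level \<open>C\<close> is not reached.  The path \<open>x\<close> is only given up to time \<open>T\<close>.
\<close>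

definition exit_time ::
    "real \<Rightarrow> real \<Rightarrow> ((real \<Rightarrow> real) \<Rightarrow> real) \<Rightarrow> real \<Rightarrow> real \<Rightarrow> real \<Rightarrow> (real \<Rightarrow> real) \<Rightarrow> ereal" where
  "exit_time r T L \<omega> C \<epsilon> x =
     Inf (ereal ` {t \<in> {0..T}. C \<le> sup_norm r (pihat r L \<omega> (Pi_seg \<epsilon> t x))})"

text \<open>
  Each stochastic convolution is only determined up to a null set, so the supremum over \<open>\<theta>\<close> and
  \<open>s\<close> refers to a version that is jointly continuous in \<open>(s,\<theta>)\<close>.
\<close>

definition stochastic_convolution ::
    "'a measure \<Rightarrow> (real \<Rightarrow> 'a \<Rightarrow> real) \<Rightarrow> real \<Rightarrow> real \<Rightarrow> ((real \<Rightarrow> real) \<Rightarrow> real) \<Rightarrow> real \<Rightarrow> real \<Rightarrow>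
     real \<Rightarrow> (real \<Rightarrow> real \<Rightarrow> 'a \<Rightarrow> real) \<Rightarrow> bool" where
  "stochastic_convolution M W r T L \<omega> \<sigma> \<epsilon> Z \<longleftrightarrow>
     (\<forall>s\<in>{0..T}. \<forall>\<theta>\<in>{-r..0}. has_wiener_integral M W
        (\<lambda>u. That r L ((s - u) / \<epsilon>\<^sup>2) (one_minus_pihat r L \<omega> (indicator {0})) \<theta> * \<sigma>)
        s (Z s \<theta>)) \<and>
     (\<forall>w\<in>space M. continuous_on ({0..T} \<times> {-r..0}) (\<lambda>(s, \<theta>). Z s \<theta> w))"

definition Upsilon :: "real \<Rightarrow> (real \<Rightarrow> real \<Rightarrow> 'a \<Rightarrow> real) \<Rightarrow> real \<Rightarrow> 'a \<Rightarrow> real" where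
  "Upsilon r Z s w = (SUP \<theta>\<in>{-r..0}. \<bar>Z s \<theta> w\<bar>)"

definition p_eps :: "real \<Rightarrow> real \<Rightarrow> real \<Rightarrow> real \<Rightarrow> real \<Rightarrow> real \<Rightarrow> real" where
  "p_eps r T K a \<delta> \<epsilon> =
     1 - K * \<epsilon> powr (- a) * sqrt (r * \<epsilon> powr \<delta> * ln (T / (r * \<epsilon> powr \<delta>)))"

end

theory Submission
  imports Defs "HOL-Real_Asymp.Real_Asymp"
begin

text \<open>
 Shifting the inversion contour of the Laplace transform past the two imaginary roots writes the
 fundamental solution as an oscillation plus an exponentially decaying kernel of bounded variation.
 The oscillation is removed by the projection onto \<open>P\<close>, and Abel summation against the decaying part
 bounds the stochastic convolution by the Hoelder constant of \<open>W\<close> times a power of \<open>eps\<close>.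
 The same estimate for the increments of the rotated \<open>P\<close>-coordinates gives an integral inequality for
 the difference of the two processes, in which \<open>G\<close> is Lipschitz as long as both stay bounded.
 A continuity argument with Gronwall's inequality then keeps the difference small on the event where
 the Hoelder constant is not too large, and Markov's inequality bounds the probability of its complement.
\<close>

abbreviation (input) seg :: "(real => 'b) => real => real => 'b" where "seg x s == (%th. x (s + th))"

lemma abs_le_sup_norm:
 assumes "bounded (phi ` {-r..0})" "th \<in> {-r..0}"
 shows "abs (phi th) <= sup_norm r phi"
 unfolding sup_norm_def
proof (rule cSUP_upper[OF assms(2)])
 obtain B where "\<forall>x\<in>phi ` {-r..0}. norm x <= B" using assms(1) by (auto simp: bounded_iff)
 then show "bdd_above ((%th. \<bar>phi th\<bar>) ` {-r..0})" by (intro bdd_aboveI[of _ B]) auto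
qed

lemma sup_norm_le:
 assumes "r > 0" "\<And>th. th \<in> {-r..0} ==> abs (phi th) <= B"
 shows "sup_norm r phi <= B"
 unfolding sup_norm_def using assms by (intro cSUP_least) auto

lemma Cspace_bounded: "eta \<in> Cspace r ==> bounded (eta ` {-r..0})"
 unfolding Cspace_def by (auto intro!: compact_imp_bounded compact_continuous_image)

lemma Cspace_sub_Chat: "Cspace r \<subseteq> Chat_space r"
 using Cspace_bounded[of _ r]
 by (auto simp: Chat_space_def Cspace_def intro!: borel_measurable_continuous_on_restrict)

lemma bounded_linear_on_C_add:
 "bounded_linear_on_C r L ==> eta \<in> Cspace r ==> \<zeta> \<in> Cspace r ==> L (%th. eta th + \<zeta> th) = L eta + L \<zeta>"
 unfolding bounded_linear_on_C_def by simp

lemma bounded_linear_on_C_scale: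
 "bounded_linear_on_C r L ==> eta \<in> Cspace r ==> L (%th. c * eta th) = c * L eta"
 unfolding bounded_linear_on_C_def by simp

lemma bounded_linear_on_C_sum:
 assumes "bounded_linear_on_C r L" "finite S" "\<And>k. k \<in> S ==> f k \<in> Cspace r"
 shows "L (%th. \<Sum>k\<in>S. c k * f k th) = (\<Sum>k\<in>S. c k * L (f k))"
 using assms(2,3)
proof (induction S rule: finite_induct)
 case empty
 have "L (%th. 0 * (0::real)) = 0 * L (%th. 0)"
  by (rule bounded_linear_on_C_scale[OF assms(1)]) (simp add: Cspace_def)
 then show ?case by simp
next
 case (insert k S)
 have m: "(%th. c k * f k th) \<in> Cspace r" "(%th. \<Sum>k\<in>S. c k * f k th) \<in> Cspace r"
  using insert.prems unfolding Cspace_def by (auto intro!: continuous_intros)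
 have "L (%th. c k * f k th + (\<Sum>k\<in>S. c k * f k th)) = L (%th. c k * f k th) + L (%th. \<Sum>k\<in>S. c k * f k th)"
  by (rule bounded_linear_on_C_add[OF assms(1) m])
 moreover have "L (%th. c k * f k th) = c k * L (f k)"
  using insert.prems by (intro bounded_linear_on_C_scale[OF assms(1)]) auto
 ultimately show ?case using insert by simp
qed

definition fold_sgn :: "real => real" where
 "fold_sgn u = max (-1) (min 1 (1 - u))"

definition fold_loc :: "real => real => real" where
 "fold_loc r u = max (-r) (min 0 (if u < 1 then u else u - (r + 2)))"

lemma fold_loc_range: "r > 0 ==> fold_loc r u \<in> {-r..0}"
 unfolding fold_loc_def by auto

lemma fold_sgn_bound: "abs (fold_sgn u) <= 1"
 unfolding fold_sgn_def by auto

lemma measurable_fold [measurable]: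
 "fold_loc r \<in> borel_measurable borel" "fold_sgn \<in> borel_measurable borel"
 unfolding fold_loc_def fold_sgn_def by measurable

lemma isCont_fold:
 assumes "r > 0" "eta \<in> Cspace r"
 shows "isCont (%u. fold_sgn u * eta (fold_loc r u)) x"
proof -
 have c: "isCont (%u. eta (max (-r) (min 0 (u - a)))) x" for a x
 proof -
  have "continuous_on UNIV (%u. eta (max (-r) (min 0 (u - a))))"
   by (rule continuous_on_compose2[of "{-r..0}" eta])
    (use assms in "auto simp: Cspace_def intro!: continuous_intros")
  then show ?thesis by (simp add: continuous_on_eq_continuous_at)
 qed
 have s: "isCont fold_sgn x" for x
  unfolding fold_sgn_def by (intro continuous_intros)
 consider "x < 1" | "x > 1" | "x = 1" by linarith
 then show ?thesis
 proof cases
  case 1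
  have "isCont (%u. fold_sgn u * eta (max (-r) (min 0 (u - 0)))) x"
   by (intro continuous_intros s c)
  moreover have "eventually (%u. u < 1) (nhds x)"
   using 1 by (simp add: eventually_nhds_in_open[of "{..<1}", simplified])
  ultimately show ?thesis
   by (subst isCont_cong[where g = "%u. fold_sgn u * eta (max (-r) (min 0 (u - 0)))"])
    (auto elim!: eventually_mono simp: fold_loc_def)
 next
  case 2
  have "isCont (%u. fold_sgn u * eta (max (-r) (min 0 (u - (r + 2))))) x"
   by (intro continuous_intros s c)
  moreover have "eventually (%u. u > 1) (nhds x)"
   using 2 by (simp add: eventually_nhds_in_open[of "{1<..}", simplified])
  ultimately show ?thesis
   by (subst isCont_cong[where g = "%u. fold_sgn u * eta (max (-r) (min 0 (u - (r + 2))))"])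
    (auto elim!: eventually_mono simp: fold_loc_def)
 next
  case 3
  have b: "abs (eta (fold_loc r u)) <= sup_norm r eta" for u
   using fold_loc_range[OF assms(1)] by (intro abs_le_sup_norm Cspace_bounded assms)
  have "((%u. fold_sgn u * eta (fold_loc r u)) \<longlongrightarrow> 0) (at x)"
  proof (rule Lim_null_comparison)
   show "\<forall>\<^sub>F u in at x. norm (fold_sgn u * eta (fold_loc r u)) <= abs (fold_sgn u) * sup_norm r eta"
    using b by (auto simp: abs_mult intro!: always_eventually mult_left_mono)
   have "((%u. \<bar>fold_sgn u\<bar> * sup_norm r eta) \<longlongrightarrow> abs (fold_sgn x) * sup_norm r eta) (at x)"
    using s[of x] by (intro tendsto_intros) (simp add: isCont_def)
   then show "((%u. \<bar>fold_sgn u\<bar> * sup_norm r eta) \<longlongrightarrow> 0) (at x)"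
    using 3 by (simp add: fold_sgn_def)
  qed
  then show ?thesis using 3 by (simp add: isCont_def fold_sgn_def)
 qed
qed

text \<open>
 The functionals \<open>eta \<mapsto> \<Sum>\<^sub>k eta(-r + rk/n) L(b\<^sub>n\<^sub>k)\<close> given by the Bernstein polynomials \<open>b\<^sub>n\<^sub>k\<close> are signed
 measures of total variation at most \<open>\<parallel>L\<parallel>\<close> and converge to \<open>L\<close>.  To extract a limit with Helly's
 theorem they are coded as probability measures: positive atoms stay where they are, negative ones
 are shifted by \<open>r + 2\<close>, and the missing mass is put at the zero \<open>1\<close> of \<open>fold_sgn\<close>.
\<close>

lemma riesz_folded:
 assumes r: "r > 0" and L: "bounded_linear_on_C r L"
 shows "\<exists>m. finite_measure m \<and> sets m = sets (borel :: real measure) \<and>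
  (\<forall>eta\<in>Cspace r. L eta = (LINT u|m. fold_sgn u * eta (fold_loc r u)))"
proof -
 obtain K0 where K0: "\<And>eta. eta \<in> Cspace r ==> abs (L eta) <= K0 * sup_norm r eta"
  using L unfolding bounded_linear_on_C_def by blast
 define K where "K = max 1 K0"
 have K1: "K >= 1" by (simp add: K_def)
 have K: "abs (L eta) <= K * B" if "eta \<in> Cspace r" "\<And>th. th \<in> {-r..0} ==> abs (eta th) <= B" for eta B
 proof -
  have "0 <= sup_norm r eta"
   using abs_le_sup_norm[OF Cspace_bounded[OF that(1)], of 0] r by auto
  moreover have "sup_norm r eta <= B" by (rule sup_norm_le[OF r that(2)])
  ultimately have "K0 * sup_norm r eta <= K * B"
   by (intro mult_mono) (auto simp: K_def)
  then show ?thesis using K0[OF that(1)] by linarith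
 qed
 define b where "b n k th = Bernstein n k ((th + r) / r)" for n k th
 have bC: "b n k \<in> Cspace r" for n k
  unfolding b_def Cspace_def Bernstein_def using r by (auto intro!: continuous_intros)
 define a where "a n k = L (b n k)" for n k
 have var: "(\<Sum>k\<le>n. \<bar>a n k\<bar>) <= K" for n
 proof -
  have "(\<Sum>k\<le>n. \<bar>a n k\<bar>) = L (%th. \<Sum>k\<le>n. sgn (a n k) * b n k th)"
   by (subst bounded_linear_on_C_sum[OF L]) (auto simp: bC a_def abs_sgn mult.commute)
  also have "... <= K * 1"
  proof (rule order_trans[OF abs_ge_self K])
   show "(%th. \<Sum>k\<le>n. sgn (a n k) * b n k th) \<in> Cspace r"
    using bC unfolding Cspace_def by (auto intro!: continuous_intros)
   fix th assume th: "th \<in> {-r..0}"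
   then have t: "0 <= (th + r) / r" "(th + r) / r <= 1" using r by auto
   have "abs (\<Sum>k\<le>n. sgn (a n k) * b n k th) <= (\<Sum>k\<le>n. \<bar>sgn (a n k) * b n k th\<bar>)"
    by (rule sum_abs)
   also have "... <= (\<Sum>k\<le>n. b n k th)"
    by (intro sum_mono) (auto simp: abs_mult sgn_if b_def Bernstein_nonneg[OF t])
   also have "... = 1" by (simp add: b_def)
   finally show "abs (\<Sum>k\<le>n. sgn (a n k) * b n k th) <= 1" .
  qed
  finally show ?thesis by simp
 qed
 define w where "w n k = (if k <= n then \<bar>a n k\<bar> / K else if k = Suc n then 1 - (\<Sum>k\<le>n. \<bar>a n k\<bar>) / K else 0)"
  for n k
 define node where "node n k = -r + r * (real k / real n)" for n k
 define pos where "pos n k = (if k > n then 1 else if a n k >= 0 then min 0 (node n k) else r + 2 + min 0 (node n k))"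
  for n k
 have w_nonneg: "0 <= w n k" for n k
  using K1 var[of n] by (auto simp: w_def divide_le_eq)
 have w_sum: "(\<Sum>k\<le>Suc n. w n k) = 1" for n
  by (simp add: w_def sum_divide_distrib)
 have w_nn: "(\<integral>\<^sup>+k. ennreal (w n k) \<partial>count_space UNIV) = 1" for n
 proof -
  have "(\<integral>\<^sup>+k. ennreal (w n k) \<partial>count_space UNIV) = (\<Sum>k\<le>Suc n. ennreal (w n k))"
   by (rule nn_integral_count_space') (auto simp: w_def)
  also have "... = ennreal (\<Sum>k\<le>Suc n. w n k)" by (rule sum_ennreal) (rule w_nonneg)
  finally show ?thesis unfolding w_sum by simp
 qed
 define q where "q n = embed_pmf (w n)" for n
 have q: "pmf (q n) k = w n k" for n k
  unfolding q_def by (rule pmf_embed_pmf) (auto simp: w_nonneg w_nn)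
 have set_q: "k <= Suc n" if "k \<in> set_pmf (q n)" for n k
  using that unfolding set_pmf_iff q by (auto simp: w_def split: if_splits)
 define P where "P n = distr (measure_pmf (q n)) borel (pos n)" for n
 have P: "real_distribution (P n)" for n
  unfolding P_def by (rule prob_space.real_distribution_distr[OF prob_space_measure_pmf]) simp
 have pos: "pos n k \<in> {-r-1<..r+2}" for n k
 proof -
  have "-r <= node n k" using r by (simp add: node_def)
  then show ?thesis using r by (auto simp: pos_def)
 qed
 have tight: "tight P"
  unfolding tight_def
 proof (intro conjI allI impI P)
  fix e :: real assume "e > 0"
  have "measure (P n) {-r-1<..r+2} = 1" for n
   unfolding P_def using pos by (subst measure_distr) (auto simp: vimage_def)
  then show "\<exists>a b. a < b \<and> (\<forall>n. 1 - e < measure (P n) {a<..b})"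
   using \<open>e > 0\<close> r by (intro exI[of _ "-r-1"] exI[of _ "r+2"]) auto
 qed
 obtain s M where s: "strict_mono (s :: nat => nat)" and M: "real_distribution M"
  and conv: "weak_conv_m (P \<circ> id \<circ> s) M"
  using tight_imp_convergent_subsubsequence[OF tight strict_mono_id] by blast
 interpret M: real_distribution M by (rule M)
 have fin: "finite_measure (density M (%_. ennreal K))"
  by (rule finite_measureI) (auto simp: emeasure_density M.emeasure_eq_measure ennreal_mult_eq_top_iff)
 have main: "L eta = (LINT u|density M (%_. ennreal K). fold_sgn u * eta (fold_loc r u))"
  if eta: "eta \<in> Cspace r" for eta
 proof -
  define h where "h u = fold_sgn u * eta (fold_loc r u)" for u
  have hc: "isCont h u" for u
   unfolding h_def by (rule isCont_fold[OF r eta])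
  have hm[measurable]: "h \<in> borel_measurable borel"
   using hc by (intro borel_measurable_continuous_onI) (simp add: continuous_on_eq_continuous_at)
  have hb: "norm (h u) <= 1 * sup_norm r eta" for u
   unfolding h_def norm_mult using fold_loc_range[OF r]
   by (intro mult_mono) (auto simp: fold_sgn_bound intro!: abs_le_sup_norm Cspace_bounded eta)
  have "(%n. integral\<^sup>L ((P \<circ> id \<circ> s) n) h) \<longlonglongrightarrow> integral\<^sup>L M h"
   by (rule weak_conv_imp_integral_bdd_continuous_conv[OF _ M conv hc hb]) (simp add: P)
  then have lim1: "(%n. integral\<^sup>L (P (s n)) h) \<longlonglongrightarrow> integral\<^sup>L M h" by simp
  have int: "K * integral\<^sup>L (P n) h = L (%th. \<Sum>k\<le>n. eta (node n k) * b n k th)" for n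
  proof -
   have "integral\<^sup>L (P n) h = (\<integral>k. h (pos n k) \<partial>measure_pmf (q n))"
    unfolding P_def by (rule integral_distr) auto
   also have "... = (\<Sum>k\<le>Suc n. h (pos n k) * w n k)"
    by (subst integral_measure_pmf_real[of "{..Suc n}"]) (auto simp: q dest: set_q)
   also have "... = (\<Sum>k\<le>n. h (pos n k) * (abs (a n k) / K))"
    by (simp add: w_def pos_def h_def fold_sgn_def)
   also have "K * ... = (\<Sum>k\<le>n. eta (node n k) * a n k)"
    unfolding sum_distrib_left
   proof (rule sum.cong)
    fix k assume k: "k \<in> {..n}"
    have "node n k \<in> {-r..0}"
    proof -
     have "real k / real n <= 1" "0 <= real k / real n" using k by (auto simp: divide_le_eq_1)
     then have "r * (real k / real n) <= r * 1" "0 <= r * (real k / real n)"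
      using r by (auto intro!: mult_left_mono simp del: mult_1_right times_divide_eq_right)
     then show ?thesis by (simp add: node_def)
    qed
    then have "h (pos n k) = sgn (a n k) * eta (node n k)" if "a n k ~= 0"
     using k r that by (auto simp: h_def pos_def fold_sgn_def fold_loc_def)
    then show "K * (h (pos n k) * (abs (a n k) / K)) = eta (node n k) * a n k"
     using K1 by (cases "a n k = 0") (auto simp: sgn_if)
   qed simp
   also have "... = L (%th. \<Sum>k\<le>n. eta (node n k) * b n k th)"
    by (subst bounded_linear_on_C_sum[OF L]) (auto simp: bC a_def)
   finally show ?thesis .
  qed
  have "(%n. L (%th. \<Sum>k\<le>n. eta (node n k) * b n k th)) \<longlonglongrightarrow> L eta"
  proof (rule LIMSEQ_I)
   fix e :: real assume e: "e > 0"
   define f where "f t = eta (-r + r * t)" for t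
   have "continuous_on {0..1} f"
    unfolding f_def
    by (rule continuous_on_compose2[of "{-r..0}" eta])
     (use eta r mult_left_mono[of _ 1 r] in "auto simp: Cspace_def intro!: continuous_intros")
   then obtain N where N: "\<And>n x. N <= n ==> x \<in> {0..1} ==>
     \<bar>f x - (\<Sum>k\<le>n. f (k/n) * Bernstein n k x)\<bar> < e / (2 * K)"
    using Bernstein_Weierstrass[of f "e / (2 * K)"] e K1 by auto
   have "norm (L (%th. \<Sum>k\<le>n. eta (node n k) * b n k th) - L eta) < e" if n: "n >= N" for n
   proof -
    define g where "g th = (\<Sum>k\<le>n. eta (node n k) * b n k th)" for th
    have gC: "g \<in> Cspace r" "(%th. (-1) * eta th) \<in> Cspace r"
     using bC eta unfolding g_def Cspace_def by (auto intro!: continuous_intros)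
    have "L (%th. g th + (-1) * eta th) = L g + L (%th. (-1) * eta th)"
     by (rule bounded_linear_on_C_add[OF L gC])
    also have "L (%th. (-1) * eta th) = (-1) * L eta"
     by (rule bounded_linear_on_C_scale[OF L eta])
    finally have eq: "L (%th. g th - eta th) = L g - L eta" by simp
    have "abs (L (%th. g th - eta th)) <= K * (e / (2 * K))"
    proof (rule K)
     show "(%th. g th - eta th) \<in> Cspace r"
      using gC(1) eta unfolding Cspace_def by (auto intro!: continuous_intros)
     fix th assume th: "th \<in> {-r..0}"
     have "g th = (\<Sum>k\<le>n. f (k/n) * Bernstein n k ((th + r) / r))"
      by (simp add: g_def f_def node_def b_def)
     moreover have "f ((th + r) / r) = eta th" using r by (simp add: f_def)
     ultimately show "abs (g th - eta th) <= e / (2 * K)"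
      using N[OF n, of "(th + r) / r"] th r by (auto simp: abs_minus_commute)
    qed
    then have "abs (L g - L eta) <= e / 2" using eq K1 by simp
    then show ?thesis using e unfolding g_def by simp
   qed
   then show "\<exists>N. \<forall>n\<ge>N. norm (L (%th. \<Sum>k\<le>n. eta (node n k) * b n k th) - L eta) < e" by blast
  qed
  then have "(%n. K * integral\<^sup>L (P (s n)) h) \<longlonglongrightarrow> L eta"
   unfolding int[symmetric] using LIMSEQ_subseq_LIMSEQ[OF _ s, of "%n. K * integral\<^sup>L (P n) h"]
   by (simp add: o_def)
  moreover have "(%n. K * integral\<^sup>L (P (s n)) h) \<longlonglongrightarrow> K * integral\<^sup>L M h"
   by (intro tendsto_intros lim1)
  ultimately have "L eta = K * integral\<^sup>L M h" by (rule LIMSEQ_unique)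
  also have "... = integral\<^sup>L (density M (%_. ennreal K)) h"
   using K1 by (subst integral_density) auto
  also have "h = (%u. fold_sgn u * eta (fold_loc r u))" by (rule ext) (rule h_def)
  finally show ?thesis .
 qed
 have sets: "sets (density M (%_. ennreal K)) = sets borel" by simp
 show ?thesis
  by (rule exI, rule conjI[OF fin], rule conjI[OF sets], rule ballI, rule main)
qed

lemma Chat_spaceE:
 assumes "phi \<in> Chat_space r"
 obtains B where "\<And>th. th \<in> {-r..0} ==> abs (phi th) <= B"
 using assms abs_le_sup_norm[of phi r] unfolding Chat_space_def by blast

definition measure_add :: "'b measure => 'b measure => 'b measure" where
 "measure_add M N = measure_of (space M) (sets M) (%A. emeasure M A + emeasure N A)"

lemma sets_measure_add [simp]: "sets (measure_add M N) = sets M"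
 by (simp add: measure_add_def)

lemma emeasure_measure_add:
 assumes "sets N = sets M" "A \<in> sets M" shows "emeasure (measure_add M N) A = emeasure M A + emeasure N A"
 unfolding measure_add_def
proof (rule emeasure_measure_of_sigma[OF sets.sigma_algebra_axioms _ _ assms(2)])
 show "countably_additive (sets M) (%A. emeasure M A + emeasure N A)"
  using assms(1) by (auto simp: countably_additive_def suminf_emeasure suminf_add[symmetric])
qed (simp add: positive_def)

lemma nn_integral_measure_add:
 assumes s: "sets N = sets M" and f: "f \<in> borel_measurable M"
 shows "(\<integral>\<^sup>+x. f x \<partial>measure_add M N) = (\<integral>\<^sup>+x. f x \<partial>M) + (\<integral>\<^sup>+x. f x \<partial>N)"
 using f
proof induction
 note c = measurable_cong_sets[OF sets_measure_add refl, of M N] measurable_cong_sets[OF s refl]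
 {
  case (cong f g)
  then have "(\<integral>\<^sup>+x. f x \<partial>L) = (\<integral>\<^sup>+x. g x \<partial>L)" if "sets L = sets M" for L
   using sets_eq_imp_space_eq[OF that] by (intro nn_integral_cong) simp
  then show ?case using cong(4) s by simp
 next
  case (set A) then show ?case using s by (simp add: emeasure_measure_add)
 next
  case (mult u a) then show ?case by (simp add: nn_integral_cmult distrib_left c)
 next
  case (add u v) then show ?case by (simp add: nn_integral_add c add_ac)
 next
  case (seq U)
  have i: "incseq (%i. \<integral>\<^sup>+x. U i x \<partial>L)" for L using \<open>incseq U\<close> by (auto simp: incseq_def le_fun_def intro!: nn_integral_mono)
  show ?case unfolding SUP_apply
   using seq by (subst (1 2 3) nn_integral_monotone_convergence_SUP) (simp_all add: c ennreal_SUP_add[OF i i])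
 }
qed

lemma signed_measure_agree:
 assumes fin: "\<And>i. i < (4::nat) ==> finite_measure (N i)"
  and sets: "\<And>i. i < 4 ==> sets (N i) = sets (restrict_space borel {-r..0})"
  and eq: "\<And>eta. eta \<in> Cspace r ==>
   (LINT th|N 0. eta th) - (LINT th|N 1. eta th) = (LINT th|N 2. eta th) - (LINT th|N 3. eta th)"
  and phi: "phi \<in> Chat_space r"
 shows "(LINT th|N 0. phi th) - (LINT th|N 1. phi th) = (LINT th|N 2. phi th) - (LINT th|N 3. phi th)"
proof -
 let ?R = "restrict_space borel {-r..0} :: real measure"
 let ?same = "%f :: real => real. (LINT th|N 0. f th) - (LINT th|N 1. f th) = (LINT th|N 2. f th) - (LINT th|N 3. f th)"
 have lt: "(0::nat) < 4" "(1::nat) < 4" "(2::nat) < 4" "(3::nat) < 4" by simp_all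
 have sp: "space (N i) = {-r..0}" if "i < 4" for i
  using sets_eq_imp_space_eq[OF sets[OF that]] by (simp add: space_restrict_space)
 have mN: "f \<in> borel_measurable (N i)" if "f \<in> borel_measurable ?R" "i < 4" for f :: "real => real" and i
  using that measurable_cong_sets[OF sets refl] by blast
 have int: "integrable (N i) f" if "f \<in> borel_measurable ?R" "\<And>th. th \<in> {-r..0} ==> abs (f th) <= B" "i < 4"
  for f :: "real => real" and B i
  using that mN[OF that(1,3)] sp[OF that(3)]
  by (intro finite_measure.integrable_const_bound[OF fin[OF that(3)], of _ B] AE_I2) auto
 have lim: "?same f"
  if Fs: "\<And>k::nat. ?same (F k)" and Fm: "\<And>k. F k \<in> borel_measurable ?R"
   and FB: "\<And>k th. th \<in> {-r..0} ==> abs (F k th) <= B"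
   and Fl: "\<And>th. th \<in> {-r..0} ==> (%k. F k th) \<longlonglongrightarrow> f th"
  for F :: "nat => real => real" and f B
 proof -
  have f: "f \<in> borel_measurable ?R"
   by (rule borel_measurable_LIMSEQ_real[of ?R F]) (use Fm Fl in "auto simp: space_restrict_space")
  have c: "(%k. LINT th|N i. F k th) \<longlonglongrightarrow> (LINT th|N i. f th)" if i: "i < 4" for i
  proof (rule integral_dominated_convergence[where w="%_. B"])
   show "integrable (N i) (%_. B)" using fin[OF i] finite_measure.integrable_const by blast
   show "AE x in N i. (%k. F k x) \<longlonglongrightarrow> f x" using Fl sp[OF i] by (intro AE_I2) simp
   show "AE x in N i. norm (F k x) <= B" for k using FB sp[OF i] by (intro AE_I2) simp
  qed (simp_all add: mN[OF f i] mN[OF Fm i])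
  have "(%k. (LINT th|N 0. F k th) - (LINT th|N 1. F k th)) \<longlonglongrightarrow> (LINT th|N 0. f th) - (LINT th|N 1. f th)"
   by (intro tendsto_diff c) auto
  moreover have "(%k. (LINT th|N 2. F k th) - (LINT th|N 3. F k th)) \<longlonglongrightarrow> (LINT th|N 2. f th) - (LINT th|N 3. f th)"
   by (intro tendsto_diff c) auto
  ultimately show "?same f" unfolding Fs by (rule LIMSEQ_unique)
 qed
 have step: "?same (indicator ({..a} \<inter> {-r..0}))" for a :: real
 proof (rule lim[of "%k th. max 0 (1 - real k * max 0 (th - a))" 1])
  fix k
  show "?same (%th. max 0 (1 - real k * max 0 (th - a)))"
   by (rule eq) (auto simp: Cspace_def intro!: continuous_intros)
  show "(%th. max 0 (1 - real k * max 0 (th - a))) \<in> borel_measurable ?R"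
   by (intro borel_measurable_continuous_on_restrict continuous_intros)
  fix th assume th: "th \<in> {-r..0}"
  show "abs (max 0 (1 - real k * max 0 (th - a))) <= 1" by auto
  show "(%k. max 0 (1 - real k * max 0 (th - a))) \<longlonglongrightarrow> indicator ({..a} \<inter> {-r..0}) th"
  proof (cases "th <= a")
   case True then show ?thesis using th by (simp add: max_def)
  next
   case False
   have "eventually (%k. real k >= 1 / (th - a)) sequentially"
    by (meson eventually_sequentiallyI nat_ceiling_le_eq)
   then have "eventually (%k. max 0 (1 - real k * max 0 (th - a)) = 0) sequentially"
    by eventually_elim (use False in "auto simp: max_def field_simps")
   then show ?thesis using False by (simp add: tendsto_eventually)
  qed
 qed
 let ?G = "range (%a::real. {..a} \<inter> {-r..0})"
 note One_nat_def[simp del]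
 define P where "P = measure_add (N 0) (N 3)"
 define Q where "Q = measure_add (N 1) (N 2)"
 note sN = sets[OF lt(1)] sets[OF lt(2)] sets[OF lt(3)] sets[OF lt(4)]
 have sPQ: "sets P = sets ?R" "sets Q = sets ?R" by (simp_all add: P_def Q_def sN)
 have G: "A \<in> sets ?R" if "A \<in> ?G" for A using that by (auto simp: sets_restrict_space)
 have eA: "emeasure (N i) A = ennreal (LINT th|N i. indicator A th)" if "A \<in> ?G" "i < 4" for A i
  using finite_measure.emeasure_eq_measure[OF fin[OF that(2)]] sets[OF that(2)] G[OF that(1)] by simp
 have PQ: "P = Q"
 proof (rule measure_eqI_generator_eq[of ?G "{-r..0}" _ _ "%_. {..0} \<inter> {-r..0}"])
  show "Int_stable ?G"
  proof (rule Int_stableI_image)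
   fix a b :: real
   show "\<exists>c\<in>UNIV. ({..a} \<inter> {-r..0}) \<inter> ({..b} \<inter> {-r..0}) = {..c} \<inter> {-r..0}"
    by (intro bexI[of _ "min a b"]) auto
  qed
  have "sets ?R = (\<inter>) {-r..0} ` sigma_sets UNIV (range atMost)"
   by (simp add: sets_restrict_space borel_eq_atMost sets_measure_of)
  also have "... = sigma_sets {-r..0} ((%A. {-r..0} \<inter> A) ` range atMost)"
  proof (rule sigma_sets_Int)
   have "{-r..0} \<in> sets (borel :: real measure)" by simp
   then show "{-r..0} \<in> sigma_sets UNIV (range (atMost :: real => _))"
    by (simp add: borel_eq_atMost sets_measure_of)
  qed simp
  finally have "sets ?R = sigma_sets {-r..0} ?G" by (simp add: image_image Int_commute)
  then show "sets P = sigma_sets {-r..0} ?G" "sets Q = sigma_sets {-r..0} ?G" using sPQ by simp_all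
  fix A assume A: "A \<in> ?G"
  then have "?same (indicator A)" using step by auto
  then show "emeasure P A = emeasure Q A"
   using G[OF A] unfolding P_def Q_def
   by (simp add: emeasure_measure_add sN eA[OF A] ennreal_plus[symmetric] del: ennreal_plus)
 next
  show "emeasure P ({..0} \<inter> {-r..0}) ~= \<infinity>"
  proof -
   have A: "{..0} \<inter> {-r..0} \<in> ?G" by (rule rangeI)
   show ?thesis unfolding P_def emeasure_measure_add[OF trans[OF sN(4) sN(1)[symmetric]] G[OF A, folded sN(1)]]
    eA[OF A lt(1)] eA[OF A lt(4)] by simp
  qed
 qed auto
 have nonneg: "?same f" if m: "f \<in> borel_measurable ?R" and f: "\<And>th. 0 <= f th" "\<And>th. th \<in> {-r..0} ==> f th <= B" for f B
 proof -
  have n: "(\<integral>\<^sup>+th. ennreal (f th) \<partial>N i) = ennreal (LINT th|N i. f th)" if "i < 4" for i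
   by (rule nn_integral_eq_integral[OF int[OF m _ that, of B]]) (use f in auto)
  have "(\<integral>\<^sup>+th. ennreal (f th) \<partial>P) = (\<integral>\<^sup>+th. ennreal (f th) \<partial>Q)" by (simp add: PQ)
  then have "ennreal ((LINT th|N 0. f th) + (LINT th|N 3. f th)) = ennreal ((LINT th|N 1. f th) + (LINT th|N 2. f th))"
   unfolding P_def Q_def using mN[OF m] by (simp add: nn_integral_measure_add sN n f)
  then have "(LINT th|N 0. f th) + (LINT th|N 3. f th) = (LINT th|N 1. f th) + (LINT th|N 2. f th)"
   by (rule ennreal_inj[THEN iffD1, rotated 2]) (simp_all add: f)
  then show ?thesis by linarith
 qed
 have phim: "phi \<in> borel_measurable ?R" using phi by (simp add: Chat_space_def)
 obtain B where B: "\<And>th. th \<in> {-r..0} ==> abs (phi th) <= B" using Chat_spaceE[OF phi] by blast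
 have b: "max 0 (phi th) <= B" "max 0 (- phi th) <= B" if "th \<in> {-r..0}" for th using B[OF that] by auto
 have s: "?same (%th. max 0 (phi th))" "?same (%th. max 0 (- phi th))"
  by (rule nonneg[of _ B]; use b phim in simp)+
 have e: "(LINT th|N i. phi th) = (LINT th|N i. max 0 (phi th)) - (LINT th|N i. max 0 (- phi th))" if i: "i < 4" for i
 proof -
  have "(LINT th|N i. max 0 (phi th) - max 0 (- phi th)) = (LINT th|N i. max 0 (phi th)) - (LINT th|N i. max 0 (- phi th))"
   by (rule Bochner_Integration.integral_diff; rule int[OF _ _ i, of _ B]) (use b phim in auto)
  moreover have "max 0 (phi th) - max 0 (- phi th) = phi th" for th by (simp add: max_def)
  ultimately show ?thesis by simp
 qed
 show ?thesis unfolding e[OF lt(1)] e[OF lt(2)] e[OF lt(3)] e[OF lt(4)] using s by linarith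
qed

definition folded_rep :: "real => ((real => real) => real) => real measure => bool" where
 "folded_rep r L m \<longleftrightarrow> finite_measure m \<and> sets m = sets (borel :: real measure) \<and>
  (\<forall>eta\<in>Cspace r. L eta = (LINT u|m. fold_sgn u * eta (fold_loc r u)))"

lemma L_ext_folded:
 assumes r: "r > 0" and m: "folded_rep r L m" and phi: "phi \<in> Chat_space r"
 shows "L_ext r L phi = (LINT u|m. fold_sgn u * phi (fold_loc r u))"
proof -
 let ?R = "restrict_space borel {-r..0} :: real measure"
 have fin: "finite_measure m" and [measurable_cong, simp]: "sets m = sets borel" using m by (auto simp: folded_rep_def)
 interpret finite_measure m by (rule fin)
 have [simp]: "space m = UNIV" using sets_eq_imp_space_eq[of m borel] by simp
 define N where "N s = distr (density m (%u. ennreal (max 0 (s * fold_sgn u)))) ?R (fold_loc r)" for s :: real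
 have Nsets: "sets (N s) = sets ?R" for s by (simp add: N_def)
 have loc[measurable]: "fold_loc r \<in> measurable borel ?R"
  by (rule measurable_restrict_space2) (use fold_loc_range[OF r] in auto)
 have Nfin: "finite_measure (N s)" if "abs s = 1" for s
 proof -
  have le: "max 0 (s * fold_sgn u) <= 1" for u
  proof -
   have "s * fold_sgn u <= abs s * abs (fold_sgn u)" by (metis abs_mult abs_ge_self)
   then show ?thesis using that fold_sgn_bound[of u] by simp
  qed
  have "emeasure (density m (%u. ennreal (max 0 (s * fold_sgn u)))) (space m) <= (\<integral>\<^sup>+u. 1 \<partial>m)"
  proof (subst emeasure_density)
   show "(\<integral>\<^sup>+u. ennreal (max 0 (s * fold_sgn u)) * indicator (space m) u \<partial>m) <= (\<integral>\<^sup>+u. 1 \<partial>m)"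
   proof (rule nn_integral_mono)
    fix u show "ennreal (max 0 (s * fold_sgn u)) * indicator (space m) u <= 1"
     using le[of u] by (simp add: ennreal_le_1 del: max.bounded_iff)
   qed
  qed auto
  also have "... < \<infinity>" by (simp add: less_top[symmetric])
  finally show ?thesis unfolding N_def
   by (intro finite_measure.finite_measure_distr finite_measureI) auto
 qed
 have Nint: "(LINT th|N s. \<zeta> th) = (LINT u|m. max 0 (s * fold_sgn u) * \<zeta> (fold_loc r u))"
  if \<zeta>[measurable]: "\<zeta> \<in> borel_measurable ?R" for \<zeta> s
 proof -
  have "(LINT th|N s. \<zeta> th) = (LINT u|density m (%u. ennreal (max 0 (s * fold_sgn u))). \<zeta> (fold_loc r u))"
   unfolding N_def by (rule integral_distr) measurable
  also have "... = (LINT u|m. max 0 (s * fold_sgn u) *\<^sub>R \<zeta> (fold_loc r u))"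
   by (rule integral_density) auto
  finally show ?thesis by simp
 qed
 have Nall: "(LINT th|N 1. \<zeta> th) - (LINT th|N (-1). \<zeta> th) = (LINT u|m. fold_sgn u * \<zeta> (fold_loc r u))"
  if \<zeta>C: "\<zeta> \<in> Chat_space r" for \<zeta>
 proof -
  have \<zeta>[measurable]: "\<zeta> \<in> borel_measurable ?R" using \<zeta>C by (simp add: Chat_space_def)
  obtain B where B: "\<And>th. th \<in> {-r..0} ==> abs (\<zeta> th) <= B" using Chat_spaceE[OF \<zeta>C] by blast
  have i: "integrable m (%u. max 0 (s * fold_sgn u) * \<zeta> (fold_loc r u))" if "abs s = 1" for s
  proof (rule integrable_const_bound[where B="1 * B"])
   have "abs (max 0 (s * fold_sgn u)) <= 1" for u
   proof -
    have "s * fold_sgn u <= abs s * abs (fold_sgn u)" by (metis abs_mult abs_ge_self)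
    then show ?thesis using that fold_sgn_bound[of u] by simp
   qed
   then show "AE u in m. norm (max 0 (s * fold_sgn u) * \<zeta> (fold_loc r u)) <= 1 * B"
    using B fold_loc_range[OF r] unfolding norm_mult by (intro AE_I2 mult_mono) auto
  qed measurable
  have "(LINT u|m. max 0 (1 * fold_sgn u) * \<zeta> (fold_loc r u)) - (LINT u|m. max 0 (-1 * fold_sgn u) * \<zeta> (fold_loc r u))
    = (LINT u|m. max 0 (1 * fold_sgn u) * \<zeta> (fold_loc r u) - max 0 (-1 * fold_sgn u) * \<zeta> (fold_loc r u))"
   by (rule Bochner_Integration.integral_diff[symmetric]; rule i; simp)
  also have "... = (LINT u|m. fold_sgn u * \<zeta> (fold_loc r u))"
   by (rule Bochner_Integration.integral_cong) (auto simp: max_def)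
  finally show ?thesis unfolding Nint[OF \<zeta>] .
 qed
 have pair: "riesz_pair r L (N 1) (N (-1))"
  using Nfin[of 1] Nfin[of "-1"] m Nall Cspace_sub_Chat[of r] Nsets
  unfolding riesz_pair_def folded_rep_def by auto
 have uniq: "(LINT th|\<mu>. phi th) - (LINT th|\<mu>'. phi th) = (LINT th|N 1. phi th) - (LINT th|N (-1). phi th)"
  if "riesz_pair r L \<mu> \<mu>'" for \<mu> \<mu>'
 proof -
  define Q where "Q i = (if i = 0 then \<mu> else if i = Suc 0 then \<mu>' else if i = 2 then N 1 else N (-1))" for i :: nat
  have "(LINT th|Q 0. phi th) - (LINT th|Q 1. phi th) = (LINT th|Q 2. phi th) - (LINT th|Q 3. phi th)"
  proof (rule signed_measure_agree[OF _ _ _ phi])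
   fix eta assume "eta \<in> Cspace r"
   then show "(LINT th|Q 0. eta th) - (LINT th|Q 1. eta th) = (LINT th|Q 2. eta th) - (LINT th|Q 3. eta th)"
    using that pair unfolding riesz_pair_def Q_def by auto
  qed (use that pair in "auto simp: riesz_pair_def Q_def")
  then show ?thesis by (simp add: Q_def)
 qed
 show ?thesis unfolding L_ext_def
 proof (rule the_equality)
  show "\<exists>\<mu> \<mu>'. riesz_pair r L \<mu> \<mu>' \<and>
    (LINT u|m. fold_sgn u * phi (fold_loc r u)) = (LINT th|\<mu>. phi th) - (LINT th|\<mu>'. phi th)"
   by (rule exI, rule exI, rule conjI[OF pair]) (simp add: Nall[OF phi])
 qed (use uniq Nall[OF phi] in auto)
qed

definition Lf :: "real => real measure => (real => 'b) => 'b::{banach, second_countable_topology}" where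
 "Lf r m phi = (LINT u|m. fold_sgn u *\<^sub>R phi (fold_loc r u))"

definition glue :: "real => (real => real) => (real => real) => real => real" where
 "glue r phi x t = indicator {-r..0} t * phi t + indicator {0<..} t * x t"

lemma measurable_glue:
 assumes "phi \<in> Chat_space r" "continuous_on {0..} x"
 shows "glue r phi x \<in> borel_measurable borel"
proof -
 have "(%t. indicator {-r..0} t *\<^sub>R phi t) \<in> borel_measurable borel"
  using assms(1) by (subst borel_measurable_restrict_space_iff[symmetric]) (auto simp: Chat_space_def)
 moreover have "(%t. indicator {0<..} t *\<^sub>R x t) \<in> borel_measurable borel"
  using assms(2) by (subst borel_measurable_restrict_space_iff[symmetric])
   (auto intro!: borel_measurable_continuous_on_restrict elim: continuous_on_subset)
 ultimately show ?thesis unfolding glue_def[abs_def] by simp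
qed

locale delay =
 fixes r :: real and L :: "(real => real) => real" and m :: "real measure"
 assumes r_pos: "r > 0" and rep: "folded_rep r L m"
begin

sublocale m: finite_measure m
 using rep by (simp add: folded_rep_def)

lemma sets_m[measurable_cong, simp]: "sets m = sets borel"
 using rep by (simp add: folded_rep_def)

lemma space_m[simp]: "space m = UNIV"
 using sets_eq_imp_space_eq[OF sets_m] by simp

definition K :: real where "K = measure m UNIV"

lemma K_nonneg: "0 <= K" by (simp add: K_def)

lemma loc_range: "-r <= fold_loc r u" "fold_loc r u <= 0"
 using fold_loc_range[OF r_pos, of u] by auto

lemma Lf_bound:
 fixes phi :: "real => 'b::{banach, second_countable_topology}"
 assumes "\<And>th. -r <= th ==> th <= 0 ==> norm (phi th) <= B"
 shows "norm (Lf r m phi) <= K * B"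
proof -
 have B: "0 <= B" using order_trans[OF norm_ge_zero assms[of 0]] r_pos by simp
 have "norm (Lf r m phi) <= (LINT u|m. B)"
 proof (cases "integrable m (%u. fold_sgn u *\<^sub>R phi (fold_loc r u))")
  case True
  have "norm (Lf r m phi) <= (LINT u|m. norm (fold_sgn u *\<^sub>R phi (fold_loc r u)))"
   unfolding Lf_def by (rule integral_norm_bound)
  also have "... <= (LINT u|m. B)"
  proof (rule integral_mono)
   fix u
   have "abs (fold_sgn u) * norm (phi (fold_loc r u)) <= 1 * B"
    using assms loc_range B by (intro mult_mono fold_sgn_bound) auto
   then show "norm (fold_sgn u *\<^sub>R phi (fold_loc r u)) <= B" by simp
  qed (rule integrable_norm[OF True], rule m.integrable_const)
  finally show ?thesis .
 next
  case False
  then show ?thesis using B by (simp add: Lf_def not_integrable_integral_eq)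
 qed
 then show ?thesis by (simp add: K_def)
qed

lemma integrable_Lf:
 fixes phi :: "real => 'b::{banach, second_countable_topology}"
 assumes "(%u. phi (fold_loc r u)) \<in> borel_measurable borel"
  "\<And>th. -r <= th ==> th <= 0 ==> norm (phi th) <= B"
 shows "integrable m (%u. fold_sgn u *\<^sub>R phi (fold_loc r u))"
proof (rule m.integrable_const_bound[of _ "1 * B"])
 show "AE u in m. norm (fold_sgn u *\<^sub>R phi (fold_loc r u)) <= 1 * B"
  unfolding norm_scaleR using assms(2) loc_range by (intro AE_I2 mult_mono) (auto simp: fold_sgn_bound)
qed (use assms(1) in measurable)

lemma Lf_add:
 fixes phi psi :: "real => 'b::{banach, second_countable_topology}"
 assumes "integrable m (%u. fold_sgn u *\<^sub>R phi (fold_loc r u))" "integrable m (%u. fold_sgn u *\<^sub>R psi (fold_loc r u))"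
 shows "Lf r m (%th. phi th + psi th) = Lf r m phi + Lf r m psi"
 using assms by (simp add: Lf_def scaleR_add_right)

lemma Lf_diff:
 fixes phi psi :: "real => 'b::{banach, second_countable_topology}"
 assumes "integrable m (%u. fold_sgn u *\<^sub>R phi (fold_loc r u))" "integrable m (%u. fold_sgn u *\<^sub>R psi (fold_loc r u))"
 shows "Lf r m (%th. phi th - psi th) = Lf r m phi - Lf r m psi"
 using assms by (simp add: Lf_def scaleR_diff_right)

lemma Lf_cong:
 "(\<And>th. -r <= th ==> th <= 0 ==> phi th = psi th) ==> Lf r m phi = Lf r m psi"
 unfolding Lf_def using loc_range by (intro Bochner_Integration.integral_cong) auto

lemma Chat_fold_measurable:
 assumes "phi \<in> Chat_space r"
 shows "(%u. phi (fold_loc r u)) \<in> borel_measurable borel"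
proof -
 have "fold_loc r \<in> measurable borel (restrict_space borel {-r..0})"
  by (rule measurable_restrict_space2) (use fold_loc_range[OF r_pos] in auto)
 moreover have "phi \<in> borel_measurable (restrict_space borel {-r..0})" using assms by (simp add: Chat_space_def)
 ultimately show ?thesis by (rule measurable_compose)
qed

lemma integrable_Lf_Chat:
 assumes "phi \<in> Chat_space r"
 shows "integrable m (%u. fold_sgn u *\<^sub>R phi (fold_loc r u))"
proof -
 obtain B where "\<And>th. th \<in> {-r..0} ==> abs (phi th) <= B" using Chat_spaceE[OF assms] by blast
 then show ?thesis by (intro integrable_Lf[OF Chat_fold_measurable[OF assms], of B]) auto
qed

lemma L_ext_eq: "phi \<in> Chat_space r ==> L_ext r L phi = Lf r m phi"
 using L_ext_folded[OF r_pos rep] by (simp add: Lf_def)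

lemma L_eq: "phi \<in> Cspace r ==> L phi = Lf r m phi"
 using rep by (simp add: folded_rep_def Lf_def)

lemma measurable_Lf_shift[measurable]:
 fixes x :: "real => 'b::{banach, second_countable_topology}"
 assumes [measurable]: "x \<in> borel_measurable borel"
 shows "(%s. Lf r m (seg x s)) \<in> borel_measurable borel"
 unfolding Lf_def by (rule m.borel_measurable_lebesgue_integral) measurable

lemma integrable_Lf_shift:
 fixes x :: "real => 'b::{banach, second_countable_topology}"
 assumes [measurable]: "x \<in> borel_measurable borel"
  and "\<And>t. s - r <= t ==> t <= s ==> norm (x t) <= B"
 shows "integrable m (%u. fold_sgn u *\<^sub>R x (s + fold_loc r u))"
 by (rule integrable_Lf[where B=B]) (use assms in auto)

lemma Lf_shift_has_integral:
 fixes x :: "real => 'b::euclidean_space"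
 assumes x[measurable]: "x \<in> borel_measurable borel"
  and B: "\<And>t. a - r <= t ==> t <= b ==> norm (x t) <= B"
 shows "((%s. Lf r m (seg x s)) has_integral Lf r m (%th. integral {a..b} (%s. x (s + th)))) {a..b}"
proof (cases "a <= b")
 case False then show ?thesis by (simp add: Lf_def)
next
 case ab: True
 interpret pair_sigma_finite lborel m by unfold_locales
 define f where "f s u = indicator {a..b} s *\<^sub>R (fold_sgn u *\<^sub>R x (s + fold_loc r u))" for s u
 have B0: "0 <= B" using order_trans[OF norm_ge_zero B[of b]] r_pos ab by simp
 have fm[measurable]: "case_prod f \<in> borel_measurable (lborel \<Otimes>\<^sub>M m)"
  unfolding f_def[abs_def] by measurable
 have fB: "norm (f s u) <= B" for s u
 proof (cases "s \<in> {a..b}")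
  case True
  have "abs (fold_sgn u) * norm (x (s + fold_loc r u)) <= 1 * B"
   using loc_range[of u] True B0 by (intro mult_mono fold_sgn_bound B) auto
  then show ?thesis using True by (simp add: f_def)
 qed (simp add: f_def B0)
 have int: "integrable (lborel \<Otimes>\<^sub>M m) (case_prod f)"
 proof (rule integrableI_bounded_set[of "{a..b} \<times> UNIV" _ _ B])
  show "emeasure (lborel \<Otimes>\<^sub>M m) ({a..b} \<times> UNIV) < \<infinity>"
   by (subst m.emeasure_pair_measure_Times) (auto simp: ennreal_mult_eq_top_iff less_top[symmetric] emeasure_lborel_Icc_eq)
  show "AE p in lborel \<Otimes>\<^sub>M m. p \<in> {a..b} \<times> UNIV --> norm (case_prod f p) <= B"
   using fB by (intro AE_I2) auto
 qed (auto intro!: AE_I2 simp: f_def indicator_def)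
 have int1: "integrable lborel (%s. LINT u|m. f s u)"
  using integrable_fst'[OF int] by simp
 have fub: "(LINT s|lborel. (LINT u|m. f s u)) = (LINT u|m. (LINT s|lborel. f s u))"
  by (rule Fubini_integral[OF int, symmetric])
 have e1: "(LINT u|m. f s u) = indicator {a..b} s *\<^sub>R Lf r m (seg x s)" for s
  by (cases "s \<in> {a..b}") (simp_all add: f_def Lf_def)
 have e2: "(LINT s|lborel. f s u) = fold_sgn u *\<^sub>R integral {a..b} (%s. x (s + fold_loc r u))" for u
 proof -
  have "set_integrable lborel {a..b} (%s. x (s + fold_loc r u))"
   unfolding set_integrable_def
  proof (rule integrableI_bounded_set[of "{a..b}" _ _ B])
   show "AE s in lborel. s \<in> {a..b} --> norm (indicator {a..b} s *\<^sub>R x (s + fold_loc r u)) <= B"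
    using loc_range[of u] B by (intro AE_I2) auto
  qed (auto simp: emeasure_lborel_Icc_eq)
  then have "(LINT s:{a..b}|lborel. x (s + fold_loc r u)) = integral {a..b} (%s. x (s + fold_loc r u))"
   by (rule set_borel_integral_eq_integral(2))
  moreover have "(LINT s|lborel. f s u) = fold_sgn u *\<^sub>R (LINT s:{a..b}|lborel. x (s + fold_loc r u))"
   unfolding f_def set_lebesgue_integral_def by (simp add: mult.commute flip: integral_scaleR_right)
  ultimately show ?thesis by simp
 qed
 have "set_integrable lborel {a..b} (%s. Lf r m (seg x s))"
  using int1 unfolding e1 set_integrable_def .
 then have "((%s. Lf r m (seg x s)) has_integral (LINT s:{a..b}|lborel. Lf r m (seg x s))) {a..b}"
  using set_borel_integral_eq_integral by (metis integrable_integral)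
 then show ?thesis using fub unfolding e1 e2 by (simp add: set_lebesgue_integral_def Lf_def)
qed

lemma delay_gronwall:
 fixes u :: "real => real"
 assumes u: "continuous_on {0..T} u" and neg: "\<And>s. -r <= s ==> s < 0 ==> abs (u s) <= A" and A: "0 <= A"
  and le: "\<And>s. 0 <= s ==> s <= T ==> abs (u s) <= A + abs (integral {0..s} (%tau. Lf r m (seg u tau)))"
  and s: "0 <= s" "s <= T"
 shows "abs (u s) <= A * exp (K * s)"
proof -
 obtain M where "\<forall>y\<in>u ` {0..T}. norm y <= M"
  using compact_imp_bounded[OF compact_continuous_image[OF u]] by (auto simp: bounded_iff)
 then have M: "abs (u s) <= M" if "0 <= s" "s <= T" for s using that by auto
 have M0: "0 <= M" using order_trans[OF abs_ge_zero M[OF s]] .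
 define b where "b n s = A * exp (K * s) + M * ((K * s) ^ n / fact n)" for n s
 have bound: "abs (u s) <= b n s" if "0 <= s" "s <= T" for n s
  using that
 proof (induction n arbitrary: s)
  case 0
  then show ?case using M[OF 0] A by (auto simp: b_def intro: add_increasing)
 next
  case (Suc n)
  have bmono: "b n tau <= b n tau'" if "0 <= tau" "tau <= tau'" for tau tau'
   unfolding b_def using that A M0 K_nonneg
   by (intro add_mono mult_left_mono divide_right_mono power_mono) (auto intro: mult_left_mono)
  have ubd: "norm (Lf r m (seg u tau)) <= K * b n tau" if tau: "tau \<in> {0..s}" for tau
  proof (rule Lf_bound)
   fix th assume th: "-r <= th" "th <= 0"
   show "norm (u (tau + th)) <= b n tau"
   proof (cases "tau + th < 0")
    case True
    then have "abs (u (tau + th)) <= A" using neg[of "tau + th"] th tau by auto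
    moreover have "A * 1 <= A * exp (K * tau)" using A K_nonneg tau by (intro mult_left_mono) auto
    moreover have "0 <= M * ((K * tau) ^ n / fact n)" using M0 K_nonneg tau by auto
    ultimately show ?thesis by (simp add: b_def)
   next
    case False
    then have "abs (u (tau + th)) <= b n (tau + th)" using th tau Suc.prems by (intro Suc.IH) auto
    also have "... <= b n tau" using False th by (intro bmono) auto
    finally show ?thesis by simp
   qed
  qed
  have hi: "((%tau. K * b n tau) has_integral (b (Suc n) s - A) - (b (Suc n) 0 - A)) {0..s}"
  proof (rule fundamental_theorem_of_calculus)
   fix tau assume "tau \<in> {0..s}"
   have "((%s. A * exp (K * s) + M * ((K * s) ^ Suc n / fact (Suc n)) - A) has_real_derivative
     A * (exp (K * tau) * K) + M * (real (Suc n) * (K * tau) ^ n * K / fact (Suc n))) (at tau within {0..s})"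
    by (rule derivative_eq_intros refl | simp)+
   moreover have "A * (exp (K * tau) * K) + M * (real (Suc n) * (K * tau) ^ n * K / fact (Suc n)) = K * b n tau"
    by (simp add: b_def field_simps del: of_nat_Suc)
   ultimately show "((%s. b (Suc n) s - A) has_vector_derivative K * b n tau) (at tau within {0..s})"
    unfolding b_def has_real_derivative_iff_has_vector_derivative by simp
  qed (use Suc.prems in simp)
  have "abs (integral {0..s} (%tau. Lf r m (seg u tau))) <= b (Suc n) s - A"
  proof (cases "(%tau. Lf r m (seg u tau)) integrable_on {0..s}")
   case True
   have "norm (integral {0..s} (%tau. Lf r m (seg u tau))) <= integral {0..s} (%tau. K * b n tau)"
    by (rule integral_norm_bound_integral[OF True _ ubd]) (use hi in auto)
   also have "... = b (Suc n) s - A" using integral_unique[OF hi] by (simp add: b_def)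
   finally show ?thesis by simp
  next
   case False
   have "A * exp (K * s) >= A * 1" using A K_nonneg Suc.prems by (intro mult_left_mono) auto
   moreover have "0 <= M * ((K * s) ^ Suc n / fact (Suc n))" using M0 K_nonneg Suc.prems by auto
   ultimately show ?thesis using False by (simp add: not_integrable_integral b_def)
  qed
  then show ?case using le[OF Suc.prems] by linarith
 qed
 have "(%n. b n s) \<longlonglongrightarrow> A * exp (K * s) + M * 0"
  unfolding b_def using summable_LIMSEQ_zero[OF summable_exp[of "K * s"]]
  by (intro tendsto_intros) (simp add: divide_inverse mult.commute)
 then show ?thesis using bound[OF s] by (intro LIMSEQ_le_const[of "%n. b n s"]) auto
qed

text \<open>\<open>x\<close> solves \<open>x' = L x\<^sub>t + f'\<close> on \<open>[0,T]\<close> with history \<open>phi\<close>; the forcing \<open>f\<close> need not be differentiable.\<close>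

definition forced :: "real => (real => real) => (real => real) => (real => real) => bool" where
 "forced T phi f x \<longleftrightarrow> (\<forall>th\<in>{-r..0}. x th = phi th) \<and> continuous_on {0..T} x \<and>
   (\<forall>t\<in>{0..T}. x t = phi 0 + f t + integral {0..t} (%s. Lf r m (seg x s)))"

lemma measurable_clamped:
 assumes "phi \<in> Chat_space r" "\<And>th. th \<in> {-r..0} ==> x th = phi th" "continuous_on {0..T} x" "0 <= T"
 shows "\<exists>g B. g \<in> borel_measurable borel \<and> (\<forall>t. -r <= t \<and> t <= T --> g t = x t) \<and> (\<forall>t. \<bar>g t\<bar> <= B)"
proof -
 have c: "continuous_on {0..} (%t. x (min T t))"
  by (rule continuous_on_compose2[OF assms(3)]) (use assms(4) in "auto intro!: continuous_intros")
 obtain B1 where B1: "\<And>th. th \<in> {-r..0} ==> abs (phi th) <= B1" using Chat_spaceE[OF assms(1)] by blast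
 obtain B2 where B2: "\<forall>y\<in>x ` {0..T}. norm y <= B2"
  using compact_imp_bounded[OF compact_continuous_image[OF assms(3)]] by (auto simp: bounded_iff)
 have B2': "abs (x (min T t)) <= B2" if "0 < t" for t using B2 assms(4) that by (auto simp: min_def)
 have "abs (glue r phi (%t. x (min T t)) t) <= max 0 (max B1 B2)" for t
  using B1[of t] B2'[of t] by (auto simp: glue_def indicator_def)
 then show ?thesis
  by (intro exI[of _ "glue r phi (%t. x (min T t))"] exI[of _ "max 0 (max B1 B2)"] conjI measurable_glue[OF assms(1) c])
   (use r_pos in "auto simp: glue_def indicator_def assms(2)")
qed

lemma segment_Chat:
 assumes "phi \<in> Chat_space r" "\<And>th. th \<in> {-r..0} ==> x th = phi th" "continuous_on {0..T} x" "0 <= s" "s <= T"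
 shows "(seg x s) \<in> Chat_space r"
proof -
 have T: "0 <= T" using assms(4,5) by simp
 obtain g B where g[measurable]: "g \<in> borel_measurable borel" and "\<forall>t. -r <= t \<and> t <= T --> g t = x t"
  and gB: "\<forall>t. \<bar>g t\<bar> <= B"
  using measurable_clamped[OF assms(1-3) T] by blast
 then have gx: "\<And>t. -r <= t ==> t <= T ==> g t = x t" by blast
 have "(seg g s) \<in> borel_measurable (restrict_space borel {-r..0})"
  by (intro measurable_restrict_space1) measurable
 moreover have "g (s + th) = x (s + th)" if "th \<in> {-r..0}" for th using that assms by (intro gx) auto
 ultimately have "(seg x s) \<in> borel_measurable (restrict_space borel {-r..0})"
  by (subst measurable_cong[of _ _ "%th. g (s + th)"]) (auto simp: space_restrict_space)
 moreover have "bounded ((seg x s) ` {-r..0})"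
 proof (rule boundedI[of _ B])
  fix y assume "y \<in> (seg x s) ` {-r..0}"
  then obtain th where "th \<in> {-r..0}" "y = x (s + th)" by blast
  then have "y = g (s + th)" using assms by (subst gx) auto
  then show "norm y <= B" using gB by simp
 qed
 ultimately show ?thesis by (simp add: Chat_space_def)
qed

lemma Lf_segment_integrable:
 assumes "phi \<in> Chat_space r" "\<And>th. th \<in> {-r..0} ==> x th = phi th" "continuous_on {0..T} x" "0 <= t" "t <= T"
 shows "(%s. Lf r m (seg x s)) integrable_on {0..t}"
proof -
 have T: "0 <= T" using assms(4,5) by simp
 obtain g B where g[measurable]: "g \<in> borel_measurable borel" and "\<forall>t. -r <= t \<and> t <= T --> g t = x t"
  and gB: "\<forall>t. \<bar>g t\<bar> <= B"
  using measurable_clamped[OF assms(1-3) T] by blast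
 then have gx: "\<And>t. -r <= t ==> t <= T ==> g t = x t" by blast
 have "(%s. Lf r m (seg g s)) integrable_on {0..t}"
  using Lf_shift_has_integral[OF g, of 0 t B] gB by auto
 moreover have "Lf r m (seg g s) = Lf r m (seg x s)" if "s \<in> {0..t}" for s
  using that assms by (intro Lf_cong gx) auto
 ultimately show ?thesis
  by (subst integrable_cong[of _ _ "%s. Lf r m (seg g s)"]) auto
qed

lemma forced_combine:
 assumes "phi \<in> Chat_space r" "psi \<in> Chat_space r" "forced T phi f x" "forced T psi g y"
 shows "forced T (%th. phi th - c * psi th) (%t. f t - c * g t) (%t. x t - c * y t)"
 unfolding forced_def
proof (intro conjI ballI)
 note d = assms(3,4)[unfolded forced_def]
 show "continuous_on {0..T} (%t. x t - c * y t)" using d by (auto intro!: continuous_intros)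
 show "x th - c * y th = phi th - c * psi th" if "th \<in> {-r..0}" for th using d that by simp
 fix t assume t: "t \<in> {0..T}"
 have i: "(%s. Lf r m (seg x s)) integrable_on {0..t}" "(%s. Lf r m (seg y s)) integrable_on {0..t}"
  using d t by (intro Lf_segment_integrable[OF assms(1), of _ T] Lf_segment_integrable[OF assms(2), of _ T]; simp)+
 have "Lf r m (%th. x (s + th) - c * y (s + th)) = Lf r m (seg x s) - c * Lf r m (seg y s)"
  if "s \<in> {0..t}" for s
 proof -
  have "(seg x s) \<in> Chat_space r" "(seg y s) \<in> Chat_space r"
   using d t that by (intro segment_Chat[OF assms(1), of _ T] segment_Chat[OF assms(2), of _ T]; simp)+
  then have "integrable m (%u. fold_sgn u *\<^sub>R x (s + fold_loc r u))"
   "integrable m (%u. fold_sgn u *\<^sub>R y (s + fold_loc r u))"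
   by (auto dest: integrable_Lf_Chat)
  then show ?thesis by (simp add: Lf_def algebra_simps)
 qed
 then have "integral {0..t} (%s. Lf r m (%th. x (s + th) - c * y (s + th))) = integral {0..t} (%s. Lf r m (seg x s) - c * Lf r m (seg y s))"
  by (intro Henstock_Kurzweil_Integration.integral_cong) auto
 also have "... = integral {0..t} (%s. Lf r m (seg x s)) - c * integral {0..t} (%s. Lf r m (seg y s))"
  using i by (subst Henstock_Kurzweil_Integration.integral_diff) (auto intro: integrable_on_mult_right)
 finally have e: "integral {0..t} (%s. Lf r m (%th. x (s + th) - c * y (s + th))) =
   integral {0..t} (%s. Lf r m (seg x s)) - c * integral {0..t} (%s. Lf r m (seg y s))" .
 have "x t = phi 0 + f t + integral {0..t} (%s. Lf r m (seg x s))"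
  "y t = psi 0 + g t + integral {0..t} (%s. Lf r m (seg y s))"
  using d t by blast+
 then show "x t - c * y t = phi 0 - c * psi 0 + (f t - c * g t) + integral {0..t} (%s. Lf r m (%th. x (s + th) - c * y (s + th)))"
  unfolding e by (simp add: algebra_simps)
qed

lemma forced_bound:
 assumes f: "forced T phi f x" and B: "\<And>th. th \<in> {-r..0} ==> abs (phi th) <= B"
  and A: "\<And>s. 0 <= s ==> s <= T ==> abs (f s) <= A"
  and s: "-r <= s" "s <= T" and T: "0 <= T"
 shows "abs (x s) <= (A + B) * exp (K * max 0 s)"
proof -
 note d = f[unfolded forced_def]
 have AB: "0 <= A" "0 <= B" using A[of 0] B[of 0] r_pos T by auto
 show ?thesis
 proof (cases "s <= 0")
  case True then show ?thesis using d B[of s] s AB by auto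
 next
  case False
  have "abs (x s) <= (A + B) * exp (K * s)"
  proof (rule delay_gronwall)
   show "continuous_on {0..T} x" using d by simp
   show "abs (x s) <= A + B" if "-r <= s" "s < 0" for s using d B[of s] that AB by auto
   fix s assume s: "0 <= s" "s <= T"
   have "x s = phi 0 + f s + integral {0..s} (%s. Lf r m (seg x s))" using d s by simp
   then show "abs (x s) <= A + B + abs (integral {0..s} (%tau. Lf r m (seg x tau)))"
    using A[OF s] B[of 0] r_pos by auto
  qed (use False s AB in auto)
  then show ?thesis using False by simp
 qed
qed

lemma forced_unique:
 assumes "phi \<in> Chat_space r" "forced T phi f x" "forced T phi f y" "-r <= s" "s <= T" "0 <= T"
 shows "x s = y s"
 using forced_bound[OF forced_combine[OF assms(1,1,2,3), of 1], of 0 0 s] assms(4-6) by simp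

lemma delay_solution_iff:
 assumes phi: "phi \<in> Chat_space r"
 shows "delay_solution r L phi x \<longleftrightarrow> (\<forall>T\<ge>0. forced T phi (%_. 0) x)"
proof
 assume d: "delay_solution r L phi x"
 then have x0: "\<And>th. th \<in> {-r..0} ==> x th = phi th"
  and hi: "\<And>t. 0 <= t ==> ((%s. L_ext r L (seg x s)) has_integral (x t - phi 0)) {0..t}"
  by (auto simp: delay_solution_def)
 show "\<forall>T\<ge>0. forced T phi (%_. 0) x"
 proof (intro allI impI)
  fix T :: real assume T: "0 <= T"
  have "continuous_on {0..T} (%t. phi 0 + integral {0..t} (%s. L_ext r L (seg x s)))"
   using hi[OF T] by (intro continuous_intros indefinite_integral_continuous_1) auto
  moreover have "x t = phi 0 + integral {0..t} (%s. L_ext r L (seg x s))" if "t \<in> {0..T}" for t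
   using integral_unique[OF hi[of t]] that by simp
  ultimately have c: "continuous_on {0..T} x" using continuous_on_cong[of "{0..T}" "{0..T}" x] by simp
  have "x t = phi 0 + 0 + integral {0..t} (%s. Lf r m (seg x s))" if t: "t \<in> {0..T}" for t
  proof -
   have "L_ext r L (seg x s) = Lf r m (seg x s)" if "s \<in> {0..t}" for s
    using that t by (intro L_ext_eq segment_Chat[OF phi x0 c]) auto
   then have "((%s. Lf r m (seg x s)) has_integral (x t - phi 0)) {0..t}"
    using hi[of t] t by (subst has_integral_cong[of _ _ "%s. L_ext r L (seg x s)"]) auto
   then show ?thesis by (simp add: integral_unique)
  qed
  then show "forced T phi (%_. 0) x" using x0 c by (simp add: forced_def)
 qed
next
 assume d: "\<forall>T\<ge>0. forced T phi (%_. 0) x"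
 then have x0: "\<And>th. th \<in> {-r..0} ==> x th = phi th" unfolding forced_def by (meson order_refl)
 show "delay_solution r L phi x"
  unfolding delay_solution_def
 proof (intro conjI ballI allI impI x0)
  fix t :: real assume t: "0 <= t"
  have c: "continuous_on {0..t} x" and e: "x t = phi 0 + 0 + integral {0..t} (%s. Lf r m (seg x s))"
   using d t by (auto simp: forced_def)
  have "L_ext r L (seg x s) = Lf r m (seg x s)" if "s \<in> {0..t}" for s
   using that by (intro L_ext_eq segment_Chat[OF phi x0 c]) auto
  moreover have "((%s. Lf r m (seg x s)) has_integral (x t - phi 0)) {0..t}"
   using integrable_integral[OF Lf_segment_integrable[OF phi x0 c t order_refl]] e by simp
  ultimately show "((%s. L_ext r L (seg x s)) has_integral (x t - phi 0)) {0..t}"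
   by (subst has_integral_cong[of _ _ "%s. Lf r m (seg x s)"]) auto
 qed
qed

lemma That_eq:
 assumes "phi \<in> Chat_space r" "delay_solution r L phi x" "0 <= t" "-r <= th" "th <= 0"
 shows "That r L t phi th = x (t + th)"
proof -
 have "delay_solution r L phi (SOME x. delay_solution r L phi x)" by (rule someI[of "delay_solution r L phi"]) (rule assms(2))
 then show ?thesis unfolding That_def
  using assms delay_solution_iff[OF assms(1)] by (intro forced_unique[OF assms(1), of t]) auto
qed

end

lemma integrable_inverse_square: "integrable lborel (%y::real. C / (1 + y\<^sup>2))"
 and integral_inverse_square: "(LINT y|lborel. C / (1 + y\<^sup>2)) = C * pi"
proof -
 have "set_integrable lborel UNIV (%x::real. inverse (1 + x\<^sup>2))"
  using integrable_inverse_1_plus_square by simp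
 then have i: "integrable lborel (%x::real. inverse (1 + x\<^sup>2))" by (simp add: set_integrable_def)
 then show "integrable lborel (%y::real. C / (1 + y\<^sup>2))" by (simp add: divide_inverse)
 have "(LINT x|lborel. inverse (1 + x\<^sup>2)) = (LBINT x=-\<infinity>..\<infinity>. inverse (1 + x\<^sup>2))"
  by (simp add: interval_lebesgue_integral_def set_lebesgue_integral_def)
 then have "(LINT x|lborel. inverse (1 + x\<^sup>2)) = pi" by (simp add: LBINT_inverse_1_plus_square)
 then show "(LINT y|lborel. C / (1 + y\<^sup>2)) = C * pi" by (simp add: divide_inverse)
qed

abbreviation vseg :: "real => real => real => complex" where
 "vseg a Y \<equiv> linepath (Complex a (-Y)) (Complex a Y)"

lemma vline_tendsto:
 fixes f :: "complex => complex"
 assumes int: "integrable lborel (%y. f (Complex a y))"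
 shows "(%n. contour_integral (vseg a (real (Suc n))) f) \<longlonglongrightarrow> \<i> * (LINT y|lborel. f (Complex a y))"
proof -
 have e: "contour_integral (vseg a (real (Suc n))) f =
   \<i> * (LINT y|lborel. indicator {-real (Suc n)..real (Suc n)} y *\<^sub>R f (Complex a y))" for n
 proof -
  have "set_integrable lborel {-real (Suc n)..real (Suc n)} (%y. f (Complex a y))"
   unfolding set_integrable_def by (rule integrable_mult_indicator[OF _ int]) simp
  then show ?thesis
   by (subst contour_integral_linepath_same_Re[of _ a _ "-real (Suc n)" "real (Suc n)"])
    (auto simp: set_borel_integral_eq_integral(2)[symmetric] set_lebesgue_integral_def)
 qed
 have "(%n. LINT y|lborel. indicator {-real (Suc n)..real (Suc n)} y *\<^sub>R f (Complex a y)) \<longlonglongrightarrow> (LINT y|lborel. f (Complex a y))"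
 proof (rule integral_dominated_convergence[where w="%y. norm (f (Complex a y))"])
  show "AE y in lborel. (%n. indicator {-real (Suc n)..real (Suc n)} y *\<^sub>R f (Complex a y)) \<longlonglongrightarrow> f (Complex a y)"
  proof (rule AE_I2)
   fix y :: real
   obtain N where N: "abs y <= real N" using real_arch_simple by blast
   have "\<forall>\<^sub>F n in sequentially. indicator {-real (Suc n)..real (Suc n)} y *\<^sub>R f (Complex a y) = f (Complex a y)"
    using N by (auto simp: eventually_sequentially indicator_def intro!: exI[of _ N])
   then show "(%n. indicator {-real (Suc n)..real (Suc n)} y *\<^sub>R f (Complex a y)) \<longlonglongrightarrow> f (Complex a y)"
    by (rule tendsto_eventually)
  qed
 qed (use int in "auto simp: indicator_def")
 then show ?thesis unfolding e by (intro tendsto_mult tendsto_const)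
qed

lemma rectpath_sides:
 assumes "(f has_contour_integral I) (rectpath (Complex a c) (Complex b d))"
 shows "I = contour_integral (linepath (Complex a c) (Complex b c)) f
  + contour_integral (linepath (Complex b c) (Complex b d)) f
  + contour_integral (linepath (Complex b d) (Complex a d)) f
  - contour_integral (linepath (Complex a c) (Complex a d)) f"
  "f contour_integrable_on linepath (Complex a c) (Complex b c)"
  "f contour_integrable_on linepath (Complex b c) (Complex b d)"
  "f contour_integrable_on linepath (Complex b d) (Complex a d)"
  "f contour_integrable_on linepath (Complex a c) (Complex a d)"
proof -
 have "f contour_integrable_on rectpath (Complex a c) (Complex b d)"
  using assms by (auto simp: contour_integrable_on_def)
 then have i: "f contour_integrable_on linepath (Complex a c) (Complex b c)"
  "f contour_integrable_on linepath (Complex b c) (Complex b d)"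
  "f contour_integrable_on linepath (Complex b d) (Complex a d)"
  "f contour_integrable_on linepath (Complex a d) (Complex a c)"
  by (auto simp: rectpath_def Let_def)
 then show "f contour_integrable_on linepath (Complex a c) (Complex b c)"
  "f contour_integrable_on linepath (Complex b c) (Complex b d)"
  "f contour_integrable_on linepath (Complex b d) (Complex a d)" by auto
 show i4: "f contour_integrable_on linepath (Complex a c) (Complex a d)"
  using contour_integrable_reversepath[OF _ i(4)] by simp
 have "contour_integral (linepath (Complex a d) (Complex a c)) f = - contour_integral (linepath (Complex a c) (Complex a d)) f"
  using contour_integral_reversepath[of "linepath (Complex a c) (Complex a d)" f] by simp
 moreover have "I = contour_integral (rectpath (Complex a c) (Complex b d)) f"
  using assms by (simp add: contour_integral_unique)
 ultimately show "I = contour_integral (linepath (Complex a c) (Complex b c)) f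
  + contour_integral (linepath (Complex b c) (Complex b d)) f
  + contour_integral (linepath (Complex b d) (Complex a d)) f
  - contour_integral (linepath (Complex a c) (Complex a d)) f"
  using i by (simp add: rectpath_def Let_def)
qed

lemma linepath_integral_bound:
 assumes "f contour_integrable_on linepath p q" "\<And>z. z \<in> closed_segment p q ==> cmod (f z) <= B" "0 <= B"
  "cmod (q - p) <= l"
 shows "cmod (contour_integral (linepath p q) f) <= B * l"
proof -
 have "cmod (contour_integral (linepath p q) f) <= B * cmod (q - p)"
  by (rule has_contour_integral_bound_linepath[OF has_contour_integral_integral[OF assms(1)] assms(3)])
   (rule assms(2))
 also have "... <= B * l" using assms by (intro mult_left_mono) auto
 finally show ?thesis .
qed

lemma seg_hor: "z \<in> closed_segment (Complex a y) (Complex b y) ==> Im z = y \<and> min a b <= Re z \<and> Re z <= max a b"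
 by (auto simp: closed_segment_same_Im closed_segment_eq_real_ivl split: if_splits)

lemma seg_ver: "z \<in> closed_segment (Complex a y) (Complex a y') ==> Re z = a"
 by (auto simp: closed_segment_same_Re)

lemma cmod_Complex_diff: "cmod (Complex a y - Complex b y) = abs (a - b)" "cmod (Complex a y - Complex a y') = abs (y - y')"
 by (simp_all add: norm_complex_def)

lemma rectpath_sub_halfplane:
 assumes "c < a" "a <= b" "y <= y'"
 shows "path_image (rectpath (Complex a y) (Complex b y')) \<subseteq> {z. c < Re z}"
proof -
 have "path_image (rectpath (Complex a y) (Complex b y')) \<subseteq> cbox (Complex a y) (Complex b y')"
  using assms by (intro path_image_rectpath_subset_cbox) auto
 also have "... \<subseteq> {z. c < Re z}" using assms by (auto simp: in_cbox_complex_iff)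
 finally show ?thesis .
qed

definition quad_decay :: "real => real => (complex => complex) => bool" where
 "quad_decay a C F \<longleftrightarrow> (\<forall>z. a <= Re z --> cmod (F z) <= C / (1 + (cmod z)\<^sup>2))"

definition ilap :: "real => (complex => complex) => real => complex" where
 "ilap a F t = of_real (1 / (2 * pi)) * (LINT y|lborel. exp (Complex a y * of_real t) * F (Complex a y))"

lemma quad_decay_nonneg: "quad_decay a C F ==> 0 <= C"
proof -
 assume "quad_decay a C F"
 then have "a <= Re (of_real a) --> cmod (F (of_real a)) <= C / (1 + (cmod (of_real a))\<^sup>2)"
  unfolding quad_decay_def by blast
 then have "cmod (F (of_real a)) <= C / (1 + (cmod (of_real a))\<^sup>2)" by simp
 then have "0 <= C / (1 + (cmod (of_real a))\<^sup>2)" by (rule order_trans[OF norm_ge_zero])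
 moreover have "1 + (cmod (of_real a))\<^sup>2 > 0" by (simp add: add_pos_nonneg)
 ultimately show ?thesis by (simp add: zero_le_divide_iff)
qed

lemma quad_decay_line:
 assumes "quad_decay a C F" "a <= b"
 shows "cmod (F (Complex b y)) <= C / (1 + y\<^sup>2)"
proof -
 have "cmod (F (Complex b y)) <= C / (1 + (cmod (Complex b y))\<^sup>2)"
  using assms unfolding quad_decay_def by simp
 also have "... <= C / (1 + y\<^sup>2)"
  using quad_decay_nonneg[OF assms(1)] by (intro divide_left_mono mult_pos_pos) (auto simp: cmod_power2 add_pos_nonneg)
 finally show ?thesis .
qed

lemma quad_decay_mono: "quad_decay a C F ==> a <= b ==> quad_decay b C F"
 by (auto simp: quad_decay_def)

lemma cont_Complex: "continuous_on UNIV (%y. Complex a y)"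
 unfolding Complex_eq by (intro continuous_intros)

lemma measurable_Complex[measurable]: "(%y. Complex a y) \<in> borel_measurable borel"
 by (rule borel_measurable_continuous_onI[OF cont_Complex])

lemma ilap_measurable:
 assumes "continuous_on {z. c < Re z} F" "c < a"
 shows "(%y. F (Complex a y)) \<in> borel_measurable borel"
 by (rule borel_measurable_continuous_onI, rule continuous_on_compose2[OF assms(1) cont_Complex])
  (use assms in auto)

lemma ilap_integrable:
 assumes F: "(%y. F (Complex a y)) \<in> borel_measurable borel" "quad_decay a C F"
 shows "integrable lborel (%y. exp (Complex a y * of_real t) * F (Complex a y))"
proof (rule Bochner_Integration.integrable_bound[OF integrable_inverse_square[of "exp (a * t) * C"]])
 show "AE y in lborel. norm (exp (Complex a y * of_real t) * F (Complex a y)) <= norm (exp (a * t) * C / (1 + y\<^sup>2))"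
  using quad_decay_line[OF F(2) order_refl] quad_decay_nonneg[OF F(2)]
  by (intro AE_I2) (auto simp: norm_mult abs_mult abs_divide mult_left_mono simp flip: times_divide_eq_right)
qed (use F in measurable)

lemma ilap_bound:
 assumes F: "(%y. F (Complex a y)) \<in> borel_measurable borel" "quad_decay a C F"
 shows "cmod (ilap a F t) <= C / 2 * exp (a * t)"
proof -
 have "cmod (LINT y|lborel. exp (Complex a y * of_real t) * F (Complex a y)) <= (LINT y|lborel. exp (a * t) * C / (1 + y\<^sup>2))"
  using quad_decay_line[OF F(2) order_refl]
  by (intro order_trans[OF integral_norm_bound] integral_mono integrable_norm ilap_integrable[OF F] integrable_inverse_square)
   (auto simp: norm_mult mult_left_mono simp flip: times_divide_eq_right)
 then show ?thesis
  unfolding ilap_def integral_inverse_square norm_mult by (simp add: norm_divide field_simps)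
qed

lemma continuous_ilap:
 assumes F: "(%y. F (Complex a y)) \<in> borel_measurable borel" "quad_decay a C F"
 shows "isCont (ilap a F) t"
 unfolding continuous_at_sequentially o_def
proof (intro allI impI)
 fix x assume x: "x \<longlonglongrightarrow> t"
 obtain B where B: "\<And>n. \<bar>x n\<bar> <= B"
  using convergent_imp_Bseq[OF convergentI[OF x]] by (auto simp: Bseq_def)
 show "(%n. ilap a F (x n)) \<longlonglongrightarrow> ilap a F t"
  unfolding ilap_def
 proof (intro tendsto_mult tendsto_const integral_dominated_convergence)
  show "integrable lborel (%y. exp (abs a * B) * C / (1 + y\<^sup>2))" by (rule integrable_inverse_square)
  show "AE y in lborel. norm (exp (Complex a y * of_real (x n)) * F (Complex a y)) <= exp (abs a * B) * C / (1 + y\<^sup>2)" for n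
  proof -
   have "a * x n <= abs a * abs (x n)" by (metis abs_ge_self abs_mult)
   also have "... <= abs a * B" using B by (intro mult_left_mono) auto
   finally have "exp (a * x n) <= exp (abs a * B)" by simp
   then show ?thesis using quad_decay_line[OF F(2) order_refl]
    by (intro AE_I2) (auto simp: norm_mult simp flip: times_divide_eq_right intro!: mult_mono)
  qed
  show "AE y in lborel. (%n. exp (Complex a y * of_real (x n)) * F (Complex a y)) \<longlonglongrightarrow> exp (Complex a y * of_real t) * F (Complex a y)"
   by (intro AE_I2 tendsto_intros x)
 qed (use F in measurable)
qed

lemma ilap_shift:
 assumes F: "F holomorphic_on {z. c < Re z}" "quad_decay a C F" and c: "c < a" "a <= b"
 shows "ilap a F t = ilap b F t"
proof -
 let ?f = "%z. exp (z * of_real t) * F z"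
 have C: "0 <= C" using quad_decay_nonneg F(2) by auto
 define M where "M = exp (max \<bar>a\<bar> \<bar>b\<bar> * abs t)"
 have hol: "?f holomorphic_on {z. c < Re z}" by (intro holomorphic_intros F)
 have cont: "continuous_on {z. c < Re z} F" using F(1) by (rule holomorphic_on_imp_continuous_on)
 have meas: "(%y. F (Complex a y)) \<in> borel_measurable borel" "(%y. F (Complex b y)) \<in> borel_measurable borel"
  using ilap_measurable[OF cont] c by auto
 have lim: "(%n. contour_integral (vseg a (real (Suc n))) ?f) \<longlonglongrightarrow> \<i> * (LINT y|lborel. ?f (Complex a y))"
   "(%n. contour_integral (vseg b (real (Suc n))) ?f) \<longlonglongrightarrow> \<i> * (LINT y|lborel. ?f (Complex b y))"
  by (rule vline_tendsto[OF ilap_integrable[OF meas(1) F(2)]],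
    rule vline_tendsto[OF ilap_integrable[OF meas(2) quad_decay_mono[OF F(2) c(2)]]])
 have d: "cmod (contour_integral (vseg a (real (Suc n))) ?f - contour_integral (vseg b (real (Suc n))) ?f) <= (2 * M * C * (b - a)) * inverse (real (Suc n))" for n
 proof -
  define Y where "Y = real (Suc n)"
  have Y: "Y >= 1" by (simp add: Y_def)
  have I: "(?f has_contour_integral 0) (rectpath (Complex a (-Y)) (Complex b Y))"
   by (rule Cauchy_theorem_convex_simple[OF hol convex_halfspace_Re_gt])
    (use rectpath_sub_halfplane[OF c] Y in auto)
  have bd: "cmod (contour_integral (linepath p q) ?f) <= (M * (C / Y)) * (b - a)"
   if i: "?f contour_integrable_on linepath p q" and "(p = Complex a y \<and> q = Complex b y) \<or> (p = Complex b y \<and> q = Complex a y)"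
    and y: "abs y = Y" for p q y
  proof (rule linepath_integral_bound[OF i])
   fix z assume "z \<in> closed_segment p q"
   then have z: "Im z = y" "a <= Re z" "Re z <= b" using that(2) c seg_hor[of z a y b] seg_hor[of z b y a] by auto
   have "Re z * t <= abs (Re z) * abs t" by (metis abs_ge_self abs_mult)
   also have "... <= max \<bar>a\<bar> \<bar>b\<bar> * abs t" using z by (intro mult_right_mono) auto
   finally have "cmod (exp (z * of_real t)) <= M" by (simp add: M_def)
   moreover have "cmod (F z) <= C / Y"
   proof -
    have "cmod (F z) <= C / (1 + (cmod z)\<^sup>2)" using F(2) z by (simp add: quad_decay_def)
    also have "... <= C / Y"
    proof (intro divide_left_mono mult_pos_pos C)
     have "Y * 1 <= Y * Y" using Y by (intro mult_left_mono) auto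
     also have "Y * Y = (Im z)\<^sup>2" using z y by (metis power2_abs power2_eq_square)
     also have "... <= (cmod z)\<^sup>2" by (simp add: cmod_power2)
     finally show "Y <= 1 + (cmod z)\<^sup>2" by simp
    qed (use Y in "auto simp: add_pos_nonneg")
    finally show ?thesis .
   qed
   ultimately show "cmod (?f z) <= M * (C / Y)" unfolding norm_mult using C Y by (intro mult_mono) (auto simp: M_def)
  next
   show "cmod (q - p) <= b - a" using that(2) c(2) by (auto simp: cmod_Complex_diff)
  qed (use C Y in "auto simp: M_def")
  have "contour_integral (vseg a Y) ?f - contour_integral (vseg b Y) ?f =
   contour_integral (linepath (Complex a (-Y)) (Complex b (-Y))) ?f + contour_integral (linepath (Complex b Y) (Complex a Y)) ?f"
   using rectpath_sides(1)[OF I] by (simp add: algebra_simps)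
  then have "cmod (contour_integral (vseg a Y) ?f - contour_integral (vseg b Y) ?f) <= (M * (C / Y)) * (b - a) + (M * (C / Y)) * (b - a)"
   using bd[OF rectpath_sides(2)[OF I], of "-Y"] bd[OF rectpath_sides(4)[OF I], of Y] Y
   by (simp only:) (intro order_trans[OF norm_triangle_ineq] add_mono; simp)
  also have "... = (2 * M * C * (b - a)) * inverse Y" by (simp add: field_simps)
  finally show ?thesis by (simp add: Y_def)
 qed
 have "(%n. contour_integral (vseg a (real (Suc n))) ?f - contour_integral (vseg b (real (Suc n))) ?f) \<longlonglongrightarrow> 0"
 proof (rule Lim_null_comparison)
  show "\<forall>\<^sub>F n in sequentially. norm (contour_integral (vseg a (real (Suc n))) ?f - contour_integral (vseg b (real (Suc n))) ?f) <= (2 * M * C * (b - a)) * inverse (real (Suc n))"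
   using d by (intro always_eventually) blast
  show "(%n. (2 * M * C * (b - a)) * inverse (real (Suc n))) \<longlonglongrightarrow> 0"
   using tendsto_mult_right_zero[OF LIMSEQ_inverse_real_of_nat] .
 qed
 moreover have "(%n. contour_integral (vseg a (real (Suc n))) ?f - contour_integral (vseg b (real (Suc n))) ?f) \<longlonglongrightarrow> \<i> * (LINT y|lborel. ?f (Complex a y)) - \<i> * (LINT y|lborel. ?f (Complex b y))"
  by (intro tendsto_diff lim)
 ultimately have "\<i> * (LINT y|lborel. ?f (Complex a y)) - \<i> * (LINT y|lborel. ?f (Complex b y)) = 0"
  by (rule LIMSEQ_unique[symmetric])
 then show ?thesis by (simp add: ilap_def)
qed

lemma vline_zero:
 assumes int: "integrable lborel (%y. f (Complex a y))"
  and small: "\<And>n. cmod (contour_integral (vseg a (real (Suc n))) f - c) <= D / real (Suc n)"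
 shows "\<i> * (LINT y|lborel. f (Complex a y)) = c"
proof -
 have "(%n. contour_integral (vseg a (real (Suc n))) f - c) \<longlonglongrightarrow> 0"
 proof (rule Lim_null_comparison)
  show "\<forall>\<^sub>F n in sequentially. norm (contour_integral (vseg a (real (Suc n))) f - c) <= D * inverse (real (Suc n))"
   using small by (intro always_eventually) (auto simp: divide_inverse)
  show "(%n. D * inverse (real (Suc n))) \<longlonglongrightarrow> 0"
   using tendsto_mult_right_zero[OF LIMSEQ_inverse_real_of_nat] .
 qed
 moreover have "(%n. contour_integral (vseg a (real (Suc n))) f - c) \<longlonglongrightarrow> \<i> * (LINT y|lborel. f (Complex a y)) - c"
  by (intro tendsto_diff vline_tendsto int tendsto_const)
 ultimately show ?thesis using LIMSEQ_unique by fastforce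
qed

lemma norm_ge_Im: "abs (Im z) >= Y ==> cmod z >= Y"
 using abs_Im_le_cmod[of z] by linarith

lemma norm_ge_Re: "abs (Re z) >= Y ==> cmod z >= Y"
 using abs_Re_le_cmod[of z] by linarith

lemma ilap_neg:
 assumes F: "F holomorphic_on {z. c < Re z}" "quad_decay a C F" and c: "c < a" and t: "t <= 0"
 shows "ilap a F t = 0"
proof -
 let ?f = "%z. exp (z * of_real t) * F z"
 have C: "0 <= C" using quad_decay_nonneg F(2) by auto
 define M where "M = exp (a * t)"
 have hol: "?f holomorphic_on {z. c < Re z}" by (intro holomorphic_intros F)
 have cont: "continuous_on {z. c < Re z} F" using F(1) by (rule holomorphic_on_imp_continuous_on)
 have meas: "(%y. F (Complex a y)) \<in> borel_measurable borel"
  using ilap_measurable[OF cont] c by auto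
 have "\<i> * (LINT y|lborel. ?f (Complex a y)) = 0"
 proof (rule vline_zero[OF ilap_integrable[OF meas F(2)]])
  fix n
  define Y where "Y = real (Suc n)"
  have Y: "Y >= 1" by (simp add: Y_def)
  define b where "b = abs a + Y"
  define l where "l = (2 * abs a + 1) * Y"
  have l: "b - a <= l" "a <= b"
   using Y mult_left_mono[of 1 Y "2 * abs a"] by (auto simp: l_def b_def algebra_simps)
  have I: "(?f has_contour_integral 0) (rectpath (Complex a (-Y)) (Complex b Y))"
   by (rule Cauchy_theorem_convex_simple[OF hol convex_halfspace_Re_gt])
    (use rectpath_sub_halfplane[OF c l(2), of "-Y" Y] Y in auto)
  have fb: "cmod (?f z) <= M * (C / Y\<^sup>2)" if "a <= Re z" "Y <= cmod z" for z
  proof -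
   have "cmod (exp (z * of_real t)) <= M" using that t by (simp add: M_def mult_right_mono_neg)
   moreover have "cmod (F z) <= C / Y\<^sup>2"
   proof -
    have "Y\<^sup>2 <= (cmod z)\<^sup>2" using that Y by (intro power_mono) auto
    then have Yz: "Y\<^sup>2 <= 1 + (cmod z)\<^sup>2" by linarith
    have "cmod (F z) <= C / (1 + (cmod z)\<^sup>2)" using F(2) that by (simp add: quad_decay_def)
    moreover have "... <= C / Y\<^sup>2"
     by (rule divide_left_mono[OF Yz C]) (use Y in "auto simp: add_pos_nonneg")
    ultimately show ?thesis by linarith
   qed
   ultimately show ?thesis unfolding norm_mult using C Y by (intro mult_mono) (auto simp: M_def)
  qed
  have MC: "0 <= M * (C / Y\<^sup>2)" using C by (simp add: M_def)
  have b1: "cmod (contour_integral (linepath (Complex a (-Y)) (Complex b (-Y))) ?f) <= M * (C / Y\<^sup>2) * l"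
  proof (rule linepath_integral_bound[OF rectpath_sides(2)[OF I] fb MC])
   fix z assume "z \<in> closed_segment (Complex a (-Y)) (Complex b (-Y))"
   then show "a <= Re z" "Y <= cmod z" using seg_hor[of z a "-Y" b] l Y by (auto intro!: norm_ge_Im)
  qed (use l in "auto simp: cmod_Complex_diff")
  have b2: "cmod (contour_integral (linepath (Complex b (-Y)) (Complex b Y)) ?f) <= M * (C / Y\<^sup>2) * (2 * Y)"
  proof (rule linepath_integral_bound[OF rectpath_sides(3)[OF I] fb MC])
   fix z assume "z \<in> closed_segment (Complex b (-Y)) (Complex b Y)"
   then show "a <= Re z" "Y <= cmod z" using seg_ver[of z b "-Y" Y] Y by (auto intro!: norm_ge_Re simp: b_def)
  qed (use Y in "auto simp: cmod_Complex_diff")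
  have b3: "cmod (contour_integral (linepath (Complex b Y) (Complex a Y)) ?f) <= M * (C / Y\<^sup>2) * l"
  proof (rule linepath_integral_bound[OF rectpath_sides(4)[OF I] fb MC])
   fix z assume "z \<in> closed_segment (Complex b Y) (Complex a Y)"
   then show "a <= Re z" "Y <= cmod z" using seg_hor[of z b "Y" a] l Y by (auto intro!: norm_ge_Im)
  qed (use l in "auto simp: cmod_Complex_diff")
  have "contour_integral (vseg a Y) ?f = contour_integral (linepath (Complex a (-Y)) (Complex b (-Y))) ?f
   + contour_integral (linepath (Complex b (-Y)) (Complex b Y)) ?f
   + contour_integral (linepath (Complex b Y) (Complex a Y)) ?f"
   using rectpath_sides(1)[OF I] by (simp add: algebra_simps)
  also have "cmod ... <= M * (C / Y\<^sup>2) * l + M * (C / Y\<^sup>2) * (2 * Y) + M * (C / Y\<^sup>2) * l"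
   using b1 b2 b3 by (intro order_trans[OF norm_triangle_ineq] add_mono)
  also have "... = (4 * abs a + 4) * M * C / Y" using Y by (simp add: field_simps power2_eq_square l_def)
  finally show "cmod (contour_integral (vseg a (real (Suc n))) ?f - 0) <= (4 * abs a + 4) * M * C / real (Suc n)" by (simp add: Y_def)
 qed
 then show ?thesis by (simp add: ilap_def)
qed

lemma ilap_exp:
 assumes a: "a > 0" and b: "Re b <= 0" "b ~= -1" and t: "t >= 0"
  and dec: "quad_decay a C (%z. 1 / ((z - b) * (z + 1)))"
 shows "ilap a (%z. 1 / ((z - b) * (z + 1))) t = (exp (b * of_real t) - exp (- of_real t)) / (b + 1)"
proof -
 let ?F = "%z. 1 / ((z - b) * (z + 1))"
 let ?f = "%z. exp (z * of_real t) * ?F z"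
 define c where "c = 2 * of_real pi * \<i> * ((exp (b * of_real t) - exp (- of_real t)) / (b + 1))"
 define M where "M = exp (a * t)"
 define N where "N = max (2 * cmod b + 1) (max 3 (a + 1))"
 have b1: "b + 1 ~= 0" using b(2) by (simp add: add_eq_0_iff2)
 have cont: "continuous_on {z. 0 < Re z} ?F"
 proof (intro continuous_intros ballI)
  fix z assume z: "z \<in> {z. 0 < Re z}"
  then have "z ~= b" "z ~= -1" using b by auto
  then show "(z - b) * (z + 1) ~= 0" by (simp add: add_eq_0_iff2)
 qed
 have meas: "(%y. ?F (Complex a y)) \<in> borel_measurable borel"
  by (rule ilap_measurable[OF cont a])
 have "\<i> * (LINT y|lborel. ?f (Complex a y)) = c"
 proof (rule LIMSEQ_unique[OF vline_tendsto[OF ilap_integrable[OF meas dec]]])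
  have small: "cmod (contour_integral (vseg a (real (Suc n))) ?f - c) <= 24 * M * inverse (real (Suc n))" if n: "N <= real n" for n
  proof -
   define Y where "Y = real (Suc n)"
   have Y: "Y >= 2 * cmod b + 1" "Y >= 3" "Y >= a + 1" using n by (auto simp: Y_def N_def)
   have box: "b \<in> box (Complex (-Y) (-Y)) (Complex a Y)" "-1 \<in> box (Complex (-Y) (-Y)) (Complex a Y)"
    using abs_Re_le_cmod[of b] abs_Im_le_cmod[of b] Y a b by (auto simp: in_box_complex_iff)
   have sub: "path_image (rectpath (Complex (-Y) (-Y)) (Complex a Y)) \<subseteq> UNIV - {w}"
    if "w \<in> box (Complex (-Y) (-Y)) (Complex a Y)" for w
    using path_image_rectpath_inter_box[of "Complex (-Y) (-Y)" "Complex a Y"] that Y a by auto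
   have I0: "((%z. exp (z * of_real t) / (z - w)) has_contour_integral 2 * of_real pi * \<i> * exp (w * of_real t)) (rectpath (Complex (-Y) (-Y)) (Complex a Y))"
    if w: "w \<in> box (Complex (-Y) (-Y)) (Complex a Y)" for w
   proof -
    have "((%z. exp (z * of_real t) / (z - w)) has_contour_integral
      of_real (2 * pi) * \<i> * winding_number (rectpath (Complex (-Y) (-Y)) (Complex a Y)) w * exp (w * of_real t)) (rectpath (Complex (-Y) (-Y)) (Complex a Y))"
     by (rule Cauchy_integral_formula_convex_simple[OF convex_UNIV]) (use sub[OF w] in "auto intro!: holomorphic_intros")
    then show ?thesis using winding_number_rectpath[OF w] by simp
   qed
   have I1: "((%z. (exp (z * of_real t) / (z - b) - exp (z * of_real t) / (z - (-1))) / (b + 1)) has_contour_integral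
     (2 * of_real pi * \<i> * exp (b * of_real t) - 2 * of_real pi * \<i> * exp ((-1) * of_real t)) / (b + 1)) (rectpath (Complex (-Y) (-Y)) (Complex a Y))"
    by (intro has_contour_integral_div has_contour_integral_diff I0 box)
   have I: "(?f has_contour_integral c) (rectpath (Complex (-Y) (-Y)) (Complex a Y))"
   proof (rule has_contour_integral_eq)
    show "((%z. (exp (z * of_real t) / (z - b) - exp (z * of_real t) / (z - (-1))) / (b + 1)) has_contour_integral c) (rectpath (Complex (-Y) (-Y)) (Complex a Y))"
     using I1 by (simp add: c_def diff_divide_distrib right_diff_distrib)
    fix z assume "z \<in> path_image (rectpath (Complex (-Y) (-Y)) (Complex a Y))"
    then have "z - b ~= 0" "z + 1 ~= 0" using sub[OF box(1)] sub[OF box(2)] by (auto simp: add_eq_0_iff2)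
    then have "exp (z * of_real t) / (z - b) - exp (z * of_real t) / (z + 1)
      = (exp (z * of_real t) * (z + 1) - exp (z * of_real t) * (z - b)) / ((z - b) * (z + 1))"
     by (rule diff_frac_eq)
    also have "exp (z * of_real t) * (z + 1) - exp (z * of_real t) * (z - b) = exp (z * of_real t) * (b + 1)"
     by (simp add: algebra_simps)
    finally show "(exp (z * of_real t) / (z - b) - exp (z * of_real t) / (z - (-1))) / (b + 1) = ?f z"
     using b1 by simp
   qed
   have fb: "cmod (?f z) <= M * (4 / Y\<^sup>2)" if "Re z <= a" "Y <= cmod z" for z
   proof -
    have "cmod (exp (z * of_real t)) <= M" using that t by (simp add: M_def mult_right_mono)
    moreover have "cmod (?F z) <= 4 / Y\<^sup>2"
    proof -
     have "Y / 2 <= cmod (z - b)" using norm_triangle_ineq2[of z b] that Y by linarith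
     moreover have "Y / 2 <= cmod (z + 1)" using norm_triangle_ineq2[of z "-1"] that Y by simp
     ultimately have "(Y / 2) * (Y / 2) <= cmod ((z - b) * (z + 1))" unfolding norm_mult using Y by (intro mult_mono) auto
     moreover have "0 < (Y / 2) * (Y / 2)" using Y by simp
     ultimately have "1 / cmod ((z - b) * (z + 1)) <= 1 / ((Y / 2) * (Y / 2))"
      by (intro frac_le) auto
     then show ?thesis using Y by (simp add: norm_divide field_simps power2_eq_square)
    qed
    ultimately show ?thesis unfolding norm_mult by (intro mult_mono) (auto simp: M_def)
   qed
   have MC: "0 <= M * (4 / Y\<^sup>2)" by (simp add: M_def)
   have s1: "cmod (contour_integral (linepath (Complex (-Y) (-Y)) (Complex a (-Y))) ?f) <= M * (4 / Y\<^sup>2) * (2 * Y)"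
   proof (rule linepath_integral_bound[OF rectpath_sides(2)[OF I] fb MC])
    fix z assume "z \<in> closed_segment (Complex (-Y) (-Y)) (Complex a (-Y))"
    then show "Re z <= a" "Y <= cmod z" using seg_hor[of z "-Y" "-Y" a] a Y by (auto intro!: norm_ge_Im)
   qed (use a Y in "auto simp: cmod_Complex_diff")
   have s3: "cmod (contour_integral (linepath (Complex a Y) (Complex (-Y) Y)) ?f) <= M * (4 / Y\<^sup>2) * (2 * Y)"
   proof (rule linepath_integral_bound[OF rectpath_sides(4)[OF I] fb MC])
    fix z assume "z \<in> closed_segment (Complex a Y) (Complex (-Y) Y)"
    then show "Re z <= a" "Y <= cmod z" using seg_hor[of z a Y "-Y"] a Y by (auto intro!: norm_ge_Im)
   qed (use a Y in "auto simp: cmod_Complex_diff")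
   have s4: "cmod (contour_integral (linepath (Complex (-Y) (-Y)) (Complex (-Y) Y)) ?f) <= M * (4 / Y\<^sup>2) * (2 * Y)"
   proof (rule linepath_integral_bound[OF rectpath_sides(5)[OF I] fb MC])
    fix z assume "z \<in> closed_segment (Complex (-Y) (-Y)) (Complex (-Y) Y)"
    then show "Re z <= a" "Y <= cmod z" using seg_ver[of z "-Y" "-Y" Y] a Y by (auto intro!: norm_ge_Re)
   qed (use a Y in "auto simp: cmod_Complex_diff")
   have "contour_integral (vseg a Y) ?f - c = contour_integral (linepath (Complex (-Y) (-Y)) (Complex (-Y) Y)) ?f
    - contour_integral (linepath (Complex (-Y) (-Y)) (Complex a (-Y))) ?f
    - contour_integral (linepath (Complex a Y) (Complex (-Y) Y)) ?f"
    using rectpath_sides(1)[OF I] by (simp add: algebra_simps)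
   also have "cmod ... <= M * (4 / Y\<^sup>2) * (2 * Y) + M * (4 / Y\<^sup>2) * (2 * Y) + M * (4 / Y\<^sup>2) * (2 * Y)"
    using s1 s3 s4 by (intro order_trans[OF norm_triangle_ineq4] add_mono)
   also have "... = 24 * M * inverse Y" using Y by (simp add: field_simps power2_eq_square)
   finally show ?thesis by (simp add: Y_def)
  qed
  have "(%n. contour_integral (vseg a (real (Suc n))) ?f - c) \<longlonglongrightarrow> 0"
  proof (rule Lim_null_comparison)
   show "\<forall>\<^sub>F n in sequentially. norm (contour_integral (vseg a (real (Suc n))) ?f - c) <= 24 * M * inverse (real (Suc n))"
    unfolding eventually_sequentially
   proof (intro exI allI impI small)
    fix n assume "nat \<lceil>N\<rceil> <= n" then show "N <= real n" by linarith
   qed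
   show "(%n. 24 * M * inverse (real (Suc n))) \<longlonglongrightarrow> 0"
    using tendsto_mult_right_zero[OF LIMSEQ_inverse_real_of_nat] .
  qed
  then show "(%n. contour_integral (vseg a (real (Suc n))) ?f) \<longlonglongrightarrow> c" by (rule LIM_zero_cancel)
 qed
 then have "\<i> * (LINT y|lborel. ?f (Complex a y)) = \<i> * (2 * of_real pi * ((exp (b * of_real t) - exp (- of_real t)) / (b + 1)))"
  by (simp add: c_def mult_ac)
 then have "(LINT y|lborel. ?f (Complex a y)) = 2 * of_real pi * ((exp (b * of_real t) - exp (- of_real t)) / (b + 1))"
  using mult_cancel_left[of "\<i>"] complex_i_not_zero by blast
 then show ?thesis unfolding ilap_def by simp
qed

lemma ilap_add:
 assumes "(%y. F (Complex a y)) \<in> borel_measurable borel" "quad_decay a C F"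
  "(%y. G (Complex a y)) \<in> borel_measurable borel" "quad_decay a D G"
 shows "ilap a (%z. F z + G z) t = ilap a F t + ilap a G t"
 unfolding ilap_def distrib_left
 by (subst Bochner_Integration.integral_add) (auto intro!: ilap_integrable assms simp: distrib_left)

lemma ilap_cmult: "ilap a (%z. c * F z) t = c * ilap a F t"
 unfolding ilap_def by (simp add: mult.left_commute)

lemma quad_decay_cmult: "quad_decay a C F ==> quad_decay a (cmod c * C) (%z. c * F z)"
 unfolding quad_decay_def norm_mult by (auto intro!: mult_left_mono simp flip: times_divide_eq_right)

lemma quad_decay_add: "quad_decay a C F ==> quad_decay a D G ==> quad_decay a (C + D) (%z. F z + G z)"
 unfolding quad_decay_def add_divide_distrib by (auto intro: norm_triangle_mono)

lemma ilap_cong: "(\<And>z. Re z = a ==> F z = G z) ==> ilap a F = ilap a G"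
 by (auto simp: ilap_def fun_eq_iff intro!: Bochner_Integration.integral_cong)

lemma quad_decay_double_pole:
 assumes a: "1 <= a" and b: "Re b <= 0" "cmod b <= be"
 shows "quad_decay a (4 * be + 4) (%z. 1 / ((z - b) * (z + 1)))"
 unfolding quad_decay_def
proof (intro allI impI)
 fix z assume z: "a <= Re z"
 have be: "0 <= be" using b(2) norm_ge_zero[of b] by linarith
 have z1: "1 <= cmod z" using z a complex_Re_le_cmod[of z] by linarith
 have "cmod z / (2 * be + 2) <= cmod (z - b)"
 proof (cases "2 * be <= cmod z")
  case True
  have "cmod z / (2 * be + 2) <= cmod z / 2" using be by (intro frac_le) auto
  also have "... <= cmod (z - b)" using norm_triangle_ineq2[of z b] b True by linarith
  finally show ?thesis .
 next
  case False
  then have "cmod z / (2 * be + 2) <= 1" using be by (simp add: divide_le_eq)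
  also have "... <= cmod (z - b)" using complex_Re_le_cmod[of "z - b"] z a b by simp
  finally show ?thesis .
 qed
 moreover have "cmod z <= cmod (z + 1)"
 proof -
  have "(Re z)\<^sup>2 <= (Re z + 1)\<^sup>2" using z a by (intro power_mono) auto
  then show ?thesis by (simp add: cmod_def)
 qed
 ultimately have "(cmod z / (2 * be + 2)) * cmod z <= cmod ((z - b) * (z + 1))"
  unfolding norm_mult using z1 by (intro mult_mono) auto
 moreover have "(1 + (cmod z)\<^sup>2) / (4 * be + 4) <= (cmod z / (2 * be + 2)) * cmod z"
 proof -
  have "1 * 1 <= cmod z * cmod z" using z1 by (intro mult_mono) auto
  then have "(1 + (cmod z)\<^sup>2) / (4 * be + 4) <= (2 * (cmod z * cmod z)) / (4 * be + 4)"
   using be by (intro divide_right_mono) (auto simp: power2_eq_square)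
  also have "... = (2 * (cmod z * cmod z)) / (2 * (2 * be + 2))" by (simp add: algebra_simps)
  also have "... = (cmod z / (2 * be + 2)) * cmod z" by (subst mult_divide_mult_cancel_left) auto
  finally show ?thesis .
 qed
 ultimately have le: "(1 + (cmod z)\<^sup>2) / (4 * be + 4) <= cmod ((z - b) * (z + 1))" by linarith
 have "0 < (1 + (cmod z)\<^sup>2) / (4 * be + 4)" using be by (intro divide_pos_pos) (auto simp: add_pos_nonneg)
 then have "1 / cmod ((z - b) * (z + 1)) <= 1 / ((1 + (cmod z)\<^sup>2) / (4 * be + 4))" using le by (intro frac_le) auto
 then show "cmod (1 / ((z - b) * (z + 1))) <= (4 * be + 4) / (1 + (cmod z)\<^sup>2)" by (simp add: norm_divide)
qed

lemma ilap_average: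
 fixes N :: "'b measure" and w :: "'b => real" and tau :: "'b => real"
 assumes N: "sigma_finite_measure N" and w: "integrable N w" and tau[measurable]: "tau \<in> borel_measurable N"
  and tauB: "\<And>p. \<bar>tau p\<bar> <= T"
  and F[measurable]: "(%y. F (Complex a y)) \<in> borel_measurable borel" "quad_decay a C F"
 shows "(LINT p|N. w p *\<^sub>R ilap a F (tau p)) =
  of_real (1 / (2 * pi)) * (LINT y|lborel. F (Complex a y) * (LINT p|N. w p *\<^sub>R exp (Complex a y * of_real (tau p))))"
proof -
 interpret N: sigma_finite_measure N by (rule N)
 interpret pair_sigma_finite lborel N ..
 have wm[measurable]: "w \<in> borel_measurable N" using w by simp
 define f where "f y p = w p *\<^sub>R (exp (Complex a y * of_real (tau p)) * F (Complex a y))" for y p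
 have fm: "case_prod f \<in> borel_measurable (lborel \<Otimes>\<^sub>M N)" unfolding f_def[abs_def] by measurable
 have C: "0 <= C" using quad_decay_nonneg F(2) by auto
 have fB: "norm (f y p) <= abs (w p) * (exp (abs a * T) * C / (1 + y\<^sup>2))" for y p
 proof -
  have "a * tau p <= abs a * abs (tau p)" by (metis abs_ge_self abs_mult)
  also have "... <= abs a * T" using tauB by (intro mult_left_mono) auto
  finally have "exp (a * tau p) * cmod (F (Complex a y)) <= exp (abs a * T) * (C / (1 + y\<^sup>2))"
   using quad_decay_line[OF F(2) order_refl] by (intro mult_mono) auto
  then show ?thesis unfolding f_def norm_scaleR norm_mult by (intro mult_left_mono) auto
 qed
 have int: "integrable (lborel \<Otimes>\<^sub>M N) (case_prod f)"
 proof (rule Fubini_integrable[OF fm])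
  have i1: "integrable N (%p. f y p)" for y
   by (rule Bochner_Integration.integrable_bound[OF integrable_mult_left[OF integrable_abs[OF w], of "exp (abs a * T) * C / (1 + y\<^sup>2)"]])
    (use fB[of y] C in "auto simp: f_def intro!: AE_I2")
  then show "AE y in lborel. integrable N (%p. case_prod f (y, p))" by simp
  show "integrable lborel (%y. LINT p|N. norm (case_prod f (y, p)))"
  proof (rule Bochner_Integration.integrable_bound[OF integrable_inverse_square[of "(LINT p|N. \<bar>w p\<bar>) * (exp (abs a * T) * C)"]])
   show "(%y. LINT p|N. norm (case_prod f (y, p))) \<in> borel_measurable lborel"
    using fm by measurable
   show "AE y in lborel. norm (LINT p|N. norm (case_prod f (y, p))) <= norm ((LINT p|N. \<bar>w p\<bar>) * (exp (abs a * T) * C) / (1 + y\<^sup>2))"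
   proof (rule AE_I2)
    fix y
    have "(LINT p|N. norm (f y p)) <= (LINT p|N. \<bar>w p\<bar> * (exp (abs a * T) * C / (1 + y\<^sup>2)))"
     using fB by (intro integral_mono integrable_norm i1 integrable_mult_left integrable_abs w)
    also have "... = (LINT p|N. \<bar>w p\<bar>) * (exp (abs a * T) * C) / (1 + y\<^sup>2)" by simp
    also have "... <= norm ((LINT p|N. \<bar>w p\<bar>) * (exp (abs a * T) * C) / (1 + y\<^sup>2))"
     unfolding real_norm_def by (rule abs_ge_self)
    finally show "norm (LINT p|N. norm (case_prod f (y, p))) <= norm ((LINT p|N. \<bar>w p\<bar>) * (exp (abs a * T) * C) / (1 + y\<^sup>2))"
     by simp
   qed
  qed
 qed
 have "(LINT p|N. w p *\<^sub>R ilap a F (tau p)) = of_real (1 / (2 * pi)) * (LINT p|N. (LINT y|lborel. f y p))"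
  unfolding ilap_def f_def by (simp add: scaleR_conv_of_real mult.left_commute)
 also have "(LINT p|N. (LINT y|lborel. f y p)) = (LINT y|lborel. (LINT p|N. f y p))"
  using Fubini_integral[OF int] .
 also have fe: "(%y. LINT p|N. f y p) = (%y. F (Complex a y) * (LINT p|N. w p *\<^sub>R exp (Complex a y * of_real (tau p))))"
  unfolding f_def by (simp add: mult.commute scaleR_conv_of_real mult.left_commute mult.assoc flip: integral_mult_right_zero)
 finally show ?thesis .
qed

context delay
begin

definition ell :: "complex => complex" where
 "ell z = Lf r m (%th. exp (z * of_real th))"

lemma exp_fold_measurable[measurable]: "(%u. exp (z * complex_of_real (fold_loc r u))) \<in> borel_measurable borel"
 by measurable

lemma norm_exp_seg:
 assumes "-a <= Re z" "0 <= a" "-r <= th" "th <= 0"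
 shows "cmod (exp (z * of_real th)) <= exp (a * r)"
proof -
 have "Re z * th <= (-a) * th" using assms by (intro mult_right_mono_neg) auto
 also have "... <= a * r" using assms mult_left_mono[of "-th" r a] by simp
 finally show ?thesis by simp
qed

lemma ell_bound: "-a <= Re z ==> 0 <= a ==> cmod (ell z) <= K * exp (a * r)"
 unfolding ell_def by (rule Lf_bound, rule norm_exp_seg)

lemma integrable_ell: "integrable m (%u. fold_sgn u *\<^sub>R exp (z * complex_of_real (fold_loc r u)))"
 by (rule integrable_Lf[where phi="%th. exp (z * complex_of_real th)" and B="exp (abs (Re z) * r)"])
  (use norm_exp_seg[of "abs (Re z)" z] in auto)

lemma char_fun_eq: "char_fun L z = z - ell z"
proof -
 have "(%th. Re (exp (z * of_real th))) \<in> Cspace r" "(%th. Im (exp (z * of_real th))) \<in> Cspace r"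
  unfolding Cspace_def by (auto intro!: continuous_intros)
 then have "L (%th. Re (exp (z * of_real th))) = Lf r m (%th. Re (exp (z * of_real th)))"
  "L (%th. Im (exp (z * of_real th))) = Lf r m (%th. Im (exp (z * of_real th)))"
  by (auto dest: L_eq)
 moreover have "Lf r m (%th. Re (exp (z * of_real th))) = Re (ell z)" "Lf r m (%th. Im (exp (z * of_real th))) = Im (ell z)"
  unfolding ell_def Lf_def using integral_Re[OF integrable_ell[of z]] integral_Im[OF integrable_ell[of z]] by simp_all
 ultimately show ?thesis by (simp add: char_fun_def complex_surj)
qed

lemma ell_holomorphic: "ell holomorphic_on UNIV"
proof -
 define a where "a n = (LINT u|m. fold_sgn u *\<^sub>R (complex_of_real (fold_loc r u) ^ n /\<^sub>R fact n))" for n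
 have "(%n. a n * (z - 0) ^ n) sums ell z" for z
 proof -
  define f where "f n u = fold_sgn u *\<^sub>R ((z * of_real (fold_loc r u)) ^ n /\<^sub>R fact n)" for n u
  have fB: "norm (f n u) <= (cmod z * r) ^ n /\<^sub>R fact n" for n u
  proof -
   have "norm (f n u) = abs (fold_sgn u) * ((cmod z * abs (fold_loc r u)) ^ n /\<^sub>R fact n)"
    by (simp add: f_def norm_mult norm_power abs_mult)
   also have "... <= 1 * ((cmod z * r) ^ n /\<^sub>R fact n)"
   proof (rule mult_mono)
    have "cmod z * abs (fold_loc r u) <= cmod z * r" using loc_range[of u] by (intro mult_left_mono) auto
    then show "(cmod z * abs (fold_loc r u)) ^ n /\<^sub>R fact n <= (cmod z * r) ^ n /\<^sub>R fact n"
     by (intro scaleR_left_mono power_mono) auto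
   qed (auto simp: fold_sgn_bound simp del: abs_mult)
   finally show ?thesis by simp
  qed
  have s: "summable (%n. (cmod z * r) ^ n /\<^sub>R fact n)" by (rule summable_exp_generic)
  have fi: "integrable m (f n)" for n
  proof (rule m.integrable_const_bound[of _ "(cmod z * r) ^ n /\<^sub>R fact n"])
   show "f n \<in> borel_measurable m" unfolding f_def[abs_def] by measurable
  qed (use fB[of n] in "intro AE_I2")
  have "(%n. integral\<^sup>L m (f n)) sums (LINT u|m. (\<Sum>n. f n u))"
  proof (rule sums_integral[OF fi])
   show "AE u in m. summable (%n. norm (f n u))"
    using fB by (intro AE_I2 summable_comparison_test'[OF s]) auto
   show "summable (%n. LINT u|m. norm (f n u))"
   proof (rule summable_comparison_test'[OF summable_mult[OF s, of K]])
    fix n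
    have "(LINT u|m. norm (f n u)) <= (LINT u|m. (cmod z * r) ^ n /\<^sub>R fact n)"
     using fB by (intro integral_mono integrable_norm fi) auto
    then show "norm (LINT u|m. norm (f n u)) <= K * ((cmod z * r) ^ n /\<^sub>R fact n)"
     by (simp add: K_def)
   qed
  qed
  moreover have "integral\<^sup>L m (f n) = a n * (z - 0) ^ n" for n
   unfolding f_def a_def by (simp add: power_mult_distrib mult.commute flip: integral_mult_right_zero)
  moreover have "(\<Sum>n. f n u) = fold_sgn u *\<^sub>R exp (z * of_real (fold_loc r u))" for u
   unfolding f_def exp_def by (rule suminf_scaleR_right[symmetric]) (rule summable_exp_generic)
  ultimately show ?thesis by (simp add: ell_def Lf_def)
 qed
 then have h: "ell holomorphic_on ball 0 R" for R by (intro power_series_holomorphic)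
 show ?thesis
 proof (subst holomorphic_on_open, simp, intro ballI)
  fix z :: complex
  have "z \<in> ball 0 (cmod z + 1)" by simp
  then show "\<exists>f'. (ell has_field_derivative f') (at z)"
   using h[of "cmod z + 1"] by (subst (asm) holomorphic_on_open) auto
 qed
qed

end

locale delay_char = delay +
 fixes om :: real
 assumes om_pos: "om > 0" and char: "char_condition L om"
begin

definition Dl :: "complex => complex" where "Dl z = z - ell z"

lemma char_fun_Delta: "char_fun L = Dl"
 by (auto simp: Dl_def char_fun_eq fun_eq_iff)

lemma Delta_holomorphic: "Dl holomorphic_on S"
 unfolding Dl_def using ell_holomorphic by (intro holomorphic_intros) (auto elim: holomorphic_on_subset)

lemma Delta_zero: "Dl (\<i> * of_real om) = 0" "Dl (- \<i> * of_real om) = 0"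
 using char unfolding char_condition_def char_fun_Delta by blast+

lemma ell_root: "ell (\<i> * of_real om) = \<i> * of_real om" "ell (- \<i> * of_real om) = - \<i> * of_real om"
 using Delta_zero by (simp_all add: Dl_def)

lemma Delta_zero_cases: "Dl z = 0 ==> z = \<i> * of_real om \<or> z = - \<i> * of_real om \<or> Re z < 0"
 using char unfolding char_condition_def char_fun_Delta by blast

lemma Delta_lower: "-a <= Re z ==> 0 <= a ==> cmod z - K * exp (a * r) <= cmod (Dl z)"
 using ell_bound[of a z] norm_triangle_ineq2[of z "ell z"] by (simp add: Dl_def)

lemma Delta_nonzero: "K < Re z ==> Dl z ~= 0"
 using Delta_lower[of 0 z] K_nonneg complex_Re_le_cmod[of z] by auto

lemma simple_root:
 assumes "zorder Dl a = 1" "Dl a = 0"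
 shows "deriv Dl a ~= 0"
proof -
 have "\<exists>w\<in>UNIV. Dl w ~= 0" using Delta_nonzero[of "of_real (K + 1)"] by auto
 then obtain R where R: "R > 0" "zor_poly Dl a holomorphic_on cball a R"
  "\<And>w. w \<in> cball a R ==> Dl w = zor_poly Dl a w * (w - a) ^ nat 1 \<and> zor_poly Dl a w ~= 0"
  using zorder_exist_zero[of Dl UNIV a, OF Delta_holomorphic open_UNIV connected_UNIV] assms by auto
 have "(zor_poly Dl a has_field_derivative deriv (zor_poly Dl a) a) (at a)"
  using R by (intro holomorphic_derivI[of _ "ball a R"]) (auto elim: holomorphic_on_subset)
 then have "((%w. zor_poly Dl a w * (w - a)) has_field_derivative zor_poly Dl a a) (at a)"
  by (auto intro!: derivative_eq_intros)
 then have "(Dl has_field_derivative zor_poly Dl a a) (at a)"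
  by (rule has_field_derivative_transform_within_open[OF _ open_ball[of a R]]) (use R in auto)
 then have "deriv Dl a = zor_poly Dl a a" by (rule DERIV_imp_deriv)
 then show ?thesis using R(1) R(3)[of a] by simp
qed

lemma deriv_Delta_nonzero: "deriv Dl (\<i> * of_real om) ~= 0" "deriv Dl (- \<i> * of_real om) ~= 0"
 by (rule simple_root, use char in \<open>simp add: char_condition_def char_fun_Delta\<close>, rule Delta_zero,
   rule simple_root, use char in \<open>simp add: char_condition_def char_fun_Delta\<close>, rule Delta_zero)

lemma zero_free_strip:
 "\<exists>kap>0. \<forall>z. Dl z = 0 \<and> -kap <= Re z --> z = \<i> * of_real om \<or> z = - \<i> * of_real om"
proof -
 define Z where "Z = {z \<in> cball 0 (K * exp (1 * r)). Dl z = 0} - {\<i> * of_real om, - \<i> * of_real om}"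
 have "\<not> Dl constant_on UNIV"
  using Delta_nonzero[of "of_real (K + 1)"] Delta_zero(1) unfolding constant_on_def by (metis Re_complex_of_real UNIV_I less_add_one)
 then have "finite {z \<in> cball 0 (K * exp (1 * r)). Dl z = 0}"
  by (intro holomorphic_compact_finite_zeros[OF Delta_holomorphic open_UNIV]) auto
 then have fin: "finite Z" by (simp add: Z_def)
 have neg: "Re z < 0" if "z \<in> Z" for z using that Delta_zero_cases[of z] by (auto simp: Z_def)
 define kap where "kap = Min (insert 1 ((%z. - Re z / 2) ` Z))"
 have "kap > 0" using fin neg by (simp add: kap_def)
 moreover have "z = \<i> * of_real om \<or> z = - \<i> * of_real om" if z: "Dl z = 0" "-kap <= Re z" for z
 proof (rule ccontr)
  assume n: "\<not> ?thesis"
  have "kap <= 1" using fin by (simp add: kap_def)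
  then have "cmod z <= K * exp (1 * r)" using Delta_lower[of 1 z] z by simp
  then have "z \<in> Z" using n z by (auto simp: Z_def)
  then have "kap <= - Re z / 2" using fin by (simp add: kap_def)
  then show False using z neg[OF \<open>z \<in> Z\<close>] by simp
 qed
 ultimately show ?thesis by blast
qed

lemma split_pole:
 assumes "q holomorphic_on S" "open S" "a \<in> S"
 shows "\<exists>g. g holomorphic_on S \<and> (\<forall>z\<in>S - {a}. q z / (z - a) = g z + q a / (z - a))"
proof (intro exI conjI ballI)
 show "(%z. if z = a then deriv q a else (q z - q a) / (z - a)) holomorphic_on S"
  using assms by (intro pole_lemma) (auto simp: interior_open)
qed (auto simp: diff_divide_distrib)

lemma inverse_Delta_split:
 "\<exists>kap g c1 c2. 0 < kap \<and> g holomorphic_on {z. -kap < Re z} \<and>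
  (\<forall>z. -kap < Re z \<and> z ~= \<i> * of_real om \<and> z ~= - \<i> * of_real om -->
    Dl z ~= 0 \<and> 1 / Dl z = g z + c1 / (z - \<i> * of_real om) + c2 / (z + \<i> * of_real om))"
proof -
 define a where "a = \<i> * of_real om"
 have a0: "a ~= 0" "a ~= -a" "2 * a ~= 0" using om_pos by (auto simp: a_def equal_neg_zero)
 obtain kap where kap: "kap > 0" "\<And>z. Dl z = 0 ==> -kap <= Re z ==> z = a \<or> z = -a"
  using zero_free_strip by (auto simp: a_def)
 have D0: "Dl a = 0" "Dl (-a) = 0" using Delta_zero by (auto simp: a_def)
 obtain q1 where q1: "q1 holomorphic_on UNIV" "\<And>z. z ~= a ==> Dl z / (z - a) = q1 z"
  using split_pole[OF Delta_holomorphic open_UNIV, of a] D0 by auto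
 have q10: "q1 (-a) = 0" using q1(2)[of "-a"] D0 a0 by simp
 obtain q where q: "q holomorphic_on UNIV" "\<And>z. z ~= -a ==> q1 z / (z - (-a)) = q z"
  using split_pole[OF q1(1) open_UNIV, of "-a"] q10 by auto
 have fac: "Dl z = (z - a) * (z + a) * q z" for z
 proof (cases "z = a \<or> z = -a")
  case True then show ?thesis using D0 by auto
 next
  case False
  then have "z - a ~= 0" "z + a ~= 0" by (auto simp: add_eq_0_iff2)
  then show ?thesis using q1(2)[of z] q(2)[of z] False by (auto simp: field_simps)
 qed
 have der: "(Dl has_field_derivative (2 * w) * q w) (at w)" if "w = a \<or> w = -a" for w
 proof -
  have "(q has_field_derivative deriv q w) (at w)" using q(1) by (intro holomorphic_derivI[of _ UNIV]) auto
  then have "((%z. (z - a) * (z + a) * q z) has_field_derivative ((w - a) * (w + a) * deriv q w + ((w - a) + (w + a)) * q w)) (at w)"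
   by (auto intro!: derivative_eq_intros simp: algebra_simps)
  moreover have "(w - a) * (w + a) * deriv q w + ((w - a) + (w + a)) * q w = 2 * w * q w" using that by auto
  ultimately have "((%z. (z - a) * (z + a) * q z) has_field_derivative 2 * w * q w) (at w)" by metis
  moreover have "Dl = (%z. (z - a) * (z + a) * q z)" using fac by (rule ext)
  ultimately show ?thesis by simp
 qed
 have qa: "q a ~= 0" "q (-a) ~= 0"
  using DERIV_imp_deriv[OF der[of a]] DERIV_imp_deriv[OF der[of "-a"]] deriv_Delta_nonzero by (auto simp: a_def)
 let ?\<Omega> = "{z. -kap < Re z}"
 have qn: "q z ~= 0" if "z \<in> ?\<Omega>" for z
  using kap(2)[of z] fac[of z] qa that by auto
 have P: "(%z. 1 / q z / (2 * a)) holomorphic_on ?\<Omega>"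
  using q(1) qn a0 by (intro holomorphic_intros) (auto elim: holomorphic_on_subset)
 have op: "open ?\<Omega>" by (rule open_halfspace_Re_gt)
 have ain: "a \<in> ?\<Omega>" "-a \<in> ?\<Omega>" using kap(1) by (auto simp: a_def)
 obtain g1 where g1: "g1 holomorphic_on ?\<Omega>"
  "\<And>z. z \<in> ?\<Omega> - {a} ==> (1 / q z / (2 * a)) / (z - a) = g1 z + (1 / q a / (2 * a)) / (z - a)"
  using split_pole[OF P op ain(1)] by blast
 obtain g2 where g2: "g2 holomorphic_on ?\<Omega>"
  "\<And>z. z \<in> ?\<Omega> - {-a} ==> (1 / q z / (2 * a)) / (z - (-a)) = g2 z + (1 / q (-a) / (2 * a)) / (z - (-a))"
  using split_pole[OF P op ain(2)] by blast
 have main: "Dl z ~= 0 \<and> 1 / Dl z = (g1 z - g2 z) + (1 / q a / (2 * a)) / (z - a) + (- (1 / q (-a) / (2 * a))) / (z + a)"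
  if z: "-kap < Re z" "z ~= a" "z ~= -a" for z
 proof -
  have nz: "z - a ~= 0" "z + a ~= 0" "q z ~= 0" using z qn by (auto simp: add_eq_0_iff2)
  define A where "A = 1 / q z / (2 * a)"
  have "A * (z + a) - A * (z - a) = A * (2 * a)" by (simp add: algebra_simps)
  also have "... = 1 / q z" using a0 by (simp add: A_def)
  finally have "1 / Dl z = (A * (z + a) - A * (z - a)) / ((z - a) * (z + a))"
   by (simp add: fac)
  also have "... = A / (z - a) - A / (z + a)"
   by (rule diff_frac_eq[OF nz(1,2), symmetric])
  finally have "1 / Dl z = (1 / q z / (2 * a)) / (z - a) - (1 / q z / (2 * a)) / (z + a)"
   by (simp only: A_def)
  also have "... = (g1 z + (1 / q a / (2 * a)) / (z - a)) - (g2 z + (1 / q (-a) / (2 * a)) / (z + a))"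
   using g1(2)[of z] g2(2)[of z] z by simp
  finally show ?thesis using nz by (simp add: fac)
 qed
 show ?thesis
  by (rule exI[of _ kap], rule exI[of _ "%z. g1 z - g2 z"], rule exI[of _ "1 / q a / (2 * a)"], rule exI[of _ "- (1 / q (-a) / (2 * a))"])
   (use kap(1) main g1(1) g2(1) in "auto simp: a_def intro!: holomorphic_intros")
qed

lemma fundamental_decay:
 "\<exists>kap c1 c2 C. 0 < kap \<and> 0 <= C \<and> (\<forall>t\<ge>0. cmod (ilap (K + 1) (%z. 1 / ((z + 1) * Dl z)) t
   - c1 * exp (\<i> * of_real om * of_real t) / (1 + \<i> * of_real om)
   - c2 * exp (- \<i> * of_real om * of_real t) / (1 - \<i> * of_real om)) <= C * exp (- kap * t))"
proof -
 define a where "a = \<i> * of_real om"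
 obtain kap0 g c1 c2 where kap0: "0 < kap0" "g holomorphic_on {z. -kap0 < Re z}"
  "\<And>z. -kap0 < Re z ==> z ~= a ==> z ~= - a ==> Dl z ~= 0 \<and> 1 / Dl z = g z + c1 / (z - a) + c2 / (z + a)"
  using inverse_Delta_split by (auto simp: a_def)
 define kap where "kap = min (kap0 / 2) (1 / 2)"
 have kap: "0 < kap" "kap < kap0" "kap <= 1 / 2" using kap0(1) by (auto simp: kap_def)
 define c where "c = min kap0 (3 / 4)"
 have c: "kap < c" "c <= kap0" "c < 1" using kap kap0(1) by (auto simp: c_def kap_def)
 define Rt where "Rt z = g z / (z + 1)" for z
 have Rt_hol: "Rt holomorphic_on {z. -c < Re z}"
  unfolding Rt_def using kap0(2) c
  by (intro holomorphic_intros) (auto simp: complex_eq_iff elim!: holomorphic_on_subset)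
 define Q where "Q = K * exp (1 / 2 * r)"
 define R0 where "R0 = 2 * (Q + om + 2)"
 have Ke: "0 <= Q" using K_nonneg by (simp add: Q_def)
 have R0: "R0 >= 4" using Ke om_pos by (simp add: R0_def)
 have ca: "cmod a = om" using om_pos by (simp add: a_def norm_mult)
 define A where "A = 2 + 2 * cmod c1 + 2 * cmod c2"
 have A0: "0 <= A" by (simp add: A_def)
 have large: "cmod (Rt z) <= 4 * A / (1 + (cmod z)\<^sup>2)" if z: "-kap <= Re z" "R0 <= cmod z" for z
 proof -
  define rho where "rho = cmod z"
  have rho: "rho >= 4" "rho >= R0" using z R0 by (auto simp: rho_def)
  have "om < R0" using om_pos Ke by (simp add: R0_def)
  then have "om < cmod z" using z(2) by (rule less_le_trans)
  then have ne: "z ~= a" "z ~= -a" using ca by auto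
  have D: "rho / 2 <= cmod (Dl z)"
   using Delta_lower[of "1/2" z, folded Q_def] z kap om_pos Ke by (simp add: rho_def R0_def)
  have b1: "rho / 2 <= cmod (z - a)" using norm_triangle_ineq2[of z a] ca z om_pos Ke by (simp add: rho_def R0_def)
  have b2: "rho / 2 <= cmod (z + a)" using norm_triangle_ineq2[of z "-a"] ca z om_pos Ke by (simp add: rho_def R0_def)
  have b3: "rho / 2 <= cmod (z + 1)" using norm_triangle_ineq2[of z "-1"] rho by (simp add: rho_def)
  have "g z = 1 / Dl z - c1 / (z - a) - c2 / (z + a)" using kap0(3)[of z] ne z kap by simp
  also have "cmod ... <= cmod 1 / (rho / 2) + cmod c1 / (rho / 2) + cmod c2 / (rho / 2)"
  proof -
   have fr: "cmod (d / w) <= cmod d / (rho / 2)" if "rho / 2 <= cmod w" for d w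
    unfolding norm_divide by (rule frac_le) (use that rho in simp_all)
   show ?thesis by (intro order_trans[OF norm_triangle_ineq4] add_mono fr D b1 b2)
  qed
  also have "... = A / rho" by (simp add: A_def add_divide_distrib mult.commute)
  finally have "cmod (Rt z) <= (A / rho) / (rho / 2)" unfolding Rt_def norm_divide using b3 rho A0 by (intro frac_le) auto
  also have "... = 4 * A / (2 * rho\<^sup>2)" using rho by (simp add: power2_eq_square)
  also have "... <= 4 * A / (1 + rho\<^sup>2)"
  proof (rule divide_left_mono)
   have "1 * 1 <= rho * rho" using rho by (intro mult_mono) auto
   then show "1 + rho\<^sup>2 <= 2 * rho\<^sup>2" by (simp add: power2_eq_square)
   show "0 < (2 * rho\<^sup>2) * (1 + rho\<^sup>2)" using rho by (intro mult_pos_pos) (auto simp: add_pos_nonneg)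
  qed (use A0 in auto)
  finally show ?thesis by (simp add: rho_def)
 qed
 have "compact ({z. -kap <= Re z} \<inter> cball 0 R0)"
  by (intro closed_Int_compact closed_halfspace_Re_ge) auto
 moreover have "continuous_on ({z. -kap <= Re z} \<inter> cball 0 R0) Rt"
  by (rule continuous_on_subset[OF holomorphic_on_imp_continuous_on[OF Rt_hol]]) (use c in auto)
 ultimately have "bounded (Rt ` ({z. -kap <= Re z} \<inter> cball 0 R0))"
  by (intro compact_imp_bounded compact_continuous_image)
 then obtain B where "\<forall>y\<in>Rt ` ({z. -kap <= Re z} \<inter> cball 0 R0). cmod y <= B"
  unfolding bounded_iff by blast
 then have B: "cmod (Rt z) <= B" if "-kap <= Re z" "cmod z <= R0" for z using that by auto
 define CC where "CC = 4 * A + abs B * (1 + R0\<^sup>2)"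
 have dec: "quad_decay (-kap) CC Rt"
  unfolding quad_decay_def
 proof (intro allI impI)
  fix z assume z: "-kap <= Re z"
  have p: "0 < 1 + (cmod z)\<^sup>2" by (simp add: add_pos_nonneg)
  show "cmod (Rt z) <= CC / (1 + (cmod z)\<^sup>2)"
  proof (cases "R0 <= cmod z")
   case True
   have "4 * A / (1 + (cmod z)\<^sup>2) <= CC / (1 + (cmod z)\<^sup>2)"
    using p by (intro divide_right_mono) (auto simp: CC_def add_nonneg_nonneg)
   then show ?thesis using large[OF z True] by simp
  next
   case False
   have "cmod (Rt z) * (1 + (cmod z)\<^sup>2) <= abs B * (1 + R0\<^sup>2)"
    using B[OF z] False R0 by (intro mult_mono add_left_mono power_mono) auto
   also have "... <= CC" using A0 by (simp add: CC_def)
   finally show ?thesis using p by (simp add: pos_le_divide_eq)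
  qed
 qed
 have shift: "ilap (K + 1) Rt t = ilap (-kap) Rt t" for t
  by (rule ilap_shift[OF Rt_hol dec, symmetric]) (use c K_nonneg kap in auto)
 have contRt: "continuous_on {z. -c < Re z} Rt" by (rule holomorphic_on_imp_continuous_on[OF Rt_hol])
 have mRt: "(%y. Rt (Complex b y)) \<in> borel_measurable borel" if "-kap <= b" for b
  by (rule ilap_measurable[OF contRt]) (use that c in auto)
 define V where "V b z = 1 / ((z - b) * (z + 1))" for b z :: complex
 have mV: "(%y. V b (Complex (K + 1) y)) \<in> borel_measurable borel" for b
  unfolding V_def by measurable
 have dV: "quad_decay (K + 1) (4 * om + 4) (V b)" if "b = a \<or> b = -a" for b
  unfolding V_def using that ca K_nonneg by (intro quad_decay_double_pole) (auto simp: a_def)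
 have Veq: "ilap (K + 1) (V b) t = (exp (b * of_real t) - exp (- of_real t)) / (b + 1)" if b: "b = a \<or> b = -a" and t: "0 <= t" for b t
  unfolding V_def
  by (rule ilap_exp[OF _ _ _ t dV[OF b, unfolded V_def]]) (use b K_nonneg in "auto simp: a_def complex_eq_iff")
 have dRt: "quad_decay (K + 1) CC Rt" by (rule quad_decay_mono[OF dec]) (use kap K_nonneg in auto)
 have split: "ilap (K + 1) (%z. 1 / ((z + 1) * Dl z)) t = ilap (-kap) Rt t + c1 * ilap (K + 1) (V a) t + c2 * ilap (K + 1) (V (-a)) t" for t
 proof -
  have "ilap (K + 1) (%z. 1 / ((z + 1) * Dl z)) t = ilap (K + 1) (%z. Rt z + (c1 * V a z + c2 * V (-a) z)) t"
  proof (rule ilap_cong[THEN fun_cong])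
   fix z :: complex assume z: "Re z = K + 1"
   then have "z ~= a" "z ~= -a" "-kap0 < Re z" using K_nonneg kap0(1) by (auto simp: a_def)
   then have "1 / Dl z = g z + c1 / (z - a) + c2 / (z + a)" using kap0(3)[of z] by simp
   then have "1 / Dl z / (z + 1) = (g z + c1 / (z - a) + c2 / (z + a)) / (z + 1)" by simp
   then show "1 / ((z + 1) * Dl z) = Rt z + (c1 * V a z + c2 * V (-a) z)"
    by (simp add: Rt_def V_def add_divide_distrib mult.commute)
  qed
  also have "ilap (K + 1) (%z. Rt z + (c1 * V a z + c2 * V (-a) z)) t = ilap (K + 1) Rt t + ilap (K + 1) (%z. c1 * V a z + c2 * V (-a) z) t"
   using kap K_nonneg by (intro ilap_add[OF mRt dRt _ quad_decay_add[OF quad_decay_cmult[OF dV] quad_decay_cmult[OF dV]]])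
    (auto intro!: borel_measurable_add borel_measurable_times mV)
  also have "ilap (K + 1) (%z. c1 * V a z + c2 * V (-a) z) t = c1 * ilap (K + 1) (V a) t + c2 * ilap (K + 1) (V (-a)) t"
   by (subst ilap_add[OF _ quad_decay_cmult[OF dV] _ quad_decay_cmult[OF dV]]) (auto intro!: borel_measurable_times mV simp: ilap_cmult)
  finally show ?thesis by (simp add: shift)
 qed
 have "cmod (ilap (K + 1) (%z. 1 / ((z + 1) * Dl z)) t
   - c1 * exp (\<i> * of_real om * of_real t) / (1 + \<i> * of_real om)
   - c2 * exp (- \<i> * of_real om * of_real t) / (1 - \<i> * of_real om)) <= (CC / 2 + cmod c1 + cmod c2) * exp (- kap * t)"
  if t: "0 <= t" for t
 proof -
  have a1: "1 <= cmod (1 + a)" "1 <= cmod (1 - a)"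
   using complex_Re_le_cmod[of "1 + a"] complex_Re_le_cmod[of "1 - a"] by (auto simp: a_def)
  have "ilap (K + 1) (%z. 1 / ((z + 1) * Dl z)) t - c1 * exp (a * of_real t) / (1 + a) - c2 * exp (- a * of_real t) / (1 - a)
   = ilap (-kap) Rt t - c1 * exp (- of_real t) / (1 + a) - c2 * exp (- of_real t) / (1 - a)"
   unfolding split Veq[of a, OF disjI1[OF refl] t] Veq[of "-a", OF disjI2[OF refl] t]
   by (simp add: right_diff_distrib diff_divide_distrib add.commute)
  also have "cmod ... <= CC / 2 * exp (- kap * t) + cmod c1 * exp (- kap * t) + cmod c2 * exp (- kap * t)"
  proof (intro order_trans[OF norm_triangle_ineq4] add_mono)
   show "cmod (ilap (-kap) Rt t) <= CC / 2 * exp (- kap * t)"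
    by (rule ilap_bound[OF mRt dec]) simp
   have e: "exp (-t) <= exp (- kap * t)" using kap t mult_right_mono[of kap 1 t] by simp
   have "cmod (d * exp (- of_real t) / w) <= cmod d * exp (- kap * t)" if "1 <= cmod w" for d w
   proof -
    have "cmod (d * exp (- of_real t) / w) = cmod d * exp (-t) / cmod w" by (simp add: norm_divide norm_mult)
    also have "... <= cmod d * exp (-t) / 1" using that by (intro frac_le) auto
    also have "... <= cmod d * exp (- kap * t)" using e by (simp add: mult_left_mono)
    finally show ?thesis .
   qed
   then show "cmod (c1 * exp (- of_real t) / (1 + a)) <= cmod c1 * exp (- kap * t)"
    "cmod (c2 * exp (- of_real t) / (1 - a)) <= cmod c2 * exp (- kap * t)" using a1 by auto
  qed
  finally show ?thesis by (simp add: a_def algebra_simps)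
 qed
 moreover have "0 <= CC / 2 + cmod c1 + cmod c2" using quad_decay_nonneg[OF dec] by simp
 ultimately show ?thesis using kap(1) by blast
qed

end

context delay_char
begin

definition R1 :: "complex => complex" where "R1 z = 1 / ((z + 1) * Dl z)"

definition S :: "real => real" where "S t = Re (ilap (K + 1) R1 t)"

lemma halfplane_facts:
 assumes "K < Re z"
 shows "Dl z ~= 0" "z ~= 0" "z + 1 ~= 0" "cmod (ell z) <= K"
 using Delta_nonzero[OF assms] K_nonneg assms ell_bound[of 0 z] by (auto simp: complex_eq_iff)

lemma R1_holomorphic: "R1 holomorphic_on {z. K < Re z}"
 unfolding R1_def using halfplane_facts
 by (intro holomorphic_intros Delta_holomorphic) auto

lemma ell_holomorphic_on: "ell holomorphic_on U"
 by (rule holomorphic_on_subset[OF ell_holomorphic]) simp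

lemma R1_decay: "quad_decay (K + 1) (2 * (K + 1)) R1"
 unfolding quad_decay_def
proof (intro allI impI)
 fix z assume z: "K + 1 <= Re z"
 have zK: "K + 1 <= cmod z" using z complex_Re_le_cmod[of z] by linarith
 have "cmod z / (K + 1) <= cmod z - K"
  using zK K_nonneg mult_left_mono[of "K + 1" "cmod z" K] by (subst pos_divide_le_eq) (auto simp: algebra_simps)
 also have "... <= cmod (Dl z)" using Delta_lower[of 0 z] z K_nonneg by simp
 finally have D: "cmod z / (K + 1) <= cmod (Dl z)" .
 have z1: "cmod z <= cmod (z + 1)"
 proof -
  have "(Re z)\<^sup>2 <= (Re z + 1)\<^sup>2" using z K_nonneg by (intro power_mono) auto
  then show ?thesis by (simp add: cmod_def)
 qed
 have le: "cmod z * (cmod z / (K + 1)) <= cmod ((z + 1) * Dl z)"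
  unfolding norm_mult using D z1 K_nonneg by (intro mult_mono) auto
 have "1 * 1 <= cmod z * cmod z" using zK K_nonneg by (intro mult_mono) auto
 then have "(1 + (cmod z)\<^sup>2) / (2 * (K + 1)) <= (2 * (cmod z * cmod z)) / (2 * (K + 1))"
  using K_nonneg by (intro divide_right_mono) (auto simp: power2_eq_square)
 also have "... = cmod z * (cmod z / (K + 1))" by (subst mult_divide_mult_cancel_left) auto
 finally have le2: "(1 + (cmod z)\<^sup>2) / (2 * (K + 1)) <= cmod ((z + 1) * Dl z)" using le by linarith
 have "0 < (1 + (cmod z)\<^sup>2) / (2 * (K + 1))" using K_nonneg by (intro divide_pos_pos) (auto simp: add_pos_nonneg)
 then have "1 / cmod ((z + 1) * Dl z) <= 1 / ((1 + (cmod z)\<^sup>2) / (2 * (K + 1)))" using le2 by (intro frac_le) auto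
 then show "cmod (R1 z) <= 2 * (K + 1) / (1 + (cmod z)\<^sup>2)" by (simp add: R1_def norm_divide)
qed

lemma line_measurable: "F holomorphic_on {z. K < Re z} ==> (%y. F (Complex (K + 1) y)) \<in> borel_measurable borel"
 by (rule ilap_measurable[OF holomorphic_on_imp_continuous_on]) auto

definition R2 :: "complex => complex" where "R2 z = R1 z * ell z"

lemma R2_holomorphic: "R2 holomorphic_on {z. K < Re z}"
 unfolding R2_def by (intro holomorphic_intros R1_holomorphic ell_holomorphic_on)

lemma R2_decay: "quad_decay (K + 1) (2 * (K + 1) * K) R2"
 unfolding quad_decay_def
proof (intro allI impI)
 fix z assume z: "K + 1 <= Re z"
 have "cmod (R1 z) * cmod (ell z) <= (2 * (K + 1) / (1 + (cmod z)\<^sup>2)) * K"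
  using R1_decay z halfplane_facts(4)[of z] K_nonneg unfolding quad_decay_def by (intro mult_mono) auto
 then show "cmod (R2 z) <= 2 * (K + 1) * K / (1 + (cmod z)\<^sup>2)" by (simp add: R2_def norm_mult)
qed

lemma R3_decay: "quad_decay (K + 1) (2 * (K + 1) * K) (%z. R2 z / z)"
 unfolding quad_decay_def
proof (intro allI impI)
 fix z assume z: "K + 1 <= Re z"
 have b: "cmod (R2 z) <= 2 * (K + 1) * K / (1 + (cmod z)\<^sup>2)" using R2_decay z unfolding quad_decay_def by blast
 have "cmod (R2 z) / cmod z <= cmod (R2 z) / 1"
  using z K_nonneg complex_Re_le_cmod[of z] by (intro divide_left_mono) auto
 then show "cmod (R2 z / z) <= 2 * (K + 1) * K / (1 + (cmod z)\<^sup>2)" using b by (simp add: norm_divide)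
qed

lemma R3_holomorphic: "(%z. R2 z / z) holomorphic_on {z. K < Re z}"
 using halfplane_facts by (intro holomorphic_intros R2_holomorphic) auto

lemma S_neg: "t <= 0 ==> S t = 0"
 unfolding S_def by (subst ilap_neg[OF R1_holomorphic R1_decay]) auto

lemma S_cont: "isCont S t"
 unfolding S_def by (intro isCont_Re continuous_ilap[OF line_measurable[OF R1_holomorphic] R1_decay])

lemma S_measurable[measurable]: "S \<in> borel_measurable borel"
 using S_cont by (intro borel_measurable_continuous_onI) (simp add: continuous_on_eq_continuous_at)

lemma Lf_S: "Lf r m (seg S t) = Re (ilap (K + 1) R2 t)"
proof -
 have sg: "integrable m fold_sgn"
  by (rule m.integrable_const_bound[of _ 1]) (auto simp: fold_sgn_bound)
 have tb: "abs (t + fold_loc r u) <= abs t + r" for u using loc_range[of u] by auto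
 have "(LINT u|m. fold_sgn u *\<^sub>R ilap (K + 1) R1 (t + fold_loc r u)) =
  of_real (1 / (2 * pi)) * (LINT y|lborel. R1 (Complex (K + 1) y) * (LINT u|m. fold_sgn u *\<^sub>R exp (Complex (K + 1) y * of_real (t + fold_loc r u))))"
  by (rule ilap_average[OF _ sg _ tb line_measurable[OF R1_holomorphic] R1_decay]) (unfold_locales, measurable)
 also have "(%y. LINT u|m. fold_sgn u *\<^sub>R exp (Complex (K + 1) y * of_real (t + fold_loc r u))) =
   (%y. exp (Complex (K + 1) y * of_real t) * ell (Complex (K + 1) y))"
  unfolding ell_def Lf_def
  by (simp add: distrib_left exp_add scaleR_conv_of_real mult.left_commute flip: integral_mult_right_zero)
 also have "of_real (1 / (2 * pi)) * (LINT y|lborel. R1 (Complex (K + 1) y) * (exp (Complex (K + 1) y * of_real t) * ell (Complex (K + 1) y)))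
   = ilap (K + 1) R2 t"
  unfolding ilap_def R2_def by (simp add: mult_ac)
 finally have e: "(LINT u|m. fold_sgn u *\<^sub>R ilap (K + 1) R1 (t + fold_loc r u)) = ilap (K + 1) R2 t" .
 have "continuous_on UNIV (ilap (K + 1) R1)"
  using continuous_ilap[OF line_measurable[OF R1_holomorphic] R1_decay] by (simp add: continuous_on_eq_continuous_at)
 then have [measurable]: "ilap (K + 1) R1 \<in> borel_measurable borel" by (rule borel_measurable_continuous_onI)
 have "integrable m (%u. fold_sgn u *\<^sub>R ilap (K + 1) R1 (t + fold_loc r u))"
 proof (rule integrable_Lf[where B="2 * (K + 1) / 2 * exp ((K + 1) * abs t)"])
  fix th assume th: "-r <= th" "th <= 0"
  have "cmod (ilap (K + 1) R1 (t + th)) <= 2 * (K + 1) / 2 * exp ((K + 1) * (t + th))"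
   by (rule ilap_bound[OF line_measurable[OF R1_holomorphic] R1_decay])
  also have "... <= 2 * (K + 1) / 2 * exp ((K + 1) * abs t)"
   using K_nonneg th by (intro mult_left_mono) auto
  finally show "norm (ilap (K + 1) R1 (t + th)) <= 2 * (K + 1) / 2 * exp ((K + 1) * abs t)" .
 qed measurable
 from integral_Re[OF this] show ?thesis unfolding e[symmetric] Lf_def S_def by simp
qed

lemma Lf_S_cont: "isCont (%t. Lf r m (seg S t)) t"
 unfolding Lf_S by (intro isCont_Re continuous_ilap[OF line_measurable[OF R2_holomorphic] R2_decay])

lemma exp_interval_integral:
 fixes z :: complex
 assumes "z ~= 0" "0 <= t"
 shows "(LINT s|lborel. indicator {0..t} s *\<^sub>R exp (z * of_real (max 0 (min t s)))) = (exp (z * of_real t) - 1) / z"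
proof -
 have "((%s. exp (z * of_real s)) has_integral (exp (z * of_real t) / z - exp (z * of_real 0) / z)) {0..t}"
 proof (rule fundamental_theorem_of_calculus[OF assms(2)])
  fix s assume "s \<in> {0..t}"
  have "((%w. exp (z * w) / z) has_field_derivative exp (z * of_real s)) (at (of_real s))"
   using assms(1) by (auto intro!: derivative_eq_intros)
  from has_vector_derivative_real_field[OF this]
  show "((%s. exp (z * of_real s) / z) has_vector_derivative exp (z * of_real s)) (at s within {0..t})" by simp
 qed
 moreover have si: "set_integrable lborel {0..t} (%s. exp (z * of_real s))"
  by (intro borel_integrable_atLeastAtMost' continuous_intros)
 ultimately have "(LINT s:{0..t}|lborel. exp (z * of_real s)) = exp (z * of_real t) / z - exp (z * of_real 0) / z"
  using set_borel_integral_eq_integral(2)[OF si] by (simp add: integral_unique)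
 moreover have "(LINT s|lborel. indicator {0..t} s *\<^sub>R exp (z * of_real (max 0 (min t s)))) = (LINT s:{0..t}|lborel. exp (z * of_real s))"
  unfolding set_lebesgue_integral_def by (intro Bochner_Integration.integral_cong) (auto simp: indicator_def)
 ultimately show ?thesis by (simp add: diff_divide_distrib)
qed

lemma S_integral_equation:
 assumes t: "0 <= t"
 shows "((%s. Lf r m (seg S s)) has_integral (S t - (1 - exp (-t)))) {0..t}"
proof -
 define V where "V z = 1 / ((z - 0) * (z + 1))" for z :: complex
 have dV: "quad_decay (K + 1) (4 * 0 + 4) V"
  unfolding V_def using K_nonneg by (intro quad_decay_double_pole) auto
 have V: "ilap (K + 1) V t = (exp (0 * of_real t) - exp (- of_real t)) / (0 + 1)"
  unfolding V_def by (rule ilap_exp[OF _ _ _ t dV[unfolded V_def]]) (use K_nonneg in auto)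
 have mV: "(%y. V (Complex (K + 1) y)) \<in> borel_measurable borel" unfolding V_def by measurable
 have w: "integrable lborel (indicator {0..t} :: real => real)" by (simp add: integrable_indicator_iff emeasure_lborel_Icc_eq)
 have tm: "(%s. max 0 (min t s)) \<in> borel_measurable lborel" by measurable
 have tb: "abs (max 0 (min t s)) <= t" for s using t by auto
 have "(LINT s|lborel. indicator {0..t} s *\<^sub>R ilap (K + 1) R2 (max 0 (min t s))) =
  of_real (1 / (2 * pi)) * (LINT y|lborel. R2 (Complex (K + 1) y) * (LINT s|lborel. indicator {0..t} s *\<^sub>R exp (Complex (K + 1) y * of_real (max 0 (min t s)))))"
  by (rule ilap_average[OF lborel.sigma_finite_measure_axioms w tm tb line_measurable[OF R2_holomorphic] R2_decay])
 also have "(%y. LINT s|lborel. indicator {0..t} s *\<^sub>R exp (Complex (K + 1) y * of_real (max 0 (min t s)))) =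
   (%y. (exp (Complex (K + 1) y * of_real t) - 1) / Complex (K + 1) y)"
  using K_nonneg t by (intro ext exp_interval_integral) (auto simp: complex_eq_iff)
 also have "of_real (1 / (2 * pi)) * (LINT y|lborel. R2 (Complex (K + 1) y) * ((exp (Complex (K + 1) y * of_real t) - 1) / Complex (K + 1) y))
   = ilap (K + 1) (%z. R2 z / z) t - ilap (K + 1) (%z. R2 z / z) 0"
 proof -
  note i = ilap_integrable[OF line_measurable[OF R3_holomorphic] R3_decay]
  have "(LINT y|lborel. R2 (Complex (K + 1) y) * ((exp (Complex (K + 1) y * of_real t) - 1) / Complex (K + 1) y)) =
   (LINT y|lborel. exp (Complex (K + 1) y * of_real t) * (R2 (Complex (K + 1) y) / Complex (K + 1) y) -
     exp (Complex (K + 1) y * of_real 0) * (R2 (Complex (K + 1) y) / Complex (K + 1) y))"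
   by (intro Bochner_Integration.integral_cong) (auto simp: diff_divide_distrib algebra_simps)
  also have "... = (LINT y|lborel. exp (Complex (K + 1) y * of_real t) * (R2 (Complex (K + 1) y) / Complex (K + 1) y)) -
     (LINT y|lborel. exp (Complex (K + 1) y * of_real 0) * (R2 (Complex (K + 1) y) / Complex (K + 1) y))"
   by (rule Bochner_Integration.integral_diff[OF i i])
  finally show ?thesis unfolding ilap_def by (simp only: right_diff_distrib)
 qed
 also have "ilap (K + 1) (%z. R2 z / z) 0 = 0" by (rule ilap_neg[OF R3_holomorphic R3_decay]) auto
 also have "ilap (K + 1) (%z. R2 z / z) t = ilap (K + 1) (%z. R1 z + (-1) * V z) t"
 proof (rule ilap_cong[THEN fun_cong])
  fix z :: complex assume "Re z = K + 1"
  then have nz: "Dl z ~= 0" "z ~= 0" "z + 1 ~= 0" using halfplane_facts[of z] by auto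
  have "ell z = z - Dl z" by (simp add: Dl_def)
  then have "R2 z / z = (z - Dl z) / (z * ((z + 1) * Dl z))" by (simp add: R2_def R1_def)
  also have "... = R1 z + (-1) * V z" using nz by (simp add: R1_def V_def diff_divide_distrib)
  finally show "R2 z / z = R1 z + (-1) * V z" .
 qed
 also have "... = ilap (K + 1) R1 t + ilap (K + 1) (%z. (-1) * V z) t"
  by (rule ilap_add[OF line_measurable[OF R1_holomorphic] R1_decay _ quad_decay_cmult[OF dV]])
   (intro borel_measurable_times borel_measurable_const mV)
 also have "ilap (K + 1) (%z. (-1) * V z) t = (-1) * ilap (K + 1) V t" by (rule ilap_cmult)
 finally have e: "(LINT s|lborel. indicator {0..t} s *\<^sub>R ilap (K + 1) R2 (max 0 (min t s))) = ilap (K + 1) R1 t - (1 - exp (- of_real t))"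
  unfolding V by simp
 have c: "continuous_on {0..t} (ilap (K + 1) R2)"
  using continuous_ilap[OF line_measurable[OF R2_holomorphic] R2_decay] by (intro continuous_at_imp_continuous_on) auto
 then have si: "set_integrable lborel {0..t} (ilap (K + 1) R2)" by (rule borel_integrable_atLeastAtMost')
 have "(LINT s|lborel. indicator {0..t} s *\<^sub>R ilap (K + 1) R2 (max 0 (min t s))) = (LINT s:{0..t}|lborel. ilap (K + 1) R2 s)"
  unfolding set_lebesgue_integral_def by (intro Bochner_Integration.integral_cong) (auto simp: indicator_def)
 then have "(ilap (K + 1) R2 has_integral (ilap (K + 1) R1 t - (1 - exp (- of_real t)))) {0..t}"
  using set_borel_integral_eq_integral[OF si] e by (metis integrable_integral)
 then have "((Re \<circ> ilap (K + 1) R2) has_integral Re (ilap (K + 1) R1 t - (1 - exp (- of_real t)))) {0..t}"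
  by (rule has_integral_linear[OF _ bounded_linear_Re])
 then show ?thesis unfolding Lf_S by (simp add: S_def o_def Re_exp)
qed

definition DS :: "real => real" where
 "DS t = (if t < 0 then 0 else Lf r m (seg S t) + exp (-t))"

definition X0 :: "real => real" where "X0 t = DS t + S t"

lemma DS_measurable[measurable]: "DS \<in> borel_measurable borel"
 unfolding DS_def[abs_def] by measurable

lemma DS_integral_pos:
 assumes "0 <= b" shows "(DS has_integral S b) {0..b}"
proof -
 have "((%s. exp (-s)) has_integral (- exp (-b) - (- exp (-0)))) {0..b}"
  by (rule fundamental_theorem_of_calculus[OF assms])
   (auto intro!: derivative_eq_intros simp: has_real_derivative_iff_has_vector_derivative[symmetric])
 from has_integral_add[OF S_integral_equation[OF assms] this]
 have "((%s. Lf r m (seg S s) + exp (-s)) has_integral S b) {0..b}" by simp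
 then show ?thesis by (rule has_integral_eq[rotated]) (simp add: DS_def)
qed

lemma DS_integral_from_neg:
 assumes "c <= 0" "c <= b" shows "(DS has_integral S b) {c..b}"
proof -
 have neg: "(DS has_integral 0) {c..b'}" if "b' <= 0" for b'
  by (rule has_integral_spike[of "{0}" _ _ "%_. 0"]) (use that in "auto simp: DS_def")
 show ?thesis
 proof (cases "b <= 0")
  case True then show ?thesis using neg[OF True] S_neg by simp
 next
  case False
  then show ?thesis using has_integral_combine[of c 0 b DS 0 "S b"] assms neg[of 0] DS_integral_pos[of b] by simp
 qed
qed

lemma DS_shift_integral:
 assumes "0 <= t" "th <= 0" shows "integral {0..t} (%s. DS (s + th)) = S (t + th)"
 using DS_integral_from_neg[of th "t + th"] assms integral_shift_real_ivl[of th th "t + th" DS]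
 by (simp add: integral_unique)

lemma DS_cont: "continuous_on {0..} DS"
proof -
 have "continuous_on {0..} (%t. Lf r m (seg S t) + exp (-t))"
  using Lf_S_cont by (intro continuous_intros continuous_at_imp_continuous_on) auto
 then show ?thesis by (rule continuous_on_eq) (simp add: DS_def)
qed

lemma X0_cont: "continuous_on {0..} X0"
 unfolding X0_def[abs_def] by (intro continuous_intros DS_cont continuous_at_imp_continuous_on) (auto simp: S_cont)

lemma X0_0: "X0 0 = 1"
proof -
 have "Lf r m (seg S 0) = Lf r m (%th. 0)" by (rule Lf_cong) (auto simp: S_neg)
 then show ?thesis by (simp add: X0_def DS_def S_neg Lf_def)
qed

lemma X0_neg: "t < 0 ==> X0 t = 0" by (simp add: X0_def DS_def S_neg)

lemma X0_measurable[measurable]: "X0 \<in> borel_measurable borel"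
 unfolding X0_def[abs_def] by measurable

lemma bounded_on_neg_cont:
 fixes f :: "real => real"
 assumes "continuous_on {0..} f" "\<And>t. t < 0 ==> f t = 0"
 shows "\<exists>B. \<forall>t\<le>T. \<bar>f t\<bar> <= B"
proof -
 have "continuous_on {0..max 0 T} f" using assms(1) by (rule continuous_on_subset) auto
 then have "bounded (f ` {0..max 0 T})" by (rule compact_imp_bounded[OF compact_continuous_image[OF _ compact_Icc]])
 then obtain B where B: "\<forall>y\<in>f ` {0..max 0 T}. norm y <= B" by (auto simp: bounded_iff)
 have "abs (f t) <= max 0 B" if "t <= T" for t
 proof (cases "t < 0")
  case False
  then have "f t \<in> f ` {0..max 0 T}" using that by auto
  then have "norm (f t) <= B" using B by blast
  then show ?thesis by (simp add: le_max_iff_disj)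
 qed (simp add: assms(2))
 then show ?thesis by blast
qed

lemma X0_equation:
 assumes t: "0 <= t"
 shows "((%s. Lf r m (seg X0 s)) has_integral (X0 t - 1)) {0..t}"
proof -
 obtain B1 where B1: "\<forall>s\<le>t. \<bar>DS s\<bar> <= B1" using bounded_on_neg_cont[OF DS_cont, of t] by (auto simp: DS_def)
 obtain B2 where B2: "\<forall>s\<le>t. \<bar>S s\<bar> <= B2"
  using bounded_on_neg_cont[of S t] S_neg S_cont by (auto intro!: continuous_at_imp_continuous_on)
 have "((%s. Lf r m (seg DS s)) has_integral Lf r m (%th. integral {0..t} (%s. DS (s + th)))) {0..t}"
  by (rule Lf_shift_has_integral[of DS 0 t B1]) (use B1 in auto)
 also have "Lf r m (%th. integral {0..t} (%s. DS (s + th))) = Lf r m (seg S t)"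
  by (rule Lf_cong) (use t in "auto simp: DS_shift_integral")
 finally have "((%s. Lf r m (seg DS s) + Lf r m (seg S s)) has_integral
   Lf r m (seg S t) + (S t - (1 - exp (-t)))) {0..t}"
  by (rule has_integral_add[OF _ S_integral_equation[OF t]])
 moreover have "Lf r m (seg X0 s) = Lf r m (seg DS s) + Lf r m (seg S s)" if "s \<in> {0..t}" for s
  unfolding X0_def
  by (rule Lf_add; rule integrable_Lf_shift[of _ _ "max B1 B2"]) (use B1 B2 that in "auto simp: le_max_iff_disj")
 ultimately have "((%s. Lf r m (seg X0 s)) has_integral Lf r m (seg S t) + (S t - (1 - exp (-t)))) {0..t}"
  by (subst has_integral_cong) auto
 moreover have "X0 t - 1 = Lf r m (seg S t) + (S t - (1 - exp (-t)))"
  using t by (simp add: X0_def DS_def)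
 ultimately show ?thesis by (simp only:)
qed

lemma Lf_cis: "Lf r m (%th. c * exp (z * of_real (t + th))) = c * exp (z * of_real t) * ell z"
 unfolding Lf_def ell_def
 by (simp add: distrib_left exp_add scaleR_conv_of_real mult.left_commute mult.assoc flip: integral_mult_right_zero)

lemma X0_decay: "\<exists>kap C gam. 0 < kap \<and> 0 <= C \<and> (\<forall>t\<ge>0. \<bar>X0 t - Re (gam * exp (\<i> * of_real (om * t)))\<bar> <= C * exp (- kap * t))"
proof -
 define a where "a = \<i> * of_real om"
 obtain kap0 c1 c2 C0 where kap0: "0 < kap0" "0 <= C0"
  and dec0: "\<And>t. t >= 0 ==> cmod (ilap (K + 1) R1 t - c1 * exp (a * of_real t) / (1 + a) - c2 * exp (- a * of_real t) / (1 - a)) <= C0 * exp (- kap0 * t)"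
  using fundamental_decay unfolding R1_def[abs_def, symmetric] by (auto simp: a_def)
 define kap where "kap = min kap0 1"
 have kap: "0 < kap" "kap <= kap0" "kap <= 1" using kap0 by (auto simp: kap_def)
 define qc where "qc t = c1 / (1 + a) * exp (a * of_real t) + c2 / (1 - a) * exp (- a * of_real t)" for t
 define q where "q t = Re (qc t)" for t
 have ne: "1 + a ~= 0" "1 - a ~= 0" by (auto simp: a_def complex_eq_iff)
 have na: "cmod (exp (a * of_real s)) = 1" "cmod (exp (- a * of_real s)) = 1" for s
  by (simp_all add: a_def norm_exp_eq_Re)
 define Q where "Q = cmod (c1 / (1 + a)) + cmod (c2 / (1 - a))"
 have qQ: "abs (q t) <= Q" for t
 proof -
  have "abs (q t) <= cmod (qc t)" unfolding q_def by (rule abs_Re_le_cmod)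
  also have "... <= Q" unfolding qc_def Q_def by (rule order_trans[OF norm_triangle_ineq]) (simp only: norm_mult na mult_1_right order_refl)
  finally show ?thesis .
 qed
 define C1 where "C1 = C0 + Q"
 have Q0: "0 <= Q" by (simp add: Q_def)
 have rho: "abs (S t - q t) <= C1 * exp (- kap * t)" for t
 proof (cases "0 <= t")
  case True
  have "abs (S t - q t) <= cmod (ilap (K + 1) R1 t - qc t)"
   unfolding S_def q_def by (metis abs_Re_le_cmod minus_complex.simps(1))
  also have "... <= C0 * exp (- kap0 * t)" using dec0[OF True] by (simp add: qc_def diff_diff_eq)
  also have "... <= C1 * exp (- kap * t)" using kap kap0 Q0 True by (intro mult_mono) (auto simp: C1_def mult_right_mono)
  finally show ?thesis .
 next
  case False
  have "Q * 1 <= C1 * exp (- kap * t)" using False kap kap0 Q0 by (intro mult_mono) (auto simp: C1_def mult_nonneg_nonpos)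
  then show ?thesis using qQ[of t] S_neg[of t] False by simp
 qed
 have qm[measurable]: "q \<in> borel_measurable borel" unfolding q_def qc_def by measurable
 have Lq: "Lf r m (seg q t) = Re (c1 / (1 + a) * exp (a * of_real t) * a + c2 / (1 - a) * exp (- a * of_real t) * (- a))" for t
 proof -
  have "integrable m (%u. fold_sgn u *\<^sub>R qc (t + fold_loc r u))"
   unfolding qc_def
  proof (rule integrable_Lf[where B=Q])
   show "norm (c1 / (1 + a) * exp (a * of_real (t + th)) + c2 / (1 - a) * exp (- a * of_real (t + th))) <= Q" for th
    unfolding Q_def by (rule order_trans[OF norm_triangle_ineq]) (simp only: norm_mult na mult_1_right order_refl)
  qed measurable
  from integral_Re[OF this] have "Lf r m (seg q t) = Re (Lf r m (seg qc t))" by (simp add: Lf_def q_def)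
  also have "Lf r m (seg qc t) = Lf r m (%th. c1 / (1 + a) * exp (a * of_real (t + th))) + Lf r m (%th. c2 / (1 - a) * exp (- a * of_real (t + th)))"
   unfolding qc_def
   by (rule Lf_add; rule integrable_Lf[where B="max (cmod (c1 / (1 + a))) (cmod (c2 / (1 - a)))"])
    (measurable, simp only: norm_mult na mult_1_right max.cobounded1 max.cobounded2, measurable, simp only: norm_mult na mult_1_right max.cobounded1 max.cobounded2)
  also have "... = c1 / (1 + a) * exp (a * of_real t) * a + c2 / (1 - a) * exp (- a * of_real t) * (- a)"
   unfolding Lf_cis using ell_root by (simp add: a_def)
  finally show ?thesis .
 qed
 define C where "C = K * (C1 * exp (kap * r)) + 1 + C1"
 have C10: "0 <= C1" using kap0 Q0 by (simp add: C1_def)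
 have main: "abs (X0 t - Re (c1 * exp (a * of_real t) + c2 * exp (- a * of_real t))) <= C * exp (- kap * t)" if t: "0 <= t" for t
 proof -
  have b1: "abs (Lf r m (%th. S (t + th) - q (t + th))) <= K * (C1 * exp (kap * r) * exp (- kap * t))"
   unfolding real_norm_def[symmetric]
  proof (rule Lf_bound)
   fix th assume th: "-r <= th" "th <= 0"
   have "norm (S (t + th) - q (t + th)) <= C1 * exp (- kap * (t + th))" using rho by simp
   also have "... <= C1 * exp (kap * r + - kap * t)"
    using th kap C10 mult_left_mono[of "-th" r kap] by (intro mult_left_mono) (auto simp: algebra_simps)
   also have "... = C1 * exp (kap * r) * exp (- kap * t)" by (simp only: exp_add mult.assoc)
   finally show "norm (S (t + th) - q (t + th)) <= C1 * exp (kap * r) * exp (- kap * t)" .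
  qed
  obtain B2 where B2: "\<forall>s\<le>t. \<bar>S s\<bar> <= B2"
   using bounded_on_neg_cont[of S t] S_neg S_cont by (auto intro!: continuous_at_imp_continuous_on)
  have "Lf r m (%th. S (t + th) - q (t + th)) = Lf r m (seg S t) - Lf r m (seg q t)"
   by (rule Lf_diff; rule integrable_Lf_shift[of _ _ "max B2 Q"]) (use B2 qQ in "auto simp: le_max_iff_disj")
  then have "X0 t - (Lf r m (seg q t) + q t) = Lf r m (%th. S (t + th) - q (t + th)) + exp (-t) + (S t - q t)"
   using t by (simp add: X0_def DS_def)
  also have "abs (...) <= K * (C1 * exp (kap * r) * exp (- kap * t)) + exp (- kap * t) + C1 * exp (- kap * t)"
   using b1 rho[of t] kap t by (intro order_trans[OF abs_triangle_ineq] add_mono) (auto simp: mult_left_le_one_le)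
  also have "... = C * exp (- kap * t)" by (simp add: C_def algebra_simps)
  also have "Lf r m (seg q t) + q t = Re (c1 * exp (a * of_real t) + c2 * exp (- a * of_real t))"
  proof -
   have e1: "c1 / (1 + a) * exp (a * of_real t) * a + c1 / (1 + a) * exp (a * of_real t) = c1 * exp (a * of_real t)"
   proof -
    have "k * E * a + k * E = k * (1 + a) * E" for k E :: complex by (simp add: algebra_simps)
    then show ?thesis by (simp only: nonzero_eq_divide_eq[OF ne(1), THEN iffD1, OF refl])
   qed
   have e2: "c2 / (1 - a) * exp (- a * of_real t) * (- a) + c2 / (1 - a) * exp (- a * of_real t) = c2 * exp (- a * of_real t)"
   proof -
    have "k * E * (- a) + k * E = k * (1 - a) * E" for k E :: complex by (simp add: algebra_simps)
    then show ?thesis by (simp only: nonzero_eq_divide_eq[OF ne(2), THEN iffD1, OF refl])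
   qed
   have "Lf r m (seg q t) + q t =
    Re ((c1 / (1 + a) * exp (a * of_real t) * a + c1 / (1 + a) * exp (a * of_real t))
     + (c2 / (1 - a) * exp (- a * of_real t) * (- a) + c2 / (1 - a) * exp (- a * of_real t)))"
    unfolding Lq unfolding q_def qc_def by (simp only: plus_complex.simps add_ac)
   then show ?thesis unfolding e1 e2 .
  qed
  finally show ?thesis .
 qed
 have "Re (c1 * exp (a * of_real t) + c2 * exp (- a * of_real t)) = Re ((c1 + cnj c2) * exp (\<i> * of_real (om * t)))" for t
 proof -
  have "Re (c2 * exp (- a * of_real t)) = Re (cnj (c2 * exp (- a * of_real t)))" by simp
  also have "cnj (c2 * exp (- a * of_real t)) = cnj c2 * exp (a * of_real t)" by (simp add: exp_cnj a_def)
  finally show ?thesis by (simp add: a_def algebra_simps)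
 qed
 moreover have "0 <= C" using C10 K_nonneg by (simp add: C_def)
 ultimately show ?thesis using main kap(1) by metis
qed

end

definition conv :: "(real => real) => (real => real) => real => real" where
 "conv f h t = (LINT s|lborel. f s * h (t - s))"

lemma conv_measurable[measurable]:
 assumes [measurable]: "f \<in> borel_measurable borel" "h \<in> borel_measurable borel"
 shows "conv f h \<in> borel_measurable borel"
 unfolding conv_def[abs_def] by (rule lborel.borel_measurable_lebesgue_integral) measurable

lemma conv_integrable:
 fixes Bf Bh rho t :: real
 assumes [measurable]: "f \<in> borel_measurable borel" "h \<in> borel_measurable borel"
  and f: "\<And>s. \<bar>f s\<bar> <= Bf" "\<And>s. s \<notin> {0..rho} ==> f s = 0" and h: "\<And>s. s \<in> {0..rho} ==> abs (h (t - s)) <= Bh"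
 shows "integrable lborel (%s. f s * h (t - s))"
proof (rule integrableI_bounded_set[of "{0..rho}" _ _ "Bf * Bh"])
 show "AE s in lborel. s \<in> {0..rho} --> norm (f s * h (t - s)) <= Bf * Bh"
  using f(1) h order_trans[OF abs_ge_zero f(1)] by (intro AE_I2 impI) (auto simp: abs_mult intro!: mult_mono)
qed (use f(2) in "auto simp: emeasure_lborel_Icc_eq")

lemma conv_bound:
 fixes Bf Bh rho t :: real
 assumes [measurable]: "f \<in> borel_measurable borel" "h \<in> borel_measurable borel"
  and f: "\<And>s. \<bar>f s\<bar> <= Bf" "\<And>s. s \<notin> {0..rho} ==> f s = 0" and h: "\<And>s. s \<in> {0..rho} ==> abs (h (t - s)) <= Bh" and rho: "0 <= rho"
 shows "abs (conv f h t) <= rho * (Bf * Bh)"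
proof -
 have "abs (conv f h t) <= (LINT s|lborel. norm (f s * h (t - s)))"
  unfolding conv_def real_norm_def[symmetric] by (rule integral_norm_bound)
 also have "... <= (LINT s|lborel. indicator {0..rho} s * (Bf * Bh))"
 proof (rule integral_mono)
  show "integrable lborel (%s. norm (f s * h (t - s)))" by (intro integrable_norm conv_integrable[OF assms(1-5)])
  show "integrable lborel (%s. indicator {0..rho} s * (Bf * Bh))"
   by (intro integrable_mult_left) (auto simp: integrable_indicator_iff emeasure_lborel_Icc_eq)
  show "norm (f s * h (t - s)) <= indicator {0..rho} s * (Bf * Bh)" for s
   using f(1)[of s] f(2)[of s] h[of s] order_trans[OF abs_ge_zero f(1)]
   by (cases "s \<in> {0..rho}") (auto simp: abs_mult intro!: mult_mono)
 qed
 also have "... = rho * (Bf * Bh)" using rho by simp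
 finally show ?thesis .
qed

lemma conv_average:
 fixes N :: "'b measure" and w :: "'b => real" and tau :: "'b => real"
 assumes N: "sigma_finite_measure N" and w: "integrable N w" and tau[measurable]: "tau \<in> borel_measurable N"
  and [measurable]: "f \<in> borel_measurable borel" "h \<in> borel_measurable borel"
  and f: "\<And>s. \<bar>f s\<bar> <= Bf" "\<And>s. s \<notin> {0..rho} ==> f s = 0" and h: "\<And>s. \<bar>h s\<bar> <= Bh"
 shows "(LINT p|N. w p * conv f h (tau p)) = (LINT s|lborel. f s * (LINT p|N. w p * h (tau p - s)))"
proof -
 interpret N: sigma_finite_measure N by (rule N)
 interpret pair_sigma_finite lborel N ..
 have wm[measurable]: "w \<in> borel_measurable N" using w by simp
 define F where "F s p = w p * (f s * h (tau p - s))" for s p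
 have Fm: "case_prod F \<in> borel_measurable (lborel \<Otimes>\<^sub>M N)" unfolding F_def[abs_def] by measurable
 have B0: "0 <= Bf" "0 <= Bh" using order_trans[OF abs_ge_zero f(1)] order_trans[OF abs_ge_zero h] by auto
 have FB: "norm (F s p) <= abs (w p) * (indicator {0..rho} s * (Bf * Bh))" for s p
  using f(1)[of s] f(2)[of s] h[of "tau p - s"] B0
  by (cases "s \<in> {0..rho}") (auto simp: F_def abs_mult intro!: mult_mono mult_left_mono)
 have int: "integrable (lborel \<Otimes>\<^sub>M N) (case_prod F)"
 proof (rule Fubini_integrable[OF Fm])
  have i1: "integrable N (%p. F s p)" for s
   by (rule Bochner_Integration.integrable_bound[OF integrable_mult_left[OF integrable_abs[OF w], of "indicator {0..rho} s * (Bf * Bh)"]])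
    (use FB[of s] B0 in "auto simp: F_def intro!: AE_I2")
  then show "AE s in lborel. integrable N (%p. case_prod F (s, p))" by simp
  have ii: "integrable lborel (%s. (LINT p|N. \<bar>w p\<bar>) * (indicator {0..rho} s * (Bf * Bh)))"
   by (intro integrable_mult_left integrable_mult_right) (auto simp: integrable_indicator_iff emeasure_lborel_Icc_eq)
  show "integrable lborel (%s. LINT p|N. norm (case_prod F (s, p)))"
  proof (rule Bochner_Integration.integrable_bound[OF ii])
   show "(%s. LINT p|N. norm (case_prod F (s, p))) \<in> borel_measurable lborel"
    using Fm by measurable
   show "AE s in lborel. norm (LINT p|N. norm (case_prod F (s, p))) <= norm ((LINT p|N. \<bar>w p\<bar>) * (indicator {0..rho} s * (Bf * Bh)))"
   proof (rule AE_I2)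
    fix s
    have "(LINT p|N. norm (F s p)) <= (LINT p|N. \<bar>w p\<bar> * (indicator {0..rho} s * (Bf * Bh)))"
     using FB by (intro integral_mono integrable_norm i1 integrable_mult_left integrable_abs w)
    also have "... = (LINT p|N. \<bar>w p\<bar>) * (indicator {0..rho} s * (Bf * Bh))" by simp
    also have "... <= norm ((LINT p|N. \<bar>w p\<bar>) * (indicator {0..rho} s * (Bf * Bh)))"
     unfolding real_norm_def by (rule abs_ge_self)
    finally show "norm (LINT p|N. norm (case_prod F (s, p))) <= norm ((LINT p|N. \<bar>w p\<bar>) * (indicator {0..rho} s * (Bf * Bh)))"
     by simp
   qed
  qed
 qed
 have "(LINT p|N. w p * conv f h (tau p)) = (LINT p|N. (LINT s|lborel. F s p))"
  unfolding conv_def F_def by simp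
 also have "... = (LINT s|lborel. (LINT p|N. F s p))"
  using Fubini_integral[OF int] .
 also have "(%s. LINT p|N. F s p) = (%s. f s * (LINT p|N. w p * h (tau p - s)))"
  unfolding F_def by (simp add: mult.left_commute)
 finally show ?thesis .
qed

locale delay_split = delay_char +
 fixes kap Cx :: real and gam :: complex
 assumes kappa_pos: "0 < kap" and Cx_nonneg: "0 <= Cx"
  and X0_dec: "\<And>t. 0 <= t ==> abs (X0 t - Re (gam * exp (\<i> * of_real (om * t)))) <= Cx * exp (- kap * t)"
begin

definition pw :: "complex => real => real" where
 "pw z t = Re (z * exp (\<i> * of_real (om * t)))"

lemma pw_bound: "abs (pw z t) <= cmod z"
 unfolding pw_def by (rule order_trans[OF abs_Re_le_cmod]) (simp add: norm_mult norm_exp_eq_Re)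

lemma pw_cont: "continuous_on A (pw z)"
 unfolding pw_def[abs_def] by (intro continuous_intros)

lemma pw_measurable[measurable]: "pw z \<in> borel_measurable borel"
 by (intro borel_measurable_continuous_onI pw_cont)

lemma pw_shift: "pw z (t + s) = pw (exp (\<i> * of_real (om * t)) * z) s"
 by (simp add: pw_def ring_distribs exp_add mult_ac)

definition Cb :: real where "Cb = cmod gam + Cx"

lemma Cb_nonneg: "0 <= Cb" using Cx_nonneg by (simp add: Cb_def)

lemma X0_bound: "abs (X0 t) <= Cb"
proof (cases "0 <= t")
 case True
 have "exp (- kap * t) <= 1" using True kappa_pos by (simp add: mult_nonneg_nonneg)
 then have "Cx * exp (- kap * t) <= Cx" using Cx_nonneg mult_left_mono[of "exp (- kap * t)" 1 Cx] by simp
 then show ?thesis using X0_dec[OF True] pw_bound[of gam t] by (simp add: Cb_def pw_def)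
qed (use Cb_nonneg in "simp add: X0_neg")

definition g0 :: "real => real" where "g0 t = X0 t - pw gam t"

lemma g0_measurable[measurable]: "g0 \<in> borel_measurable borel"
 unfolding g0_def[abs_def] by measurable

lemma g0_bound: "abs (g0 t) <= Cb * exp (- kap * t)"
proof (cases "0 <= t")
 case True
 have "Cx * exp (- kap * t) <= Cb * exp (- kap * t)" by (intro mult_right_mono) (auto simp: Cb_def)
 then show ?thesis using X0_dec[OF True] unfolding g0_def pw_def by linarith
next
 case False
 have "abs (g0 t) <= cmod gam * 1" using False pw_bound[of gam t] by (simp add: g0_def X0_neg)
 also have "... <= Cb * exp (- kap * t)"
  using False kappa_pos Cx_nonneg by (intro mult_mono) (auto simp: Cb_def mult_nonneg_nonpos)
 finally show ?thesis .
qed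

lemma Lf_X0_neg: "sig < 0 ==> Lf r m (seg X0 sig) = 0"
 by (subst Lf_cong[of _ "%_. 0"]) (auto simp: X0_neg Lf_def)

lemma X0_shift_integral:
 assumes s: "0 <= s"
 shows "(LINT tau|lborel. indicator {0..t} tau * Lf r m (seg X0 (tau - s))) = X0 (t - s) - indicator {..t} s"
proof -
 define l where "l sig = Lf r m (seg X0 sig)" for sig
 have lm[measurable]: "l \<in> borel_measurable borel" unfolding l_def[abs_def] by measurable
 have lB: "abs (l sig) <= K * Cb" for sig unfolding l_def real_norm_def[symmetric] by (rule Lf_bound) (simp add: X0_bound)
 have si: "set_integrable lborel {0..t} (%tau. l (tau - s))"
  unfolding set_integrable_def
  by (rule integrableI_bounded_set[of "{0..t}" _ _ "K * Cb"])
   (auto simp: emeasure_lborel_Icc_eq lB indicator_def intro!: AE_I2)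
 have e: "(LINT tau|lborel. indicator {0..t} tau * l (tau - s)) = integral {0..t} (%tau. l (tau - s))"
  using set_borel_integral_eq_integral(2)[OF si] by (simp add: set_lebesgue_integral_def)
 have "integral {0..t} (%tau. l (tau - s)) = X0 (t - s) - indicator {..t} s"
 proof (cases "s <= t")
  case True
  have "(l has_integral 0) {-s..0}"
   by (rule has_integral_spike[of "{0}" _ _ "%_. 0"]) (auto simp: l_def Lf_X0_neg)
  moreover have "(l has_integral (X0 (t - s) - 1)) {0..t - s}"
   unfolding l_def using True by (intro X0_equation) auto
  ultimately have "(l has_integral (0 + (X0 (t - s) - 1))) {-s..t - s}"
   by (rule has_integral_combine[rotated 2]) (use s True in auto)
  then have "((%tau. l (tau - s)) has_integral (X0 (t - s) - 1)) {0..t}"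
   using has_integral_shift_Icc_real[of l "-s" _ 0 t] by (simp add: o_def add.commute)
  then show ?thesis using True by (simp add: integral_unique)
 next
  case False
  have "integral {0..t} (%tau. l (tau - s)) = integral {0..t} (%tau. 0)"
   using False by (intro Henstock_Kurzweil_Integration.integral_cong) (auto simp: l_def Lf_X0_neg)
  then show ?thesis using False by (simp add: X0_neg)
 qed
 then show ?thesis using e by (simp add: l_def)
qed

lemma conv_X0_equation:
 assumes f[measurable]: "f \<in> borel_measurable borel" and fB: "\<And>s. \<bar>f s\<bar> <= Bf" and f0: "\<And>s. s \<notin> {0..rho} ==> f s = 0"
  and t: "0 <= t"
 shows "conv f X0 t = integral {0..t} f + integral {0..t} (%s. Lf r m (%th. conv f X0 (s + th)))"
  "f integrable_on {0..t}" "(%s. Lf r m (%th. conv f X0 (s + th))) integrable_on {0..t}"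
proof -
 define l where "l sig = Lf r m (seg X0 sig)" for sig
 have lm[measurable]: "l \<in> borel_measurable borel" unfolding l_def[abs_def] by measurable
 have lB: "abs (l sig) <= K * Cb" for sig unfolding l_def real_norm_def[symmetric] by (rule Lf_bound) (simp add: X0_bound)
 have sg: "integrable m fold_sgn"
  by (rule m.integrable_const_bound[of _ 1]) (auto simp: fold_sgn_bound)
 have L1: "Lf r m (%th. conv f X0 (tau + th)) = conv f l tau" for tau
 proof -
  have "Lf r m (%th. conv f X0 (tau + th)) = (LINT u|m. fold_sgn u * conv f X0 (tau + fold_loc r u))"
   by (simp add: Lf_def)
  also have "... = (LINT s|lborel. f s * (LINT u|m. fold_sgn u * X0 (tau + fold_loc r u - s)))"
   by (rule conv_average[OF m.sigma_finite_measure_axioms sg _ f X0_measurable fB f0 X0_bound]) measurable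
  also have "... = conv f l tau" by (simp add: conv_def l_def Lf_def algebra_simps)
  finally show ?thesis .
 qed
 have w: "integrable lborel (indicator {0..t} :: real => real)"
  by (simp add: integrable_indicator_iff emeasure_lborel_Icc_eq)
 have fi: "integrable lborel (%s. f s * indicator {..t} s)"
 proof -
  have "integrable lborel (%s. f s * indicator {0..} (t - s))"
   by (rule conv_integrable[OF f _ fB f0, of _ rho _ 1]) (auto simp: indicator_def)
  moreover have "indicator {0..} (t - s) = (indicator {..t} s :: real)" for s by (simp add: indicator_def)
  ultimately show ?thesis by simp
 qed
 have fX: "integrable lborel (%s. f s * X0 (t - s))"
  by (rule conv_integrable[OF f X0_measurable fB f0 X0_bound])
 have "(LINT tau|lborel. indicator {0..t} tau * conv f l tau) = (LINT s|lborel. f s * (LINT tau|lborel. indicator {0..t} tau * l (tau - s)))"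
  by (rule conv_average[OF lborel.sigma_finite_measure_axioms w _ f lm fB f0 lB]) measurable
 also have "... = (LINT s|lborel. f s * X0 (t - s) - f s * indicator {..t} s)"
 proof (rule Bochner_Integration.integral_cong[OF refl])
  fix s
  show "f s * (LINT tau|lborel. indicator {0..t} tau * l (tau - s)) = f s * X0 (t - s) - f s * indicator {..t} s"
   using X0_shift_integral[of s t] f0[of s] by (cases "0 <= s") (auto simp: l_def right_diff_distrib)
 qed
 also have "... = conv f X0 t - (LINT s|lborel. f s * indicator {..t} s)"
  unfolding conv_def by (rule Bochner_Integration.integral_diff[OF fX fi])
 finally have E: "(LINT tau|lborel. indicator {0..t} tau * conv f l tau) = conv f X0 t - (LINT s|lborel. f s * indicator {..t} s)" .
 have cB: "abs (conv f l tau) <= max 0 rho * (Bf * (K * Cb))" for tau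
  by (rule conv_bound[OF f lm fB _ lB]) (auto intro!: f0)
 have si: "set_integrable lborel {0..t} (conv f l)"
  unfolding set_integrable_def
  by (rule integrableI_bounded_set[of "{0..t}" _ _ "max 0 rho * (Bf * (K * Cb))"])
   (auto simp: emeasure_lborel_Icc_eq indicator_def cB intro!: AE_I2)
 have sf: "set_integrable lborel {0..t} f"
  unfolding set_integrable_def
  by (rule integrableI_bounded_set[of "{0..t}" _ _ Bf])
   (auto simp: emeasure_lborel_Icc_eq indicator_def fB intro!: AE_I2)
 show "f integrable_on {0..t}" by (rule set_borel_integral_eq_integral(1)[OF sf])
 show "(%s. Lf r m (%th. conv f X0 (s + th))) integrable_on {0..t}"
  unfolding L1 by (rule set_borel_integral_eq_integral(1)[OF si])
 have "(LINT s|lborel. f s * indicator {..t} s) = (LINT s:{0..t}|lborel. f s)"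
  unfolding set_lebesgue_integral_def using f0 by (intro Bochner_Integration.integral_cong) (auto simp: indicator_def)
 moreover have "(LINT tau|lborel. indicator {0..t} tau * conv f l tau) = (LINT tau:{0..t}|lborel. conv f l tau)"
  by (simp add: set_lebesgue_integral_def)
 ultimately show "conv f X0 t = integral {0..t} f + integral {0..t} (%s. Lf r m (%th. conv f X0 (s + th)))"
  using E unfolding L1 set_borel_integral_eq_integral(2)[OF si] set_borel_integral_eq_integral(2)[OF sf] by simp
qed

lemma continuous_on_Ici:
 fixes x :: "real => real"
 assumes "\<And>T. 0 <= T ==> continuous_on {0..T} x" shows "continuous_on {0..} x"
 unfolding continuous_on_eq_continuous_within
proof
 fix t :: real assume "t \<in> {0..}"
 then have "continuous (at t within {0..t+1}) x" using assms[of "t+1"] by (auto simp: continuous_on_eq_continuous_within)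
 moreover have "at t within {0..} = at t within {0..t+1}"
  by (rule at_within_nhd[of t "{..<t+1}"]) auto
 ultimately show "continuous (at t within {0..}) x" by simp
qed

lemma conv_X0_cont:
 assumes "f \<in> borel_measurable borel" "\<And>s. \<bar>f s\<bar> <= Bf" "\<And>s. s \<notin> {0..rho} ==> f s = 0"
 shows "continuous_on {0..} (conv f X0)"
proof (rule continuous_on_Ici)
 fix T :: real assume T: "0 <= T"
 have "continuous_on {0..T} (%t. integral {0..t} f + integral {0..t} (%s. Lf r m (%th. conv f X0 (s + th))))"
  using conv_X0_equation(2,3)[OF assms T] by (intro continuous_intros indefinite_integral_continuous_1)
 then show "continuous_on {0..T} (conv f X0)"
  by (rule continuous_on_eq) (use conv_X0_equation(1)[OF assms] in auto)
qed

definition hist :: "(real => real) => real => real" where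
 "hist phi t = indicator {-r..<0} t * phi t"

definition kick :: "(real => real) => real => real" where
 "kick phi s = indicator {0..r} s * Lf r m (seg (hist phi) s)"

definition sol :: "(real => real) => real => real" where
 "sol phi t = hist phi t + phi 0 * X0 t + conv (kick phi) X0 t"

definition zeta :: "(real => real) => complex" where
 "zeta phi = gam * (of_real (phi 0) + (LINT s|lborel. of_real (kick phi s) * exp (- \<i> * of_real (om * s))))"

lemma hist_measurable[measurable]:
 assumes "phi \<in> Chat_space r" shows "hist phi \<in> borel_measurable borel"
proof -
 have [measurable]: "(%t. indicator {-r..0} t *\<^sub>R phi t) \<in> borel_measurable borel"
  using assms by (subst borel_measurable_restrict_space_iff[symmetric]) (auto simp: Chat_space_def)
 have "hist phi = (%t. indicator {..<0} t * (indicator {-r..0} t *\<^sub>R phi t))"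
  by (auto simp: hist_def fun_eq_iff indicator_def)
 then show ?thesis by (simp only:) measurable
qed

lemma hist_bound: "(\<And>th. th \<in> {-r..0} ==> abs (phi th) <= B) ==> abs (hist phi t) <= B"
 using r_pos order_trans[OF abs_ge_zero, of "phi 0" B] by (auto simp: hist_def indicator_def)

lemma kick_measurable[measurable]: "phi \<in> Chat_space r ==> kick phi \<in> borel_measurable borel"
 unfolding kick_def[abs_def] by (intro borel_measurable_times measurable_Lf_shift hist_measurable) auto

lemma kick_bound:
 assumes "\<And>th. th \<in> {-r..0} ==> abs (phi th) <= B" shows "abs (kick phi s) <= K * B"
proof -
 have "norm (Lf r m (seg (hist phi) s)) <= K * B" by (rule Lf_bound) (use hist_bound[OF assms] in simp)
 moreover have "0 <= K * B" using calculation norm_ge_zero order_trans by blast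
 ultimately show ?thesis by (simp add: kick_def indicator_def)
qed

lemma kick_support: "s \<notin> {0..r} ==> kick phi s = 0"
 by (simp add: kick_def)

lemma Lf_hist_kick: "0 <= s ==> Lf r m (seg (hist phi) s) = kick phi s"
proof (cases "s <= r")
 case False
 then have "Lf r m (seg (hist phi) s) = Lf r m (%_. 0)" by (intro Lf_cong) (auto simp: hist_def indicator_def)
 then show ?thesis using False by (simp add: kick_def Lf_def)
qed (simp add: kick_def)

lemma sol_hist:
 assumes "-r <= t" "t <= 0" shows "sol phi t = phi t"
proof -
 have "(LINT s|lborel. kick phi s * X0 (t - s)) = 0"
 proof (rule integral_eq_zero_AE)
  have "AE s in lborel. s ~= 0" by (rule AE_lborel_singleton)
  then show "AE s in lborel. kick phi s * X0 (t - s) = 0"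
  proof eventually_elim
   case (elim s)
   then show ?case using assms kick_support[of s phi] X0_neg[of "t - s"] by (cases "0 < s") auto
  qed
 qed
 then have "conv (kick phi) X0 t = 0" by (simp add: conv_def)
 then show ?thesis using assms X0_0 X0_neg[of t] by (auto simp: sol_def hist_def indicator_def)
qed

end

context delay_split
begin

lemma sol_cont:
 assumes phi: "phi \<in> Chat_space r" shows "continuous_on {0..} (sol phi)"
proof -
 obtain B where B: "\<And>th. th \<in> {-r..0} ==> abs (phi th) <= B" using Chat_spaceE[OF phi] by blast
 have kb: "abs (kick phi s) <= K * B" for s by (rule kick_bound) (rule B)
 have "continuous_on {0..} (%t. phi 0 * X0 t + conv (kick phi) X0 t)"
  by (intro continuous_intros X0_cont conv_X0_cont[OF kick_measurable[OF phi] kb kick_support])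
 then show ?thesis by (rule continuous_on_eq) (simp add: sol_def hist_def)
qed

lemma sol_forced:
 assumes phi: "phi \<in> Chat_space r" and T: "0 <= T"
 shows "forced T phi (%_. 0) (sol phi)"
 unfolding forced_def
proof (intro conjI ballI)
 obtain B where B: "\<And>th. th \<in> {-r..0} ==> abs (phi th) <= B" using Chat_spaceE[OF phi] by blast
 have kb: "abs (kick phi s) <= K * B" for s by (rule kick_bound) (rule B)
 note cv = kick_measurable[OF phi] kb kick_support[of _ phi]
 show "sol phi th = phi th" if "th \<in> {-r..0}" for th using that sol_hist by simp
 show "continuous_on {0..T} (sol phi)" by (rule continuous_on_subset[OF sol_cont[OF phi]]) auto
 fix t assume t: "t \<in> {0..T}"
 then have t0: "0 <= t" by simp
 have cB: "abs (conv (kick phi) X0 s) <= r * ((K * B) * Cb)" for s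
  by (rule conv_bound[OF cv(1) X0_measurable cv(2) cv(3) X0_bound]) (use r_pos in auto)
 have split: "Lf r m (seg (sol phi) s) = kick phi s + phi 0 * Lf r m (seg X0 s) + Lf r m (%th. conv (kick phi) X0 (s + th))"
  if s: "s \<in> {0..t}" for s
 proof -
  have i1: "integrable m (%u. fold_sgn u *\<^sub>R hist phi (s + fold_loc r u))"
   by (rule integrable_Lf_shift[OF hist_measurable[OF phi], of _ B]) (use hist_bound[of phi B] B in simp)
  have i2: "integrable m (%u. fold_sgn u *\<^sub>R X0 (s + fold_loc r u))"
   by (rule integrable_Lf_shift[OF X0_measurable, of _ Cb]) (simp add: X0_bound)
  have i3: "integrable m (%u. fold_sgn u *\<^sub>R conv (kick phi) X0 (s + fold_loc r u))"
   by (rule integrable_Lf_shift[OF conv_measurable[OF cv(1) X0_measurable], of _ "r * ((K * B) * Cb)"]) (use cB in auto)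
  note i = i1 i2 i3
  have "Lf r m (seg (sol phi) s) = Lf r m (seg (hist phi) s) + phi 0 * Lf r m (seg X0 s) + Lf r m (%th. conv (kick phi) X0 (s + th))"
  proof -
   have i2': "integrable m (%u. fold_sgn u *\<^sub>R (phi 0 * X0 (s + fold_loc r u)))"
    using integrable_mult_right[OF i2, of "phi 0"] by (simp add: mult.left_commute)
   have "Lf r m (seg (sol phi) s) = Lf r m (%th. hist phi (s + th) + phi 0 * X0 (s + th)) + Lf r m (%th. conv (kick phi) X0 (s + th))"
    unfolding sol_def by (rule Lf_add[OF _ i3]) (use Bochner_Integration.integrable_add[OF i1 i2'] in "simp add: distrib_left")
   also have "Lf r m (%th. hist phi (s + th) + phi 0 * X0 (s + th)) = Lf r m (seg (hist phi) s) + Lf r m (%th. phi 0 * X0 (s + th))"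
    by (rule Lf_add[OF i1 i2'])
   also have "Lf r m (%th. phi 0 * X0 (s + th)) = phi 0 * Lf r m (seg X0 s)"
    unfolding Lf_def by (subst integral_mult_right_zero[symmetric]) (simp add: mult.left_commute)
   finally show ?thesis .
  qed
  then show ?thesis using Lf_hist_kick s by simp
 qed
 have "(kick phi has_integral integral {0..t} (kick phi)) {0..t}"
  by (rule integrable_integral[OF conv_X0_equation(2)[OF cv t0]])
 moreover have "((%s. phi 0 * Lf r m (seg X0 s)) has_integral (phi 0 * (X0 t - 1))) {0..t}"
  by (intro has_integral_mult_right X0_equation t0)
 moreover have "((%s. Lf r m (%th. conv (kick phi) X0 (s + th))) has_integral (conv (kick phi) X0 t - integral {0..t} (kick phi))) {0..t}"
  using integrable_integral[OF conv_X0_equation(3)[OF cv t0]] conv_X0_equation(1)[OF cv t0] by simp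
 ultimately have "((%s. kick phi s + phi 0 * Lf r m (seg X0 s) + Lf r m (%th. conv (kick phi) X0 (s + th))) has_integral
  (integral {0..t} (kick phi) + phi 0 * (X0 t - 1) + (conv (kick phi) X0 t - integral {0..t} (kick phi)))) {0..t}"
  by (intro has_integral_add)
 then have "((%s. Lf r m (seg (sol phi) s)) has_integral (phi 0 * (X0 t - 1) + conv (kick phi) X0 t)) {0..t}"
  using split by (subst has_integral_cong) auto
 then have "integral {0..t} (%s. Lf r m (seg (sol phi) s)) = phi 0 * (X0 t - 1) + conv (kick phi) X0 t"
  by (rule integral_unique)
 then show "sol phi t = phi 0 + 0 + integral {0..t} (%s. Lf r m (seg (sol phi) s))"
  using t0 by (simp add: sol_def hist_def algebra_simps)
qed

lemma sol_unique:
 assumes "phi \<in> Chat_space r" "forced T phi (%_. 0) x" "-r <= t" "t <= T" "0 <= T"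
 shows "x t = sol phi t"
 by (rule forced_unique[OF assms(1,2) sol_forced[OF assms(1)]]) (use assms in auto)

lemma That_sol:
 assumes "phi \<in> Chat_space r" "0 <= t" "-r <= th" "th <= 0"
 shows "That r L t phi th = sol phi (t + th)"
 using assms sol_forced[OF assms(1)] by (intro That_eq) (auto simp: delay_solution_iff)

lemma sol_segment_Chat:
 assumes "phi \<in> Chat_space r" "0 <= t"
 shows "(seg (sol phi) t) \<in> Chat_space r"
 by (rule segment_Chat[OF assms(1), of _ t]) (use assms sol_hist continuous_on_subset[OF sol_cont[OF assms(1)]] in auto)

definition M0 :: real where "M0 = Cb + r * (K * (Cb * exp (kap * r)))"

lemma M0_nonneg: "0 <= M0" using Cb_nonneg K_nonneg r_pos by (simp add: M0_def)

lemma sol_decay: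
 assumes phi: "phi \<in> Chat_space r" and B: "\<And>th. th \<in> {-r..0} ==> abs (phi th) <= B" and t: "0 <= t"
 shows "abs (sol phi t - pw (zeta phi) t) <= M0 * B * exp (- kap * t)"
proof -
 have kb: "abs (kick phi s) <= K * B" for s by (rule kick_bound) (rule B)
 note cv = kick_measurable[OF phi] kb kick_support[of _ phi]
 have B0: "0 <= B" using order_trans[OF abs_ge_zero B[of 0]] r_pos by simp
 have i1: "integrable lborel (%s. kick phi s * X0 (t - s))"
  by (rule conv_integrable[OF cv(1) X0_measurable cv(2) cv(3) X0_bound])
 have i2: "integrable lborel (%s. kick phi s * pw gam (t - s))"
  by (rule conv_integrable[OF cv(1) pw_measurable cv(2) cv(3) pw_bound])
 note i = i1 i2
 have ki: "integrable lborel (%s. complex_of_real (kick phi s) * exp (- \<i> * of_real (om * s)))"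
 proof (rule integrableI_bounded_set[of "{0..r}" _ _ "K * B"])
  show "AE s in lborel. s \<in> {0..r} --> norm (complex_of_real (kick phi s) * exp (- \<i> * of_real (om * s))) <= K * B"
   using cv(2) by (intro AE_I2) (simp add: norm_mult norm_exp_eq_Re)
  show "(%s. complex_of_real (kick phi s) * exp (- \<i> * of_real (om * s))) \<in> borel_measurable lborel"
   using cv(1) by measurable
 qed (auto simp: emeasure_lborel_Icc_eq kick_support)
 have "conv (kick phi) (pw gam) t = pw (gam * (LINT s|lborel. of_real (kick phi s) * exp (- \<i> * of_real (om * s)))) t"
 proof -
  have "pw (gam * (LINT s|lborel. of_real (kick phi s) * exp (- \<i> * of_real (om * s)))) t =
   Re (LINT s|lborel. gam * exp (\<i> * of_real (om * t)) * (of_real (kick phi s) * exp (- \<i> * of_real (om * s))))"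
   unfolding pw_def by (subst integral_mult_right_zero) (simp only: mult_ac)
  also have "... = (LINT s|lborel. Re (gam * exp (\<i> * of_real (om * t)) * (of_real (kick phi s) * exp (- \<i> * of_real (om * s)))))"
   by (rule integral_Re[symmetric]) (rule integrable_mult_right[OF ki])
  also have "... = (LINT s|lborel. kick phi s * pw gam (t - s))"
  proof (rule Bochner_Integration.integral_cong[OF refl])
   fix s
   have "exp (\<i> * of_real (om * t)) * exp (- \<i> * of_real (om * s)) = exp (\<i> * of_real (om * (t - s)))"
    by (simp add: exp_add[symmetric] algebra_simps)
   then have "gam * exp (\<i> * of_real (om * t)) * (of_real (kick phi s) * exp (- \<i> * of_real (om * s))) = of_real (kick phi s) * (gam * exp (\<i> * of_real (om * (t - s))))"
    by (simp only: mult_ac)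
   then show "Re (gam * exp (\<i> * of_real (om * t)) * (of_real (kick phi s) * exp (- \<i> * of_real (om * s)))) = kick phi s * pw gam (t - s)"
    by (simp only: pw_def times_complex.simps Re_complex_of_real Im_complex_of_real mult_zero_left diff_zero)
  qed
  finally show ?thesis by (simp add: conv_def)
 qed
 then have "pw (zeta phi) t = phi 0 * pw gam t + conv (kick phi) (pw gam) t"
  by (simp add: zeta_def pw_def algebra_simps)
 then have "sol phi t - pw (zeta phi) t = phi 0 * g0 t + (conv (kick phi) X0 t - conv (kick phi) (pw gam) t)"
  using t by (simp add: sol_def hist_def g0_def algebra_simps)
 also have "conv (kick phi) X0 t - conv (kick phi) (pw gam) t = conv (kick phi) g0 t"
  unfolding conv_def g0_def using Bochner_Integration.integral_diff[OF i] by (simp add: right_diff_distrib)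
 also have "abs (phi 0 * g0 t + conv (kick phi) g0 t) <= B * (Cb * exp (- kap * t)) + r * ((K * B) * (Cb * exp (kap * r) * exp (- kap * t)))"
 proof (intro order_trans[OF abs_triangle_ineq] add_mono)
  show "abs (phi 0 * g0 t) <= B * (Cb * exp (- kap * t))"
   unfolding abs_mult using B[of 0] g0_bound r_pos B0 by (intro mult_mono) auto
  show "abs (conv (kick phi) g0 t) <= r * ((K * B) * (Cb * exp (kap * r) * exp (- kap * t)))"
  proof (rule conv_bound[OF cv(1) g0_measurable cv(2) cv(3)])
   fix s assume s: "s \<in> {0..r}"
   have "abs (g0 (t - s)) <= Cb * exp (- kap * (t - s))" by (rule g0_bound)
   also have "... <= Cb * exp (kap * r + - kap * t)"
    using s kappa_pos Cb_nonneg mult_left_mono[of s r kap] by (intro mult_left_mono) (auto simp: algebra_simps)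
   also have "... = Cb * exp (kap * r) * exp (- kap * t)" by (simp only: exp_add mult.assoc)
   finally show "abs (g0 (t - s)) <= Cb * exp (kap * r) * exp (- kap * t)" .
  qed (use r_pos in auto)
 qed
 also have "... = M0 * B * exp (- kap * t)" by (simp add: M0_def algebra_simps)
 finally show ?thesis .
qed

lemma exp_decay_zero: "((%t. c * exp (- kap * t)) \<longlongrightarrow> 0) at_top"
proof -
 have "((%t. exp (- kap * t)) \<longlongrightarrow> 0) at_top"
  using kappa_pos by real_asymp
 then show ?thesis using tendsto_mult_right_zero by blast
qed

lemma sol_tends:
 assumes "phi \<in> Chat_space r" shows "((%t. sol phi t - pw (zeta phi) t) \<longlongrightarrow> 0) at_top"
proof -
 obtain B where B: "\<And>th. th \<in> {-r..0} ==> abs (phi th) <= B" using Chat_spaceE[OF assms] by blast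
 show ?thesis
 proof (rule Lim_null_comparison[OF _ exp_decay_zero[of "M0 * B"]])
  show "\<forall>\<^sub>F t in at_top. norm (sol phi t - pw (zeta phi) t) <= M0 * B * exp (- kap * t)"
   using sol_decay[OF assms B] by (intro eventually_at_top_linorderI[of 0]) auto
 qed
qed

lemma pw_tends_zero:
 assumes "((%t. pw z t) \<longlongrightarrow> 0) at_top" shows "z = 0"
proof (rule ccontr)
 assume z: "z ~= 0"
 define t where "t n = (2 * pi * real n - Arg z + 0) / om" for n
 have ft: "filterlim t at_top sequentially"
  unfolding t_def using om_pos by real_asymp
 have "pw z (t n) = cmod z" for n
 proof -
  have "om * t n = 2 * pi * real n - Arg z" using om_pos by (simp add: t_def)
  then have "exp (\<i> * of_real (om * t n)) = cis (2 * pi * real n - Arg z)" by (simp only: cis_conv_exp)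
  also have "... = cis (2 * pi * real n) * cis (- Arg z)" by (simp only: cis_mult diff_conv_add_uminus)
  also have "cis (2 * pi * real n) = 1" by (rule cis_multiple_2pi) simp
  finally have "exp (\<i> * of_real (om * t n)) = exp (- (\<i> * of_real (Arg z)))" by (simp add: cis_conv_exp)
  moreover have "z = of_real (cmod z) * exp (\<i> * of_real (Arg z))" using Arg_eq[OF z] .
  ultimately show ?thesis unfolding pw_def by (metis Re_complex_of_real exp_minus_inverse mult.assoc mult.right_neutral)
 qed
 moreover have "(%n. pw z (t n)) \<longlonglongrightarrow> 0" using filterlim_compose[OF assms ft] .
 ultimately show False using z LIMSEQ_unique[OF tendsto_const] by fastforce
qed

lemma zeta_unique:
 assumes "phi \<in> Chat_space r" "((%t. sol phi t - pw z t) \<longlongrightarrow> 0) at_top"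
 shows "zeta phi = z"
proof -
 have "((%t. (sol phi t - pw z t) - (sol phi t - pw (zeta phi) t)) \<longlongrightarrow> 0 - 0) at_top"
  by (intro tendsto_diff assms(2) sol_tends assms(1))
 then have "((%t. pw (zeta phi - z) t) \<longlongrightarrow> 0) at_top" by (simp add: pw_def algebra_simps)
 then show ?thesis using pw_tends_zero by fastforce
qed

lemma Chat_combine:
 assumes "phi \<in> Chat_space r" "psi \<in> Chat_space r"
 shows "(%th. phi th - c * psi th) \<in> Chat_space r"
proof -
 obtain B where B: "\<And>th. th \<in> {-r..0} ==> abs (phi th) <= B" using Chat_spaceE[OF assms(1)] by blast
 obtain D where D: "\<And>th. th \<in> {-r..0} ==> abs (psi th) <= D" using Chat_spaceE[OF assms(2)] by blast
 have "abs (phi th - c * psi th) <= B + abs c * D" if "th \<in> {-r..0}" for th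
  using B[OF that] D[OF that] mult_left_mono[OF D[OF that], of "abs c"] abs_triangle_ineq4[of "phi th" "c * psi th"]
  by (simp add: abs_mult)
 then have "bounded ((%th. phi th - c * psi th) ` {-r..0})" by (auto intro!: boundedI[of _ "B + abs c * D"])
 then show ?thesis using assms unfolding Chat_space_def by auto
qed

lemma sol_combine:
 assumes "phi \<in> Chat_space r" "psi \<in> Chat_space r" "-r <= t"
 shows "sol (%th. phi th - c * psi th) t = sol phi t - c * sol psi t"
proof -
 have "forced (max 0 t) (%th. phi th - c * psi th) (%_. 0) (%t. sol phi t - c * sol psi t)"
  using forced_combine[OF assms(1,2) sol_forced[OF assms(1)] sol_forced[OF assms(2)], of "max 0 t" c] by simp
 then show ?thesis by (intro sol_unique[symmetric, OF Chat_combine[OF assms(1,2)]]) (use assms in auto)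
qed

lemma pw_Cspace: "pw z \<in> Cspace r"
 by (simp add: Cspace_def pw_cont)

lemma pw_Chat: "pw z \<in> Chat_space r"
 using pw_Cspace Cspace_sub_Chat by blast

lemma Lf_pw: "Lf r m (seg (pw z) s) = pw (\<i> * of_real om * z) s"
proof -
 have "integrable m (%u. fold_sgn u *\<^sub>R (z * exp (\<i> * of_real om * of_real (s + fold_loc r u))))"
 proof (rule integrable_Lf[where B="cmod z"])
  show "norm (z * exp (\<i> * of_real om * of_real (s + th))) <= cmod z" for th
   by (simp only: norm_mult) (simp add: norm_exp_eq_Re)
 qed measurable
 from integral_Re[OF this] have "Lf r m (seg (pw z) s) = Re (Lf r m (%th. z * exp (\<i> * of_real om * of_real (s + th))))"
  by (simp add: Lf_def pw_def mult.assoc)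
 then show ?thesis unfolding Lf_cis by (simp add: ell_root pw_def mult_ac)
qed

lemma pw_deriv: "(pw z has_real_derivative pw (\<i> * of_real om * z) t) (at t within A)"
proof -
 have "((%w. z * exp (\<i> * of_real om * w)) has_field_derivative (\<i> * of_real om * z) * exp (\<i> * of_real om * of_real t)) (at (of_real t))"
  by (auto intro!: derivative_eq_intros)
 from has_vector_derivative_real_field[OF this]
 have "((%t. z * exp (\<i> * of_real om * of_real t)) has_vector_derivative (\<i> * of_real om * z) * exp (\<i> * of_real om * of_real t)) (at t within A)" .
 from bounded_linear.has_vector_derivative[OF bounded_linear_Re this] show ?thesis
  by (simp add: pw_def[abs_def] has_real_derivative_iff_has_vector_derivative algebra_simps)
qed

lemma sol_pw: assumes "-r <= t" shows "sol (pw z) t = pw z t"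
proof (rule sol_unique[OF pw_Chat _ assms, symmetric])
 show "forced (max 0 t) (pw z) (%_. 0) (pw z)"
  unfolding forced_def
 proof (intro conjI ballI pw_cont refl)
  fix s assume "s \<in> {0..max 0 t}"
  then have "((%s. pw (\<i> * of_real om * z) s) has_integral (pw z s - pw z 0)) {0..s}"
   by (intro fundamental_theorem_of_calculus) (auto intro: pw_deriv simp: has_real_derivative_iff_has_vector_derivative[symmetric])
  then show "pw z s = pw z 0 + 0 + integral {0..s} (%s. Lf r m (seg (pw z) s))"
   by (simp add: Lf_pw integral_unique)
 qed
qed auto

definition qpart :: "(real => real) => real => real" where "qpart phi th = phi th - pw (zeta phi) th"

lemma qpart_Chat: "phi \<in> Chat_space r ==> qpart phi \<in> Chat_space r"
 using Chat_combine[OF _ pw_Chat, of phi 1 "zeta phi"] by (simp add: qpart_def[abs_def])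

lemma sol_qpart: "phi \<in> Chat_space r ==> -r <= t ==> sol (qpart phi) t = sol phi t - pw (zeta phi) t"
 using sol_combine[OF _ pw_Chat, of phi t 1 "zeta phi"] by (simp add: qpart_def[abs_def] sol_pw)

lemma zeta_combine:
 assumes "phi \<in> Chat_space r" "psi \<in> Chat_space r"
 shows "zeta (%th. phi th - of_real c * psi th) = zeta phi - of_real c * zeta psi"
proof (rule zeta_unique)
 show "(%th. phi th - of_real c * psi th) \<in> Chat_space r" using Chat_combine[OF assms] by simp
 have "((%t. (sol phi t - pw (zeta phi) t) - c * (sol psi t - pw (zeta psi) t)) \<longlongrightarrow> 0 - c * 0) at_top"
  by (intro tendsto_intros sol_tends assms)
 moreover have "\<forall>\<^sub>F t in at_top. (sol phi t - pw (zeta phi) t) - c * (sol psi t - pw (zeta psi) t) =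
   sol (%th. phi th - of_real c * psi th) t - pw (zeta phi - of_real c * zeta psi) t"
 proof (rule eventually_at_top_linorderI[of 0])
  fix t :: real assume "0 <= t"
  then show "(sol phi t - pw (zeta phi) t) - c * (sol psi t - pw (zeta psi) t) =
   sol (%th. phi th - of_real c * psi th) t - pw (zeta phi - of_real c * zeta psi) t"
   using sol_combine[OF assms, of t c] r_pos by (simp add: pw_def algebra_simps)
 qed
 ultimately show "((%t. sol (%th. phi th - of_real c * psi th) t - pw (zeta phi - of_real c * zeta psi) t) \<longlongrightarrow> 0) at_top"
  using tendsto_cong by fastforce
qed

lemma zeta_pw: "zeta (pw z) = z"
 by (rule zeta_unique[OF pw_Chat]) (rule tendsto_eventually, rule eventually_at_top_linorderI[of 0], use r_pos sol_pw in auto)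

lemma zeta_bound:
 assumes phi: "phi \<in> Chat_space r" and B: "\<And>th. th \<in> {-r..0} ==> abs (phi th) <= B"
 shows "cmod (zeta phi) <= cmod gam * (1 + r * K) * B"
proof -
 have kb: "abs (kick phi s) <= K * B" for s by (rule kick_bound) (rule B)
 have "cmod (LINT s|lborel. of_real (kick phi s) * exp (- \<i> * of_real (om * s))) <= (LINT s|lborel. indicator {0..r} s * (K * B))"
 proof (rule order_trans[OF integral_norm_bound], rule integral_mono')
  show "integrable lborel (%s. indicator {0..r} s * (K * B))"
   by (intro integrable_mult_left) (auto simp: integrable_indicator_iff emeasure_lborel_Icc_eq)
  show "norm (complex_of_real (kick phi s) * exp (- \<i> * of_real (om * s))) <= indicator {0..r} s * (K * B)" for s
   using kb[of s] kick_support[of s phi] by (cases "s \<in> {0..r}") (auto simp: norm_mult norm_exp_eq_Re)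
 qed (use order_trans[OF abs_ge_zero kb[of 0]] in auto)
 also have "... = r * (K * B)" using r_pos by simp
 finally have "cmod (of_real (phi 0) + (LINT s|lborel. of_real (kick phi s) * exp (- \<i> * of_real (om * s)))) <= B + r * (K * B)"
  using B[of 0] r_pos by (intro order_trans[OF norm_triangle_ineq] add_mono) auto
 then have "cmod (zeta phi) <= cmod gam * (B + r * (K * B))"
  unfolding zeta_def norm_mult by (rule mult_left_mono) simp
 then show ?thesis by (simp add: algebra_simps)
qed

lemma zeta_shift:
 assumes phi: "phi \<in> Chat_space r" and t: "0 <= t"
 shows "zeta (seg (sol phi) t) = exp (\<i> * of_real (om * t)) * zeta phi"
  "\<And>s. -r <= s ==> sol (seg (sol phi) t) s = sol phi (t + s)"
proof -
 show sh: "sol (seg (sol phi) t) s = sol phi (t + s)" if s: "-r <= s" for s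
 proof (rule sol_unique[OF sol_segment_Chat[OF phi t] _ s, of "max 0 s", symmetric])
  show "forced (max 0 s) (seg (sol phi) t) (%_. 0) (seg (sol phi) t)"
   unfolding forced_def
  proof (intro conjI ballI refl)
   show "continuous_on {0..max 0 s} (seg (sol phi) t)"
    by (rule continuous_on_compose2[OF sol_cont[OF phi]]) (use t in "auto intro!: continuous_intros")
   fix sig assume sig: "sig \<in> {0..max 0 s}"
   note F = sol_forced[OF phi, of "t + sig", unfolded forced_def]
   let ?l = "%s. Lf r m (seg (sol phi) s)"
   have e1: "sol phi (t + sig) = phi 0 + 0 + integral {0..t + sig} ?l" "sol phi t = phi 0 + 0 + integral {0..t} ?l"
    using F t sig by auto
   have i: "?l integrable_on {0..t + sig}"
    by (rule Lf_segment_integrable[OF phi, of _ "t + sig"]) (use F t sig in auto)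
   have "integral {0..t} ?l + integral {t..t + sig} ?l = integral {0..t + sig} ?l"
    by (rule Henstock_Kurzweil_Integration.integral_combine[OF _ _ i]) (use t sig in auto)
   moreover have "integral {0..sig} (%s. ?l (t + s)) = integral {t..t + sig} ?l"
    using integral_shift_Icc_real[of 0 sig ?l t] by (simp add: o_def add.commute)
   ultimately show "sol phi (t + sig) = sol phi (t + 0) + 0 + integral {0..sig} (%s. Lf r m (%th. sol phi (t + (s + th))))"
    using e1 by (simp add: add.assoc)
  qed
 qed (use s in auto)
 show "zeta (seg (sol phi) t) = exp (\<i> * of_real (om * t)) * zeta phi"
 proof (rule zeta_unique[OF sol_segment_Chat[OF phi t]])
  have "filterlim (%s. t + s) at_top at_top" by (rule filterlim_tendsto_add_at_top[OF tendsto_const filterlim_ident])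
  from filterlim_compose[OF sol_tends[OF phi] this]
  have "((%s. sol phi (t + s) - pw (zeta phi) (t + s)) \<longlongrightarrow> 0) at_top" .
  moreover have "\<forall>\<^sub>F s in at_top. sol phi (t + s) - pw (zeta phi) (t + s) = sol (seg (sol phi) t) s - pw (exp (\<i> * of_real (om * t)) * zeta phi) s"
   by (rule eventually_at_top_linorderI[of 0]) (use sh r_pos in "auto simp: pw_shift")
  ultimately show "((%s. sol (seg (sol phi) t) s - pw (exp (\<i> * of_real (om * t)) * zeta phi) s) \<longlongrightarrow> 0) at_top"
   using tendsto_cong by fastforce
 qed
qed

definition cvec :: "complex => real^2" where
 "cvec z = vector [Re z, - Im z]"

lemma cvec_nth [simp]: "cvec z $ 1 = Re z" "cvec z $ 2 = - Im z"
 by (simp_all add: cvec_def)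

lemma Phi_cvec: "Phi om (cvec z) = pw z"
 by (auto simp: Phi_def pw_def fun_eq_iff cis_conv_exp[symmetric] simp del: of_real_mult)

lemma cvec_surj: "cvec (Complex (v $ 1) (- v $ 2)) = v"
 by (simp add: vec_eq_iff forall_2)

lemma Phi_pw: "Phi om v = pw (Complex (v $ 1) (- v $ 2))"
 by (metis Phi_cvec cvec_surj)

lemma pw_inj: "pw z = pw w ==> z = w"
 using zeta_pw by metis

lemma cvec_inj: "cvec z = cvec w ==> z = w"
 using cvec_nth by (metis complex_eqI neg_equal_iff_equal)

lemma sup_norm_That:
 assumes phi: "phi \<in> Chat_space r" and B: "\<And>th. th \<in> {-r..0} ==> abs (phi th) <= B" and t: "r <= t" and z: "zeta phi = 0"
 shows "sup_norm r (That r L t phi) <= M0 * B * exp (kap * r) * exp (- kap * t)"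
proof (rule sup_norm_le[OF r_pos])
 fix th assume th: "th \<in> {-r..0}"
 have B0: "0 <= B" using order_trans[OF abs_ge_zero B[of 0]] r_pos by simp
 have "abs (That r L t phi th) = abs (sol phi (t + th))" using th t r_pos by (simp add: That_sol[OF phi])
 also have "... <= M0 * B * exp (- kap * (t + th))" using sol_decay[OF phi B, of "t + th"] th t by (simp add: z pw_def)
 also have "... <= M0 * B * exp (kap * r + - kap * t)"
  using th kappa_pos B0 M0_nonneg mult_left_mono[of "-th" r kap] by (intro mult_left_mono mult_nonneg_nonneg) (auto simp: algebra_simps)
 also have "... = M0 * B * exp (kap * r) * exp (- kap * t)" by (simp only: exp_add mult.assoc)
 finally show "abs (That r L t phi th) <= M0 * B * exp (kap * r) * exp (- kap * t)" .
qed

lemma Qhat_iff: "phi \<in> Qhat r L \<longleftrightarrow> phi \<in> Chat_space r \<and> zeta phi = 0"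
proof
 assume q: "phi \<in> Qhat r L"
 then have phi: "phi \<in> Chat_space r" and lim: "((%t. sup_norm r (That r L t phi)) \<longlongrightarrow> 0) at_top" by (auto simp: Qhat_def)
 have "((%t. sol phi t) \<longlongrightarrow> 0) at_top"
 proof (rule Lim_null_comparison[OF _ lim], rule eventually_at_top_linorderI[of 0])
  fix t :: real assume t: "0 <= t"
  have "(%th. That r L t phi th) ` {-r..0} = (seg (sol phi) t) ` {-r..0}"
   using t by (intro image_cong) (auto simp: That_sol[OF phi])
  then have "bounded (That r L t phi ` {-r..0})"
   using sol_segment_Chat[OF phi t] by (simp add: Chat_space_def)
  from abs_le_sup_norm[OF this, of 0] show "norm (sol phi t) <= sup_norm r (That r L t phi)"
   using t r_pos by (simp add: That_sol[OF phi])
 qed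
 then show "phi \<in> Chat_space r \<and> zeta phi = 0" using zeta_unique[OF phi, of 0] phi by (simp add: pw_def)
next
 assume "phi \<in> Chat_space r \<and> zeta phi = 0"
 then have phi: "phi \<in> Chat_space r" and z: "zeta phi = 0" by auto
 obtain B where B: "\<And>th. th \<in> {-r..0} ==> abs (phi th) <= B" using Chat_spaceE[OF phi] by blast
 have "((%t. sup_norm r (That r L t phi)) \<longlongrightarrow> 0) at_top"
 proof (rule Lim_null_comparison[OF _ exp_decay_zero[of "M0 * B * exp (kap * r)"]], rule eventually_at_top_linorderI[of r])
  fix t :: real assume t: "r <= t"
  have "(%th. That r L t phi th) ` {-r..0} = (seg (sol phi) t) ` {-r..0}"
   using t r_pos by (intro image_cong) (auto simp: That_sol[OF phi])
  then have "bounded (That r L t phi ` {-r..0})"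
   using sol_segment_Chat[OF phi, of t] t r_pos by (simp add: Chat_space_def)
  from abs_le_sup_norm[OF this, of 0] r_pos have "0 <= sup_norm r (That r L t phi)" by simp
  then show "norm (sup_norm r (That r L t phi)) <= M0 * B * exp (kap * r) * exp (- kap * t)"
   using sup_norm_That[OF phi B t z] by simp
 qed
 then show "phi \<in> Qhat r L" using phi by (simp add: Qhat_def)
qed

lemma zeta_qpart: "phi \<in> Chat_space r ==> zeta (qpart phi) = 0"
 using zeta_combine[OF _ pw_Chat, of phi 1 "zeta phi"] by (simp add: qpart_def[abs_def] zeta_pw)

lemma pihat_eq:
 assumes phi: "phi \<in> Chat_space r" shows "pihat r L om phi = pw (zeta phi)"
 unfolding pihat_def
proof (rule the_equality)
 have "(%th. phi th - pw (zeta phi) th) = qpart phi" by (auto simp: qpart_def)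
 then show "pw (zeta phi) \<in> Pspace om \<and> (%th. phi th - pw (zeta phi) th) \<in> Qhat r L"
  using zeta_qpart[OF phi] qpart_Chat[OF phi] Phi_cvec unfolding Qhat_iff Pspace_def by (metis range_eqI)
next
 fix p assume p: "p \<in> Pspace om \<and> (%th. phi th - p th) \<in> Qhat r L"
 then obtain z where z: "p = pw z" by (auto simp: Pspace_def Phi_pw)
 have "zeta (%th. phi th - of_real 1 * pw z th) = zeta phi - of_real 1 * zeta (pw z)"
  by (rule zeta_combine[OF phi pw_Chat])
 then show "p = pw (zeta phi)" using p unfolding Qhat_iff z by (simp add: zeta_pw)
qed

lemma P_coords_eq:
 assumes "phi \<in> Chat_space r" shows "P_coords r L om phi = cvec (zeta phi)"
 unfolding P_coords_def pihat_eq[OF assms]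
proof (rule the_equality)
 fix v assume "pw (zeta phi) = Phi om v"
 then show "v = cvec (zeta phi)" unfolding Phi_pw using pw_inj cvec_surj by metis
qed (simp add: Phi_cvec)

lemma one_minus_pihat_eq: "phi \<in> Chat_space r ==> one_minus_pihat r L om phi = qpart phi"
 by (auto simp: one_minus_pihat_def pihat_eq qpart_def)

lemma indicator_Chat: "indicator {0} \<in> Chat_space r"
proof -
 have "(indicator {0} :: real => real) \<in> borel_measurable (restrict_space borel {-r..0})"
  by (rule measurable_restrict_space1) measurable
 then show ?thesis by (auto simp: Chat_space_def intro!: boundedI[of _ 1] split: split_indicator)
qed

lemma zeta_indicator: "zeta (indicator {0}) = gam" and sol_indicator: "-r <= t ==> sol (indicator {0}) t = X0 t"
proof -
 have h: "hist (indicator {0}) = (%_. 0)" by (auto simp: hist_def indicator_def)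
 then have k: "kick (indicator {0}) = (%_. 0)" by (simp add: kick_def Lf_def fun_eq_iff)
 show "zeta (indicator {0}) = gam" by (simp add: zeta_def k)
 show "-r <= t ==> sol (indicator {0}) t = X0 t" by (simp add: sol_def h k conv_def)
qed

lemma Psi_tilde_eq: "Psi_tilde r L om = cvec gam"
 by (simp add: Psi_tilde_def P_coords_eq[OF indicator_Chat] zeta_indicator)

lemma That_kernel:
 assumes "0 <= t" "-r <= th" "th <= 0"
 shows "That r L t (one_minus_pihat r L om (indicator {0})) th = g0 (t + th)"
 using assms by (simp add: one_minus_pihat_eq[OF indicator_Chat] That_sol[OF qpart_Chat[OF indicator_Chat]]
   sol_qpart[OF indicator_Chat] sol_indicator zeta_indicator g0_def)

end

text \<open>
 Majorising the increments of the integrator by those of a single function \<open>T\<close> lets sums over a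
 tagged division telescope, so that no common refinements are needed.
\<close>

lemma bounded_variation_majorant:
 assumes g: "bounded_variation_on a b g" and ab: "a <= b"
 shows "\<exists>T. \<forall>t u. a <= t \<and> t <= u \<and> u <= b --> abs (g u - g t) <= T u - T t"
proof -
 obtain V where V: "\<And>d. d division_of {a..b} ==> (\<Sum>k\<in>d. \<bar>g (Sup k) - g (Inf k)\<bar>) <= V"
  using g by (auto simp: bounded_variation_on_def)
 define s where "s d = (\<Sum>k\<in>d. \<bar>g (Sup k) - g (Inf k)\<bar>)" for d :: "real set set"
 have ext: "d \<union> {{t..u}} division_of {a..u} \<and> s (d \<union> {{t..u}}) = s d + abs (g u - g t)"
  if d: "d division_of {a..t}" and "a <= t" "t < u" for d t u
 proof
  have "{{t..u}} division_of {t..u}"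
   using division_of_self[of t u] that by simp
  moreover have "interior {a..t} \<inter> interior {t..u} = {}" by auto
  ultimately have "d \<union> {{t..u}} division_of {a..t} \<union> {t..u}"
   by (rule division_disjoint_union[OF d])
  then show "d \<union> {{t..u}} division_of {a..u}" using that by (simp add: ivl_disj_un_two_touch)
  have "{t..u} \<notin> d"
  proof
   assume "{t..u} \<in> d"
   then have "{t..u} \<subseteq> {a..t}" using division_ofD(2)[OF d] by blast
   then show False using that by auto
  qed
  then show "s (d \<union> {{t..u}}) = s d + abs (g u - g t)"
   using division_of_finite[OF d] that by (simp add: s_def)
 qed
 define T where "T t = (SUP d\<in>{d. d division_of {a..t}}. s d)" for t
 have sV: "s d <= V" if "d division_of {a..t}" "a <= t" "t <= b" for d t
 proof (cases "t = b")
  case False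
  then have e: "d \<union> {{t..b}} division_of {a..b} \<and> s (d \<union> {{t..b}}) = s d + abs (g b - g t)" using ext that by simp
  then have "s (d \<union> {{t..b}}) <= V" using V[of "d \<union> {{t..b}}"] unfolding s_def by blast
  then show ?thesis using e by linarith
 qed (use V that in "simp add: s_def")
 have bdd: "bdd_above (s ` {d. d division_of {a..t}})" if "a <= t" "t <= b" for t
  using sV that by (intro bdd_aboveI[of _ V]) auto
 have ne: "{d. d division_of {a..t}} ~= {}" for t
  using elementary_interval[of a t] by auto
 have "abs (g u - g t) <= T u - T t" if tu: "a <= t" "t <= u" "u <= b" for t u
 proof (cases "t = u")
  case False
  have "T t <= T u - abs (g u - g t)"
   unfolding T_def[of t]
  proof (rule cSUP_least[OF ne])
   fix d assume "d \<in> {d. d division_of {a..t}}"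
   then have e: "d \<union> {{t..u}} division_of {a..u} \<and> s (d \<union> {{t..u}}) = s d + abs (g u - g t)"
    using ext tu False by simp
   have "s (d \<union> {{t..u}}) <= T u"
    unfolding T_def by (rule cSUP_upper[OF _ bdd]) (use e tu in auto)
   then show "s d <= T u - abs (g u - g t)" using e by linarith
  qed
  then show ?thesis by linarith
 qed simp
 then show ?thesis by blast
qed

locale rs_integrator =
 fixes a b :: real and g T :: "real => real"
 assumes ab: "a <= b" and maj: "\<And>t u. a <= t ==> t <= u ==> u <= b ==> abs (g u - g t) <= T u - T t"
begin

definition V :: real where "V = T b - T a"

lemma V_nonneg: "0 <= V" using maj[of a b] ab by (simp add: V_def)

lemma T_mono: "a <= t ==> t <= u ==> u <= b ==> T t <= T u"
 using maj[of t u] by simp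

definition rs_sum :: "(real => real) => (real \<times> real set) set => real" where
 "rs_sum f p = (\<Sum>(x, k)\<in>p. f x * (g (Sup k) - g (Inf k)))"

lemma cell:
 assumes p: "p tagged_division_of {a..b}" and xk: "(x, k) \<in> p"
 shows "\<exists>c d. k = {c..d} \<and> a <= c \<and> c <= x \<and> x <= d \<and> d <= b \<and> Inf k = c \<and> Sup k = d"
proof -
 obtain c d where k: "k = cbox c d" using tagged_division_ofD(4)[OF p xk] by blast
 have x: "x \<in> k" by (rule tagged_division_ofD(2)[OF p xk])
 have sub: "k \<subseteq> {a..b}" by (rule tagged_division_ofD(3)[OF p xk])
 show ?thesis using x sub k by (intro exI[of _ c] exI[of _ d]) auto
qed

lemma tagged_sum_T:
 assumes p: "p tagged_division_of {a..b}"
 shows "(\<Sum>(x, k)\<in>p. T (Sup k) - T (Inf k)) = V"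
 unfolding V_def using additive_tagged_division_1[OF ab p, of T] .

lemma tagged_sum_bound:
 assumes p: "p tagged_division_of {a..b}" and h: "\<And>x k. (x, k) \<in> p ==> abs (h x k) <= B * (T (Sup k) - T (Inf k))"
 shows "abs (\<Sum>(x, k)\<in>p. h x k) <= B * V"
proof -
 have "abs (\<Sum>(x, k)\<in>p. h x k) <= (\<Sum>(x, k)\<in>p. B * (T (Sup k) - T (Inf k)))"
  by (rule order_trans[OF sum_abs], rule sum_mono) (use h in auto)
 also have "... = B * (\<Sum>(x, k)\<in>p. T (Sup k) - T (Inf k))"
  by (simp add: sum_distrib_left split_def)
 finally show ?thesis using tagged_sum_T[OF p] by simp
qed

lemma rs_sum_diff_bound:
 assumes p: "p tagged_division_of {a..b}" and f: "\<And>x. x \<in> {a..b} ==> abs (f x - f' x) <= B"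
 shows "abs (rs_sum f p - rs_sum f' p) <= B * V"
proof -
 have "rs_sum f p - rs_sum f' p = (\<Sum>(x, k)\<in>p. (f x - f' x) * (g (Sup k) - g (Inf k)))"
  unfolding rs_sum_def by (simp add: split_def left_diff_distrib sum_subtractf)
 also have "abs (...) <= B * V"
 proof (rule tagged_sum_bound[OF p])
  fix x k assume "(x, k) \<in> p"
  then obtain c d where k: "k = {c..d}" "a <= c" "c <= x" "x <= d" "d <= b" "Inf k = c" "Sup k = d" using cell[OF p] by blast
  have "0 <= B" using f[of x] k by auto
  then show "abs ((f x - f' x) * (g (Sup k) - g (Inf k))) <= B * (T (Sup k) - T (Inf k))"
   unfolding abs_mult using k f[of x] maj[of c d] by (intro mult_mono) auto
 qed
 finally show ?thesis .
qed

lemma has_rs_diff_bound: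
 assumes I: "has_rs_integral a b f g I" and J: "has_rs_integral a b f' g J"
  and f: "\<And>x. x \<in> {a..b} ==> abs (f x - f' x) <= B"
 shows "abs (I - J) <= B * V"
proof (rule field_le_epsilon)
 fix e :: real assume "e > 0"
 then have e: "e / 2 > 0" by simp
 obtain d1 where d1: "d1 > 0" "\<And>p. p tagged_division_of {a..b} \<and> (%x. ball x d1) fine p ==> abs (rs_sum f p - I) < e / 2"
  using I e unfolding has_rs_integral_def rs_sum_def by blast
 obtain d2 where d2: "d2 > 0" "\<And>p. p tagged_division_of {a..b} \<and> (%x. ball x d2) fine p ==> abs (rs_sum f' p - J) < e / 2"
  using J e unfolding has_rs_integral_def rs_sum_def by blast
 have "gauge (%x::real. ball x (min d1 d2))" using d1 d2 by (simp add: gauge_def)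
 then obtain p where p: "p tagged_division_of {a..b}" "(%x. ball x (min d1 d2)) fine p"
  using fine_division_exists_real by blast
 then have "(%x. ball x d1) fine p" "(%x. ball x d2) fine p" by (auto simp: fine_def) fastforce+
 then have "abs (rs_sum f p - I) < e / 2" "abs (rs_sum f' p - J) < e / 2" using d1 d2 p by auto
 then show "abs (I - J) <= B * V + e" using rs_sum_diff_bound[of p f f' B, OF p(1) f] by linarith
qed

lemma has_rs_unique: "has_rs_integral a b f g I ==> has_rs_integral a b f g J ==> I = J"
 using has_rs_diff_bound[of f I f J 0] by simp

lemma g_integrable_product:
 assumes h: "continuous_on {a..b} h" and cd: "a <= c" "d <= b"
 shows "(%s. (g s - w) * h s) integrable_on {c..d}"
proof -
 have mT: "mono_on {a..b} T" using T_mono by (auto simp: mono_on_def)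
 have mD: "mono_on {a..b} (%t. T t - g t)"
 proof (rule mono_onI)
  fix t u assume "t \<in> {a..b}" "u \<in> {a..b}" "t <= u"
  then show "T t - g t <= T u - g u" using maj[of t u] by auto
 qed
 have gm: "g \<in> borel_measurable (restrict_space borel {a..b})"
  using borel_measurable_diff[OF borel_measurable_mono_on_fnc[OF mT] borel_measurable_mono_on_fnc[OF mD]] by simp
 have hm: "h \<in> borel_measurable (restrict_space borel {a..b})"
  by (rule borel_measurable_continuous_on_restrict[OF h])
 obtain H where "\<forall>y\<in>h ` {a..b}. norm y <= H"
  using compact_imp_bounded[OF compact_continuous_image[OF h compact_Icc]] by (auto simp: bounded_iff)
 then have H: "abs (h s) <= H" if "s \<in> {a..b}" for s using that by auto
 have gb: "abs (g s - w) <= abs (g a - w) + V" if "s \<in> {a..b}" for s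
  using maj[of a s] T_mono[of s b] that ab by (auto simp: V_def)
 have "(%s. (g s - w) * h s) \<in> borel_measurable (restrict_space borel {a..b})"
  using gm hm by measurable
 then have m: "(%s. indicator {a..b} s *\<^sub>R ((g s - w) * h s)) \<in> borel_measurable borel"
  by (subst borel_measurable_restrict_space_iff[symmetric]) auto
 have "set_integrable lborel {a..b} (%s. (g s - w) * h s)"
  unfolding set_integrable_def
 proof (rule integrableI_bounded_set[of "{a..b}" _ _ "(abs (g a - w) + V) * H"])
  show "AE s in lborel. s \<in> {a..b} --> norm (indicator {a..b} s *\<^sub>R ((g s - w) * h s)) <= (abs (g a - w) + V) * H"
  proof (intro AE_I2 impI)
   fix s assume s: "s \<in> {a..b}"
   have "abs (g s - w) * abs (h s) <= (abs (g a - w) + V) * H" using gb[OF s] H[OF s] V_nonneg by (intro mult_mono) auto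
   then show "norm (indicator {a..b} s *\<^sub>R ((g s - w) * h s)) <= (abs (g a - w) + V) * H" using s by (simp add: abs_mult)
  qed
 qed (use m in "auto simp: emeasure_lborel_Icc_eq")
 then have "(%s. (g s - w) * h s) integrable_on {a..b}" by (rule set_borel_integral_eq_integral(1))
 then show ?thesis by (rule integrable_on_subinterval) (use cd in auto)
qed

lemma g_osc_integral:
 assumes h: "continuous_on {a..b} h" and hM: "\<And>s. s \<in> {a..b} ==> abs (h s) <= M"
  and cd: "a <= c" "c <= d" "d <= b" and w: "\<And>s. s \<in> {c..d} ==> abs (g s - w) <= W"
 shows "abs (integral {c..d} (%s. (g s - w) * h s)) <= W * M * (d - c)"
proof -
 have "norm (integral {c..d} (%s. (g s - w) * h s)) <= W * M * measure lborel {c..d}"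
 proof (rule has_integral_bound_real)
  show "0 <= W * M" using w[of c] hM[of c] cd by (intro mult_nonneg_nonneg) auto
  show "((%s. (g s - w) * h s) has_integral integral {c..d} (%s. (g s - w) * h s)) {c..d}"
   by (intro integrable_integral g_integrable_product[OF h] cd)
  show "norm ((g s - w) * h s) <= W * M" if "s \<in> {c..d} - {}" for s
   unfolding real_norm_def abs_mult using w[of s] hM[of s] that cd by (intro mult_mono) auto
 qed simp
 then show ?thesis using cd by simp
qed

lemma has_rs_C1:
 assumes P: "\<And>t. t \<in> {a..b} ==> (P has_real_derivative P' t) (at t within {a..b})" and P': "continuous_on {a..b} P'"
 shows "\<exists>I. has_rs_integral a b P g I"
proof -
 obtain M where "\<forall>y\<in>P' ` {a..b}. norm y <= M"
  using compact_imp_bounded[OF compact_continuous_image[OF P' compact_Icc]] by (auto simp: bounded_iff)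
 then have M: "abs (P' s) <= M" if "s \<in> {a..b}" for s using that by auto
 have M0: "0 <= M" using M[of a] ab by auto
 define F where "F t = P t * g t - integral {a..t} (%s. (g s - 0) * P' s)" for t
 have err: "abs (P x * (g d - g c) - (F d - F c)) <= (M * (d - c)) * (T d - T c)"
  if cd: "a <= c" "c <= x" "x <= d" "d <= b" for x c d
 proof -
  have gi: "(%s. (g s - w) * P' s) integrable_on {u..v}" if "a <= u" "v <= b" for u v w
   by (rule g_integrable_product[OF P' that])
  have Pi: "(P' has_integral (P v - P u)) {u..v}" if "a <= u" "u <= v" "v <= b" for u v
  proof (rule fundamental_theorem_of_calculus[OF that(2)])
   fix s assume "s \<in> {u..v}"
   then show "(P has_vector_derivative P' s) (at s within {u..v})"
    using P[of s] that by (auto simp: has_real_derivative_iff_has_vector_derivative intro: has_vector_derivative_within_subset)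
  qed
  have sub: "integral {u..v} (%s. (g s - w) * P' s) = integral {u..v} (%s. (g s - 0) * P' s) - w * (P v - P u)"
   if "a <= u" "u <= v" "v <= b" for u v w
  proof -
   have "((%s. (g s - 0) * P' s - w * P' s) has_integral (integral {u..v} (%s. (g s - 0) * P' s) - w * (P v - P u))) {u..v}"
    by (intro has_integral_diff has_integral_mult_right Pi that integrable_integral gi)
   then show ?thesis by (simp add: left_diff_distrib integral_unique)
  qed
  have comb: "integral {a..u} (%s. (g s - 0) * P' s) + integral {u..v} (%s. (g s - 0) * P' s) = integral {a..v} (%s. (g s - 0) * P' s)"
   if "a <= u" "u <= v" "v <= b" for u v
   by (rule Henstock_Kurzweil_Integration.integral_combine[OF _ _ gi]) (use that in auto)
  have comb1: "integral {a..d} (%s. (g s - 0) * P' s) = integral {a..c} (%s. (g s - 0) * P' s) + integral {c..x} (%s. (g s - 0) * P' s) + integral {x..d} (%s. (g s - 0) * P' s)"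
   using comb[of c x] comb[of x d] cd by auto
  have "P x * (g d - g c) - (F d - F c) = integral {c..x} (%s. (g s - g c) * P' s) + integral {x..d} (%s. (g s - g d) * P' s)"
   unfolding F_def comb1 using sub[of c x "g c"] sub[of x d "g d"] cd by (simp add: algebra_simps)
  also have "abs (...) <= (T d - T c) * M * (x - c) + (T d - T c) * M * (d - x)"
  proof (intro order_trans[OF abs_triangle_ineq] add_mono)
   show "abs (integral {c..x} (%s. (g s - g c) * P' s)) <= (T d - T c) * M * (x - c)"
   proof (rule g_osc_integral[OF P' M])
    fix s assume "s \<in> {c..x}"
    then show "abs (g s - g c) <= T d - T c" using maj[of c s] T_mono[of s d] cd by auto
   qed (use cd in auto)
   show "abs (integral {x..d} (%s. (g s - g d) * P' s)) <= (T d - T c) * M * (d - x)"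
   proof (rule g_osc_integral[OF P' M])
    fix s assume "s \<in> {x..d}"
    then show "abs (g s - g d) <= T d - T c" using maj[of s d] T_mono[of c s] cd by auto
   qed (use cd in auto)
  qed
  also have "... = (M * (d - c)) * (T d - T c)" by (simp add: algebra_simps)
  finally show ?thesis .
 qed
 have "has_rs_integral a b P g (F b - F a)"
  unfolding has_rs_integral_def
 proof (intro allI impI)
  fix e :: real assume e: "e > 0"
  define \<delta> where "\<delta> = e / (2 * M * V + 2 * M + 2 * V + 2)"
  have den: "2 * M * V + 2 * M + 2 * V + 2 > 0" using M0 V_nonneg by (intro add_nonneg_pos) auto
  have \<delta>: "\<delta> > 0" using e den by (simp add: \<delta>_def)
  have "abs ((\<Sum>(x, k)\<in>p. P x * (g (Sup k) - g (Inf k))) - (F b - F a)) < e"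
   if p: "p tagged_division_of {a..b}" "(%x. ball x \<delta>) fine p" for p
  proof -
   have "(\<Sum>(x, k)\<in>p. P x * (g (Sup k) - g (Inf k))) - (F b - F a) =
     (\<Sum>(x, k)\<in>p. P x * (g (Sup k) - g (Inf k)) - (F (Sup k) - F (Inf k)))"
    using additive_tagged_division_1[OF ab p(1), of F] by (simp add: split_def sum_subtractf)
   also have "abs (...) <= (M * (2 * \<delta>)) * V"
   proof (rule tagged_sum_bound[OF p(1)])
    fix x k assume xk: "(x, k) \<in> p"
    then obtain c d where k: "k = {c..d}" "a <= c" "c <= x" "x <= d" "d <= b" "Inf k = c" "Sup k = d" using cell[OF p(1)] by blast
    have "k \<subseteq> ball x \<delta>" using p(2) xk by (auto simp: fine_def)
    moreover have "c \<in> k" "d \<in> k" using k by auto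
    ultimately have "c \<in> ball x \<delta>" "d \<in> ball x \<delta>" by blast+
    then have "d - c <= 2 * \<delta>" by (auto simp: dist_real_def)
    then have "(M * (d - c)) * (T d - T c) <= (M * (2 * \<delta>)) * (T d - T c)"
     using M0 T_mono[of c d] k by (intro mult_right_mono mult_left_mono) auto
    then show "abs (P x * (g (Sup k) - g (Inf k)) - (F (Sup k) - F (Inf k))) <= (M * (2 * \<delta>)) * (T (Sup k) - T (Inf k))"
     using err[of c x d] k by simp
   qed
   also have "... = (2 * M * V) * \<delta>" by simp
   also have "... < (2 * M * V + 2 * M + 2 * V + 2) * \<delta>" using \<delta> M0 V_nonneg by (intro mult_strict_right_mono) auto
   also have "... = e" using den by (simp add: \<delta>_def)
   finally show ?thesis .
  qed
  then show "\<exists>d>0. \<forall>p. p tagged_division_of {a..b} \<and> (%x. ball x d) fine p -->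
    \<bar>(\<Sum>(x, k)\<in>p. P x * (g (Sup k) - g (Inf k))) - (F b - F a)\<bar> < e" using \<delta> by blast
 qed
 then show ?thesis by blast
qed

lemma has_rs_exists:
 assumes f: "continuous_on {a..b} f"
 shows "\<exists>I. has_rs_integral a b f g I"
proof -
 have "\<exists>P I. (\<forall>x\<in>{a..b}. \<bar>f x - P x\<bar> <= inverse (real (Suc n))) \<and> has_rs_integral a b P g I" for n
 proof -
  obtain P where P: "real_polynomial_function P" "\<And>x. x \<in> {a..b} ==> abs (f x - P x) < inverse (real (Suc n))"
   using Stone_Weierstrass_real_polynomial_function[OF compact_Icc f, of "inverse (real (Suc n))"] by auto
  then have pf: "polynomial_function P" by (simp add: real_polynomial_function_eq)
  obtain P' where P': "polynomial_function P'" "\<And>x. (P has_vector_derivative P' x) (at x)"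
   using has_vector_derivative_polynomial_function[OF pf] by blast
  have "\<exists>I. has_rs_integral a b P g I"
  proof (rule has_rs_C1)
   show "(P has_real_derivative P' t) (at t within {a..b})" for t
    using P'(2)[of t] by (simp add: has_real_derivative_iff_has_vector_derivative has_vector_derivative_at_within)
   show "continuous_on {a..b} P'" by (rule continuous_on_polymonial_function[OF P'(1)])
  qed
  then show ?thesis using P(2) by (meson less_imp_le)
 qed
 then obtain P I where P: "\<And>n x. x \<in> {a..b} ==> abs (f x - P n x) <= inverse (real (Suc n))"
  and I: "\<And>n. has_rs_integral a b (P n) g (I n)" by metis
 have IB: "abs (I n - I k) <= (inverse (real (Suc n)) + inverse (real (Suc k))) * V" for n k
 proof (rule has_rs_diff_bound[OF I I])
  fix x assume "x \<in> {a..b}"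
  then show "abs (P n x - P k x) <= inverse (real (Suc n)) + inverse (real (Suc k))"
   using P[of x n] P[of x k] by linarith
 qed
 have "Cauchy I"
 proof (rule CauchyI')
  fix e :: real assume e: "e > 0"
  have "(%n. 2 * inverse (real (Suc n)) * V) \<longlonglongrightarrow> 2 * 0 * V" by (intro tendsto_intros LIMSEQ_inverse_real_of_nat)
  then have "eventually (%n. 2 * inverse (real (Suc n)) * V < e) sequentially" using e by (intro order_tendstoD(2)) auto
  then obtain N where N: "2 * inverse (real (Suc N)) * V < e" by (auto simp: eventually_sequentially)
  have "dist (I n) (I k) < e" if "n >= N" "k > n" for n k
  proof -
   have "inverse (real (Suc n)) + inverse (real (Suc k)) <= 2 * inverse (real (Suc N))"
   proof -
    have "inverse (real (Suc n)) <= inverse (real (Suc N))" "inverse (real (Suc k)) <= inverse (real (Suc N))"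
     using that by (intro le_imp_inverse_le; simp)+
    then show ?thesis by linarith
   qed
   then have "(inverse (real (Suc n)) + inverse (real (Suc k))) * V <= 2 * inverse (real (Suc N)) * V"
    using V_nonneg by (rule mult_right_mono)
   then show ?thesis using IB[of n k] N by (simp add: dist_real_def)
  qed
  then show "\<exists>M. \<forall>m\<ge>M. \<forall>n>m. dist (I m) (I n) < e" by blast
 qed
 then obtain J where J: "I \<longlonglongrightarrow> J" using Cauchy_convergent_iff convergent_def by blast
 have "has_rs_integral a b f g J"
  unfolding has_rs_integral_def
 proof (intro allI impI)
  fix e :: real assume e: "e > 0"
  have "(%n. inverse (real (Suc n)) * V) \<longlonglongrightarrow> 0 * V" by (intro tendsto_intros LIMSEQ_inverse_real_of_nat)
  then have "eventually (%n. inverse (real (Suc n)) * V < e / 3) sequentially" using e by (intro order_tendstoD(2)) auto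
  moreover have "eventually (%n. dist (I n) J < e / 3) sequentially" using J e by (intro tendstoD) auto
  ultimately have "eventually (%n. inverse (real (Suc n)) * V < e / 3 \<and> dist (I n) J < e / 3) sequentially"
   by (rule eventually_conj)
  then obtain n where n: "inverse (real (Suc n)) * V < e / 3" "abs (I n - J) < e / 3"
   by (auto simp: eventually_sequentially dist_real_def)
  have "e / 3 > 0" using e by simp
  then obtain d where d: "d > 0" "\<And>p. p tagged_division_of {a..b} \<and> (%x. ball x d) fine p ==> abs (rs_sum (P n) p - I n) < e / 3"
   using I[of n] unfolding has_rs_integral_def rs_sum_def by blast
  have "abs (rs_sum f p - J) < e" if p: "p tagged_division_of {a..b} \<and> (%x. ball x d) fine p" for p
   using d(2)[OF p] rs_sum_diff_bound[of p f "P n", OF conjunct1[OF p] P] n by linarith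
  then show "\<exists>d>0. \<forall>p. p tagged_division_of {a..b} \<and> (%x. ball x d) fine p -->
    \<bar>(\<Sum>(x, k)\<in>p. f x * (g (Sup k) - g (Inf k))) - J\<bar> < e" using d(1) unfolding rs_sum_def by blast
 qed
 then show ?thesis by blast
qed

lemma rs_integral_diff_bound:
 assumes "continuous_on {a..b} f" "continuous_on {a..b} f'" "\<And>x. x \<in> {a..b} ==> abs (f x - f' x) <= B"
 shows "abs (rs_integral a b f g - rs_integral a b f' g) <= B * V"
proof -
 obtain I J where I: "has_rs_integral a b f g I" and J: "has_rs_integral a b f' g J"
  using has_rs_exists assms by metis
 have "rs_integral a b f g = I" "rs_integral a b f' g = J"
  unfolding rs_integral_def using I J has_rs_unique by blast+
 then show ?thesis using has_rs_diff_bound[OF I J assms(3)] by simp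
qed

lemma rs_integral_zero: "rs_integral a b (%_. 0) g = 0"
proof -
 have "has_rs_integral a b (%_. 0) g 0" by (auto simp: has_rs_integral_def split_def intro: exI[of _ 1])
 then show ?thesis unfolding rs_integral_def using has_rs_unique by blast
qed

end

lemma Gfun_lipschitz:
 assumes "integrator r \<nu>1" "integrator r \<nu>3" "r > 0"
 shows "\<exists>V\<ge>0. Gfun r \<nu>1 \<nu>3 (%_. 0) = 0 \<and> (\<forall>eta\<in>Cspace r. \<forall>\<zeta>\<in>Cspace r. \<forall>M e.
  (\<forall>th\<in>{-r..0}. \<bar>eta th\<bar> <= M \<and> abs (\<zeta> th) <= M \<and> abs (eta th - \<zeta> th) <= e) -->
  \<bar>Gfun r \<nu>1 \<nu>3 eta - Gfun r \<nu>1 \<nu>3 \<zeta>\<bar> <= V * (1 + M\<^sup>2) * e)"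
proof -
 obtain T1 where T1: "\<forall>t u. -r <= t \<and> t <= u \<and> u <= 0 --> abs (\<nu>1 u - \<nu>1 t) <= T1 u - T1 t"
  using bounded_variation_majorant[of "-r" 0 \<nu>1] assms by (auto simp: integrator_def)
 obtain T3 where T3: "\<forall>t u. -r <= t \<and> t <= u \<and> u <= 0 --> abs (\<nu>3 u - \<nu>3 t) <= T3 u - T3 t"
  using bounded_variation_majorant[of "-r" 0 \<nu>3] assms by (auto simp: integrator_def)
 interpret A: rs_integrator "-r" 0 \<nu>1 T1 by unfold_locales (use T1 assms in auto)
 interpret B: rs_integrator "-r" 0 \<nu>3 T3 by unfold_locales (use T3 assms in auto)
 define V where "V = A.V + 3 * B.V"
 have V: "0 <= V" using A.V_nonneg B.V_nonneg by (simp add: V_def)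
 have "abs (Gfun r \<nu>1 \<nu>3 eta - Gfun r \<nu>1 \<nu>3 \<zeta>) <= V * (1 + M\<^sup>2) * e"
  if eta: "eta \<in> Cspace r" and \<zeta>: "\<zeta> \<in> Cspace r"
   and b: "\<forall>th\<in>{-r..0}. \<bar>eta th\<bar> <= M \<and> abs (\<zeta> th) <= M \<and> abs (eta th - \<zeta> th) <= e" for eta \<zeta> M e
 proof -
  have c: "continuous_on {-r..0} eta" "continuous_on {-r..0} \<zeta>" using eta \<zeta> by (auto simp: Cspace_def)
  have e0: "0 <= e" using b assms(3) by (force dest: bspec[of _ _ 0])
  have "abs (rs_integral (-r) 0 eta \<nu>1 - rs_integral (-r) 0 \<zeta> \<nu>1) <= e * A.V"
   by (rule A.rs_integral_diff_bound[OF c]) (use b in auto)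
  moreover have "abs (rs_integral (-r) 0 (%th. eta th ^ 3) \<nu>3 - rs_integral (-r) 0 (%th. \<zeta> th ^ 3) \<nu>3) <= (3 * M\<^sup>2 * e) * B.V"
  proof (rule B.rs_integral_diff_bound)
   fix th assume th: "th \<in> {-r..0}"
   define x y where "x = eta th" and "y = \<zeta> th"
   have xy: "abs x <= M" "abs y <= M" "abs (x - y) <= e" using b th by (auto simp: x_def y_def)
   have "x ^ 3 - y ^ 3 = (x - y) * (x\<^sup>2 + x * y + y\<^sup>2)" by (simp add: power2_eq_square power3_eq_cube algebra_simps)
   also have "abs (...) <= e * (M\<^sup>2 + M\<^sup>2 + M\<^sup>2)"
    unfolding abs_mult
   proof (rule mult_mono[OF xy(3)])
    have M: "0 <= M" using xy by linarith
    have "abs (x\<^sup>2) <= M\<^sup>2" "abs (y\<^sup>2) <= M\<^sup>2" using xy by (auto intro: power2_le_iff_abs_le[THEN iffD2, OF M])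
    moreover have "abs (x * y) <= M\<^sup>2" unfolding abs_mult power2_eq_square using xy M by (intro mult_mono) auto
    ultimately show "abs (x\<^sup>2 + x * y + y\<^sup>2) <= M\<^sup>2 + M\<^sup>2 + M\<^sup>2" by linarith
   qed (use e0 in auto)
   finally show "abs (eta th ^ 3 - \<zeta> th ^ 3) <= 3 * M\<^sup>2 * e" by (simp add: x_def y_def mult.commute)
  qed (use c in "auto intro!: continuous_intros")
  ultimately have "abs (Gfun r \<nu>1 \<nu>3 eta - Gfun r \<nu>1 \<nu>3 \<zeta>) <= e * A.V + (3 * M\<^sup>2 * e) * B.V"
   unfolding Gfun_def by linarith
  also have "... <= V * (1 + M\<^sup>2) * e"
  proof -
   have "0 <= 3 * B.V * e" "0 <= A.V * M\<^sup>2 * e" using A.V_nonneg B.V_nonneg e0 by auto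
   then show ?thesis by (simp add: V_def algebra_simps)
  qed
  finally show ?thesis .
 qed
 moreover have "Gfun r \<nu>1 \<nu>3 (%_. 0) = 0" by (simp add: Gfun_def A.rs_integral_zero B.rs_integral_zero)
 ultimately show ?thesis using V by blast
qed

lemma step_partition_nonneg:
 assumes "step_partition s n t" "i <= n" shows "0 <= t i" "t i <= s"
proof -
 have le: "t i <= t j" if "i <= j" "j <= n" for i j
  using that
 proof (induct rule: dec_induct)
  case (step k)
  then show ?case using assms(1) order_trans[of "t i" "t k" "t (Suc k)"] by (simp add: step_partition_def)
 qed simp
 show "0 <= t i" "t i <= s"
  using le[of 0 i] le[of i n] assms by (auto simp: step_partition_def)
qed

context wiener_process begin

lemma W_measurable:
 assumes "0 <= t" shows "W t \<in> borel_measurable M"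
 by (rule measurable_from_subalg[OF _ adapted[OF assms]]) (simp add: subalgebra_def space_F sub_F)

lemma nn_increment_moment:
 assumes "0 <= s" "s <= t" "0 < k"
 shows "(\<integral>\<^sup>+w. ennreal ((W t w - W s w) ^ (2*k)) \<partial>M)
  = ennreal ((t - s) ^ k * (fact (2*k) / (2 ^ k * fact k)))"
proof (cases "s = t")
 case True
 then show ?thesis using assms by (simp add: power_0_left)
next
 case False
 then have st: "s < t" using assms by simp
 have "(\<integral>\<^sup>+w. ennreal ((W t w - W s w) ^ (2*k)) \<partial>M)
  = (\<integral>\<^sup>+x. ennreal (normal_density 0 (sqrt (t - s)) x) * ennreal (x ^ (2*k)) \<partial>lborel)"
  by (rule distributed_nn_integral[symmetric, OF increment_distr[OF assms(1) st]]) simp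
 also have "... = (\<integral>\<^sup>+x. ennreal (normal_density 0 (sqrt (t - s)) x * (x - 0) ^ (2*k)) \<partial>lborel)"
  by (intro nn_integral_cong) (simp add: ennreal_mult'')
 also have "... = ennreal (fact (2*k) / ((2 / (sqrt (t - s))\<^sup>2) ^ k * fact k))"
  using normal_moment_even[of "sqrt (t - s)" 0 k] st
  by (subst nn_integral_eq_integral) (auto simp: has_bochner_integral_iff)
 also have "fact (2*k) / ((2 / (sqrt (t - s))\<^sup>2) ^ k * fact k)
   = (t - s) ^ k * (fact (2*k) / (2 ^ k * fact k))"
  using st by (simp add: power_divide)
 finally show ?thesis .
qed

lemma increment_sq_integrable:
 assumes "0 <= s" "s <= t"
 shows "integrable M (%w. (W t w - W s w)\<^sup>2)" "(LINT w|M. (W t w - W s w)\<^sup>2) = t - s"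
  "integrable M (%w. W t w - W s w)"
proof -
 have m: "W t \<in> borel_measurable M" "W s \<in> borel_measurable M" using assms W_measurable by auto
 have n: "(\<integral>\<^sup>+w. ennreal ((W t w - W s w) ^ 2) \<partial>M) = ennreal (t - s)"
  using nn_increment_moment[OF assms, of 1] by (simp add: numeral_2_eq_2)
 show i: "integrable M (%w. (W t w - W s w)\<^sup>2)"
  using m n by (intro integrableI_nonneg) auto
 show "(LINT w|M. (W t w - W s w)\<^sup>2) = t - s"
  using m n assms by (subst integral_eq_nn_integral) auto
 show "integrable M (%w. W t w - W s w)"
  using m i by (rule_tac square_integrable_imp_integrable) auto
qed

lemma increment_mean:
 assumes "0 <= s" "s <= t" shows "(LINT w|M. W t w - W s w) = 0"
proof (cases "s = t")
 case False
 then show ?thesis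
  using normal_distributed_expectation[OF _ increment_distr[of s t]] assms by simp
qed simp

lemma increment_orthogonal:
 assumes "0 <= s" "s <= t"
 shows "integrable M (%w. (W s w - W 0 w) * (W t w - W s w))"
  "(LINT w|M. (W s w - W 0 w) * (W t w - W s w)) = 0"
proof -
 have "integrable M (%w. (W s w - W 0 w) * (W t w - W s w)) \<and>
   (LINT w|M. (W s w - W 0 w) * (W t w - W s w)) = 0"
 proof (cases "s = t")
  case False
  then have st: "s < t" using assms by simp
  let ?X = "%w. W s w - W 0 w" and ?Y = "%w. W t w - W s w"
  have mX: "?X \<in> borel_measurable (F s)"
   using adapted[OF assms(1)] measurable_from_subalg[OF _ adapted[of 0], of "F s"]
    sets_F_mono[of 0 s] assms by (auto simp: subalgebra_def space_F)
  have "indep_var borel ?X borel ?Y"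
   unfolding indep_var_eq
  proof (intro conjI)
   show "random_variable borel ?X" "random_variable borel ?Y"
    using assms by (auto intro!: borel_measurable_diff W_measurable)
   have 1: "sigma_sets (space M) {?X -` A \<inter> space M |A. A \<in> sets borel} \<subseteq> sets (F s)"
    using measurable_sets[OF mX] sets.sigma_sets_subset[of "{?X -` A \<inter> space M |A. A \<in> sets borel}" "F s"]
    unfolding space_F by blast
   have "sets (vimage_algebra (space M) ?Y borel) = sigma_sets (space M) {?Y -` A \<inter> space M |A. A \<in> sets borel}"
    by (auto simp: sets_vimage_algebra)
   with increment_indep[OF assms(1) st] have
    "indep_set (sets (F s)) (sigma_sets (space M) {?Y -` A \<inter> space M |A. A \<in> sets borel})"
    by simp
   then show "indep_set (sigma_sets (space M) {?X -` A \<inter> space M |A. A \<in> sets borel})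
     (sigma_sets (space M) {?Y -` A \<inter> space M |A. A \<in> sets borel})"
    unfolding indep_set_def by (rule indep_sets_mono_sets) (use 1 in "auto split: bool.splits")
  qed
  then show ?thesis
   using indep_var_lebesgue_integral[of ?X ?Y] indep_var_integrable[of ?X ?Y]
    increment_sq_integrable(3)[of 0 s] increment_sq_integrable(3)[OF assms] increment_mean[OF assms]
    assms by simp
 qed simp
 then show "integrable M (%w. (W s w - W 0 w) * (W t w - W s w))"
  "(LINT w|M. (W s w - W 0 w) * (W t w - W s w)) = 0" by auto
qed

lemma covariance_le:
 assumes "0 <= s" "s <= t"
 shows "integrable M (%w. (W s w - W 0 w) * (W t w - W 0 w)) \<and>
  (LINT w|M. (W s w - W 0 w) * (W t w - W 0 w)) = s"
proof -
 have e: "(W s w - W 0 w) * (W t w - W 0 w) = (W s w - W 0 w)\<^sup>2 + (W s w - W 0 w) * (W t w - W s w)" for w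
  by (simp add: power2_eq_square algebra_simps)
 show ?thesis unfolding e
  using increment_sq_integrable(1,2)[of 0 s] increment_orthogonal[OF assms] assms by simp
qed

lemma covariance:
 assumes "0 <= s" "0 <= t"
 shows "integrable M (%w. (W s w - W 0 w) * (W t w - W 0 w))"
  "(LINT w|M. (W s w - W 0 w) * (W t w - W 0 w)) = min s t"
 using covariance_le[of s t] covariance_le[of t s] assms
 by (cases "s <= t"; simp add: mult.commute)+

lemma increment_covariance:
 assumes "0 <= a" "a <= b" "0 <= c" "c <= d"
 shows "integrable M (%w. (W b w - W a w) * (W d w - W c w))"
  "(LINT w|M. (W b w - W a w) * (W d w - W c w)) = measure lborel ({a<..b} \<inter> {c<..d})"
proof -
 let ?V = "%s t w. (W s w - W 0 w) * (W t w - W 0 w)"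
 have e: "(W b w - W a w) * (W d w - W c w) = ?V b d w - ?V a d w - ?V b c w + ?V a c w" for w
  by (simp add: algebra_simps)
 have m: "measure lborel {x<..y} = max 0 (y - x)" for x y :: real
  by (cases "x <= y") (auto simp: measure_def emeasure_lborel_Ioc)
 have "{a<..b} \<inter> {c<..d} = {max a c<..min b d}" by auto
 then have "measure lborel ({a<..b} \<inter> {c<..d}) = min b d - min a d - min b c + min a c"
  using assms by (simp only: m)
 then show "integrable M (%w. (W b w - W a w) * (W d w - W c w))"
  "(LINT w|M. (W b w - W a w) * (W d w - W c w)) = measure lborel ({a<..b} \<inter> {c<..d})"
  unfolding e using assms by (simp_all add: covariance)
qed

lemma ito_isometry_sum:
 assumes fin: "finite J" and lu: "\<And>i. i \<in> J ==> 0 <= l i \<and> l i <= u i"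
 shows "(\<integral>\<^sup>+w. ennreal ((\<Sum>i\<in>J. a i * (W (u i) w - W (l i) w))\<^sup>2) \<partial>M)
  = (\<integral>\<^sup>+x. ennreal ((\<Sum>i\<in>J. a i * indicator {l i<..u i} x)\<^sup>2) \<partial>lborel)"
proof -
 define D where "D i w = W (u i) w - W (l i) w" for i w
 have q: "(\<Sum>i\<in>J. a i * f i)\<^sup>2 = (\<Sum>i\<in>J. \<Sum>j\<in>J. (a i * a j) * (f i * f j))" for f :: "'b => real"
  by (simp add: power2_eq_square sum_product algebra_simps)
 have i1: "integrable M (%w. D i w * D j w)" if "i \<in> J" "j \<in> J" for i j
  using increment_covariance(1)[of "l i" "u i" "l j" "u j"] lu[OF that(1)] lu[OF that(2)] by (simp add: D_def)
 have i2: "integrable lborel (%x. indicator {l i<..u i} x * indicator {l j<..u j} x :: real)" for i j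
  by (simp flip: indicator_inter_arith)
   (auto intro!: integrable_real_indicator simp: emeasure_lborel_Ioc
     intro: le_less_trans[OF emeasure_mono[of _ "{l i<..max (l i) (u i)}"]])
 have e: "(LINT w|M. D i w * D j w) = (LINT x|lborel. indicator {l i<..u i} x * indicator {l j<..u j} x)"
  if "i \<in> J" "j \<in> J" for i j
  using increment_covariance(2)[of "l i" "u i" "l j" "u j"] lu[OF that(1)] lu[OF that(2)]
  by (simp add: D_def flip: indicator_inter_arith)
 have q1: "integrable M (%w. (\<Sum>i\<in>J. a i * D i w)\<^sup>2)"
  and q2: "integrable lborel (%x. (\<Sum>i\<in>J. a i * indicator {l i<..u i} x :: real)\<^sup>2)"
  unfolding q by (intro Bochner_Integration.integrable_sum integrable_mult_right i1 i2; assumption)+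
 have "(\<integral>\<^sup>+w. ennreal ((\<Sum>i\<in>J. a i * D i w)\<^sup>2) \<partial>M) = ennreal (LINT w|M. (\<Sum>i\<in>J. a i * D i w)\<^sup>2)"
  by (rule nn_integral_eq_integral[OF q1]) simp
 also have "(LINT w|M. (\<Sum>i\<in>J. a i * D i w)\<^sup>2) = (LINT x|lborel. (\<Sum>i\<in>J. a i * indicator {l i<..u i} x)\<^sup>2)"
  unfolding q using i1 i2 e by simp
 also have "ennreal ... = (\<integral>\<^sup>+x. ennreal ((\<Sum>i\<in>J. a i * indicator {l i<..u i} x)\<^sup>2) \<partial>lborel)"
  by (rule nn_integral_eq_integral[OF q2, symmetric]) simp
 finally show ?thesis by (simp add: D_def)
qed

lemma step_integral_measurable:
 assumes "step_partition s n t"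
 shows "step_integral W n t c \<in> borel_measurable M"
 unfolding step_integral_def
 using step_partition_nonneg(1)[OF assms]
 by (auto intro!: borel_measurable_sum borel_measurable_times borel_measurable_diff W_measurable simp: Suc_leI)

lemma ito_isometry_diff:
 assumes "step_partition s n t" "step_partition s n' t'"
 shows "(\<integral>\<^sup>+w. ennreal ((step_integral W n t c w - step_integral W n' t' c' w)\<^sup>2) \<partial>M)
  = (\<integral>\<^sup>+x. ennreal ((step_fun n t c x - step_fun n' t' c' x)\<^sup>2) \<partial>lborel)"
proof -
 let ?J = "{..<n} <+> {..<n'}"
 have s: "(\<Sum>i\<in>?J. case_sum c (%j. - c' j) i * f i) = (\<Sum>i<n. c i * f (Inl i)) - (\<Sum>i<n'. c' i * f (Inr i))"
  for f :: "nat + nat => real" by (subst sum.Plus) (auto simp: sum_negf)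
 have "0 <= case_sum t t' i \<and> case_sum t t' i <= case_sum (%i. t (Suc i)) (%i. t' (Suc i)) i" if "i \<in> ?J" for i
  using that assms step_partition_nonneg(1) by (force simp: step_partition_def)
 from ito_isometry_sum[of ?J "case_sum t t'" "case_sum (%i. t (Suc i)) (%i. t' (Suc i))" "case_sum c (%j. - c' j)", OF _ this]
 show ?thesis
  unfolding s by (simp add: step_integral_def step_fun_def)
qed

text \<open>Fatou's lemma replaces the passage to an almost surely convergent subsequence.\<close>

lemma wiener_integral_liminf:
 assumes I: "has_wiener_integral M W h s I"
  and p: "\<And>k. step_partition s (n' k) (t' k)"
  and lim: "(%k. \<integral>\<^sup>+u\<in>{0..s}. ennreal ((h u - step_fun (n' k) (t' k) (c' k) u)\<^sup>2) \<partial>lborel) \<longlonglongrightarrow> 0"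
 shows "AE w in M. liminf (%k. ennreal ((I w - step_integral W (n' k) (t' k) (c' k) w)\<^sup>2)) = 0"
proof -
 from I obtain n t c where q: "\<And>k. step_partition s (n k) (t k)" and
  l1: "(%k. \<integral>\<^sup>+u\<in>{0..s}. ennreal ((h u - step_fun (n k) (t k) (c k) u)\<^sup>2) \<partial>lborel) \<longlonglongrightarrow> 0" and
  l2: "(%k. \<integral>\<^sup>+w. ennreal ((I w - step_integral W (n k) (t k) (c k) w)\<^sup>2) \<partial>M) \<longlonglongrightarrow> 0"
  and mI[measurable]: "I \<in> borel_measurable M" and mh: "set_borel_measurable lborel {0..s} h"
  unfolding has_wiener_integral_def by blast
 let ?S = "%k. step_integral W (n k) (t k) (c k)" and ?S' = "%k. step_integral W (n' k) (t' k) (c' k)"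
 let ?f = "%k. step_fun (n k) (t k) (c k)" and ?f' = "%k. step_fun (n' k) (t' k) (c' k)"
 have [measurable]: "?S k \<in> borel_measurable M" "?S' k \<in> borel_measurable M" for k
  using step_integral_measurable q p by auto
 have [measurable]: "step_fun n t c \<in> borel_measurable borel" for n t c
  unfolding step_fun_def by measurable
 have ind: "step_fun n t c x = indicator {0..s} x * step_fun n t c x" if "step_partition s n t" for n t c x
  unfolding step_fun_def sum_distrib_left
 proof (intro sum.cong refl)
  fix i assume "i \<in> {..<n}"
  then have "0 <= t i" "t (Suc i) <= s" using step_partition_nonneg[OF that] by auto
  then show "c i * indicator {t i<..t (Suc i)} x = indicator {0..s} x * (c i * indicator {t i<..t (Suc i)} x)"
   by (auto simp: indicator_def)
 qed
 define h' where "h' x = indicator {0..s} x * h x" for x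
 have [measurable]: "h' \<in> borel_measurable borel"
  using mh by (simp add: h'_def[abs_def] set_borel_measurable_def)
 have tri: "ennreal ((a - c)\<^sup>2) <= 2 * (ennreal ((a - b)\<^sup>2) + ennreal ((b - c)\<^sup>2))" for a b c :: real
 proof -
  have "(a - c)\<^sup>2 <= 2 * ((a - b)\<^sup>2 + (b - c)\<^sup>2)"
   using zero_le_power2[of "a - 2*b + c"] by (simp add: power2_eq_square algebra_simps)
  then have "ennreal ((a - c)\<^sup>2) <= ennreal (2 * ((a - b)\<^sup>2 + (b - c)\<^sup>2))" by (rule ennreal_leI)
  also have "... = 2 * (ennreal ((a - b)\<^sup>2) + ennreal ((b - c)\<^sup>2))"
   by (subst ennreal_mult') (auto simp: ennreal_plus)
  finally show ?thesis .
 qed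
 have fin: "(\<integral>\<^sup>+w. ennreal ((I w - ?S' k w)\<^sup>2) \<partial>M)
   <= 2 * ((\<integral>\<^sup>+w. ennreal ((I w - ?S k w)\<^sup>2) \<partial>M)
    + 2 * ((\<integral>\<^sup>+u\<in>{0..s}. ennreal ((h u - ?f k u)\<^sup>2) \<partial>lborel)
       + (\<integral>\<^sup>+u\<in>{0..s}. ennreal ((h u - ?f' k u)\<^sup>2) \<partial>lborel)))" for k
 proof -
  have hh: "(\<integral>\<^sup>+u\<in>{0..s}. ennreal ((h' u - f u)\<^sup>2) \<partial>lborel) = (\<integral>\<^sup>+u\<in>{0..s}. ennreal ((h u - f u)\<^sup>2) \<partial>lborel)" for f
   by (intro nn_integral_cong) (auto simp: h'_def indicator_def)
  have "(\<integral>\<^sup>+w. ennreal ((I w - ?S' k w)\<^sup>2) \<partial>M)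
    <= (\<integral>\<^sup>+w. 2 * (ennreal ((I w - ?S k w)\<^sup>2) + ennreal ((?S k w - ?S' k w)\<^sup>2)) \<partial>M)"
   by (intro nn_integral_mono tri)
  also have "... = 2 * ((\<integral>\<^sup>+w. ennreal ((I w - ?S k w)\<^sup>2) \<partial>M) + (\<integral>\<^sup>+w. ennreal ((?S k w - ?S' k w)\<^sup>2) \<partial>M))"
   by (simp add: nn_integral_cmult nn_integral_add)
  also have "(\<integral>\<^sup>+w. ennreal ((?S k w - ?S' k w)\<^sup>2) \<partial>M) = (\<integral>\<^sup>+x. ennreal ((?f k x - ?f' k x)\<^sup>2) \<partial>lborel)"
   by (rule ito_isometry_diff[OF q p])
  also have "... <= (\<integral>\<^sup>+x. 2 * (ennreal ((h x - ?f k x)\<^sup>2) * indicator {0..s} x + ennreal ((h x - ?f' k x)\<^sup>2) * indicator {0..s} x) \<partial>lborel)"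
  proof (intro nn_integral_mono)
   fix x
   show "ennreal ((?f k x - ?f' k x)\<^sup>2) <= 2 * (ennreal ((h x - ?f k x)\<^sup>2) * indicator {0..s} x + ennreal ((h x - ?f' k x)\<^sup>2) * indicator {0..s} x)"
    using tri[of "?f k x" "?f' k x" "h x"] ind[OF q, of k "c k" x] ind[OF p, of k "c' k" x]
    by (cases "x \<in> {0..s}") (simp_all add: power2_commute[of "h x"])
  qed
  also have "... = (\<integral>\<^sup>+x. 2 * (ennreal ((h' x - ?f k x)\<^sup>2) * indicator {0..s} x + ennreal ((h' x - ?f' k x)\<^sup>2) * indicator {0..s} x) \<partial>lborel)"
   by (intro nn_integral_cong) (auto simp: h'_def indicator_def)
  also have "... = 2 * ((\<integral>\<^sup>+u\<in>{0..s}. ennreal ((h' u - ?f k u)\<^sup>2) \<partial>lborel)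
       + (\<integral>\<^sup>+u\<in>{0..s}. ennreal ((h' u - ?f' k u)\<^sup>2) \<partial>lborel))"
   by (simp add: nn_integral_cmult nn_integral_add)
  finally show ?thesis unfolding hh by (simp add: mult_left_mono)
 qed
 have "(%k. 2 * ((\<integral>\<^sup>+w. ennreal ((I w - ?S k w)\<^sup>2) \<partial>M)
    + 2 * ((\<integral>\<^sup>+u\<in>{0..s}. ennreal ((h u - ?f k u)\<^sup>2) \<partial>lborel)
       + (\<integral>\<^sup>+u\<in>{0..s}. ennreal ((h u - ?f' k u)\<^sup>2) \<partial>lborel)))) \<longlonglongrightarrow> 2 * (0 + 2 * (0 + 0))"
  by (rule ennreal_tendsto_cmult[OF _ tendsto_add[OF l2 ennreal_tendsto_cmult[OF _ tendsto_add[OF l1 lim]]]]) simp_all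
 also have "2 * (0 + 2 * (0 + 0)) = (0::ennreal)" by simp
 finally have "(%k. \<integral>\<^sup>+w. ennreal ((I w - ?S' k w)\<^sup>2) \<partial>M) \<longlonglongrightarrow> 0"
  by (rule tendsto_sandwich[OF always_eventually[OF allI[OF zero_le]] always_eventually[OF allI[OF fin]] tendsto_const])
 then have "liminf (%k. \<integral>\<^sup>+w. ennreal ((I w - ?S' k w)\<^sup>2) \<partial>M) = 0"
  by (intro lim_imp_Liminf) auto
 then have "(\<integral>\<^sup>+w. liminf (%k. ennreal ((I w - ?S' k w)\<^sup>2)) \<partial>M) = 0"
  using nn_integral_liminf[of "%k w. ennreal ((I w - ?S' k w)\<^sup>2)" M] by auto
 then show ?thesis by (subst (asm) nn_integral_0_iff_AE) auto
qed

end

lemma liminf_sq_0_frequently: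
 fixes x :: real
 assumes "liminf (%k. ennreal ((x - y k)\<^sup>2)) = 0" "0 < e"
 shows "\<exists>\<^sub>F k in sequentially. \<bar>x - y k\<bar> < e"
proof (rule ccontr)
 assume "\<not> ?thesis"
 then have "\<forall>\<^sub>F k in sequentially. \<not> abs (x - y k) < e" by (simp add: not_frequently)
 then have "\<forall>\<^sub>F k in sequentially. ennreal (e\<^sup>2) <= ennreal ((x - y k)\<^sup>2)"
  by eventually_elim (use assms(2) in "auto intro!: ennreal_leI simp: abs_le_square_iff[symmetric]")
 then have "ennreal (e\<^sup>2) <= liminf (%k. ennreal ((x - y k)\<^sup>2))" by (rule Liminf_bounded)
 then show False using assms by (simp add: ennreal_eq_0_iff)
qed

context wiener_process begin

lemma wiener_integral_bound:
 assumes "has_wiener_integral M W h s I"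
  and "\<And>k. step_partition s (n k) (t k)"
  and "(%k. \<integral>\<^sup>+u\<in>{0..s}. ennreal ((h u - step_fun (n k) (t k) (c k) u)\<^sup>2) \<partial>lborel) \<longlonglongrightarrow> 0"
  and "AE w in M. \<forall>k. \<bar>step_integral W (n k) (t k) (c k) w\<bar> <= b w"
 shows "AE w in M. \<bar>I w\<bar> <= b w"
 using wiener_integral_liminf[OF assms(1,2,3)] assms(4)
proof eventually_elim
 case (elim w)
 show ?case
 proof (rule field_le_epsilon)
  fix e :: real assume "0 < e"
  from frequently_ex[OF liminf_sq_0_frequently[OF elim(1) this]]
  obtain k where "abs (I w - step_integral W (n k) (t k) (c k) w) < e" by blast
  then show "abs (I w) <= b w + e" using spec[OF elim(2), of k] by linarith
 qed
qed

lemma wiener_integral_limit: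
 assumes "has_wiener_integral M W h s I"
  and "\<And>k. step_partition s (n k) (t k)"
  and "(%k. \<integral>\<^sup>+u\<in>{0..s}. ennreal ((h u - step_fun (n k) (t k) (c k) u)\<^sup>2) \<partial>lborel) \<longlonglongrightarrow> 0"
  and "AE w in M. (%k. step_integral W (n k) (t k) (c k) w) \<longlonglongrightarrow> J w"
 shows "AE w in M. I w = J w"
 using wiener_integral_liminf[OF assms(1,2,3)] assms(4)
proof eventually_elim
 case (elim w)
 have "abs (I w - J w) <= 0 + e" if "0 < e" for e
 proof -
  have "\<forall>\<^sub>F k in sequentially. \<bar>step_integral W (n k) (t k) (c k) w - J w\<bar> < e/2"
   using tendstoD[OF elim(2), of "e/2"] that by (simp add: dist_real_def)
  from frequently_ex[OF frequently_eventually_frequently[OF liminf_sq_0_frequently[OF elim(1), of "e/2"] this]] that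
  obtain k where "abs (I w - step_integral W (n k) (t k) (c k) w) < e/2"
   "abs (step_integral W (n k) (t k) (c k) w - J w) < e/2" by auto
  then show ?thesis by linarith
 qed
 then have "abs (I w - J w) <= 0" by (rule field_le_epsilon)
 then show ?case by simp
qed

end

lemma dyadic_chaining:
 fixes f :: "real => real"
 assumes cont: "continuous_on {0..1} f" and q: "0 < q" "q < 1" and H: "0 <= H"
  and inc: "\<And>n j. j < 2^n ==> abs (f (real (Suc j) / 2^n) - f (real j / 2^n)) <= H * q^n"
  and t: "t \<in> {0..1}"
 shows "abs (f t - f (real (nat \<lfloor>2^n * t\<rfloor>) / 2^n)) <= H * q^n / (1 - q)"
proof -
 define d where "d n = nat \<lfloor>2^n * t\<rfloor>" for n :: nat
 have fl: "real (d n) <= 2^n * t" "2^n * t < real (d n) + 1" for n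
  using t by (auto simp: d_def)
 have d1: "d n <= 2^n" for n
 proof -
  have "real (d n) <= 2^n * 1" using t by (rule_tac order_trans[OF fl(1)]) auto
  then have "real (d n) <= real (2^n)" by simp
  then show ?thesis unfolding of_nat_le_iff .
 qed
 have dS: "d (Suc n) = 2 * d n \<or> d (Suc n) = Suc (2 * d n)" for n
 proof -
  have "real (d (Suc n)) < 2 * real (d n) + 2" "2 * real (d n) < real (d (Suc n)) + 1"
   using fl[of n] fl[of "Suc n"] by auto
  then show ?thesis by linarith
 qed
 have step: "abs (f (real (d (Suc n)) / 2^(Suc n)) - f (real (d n) / 2^n)) <= H * q^n" for n
 proof (cases "d (Suc n) = 2 * d n")
  case True
  then show ?thesis using H q by simp
 next
  case False
  then have e: "d (Suc n) = Suc (2 * d n)" using dS by auto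
  then have "2 * d n < 2^Suc n" using d1[of "Suc n"] by linarith
  from inc[OF this] have "abs (f (real (d (Suc n)) / 2^(Suc n)) - f (real (d n) / 2^n)) <= H * q ^ Suc n"
   by (simp add: e)
  also have "... <= H * q^n" using H q by (intro mult_left_mono power_decreasing) auto
  finally show ?thesis .
 qed
 have tele: "abs (f (real (d (n+m)) / 2^(n+m)) - f (real (d n) / 2^n)) <= H * (q^n - q^(n+m)) / (1-q)" for m
 proof (induct m)
  case (Suc m)
  have "H * (q^n - q^(n+m)) / (1-q) + H * q^(n+m) = H * (q^n - q^(n+Suc m)) / (1-q)"
   using q by (simp add: field_simps)
  then show ?case using Suc step[of "n+m"] by simp
 qed simp
 have lim: "(%m. real (d (n+m)) / 2^(n+m)) \<longlonglongrightarrow> t"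
 proof (rule real_tendsto_sandwich)
  show "\<forall>\<^sub>F m in sequentially. t - (1/2)^(n+m) <= real (d (n+m)) / 2^(n+m)"
  proof (intro always_eventually allI)
   fix m
   have "t * 2^(n+m) - 1 <= real (d (n+m))" using fl(2)[of "n+m"] by (simp add: mult.commute)
   then have "(t * 2^(n+m) - 1) / 2^(n+m) <= real (d (n+m)) / 2^(n+m)" by (intro divide_right_mono) auto
   then show "t - (1/2)^(n+m) <= real (d (n+m)) / 2^(n+m)" by (simp add: diff_divide_distrib power_one_over)
  qed
  show "\<forall>\<^sub>F m in sequentially. real (d (n+m)) / 2^(n+m) <= t"
   using fl(1) by (intro always_eventually allI) (simp add: field_simps)
  have "(%m. (1/2::real)^(m+n)) \<longlonglongrightarrow> 0"
   by (rule LIMSEQ_ignore_initial_segment[OF LIMSEQ_realpow_zero]) auto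
  from tendsto_diff[OF tendsto_const[of t] this]
  have "(%m. t - (1/2)^(n+m)) \<longlonglongrightarrow> t - 0" by (simp only: add.commute)
  then show "(%m. t - (1/2)^(n+m)) \<longlonglongrightarrow> t" by simp
 qed simp
 have "(%m. f (real (d (n+m)) / 2^(n+m))) \<longlonglongrightarrow> f t"
 proof (rule continuous_on_tendsto_compose[OF cont lim t])
  show "\<forall>\<^sub>F m in sequentially. real (d (n+m)) / 2^(n+m) \<in> {0..1}"
  proof (intro always_eventually allI)
   fix m
   have "real (d (n+m)) <= real (2^(n+m))" unfolding of_nat_le_iff by (rule d1)
   then show "real (d (n+m)) / 2^(n+m) \<in> {0..1}" by simp
  qed
 qed
 then have "(%m. \<bar>f (real (d (n+m)) / 2^(n+m)) - f (real (d n) / 2^n)\<bar>) \<longlonglongrightarrow> abs (f t - f (real (d n) / 2^n))"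
  by (intro tendsto_intros)
 then have "abs (f t - f (real (d n) / 2^n)) <= H * q^n / (1-q)"
 proof (rule LIMSEQ_le_const2, intro exI allI impI)
  fix m
  show "abs (f (real (d (n+m)) / 2^(n+m)) - f (real (d n) / 2^n)) <= H * q^n / (1-q)"
   using H q by (rule_tac order_trans[OF tele], intro divide_right_mono mult_left_mono) auto
 qed
 then show ?thesis by (simp add: d_def)
qed

lemma dyadic_hoelder:
 fixes f :: "real => real"
 assumes cont: "continuous_on {0..1} f" and b: "0 < be" and H: "0 <= H"
  and inc: "\<And>n j. j < 2^n ==> abs (f (real (Suc j) / 2^n) - f (real j / 2^n)) <= H * (2 powr - be)^n"
  and st: "s \<in> {0..1}" "t \<in> {0..1}"
 shows "abs (f t - f s) <= H * (2 powr be * (1 + 2 / (1 - 2 powr - be))) * abs (t - s) powr be"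
proof -
 define q where "q = 2 powr - be"
 have q: "0 < q" "q < 1" using b powr_less_mono[of "-be" 0 2] by (auto simp: q_def)
 have ch: "abs (f t - f (real (nat \<lfloor>2^m * t\<rfloor>) / 2^m)) <= H * q^m / (1 - q)" if "t \<in> {0..1}" for t m
  by (rule dyadic_chaining[OF cont q H _ that]) (use inc in "simp add: q_def")
 have key: "abs (f t - f s) <= H * (2 powr be * (1 + 2 / (1 - q))) * (t - s) powr be"
  if "s \<in> {0..1}" "t \<in> {0..1}" "s < t" for s t
 proof -
  have "\<exists>n. (1/2)^n < t - s" using real_arch_pow_inv[of "t-s" "1/2"] that by auto
  then obtain n where n: "(1/2)^n < t - s" "\<And>m. m < n ==> \<not> (1/2)^m < t - s"
   using exists_least_iff[of "%n. (1/2)^n < t - s"] by blast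
  have "n ~= 0" using n(1) that by (cases n) auto
  then obtain m where m: "n = Suc m" by (cases n) auto
  have u: "t - s <= (1/2)^m" using n(2)[of m] m by auto
  have l: "(1/2)^Suc m < t - s" using n m by auto
  define ds dt where "ds = nat \<lfloor>2^m * s\<rfloor>" and "dt = nat \<lfloor>2^m * t\<rfloor>"
  have fl: "real ds <= 2^m * s" "2^m * s < real ds + 1" "real dt <= 2^m * t" "2^m * t < real dt + 1"
   using that by (auto simp: ds_def dt_def)
  have "2^m * t - 2^m * s <= 1" using u by (simp add: field_simps power_divide)
  moreover have "2^m * s < 2^m * t" using that by simp
  ultimately have "real dt < real ds + 2" "real ds < real dt + 1" using fl by linarith+
  then have dd: "dt = ds \<or> dt = Suc ds" by linarith
  have "dt <= 2^m"
  proof -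
   have "real dt <= 2^m * 1" using that by (rule_tac order_trans[OF fl(3)]) auto
   then have "real dt <= real (2^m)" by simp
   then show ?thesis unfolding of_nat_le_iff .
  qed
  then have 1: "abs (f (real dt / 2^m) - f (real ds / 2^m)) <= H * q^m"
   using dd inc[of ds m, folded q_def] H q by auto
  have "abs (f t - f s) <= H * q^m / (1-q) + H * q^m / (1-q) + H * q^m"
   using ch[OF that(1), of m] ch[OF that(2), of m] 1 unfolding ds_def[symmetric] dt_def[symmetric] by linarith
  also have "... = H * (1 + 2/(1-q)) * q^m" by (simp add: divide_inverse ring_distribs)
  also have "q^m = 2 powr be * ((1/2)^Suc m) powr be"
  proof -
   have h: "(1/2::real)^Suc m = 2 powr - real (Suc m)"
    by (simp only: powr_minus powr_realpow zero_less_numeral) (simp add: power_one_over inverse_eq_divide)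
   have "q^m = 2 powr (be + - real (Suc m) * be)"
    by (simp add: q_def powr_realpow[symmetric] powr_powr algebra_simps)
   then show ?thesis unfolding h powr_powr powr_add .
  qed
  also have "H * (1 + 2/(1-q)) * (2 powr be * ((1/2)^Suc m) powr be) <= H * (1 + 2/(1-q)) * (2 powr be * (t - s) powr be)"
   using l b H q by (intro mult_left_mono powr_mono2) auto
  finally show ?thesis by (simp add: mult_ac)
 qed
 show ?thesis unfolding q_def[symmetric]
 proof (cases s t rule: linorder_cases)
  case greater
  then have "abs (t - s) = s - t" by simp
  then show "abs (f t - f s) <= H * (2 powr be * (1 + 2 / (1 - q))) * abs (t - s) powr be"
   using key[of t s] st greater by (simp only: abs_minus_commute[of "f t" "f s"])
 qed (use key[of s t] st in simp_all)
qed

definition hoelder_const :: "nat => real => real" where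
 "hoelder_const k T = (let be = 1/2 - 1/k in
   2 powr be * (1 + 2 / (1 - 2 powr - be)) * T powr - be + 2 * T ^ k * (fact (2*k) / (2 ^ k * fact k)))"

lemma hoelder_const_ge:
 assumes "2 < k" "0 < T"
 shows "2 powr (1/2 - 1/k) * (1 + 2 / (1 - 2 powr - (1/2 - 1/k))) * T powr - (1/2 - 1/k) <= hoelder_const k T"
  "2 * T ^ k * (fact (2*k) / (2 ^ k * fact k)) <= hoelder_const k T" "0 <= hoelder_const k T"
proof -
 have b: "0 < (1/2 - 1/real k)" using assms by (simp add: field_simps)
 have "(2::real) powr - (1/2 - 1/real k) < 2 powr 0" by (rule powr_less_mono) (use b in auto)
 then have "0 <= 2 powr (1/2 - 1/k) * (1 + 2 / (1 - 2 powr - (1/2 - 1/k))) * T powr - (1/2 - 1/k)"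
  by (intro mult_nonneg_nonneg add_nonneg_nonneg divide_nonneg_nonneg) auto
 moreover have "0 <= 2 * T ^ k * (fact (2*k) / (2 ^ k * fact k))" using assms by simp
 ultimately show "2 powr (1/2 - 1/k) * (1 + 2 / (1 - 2 powr - (1/2 - 1/k))) * T powr - (1/2 - 1/k) <= hoelder_const k T"
  "2 * T ^ k * (fact (2*k) / (2 ^ k * fact k)) <= hoelder_const k T" "0 <= hoelder_const k T"
  unfolding hoelder_const_def Let_def by linarith+
qed

context wiener_process begin

lemma hoelder:
 assumes k: "2 < k" and T: "0 < T"
 obtains R where "R \<in> borel_measurable M" "\<And>w. 0 <= R w"
  "(\<integral>\<^sup>+w. ennreal (R w ^ (2*k)) \<partial>M) <= ennreal (hoelder_const k T)"
  "AE w in M. W 0 w = 0 \<and> continuous_on {0..T} (%t. W t w) \<and>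
    (\<forall>s\<in>{0..T}. \<forall>t\<in>{0..T}. \<bar>W t w - W s w\<bar> <= hoelder_const k T * R w * abs (t - s) powr (1/2 - 1/k))"
proof -
 define be where "be = 1/2 - 1/real k"
 have b: "0 < be" using k by (simp add: be_def field_simps)
 define D where "D n j w = W (T * (real (Suc j) / 2^n)) w - W (T * (real j / 2^n)) w" for n j w
 define A where "A w = (\<Sum>n. \<Sum>j<(2::nat)^n. ennreal (2^(n*(k-2)) * D n j w ^ (2*k)))" for w
 have mD[measurable]: "D n j \<in> borel_measurable M" for n j
  unfolding D_def[abs_def] using T by (auto intro!: borel_measurable_diff W_measurable)
 have [measurable]: "A \<in> borel_measurable M" unfolding A_def[abs_def] by measurable
 have mm: "(%w. ennreal (2^(n*(k-2)) * D n j w ^ (2*k))) \<in> borel_measurable M" for n j by measurable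
 have msum: "(%w. \<Sum>j<(2::nat)^n. ennreal (2^(n*(k-2)) * D n j w ^ (2*k))) \<in> borel_measurable M" for n by measurable
 define cc :: real where "cc = fact (2*k) / (2 ^ k * fact k)"
 have cc: "0 <= cc" by (simp add: cc_def)
 have D1: "(\<integral>\<^sup>+w. ennreal (2^(n*(k-2)) * D n j w ^ (2*k)) \<partial>M) = ennreal (2^(n*(k-2)) * ((T / 2^n)^k * cc))" for n j
 proof -
  have "T * (real (Suc j) / 2^n) - T * (real j / 2^n) = T / 2^n" by (simp add: field_simps)
  then have "(\<integral>\<^sup>+w. ennreal (D n j w ^ (2*k)) \<partial>M) = ennreal ((T / 2^n)^k * cc)"
   using nn_increment_moment[of "T * (real j / 2^n)" "T * (real (Suc j) / 2^n)" k] T k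
   unfolding D_def cc_def by (simp add: divide_right_mono)
  then show ?thesis by (simp add: ennreal_mult' nn_integral_cmult)
 qed
 have A1: "(\<integral>\<^sup>+w. A w \<partial>M) = ennreal (2 * T ^ k * cc)"
 proof -
  have "(\<integral>\<^sup>+w. A w \<partial>M) = (\<Sum>n. \<Sum>j<(2::nat)^n. \<integral>\<^sup>+w. ennreal (2^(n*(k-2)) * D n j w ^ (2*k)) \<partial>M)"
   unfolding A_def nn_integral_suminf[OF msum] by (intro suminf_cong nn_integral_sum mm)
  also have "... = (\<Sum>n. ennreal ((1/2)^n * (T^k * cc)))"
  proof (intro suminf_cong)
   fix n
   obtain k' where k': "k = 2 + k'" using k less_imp_le_nat le_Suc_ex by blast
   have g: "(\<Sum>j<(2::nat)^n. ennreal y) = ennreal (real (2^n) * y)" for y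
    by (simp add: ennreal_of_nat_eq_real_of_nat ennreal_mult')
   have "(T / 2^n)^k = T^k / (2^n * (2^n * 2^(n*k')))"
    by (simp add: power_divide power_mult[symmetric] k' distrib_left mult_2_right power_add mult.assoc)
   then have "real (2^n) * (2^(n*(k-2)) * ((T / 2^n)^k * cc)) = (1/2)^n * (T^k * cc)"
    using k' by (simp add: power_one_over)
   then show "(\<Sum>j<(2::nat)^n. \<integral>\<^sup>+w. ennreal (2^(n*(k-2)) * D n j w ^ (2*k)) \<partial>M) = ennreal ((1/2)^n * (T^k * cc))"
    unfolding D1 g by (simp only:)
  qed
  also have "... = ennreal (2 * (T^k * cc))"
  proof (rule suminf_ennreal_eq)
   show "0 <= (1/2)^n * (T^k * cc)" for n using T cc by simp
   show "(%n. (1/2)^n * (T^k * cc)) sums (2 * (T^k * cc))"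
    using sums_mult2[OF geometric_sums[of "1/2::real"]] by simp
  qed
  finally show ?thesis by (simp add: mult_ac)
 qed
 define R where "R w = root (2*k) (enn2real (A w))" for w
 have k0: "0 < 2*k" using k by simp
 have Rk: "R w ^ (2*k) = enn2real (A w)" for w using k0 by (simp add: R_def)
 have R0: "0 <= R w" for w using k0 by (simp add: R_def)
 have fin: "AE w in M. A w ~= \<infinity>" by (rule nn_integral_PInf_AE) (simp_all add: A1)
 show ?thesis
 proof (rule that[of R])
  show "R \<in> borel_measurable M" unfolding R_def[abs_def] by measurable
  show "0 <= R w" for w by (rule R0)
  have "(\<integral>\<^sup>+w. ennreal (R w ^ (2*k)) \<partial>M) <= (\<integral>\<^sup>+w. A w \<partial>M)"
   unfolding Rk by (intro nn_integral_mono) (metis ennreal_enn2real_if top_greatest order_refl)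
  also have "... <= ennreal (hoelder_const k T)"
   unfolding A1 cc_def by (rule ennreal_leI hoelder_const_ge(2) k T)+
  finally show "(\<integral>\<^sup>+w. ennreal (R w ^ (2*k)) \<partial>M) <= ennreal (hoelder_const k T)" .
  show "AE w in M. W 0 w = 0 \<and> continuous_on {0..T} (%t. W t w) \<and>
    (\<forall>s\<in>{0..T}. \<forall>t\<in>{0..T}. \<bar>W t w - W s w\<bar> <= hoelder_const k T * R w * abs (t - s) powr (1/2 - 1/k))"
   using fin start continuous_paths
  proof eventually_elim
   case (elim w)
   have c: "continuous_on {0..T} (%t. W t w)" by (rule continuous_on_subset[OF elim(3)]) auto
   have cT: "continuous_on {0..1} (%t. W (T * t) w)"
    by (rule continuous_on_compose2[OF c]) (use T in "auto intro!: continuous_intros simp: mult_left_le")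
   have inc: "abs (W (T * (real (Suc j) / 2^n)) w - W (T * (real j / 2^n)) w) <= R w * (2 powr - be)^n" if "j < 2^n" for n j
   proof -
    have "ennreal (2^(n*(k-2)) * D n j w ^ (2*k)) <= (\<Sum>j<(2::nat)^n. ennreal (2^(n*(k-2)) * D n j w ^ (2*k)))"
     using that by (intro member_le_sum) auto
    also have "... <= A w" unfolding A_def
     using sum_le_suminf[of "%n. \<Sum>j<(2::nat)^n. ennreal (2^(n*(k-2)) * D n j w ^ (2*k))" "{n}"] by auto
    also have "A w = ennreal (R w ^ (2*k))" using elim(1) by (simp add: Rk less_top)
    finally have "2^(n*(k-2)) * D n j w ^ (2*k) <= R w ^ (2*k)" using R0 by (simp add: ennreal_le_iff)
    moreover have "((2 powr - be)^n)^(2*k) * (2::real)^(n*(k-2)) = 1"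
    proof -
     have "((2 powr - be)^n)^(2*k) * (2::real)^(n*(k-2)) = 2 powr (- be * (real n * real (2*k))) * 2 powr real (n*(k-2))"
      by (simp add: powr_powr powr_realpow[symmetric] mult_ac)
     also have "... = 2 powr (- be * (real n * real (2*k)) + real n * (real k - 2))"
      unfolding powr_add using k by (simp add: of_nat_diff)
     also have "- be * (real n * real (2*k)) + real n * (real k - 2) = 0"
      using k by (simp add: be_def field_simps)
     finally show ?thesis by simp
    qed
    ultimately have "abs (D n j w) ^ (2*k) <= (R w * (2 powr - be)^n) ^ (2*k)"
     using mult_left_mono[of "2^(n*(k-2)) * D n j w ^ (2*k)" "R w ^ (2*k)" "((2 powr - be)^n)^(2*k)"]
     by (simp add: power_mult_distrib mult_ac power_even_abs flip: mult.assoc)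
    then show ?thesis using power_mono_iff[of "abs (D n j w)" "R w * (2 powr - be)^n" "2*k"] R0 k0
     by (simp add: D_def)
   qed
   have "abs (W t w - W s w) <= hoelder_const k T * R w * abs (t - s) powr be" if "s \<in> {0..T}" "t \<in> {0..T}" for s t
   proof -
    have "abs (W (T * (t/T)) w - W (T * (s/T)) w) <= R w * (2 powr be * (1 + 2 / (1 - 2 powr - be))) * abs (t/T - s/T) powr be"
     by (rule dyadic_hoelder[OF cT b R0 inc]) (use that T in "auto simp: field_simps")
    also have "abs (t/T - s/T) powr be = T powr - be * abs (t - s) powr be"
     using T by (simp add: diff_divide_distrib[symmetric] powr_divide powr_minus) (simp add: divide_inverse)
    also have "R w * (2 powr be * (1 + 2 / (1 - 2 powr - be))) * (T powr - be * abs (t - s) powr be)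
     = (2 powr be * (1 + 2 / (1 - 2 powr - be)) * T powr - be) * (R w * abs (t - s) powr be)" by simp
    also have "... <= hoelder_const k T * (R w * abs (t - s) powr be)"
     using hoelder_const_ge(1)[OF k T] R0 unfolding be_def[symmetric] by (intro mult_right_mono) auto
    finally show ?thesis using T by (simp add: mult_ac)
   qed
   then show ?case using c elim(2) by (simp add: be_def)
  qed
 qed
qed

end

definition upart :: "real => nat => nat => real" where "upart s k i = s * real i / real (Suc k)"

lemma step_partition_upart: "0 <= s ==> step_partition s (Suc k) (upart s k)"
 by (auto simp: step_partition_def upart_def intro!: divide_right_mono mult_left_mono simp del: of_nat_Suc)

lemma upart_mono: "0 <= s ==> i <= j ==> upart s k i <= upart s k j"
 by (auto simp: upart_def intro!: divide_right_mono mult_left_mono)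

lemma upart_range: "0 <= s ==> i <= Suc k ==> upart s k i \<in> {0..s}"
 using step_partition_nonneg[OF step_partition_upart] by auto

lemma left_step_value:
 assumes u: "0 < u" "u <= s"
 obtains v where "v \<in> {0..s}" "v < u" "u - v <= s / real (Suc k)"
  "step_fun (Suc k) (upart s k) (%i. h (upart s k i)) u = h v"
proof -
 have s: "0 <= s" using u by simp
 define j where "j = (LEAST j. u <= upart s k (Suc j))"
 have "u <= upart s k (Suc k)" using u by (simp add: upart_def)
 then have j: "u <= upart s k (Suc j)" "j <= k"
  unfolding j_def by (rule LeastI, rule Least_le)
 have j1: "upart s k j < u"
 proof (cases j)
  case (Suc i)
  then have "\<not> u <= upart s k (Suc i)" using not_less_Least[of i "%j. u <= upart s k (Suc j)"] by (simp add: j_def)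
  then show ?thesis using Suc by simp
 qed (use u in "simp add: upart_def")
 have "step_fun (Suc k) (upart s k) (%i. h (upart s k i)) u = (\<Sum>i<Suc k. if i = j then h (upart s k j) else 0)"
  unfolding step_fun_def
 proof (intro sum.cong refl)
  fix i
  show "h (upart s k i) * indicator {upart s k i<..upart s k (Suc i)} u = (if i = j then h (upart s k j) else 0)"
   using j j1 upart_mono[OF s, of "Suc i" j k] upart_mono[OF s, of "Suc j" i k]
   by (cases i j rule: linorder_cases) (auto simp: indicator_def)
 qed
 also have "... = h (upart s k j)" using j(2) by (simp add: less_Suc_eq_le)
 finally have "step_fun (Suc k) (upart s k) (%i. h (upart s k i)) u = h (upart s k j)" .
 moreover have "upart s k (Suc j) = upart s k j + s / real (Suc k)"
  by (simp add: upart_def add_divide_distrib distrib_left)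
 ultimately show ?thesis
  using j j1 upart_range[OF s, of j k] by (intro that[of "upart s k j"]) auto
qed

lemma left_step_converges:
 assumes s: "0 <= s" and mh: "set_borel_measurable lborel {0..s} h"
  and B: "\<And>u. u \<in> {0..s} ==> abs (h u) <= B" and S: "finite S"
  and cont: "\<And>u. u \<in> {0..s} - S ==> continuous (at u within {0..s}) h"
 shows "(%k. \<integral>\<^sup>+u\<in>{0..s}. ennreal ((h u - step_fun (Suc k) (upart s k) (%i. h (upart s k i)) u)\<^sup>2) \<partial>lborel) \<longlonglongrightarrow> 0"
proof -
 define h' where "h' x = indicator {0..s} x * h x" for x
 have [measurable]: "h' \<in> borel_measurable borel"
  using mh by (simp add: h'_def[abs_def] set_borel_measurable_def)
 define f where "f k = step_fun (Suc k) (upart s k) (%i. h (upart s k i))" for k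
 have [measurable]: "f k \<in> borel_measurable borel" for k unfolding f_def step_fun_def by measurable
 have B0: "0 <= B" using B[of 0] s by force
 have ae: "AE u in lborel. u \<notin> insert 0 S"
  by (rule AE_not_in) (simp add: S finite_imp_null_set_lborel)
 have "(%k. \<integral>\<^sup>+u. ennreal ((h' u - f k u)\<^sup>2) * indicator {0..s} u \<partial>lborel) \<longlonglongrightarrow> (\<integral>\<^sup>+u. 0 \<partial>(lborel::real measure))"
 proof (rule nn_integral_dominated_convergence[where w="%u. ennreal ((2*B)\<^sup>2) * indicator {0..s} u"])
  show "(\<integral>\<^sup>+u. ennreal ((2*B)\<^sup>2) * indicator {0..s} u \<partial>lborel) < \<infinity>"
   using s by (simp add: nn_integral_cmult_indicator emeasure_lborel_Icc_eq ennreal_mult_less_top del: ennreal_power)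
  show "AE u in lborel. ennreal ((h' u - f k u)\<^sup>2) * indicator {0..s} u <= ennreal ((2*B)\<^sup>2) * indicator {0..s} u" for k
   using ae
  proof eventually_elim
   case (elim u)
   show ?case
   proof (cases "u \<in> {0..s}")
    case True
    with elim have "0 < u" "u <= s" by auto
    from left_step_value[OF this, of k h] obtain v where "v \<in> {0..s}" "f k u = h v" unfolding f_def by metis
    then have "abs (h' u - f k u) <= 2 * B" using B[of u] B[of v] True by (auto simp: h'_def)
    then have "(h' u - f k u)\<^sup>2 <= (2*B)\<^sup>2" using B0 by (intro power2_le_iff_abs_le[THEN iffD2]) auto
    then show ?thesis by (intro mult_right_mono ennreal_leI) auto
   qed simp
  qed
  show "AE u in lborel. (%k. ennreal ((h' u - f k u)\<^sup>2) * indicator {0..s} u) \<longlonglongrightarrow> 0"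
   using ae
  proof eventually_elim
   case (elim u)
   show ?case
   proof (cases "u \<in> {0..s}")
    case True
    with elim have u: "0 < u" "u <= s" by auto
    define P where "P k v \<longleftrightarrow> v \<in> {0..s} \<and> v < u \<and> u - v <= s / real (Suc k) \<and> f k u = h v" for k v
    have "\<exists>v. P k v" for k using left_step_value[OF u, of k h] unfolding f_def P_def by metis
    then obtain v where v: "\<And>k. P k (v k)" by metis
    have "(%k. u - s / real (Suc k)) \<longlonglongrightarrow> u - 0"
     by (intro tendsto_diff tendsto_const LIMSEQ_Suc[OF lim_const_over_n])
    then have "v \<longlonglongrightarrow> u" using v
     by (intro tendsto_sandwich[of "%k. u - s / real (Suc k)" v _ "%_. u"]) (auto simp: P_def algebra_simps less_imp_le intro!: always_eventually)
    moreover have "continuous (at u within {0..s}) h" using cont True elim by auto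
    ultimately have "(%k. h (v k)) \<longlonglongrightarrow> h u"
     using v by (auto simp: P_def continuous_within_sequentially o_def)
    then have "(%k. f k u) \<longlonglongrightarrow> h u" using v by (simp add: P_def)
    then have "(%k. ennreal ((h u - f k u)\<^sup>2)) \<longlonglongrightarrow> ennreal ((h u - h u)\<^sup>2)" by (intro tendsto_intros)
    then show ?thesis using True by (simp add: h'_def)
   qed simp
  qed
 qed measurable
 moreover have "(\<integral>\<^sup>+u\<in>{0..s}. ennreal ((h' u - f k u)\<^sup>2) \<partial>lborel) = (\<integral>\<^sup>+u\<in>{0..s}. ennreal ((h u - f k u)\<^sup>2) \<partial>lborel)" for k
  by (intro nn_integral_cong) (auto simp: h'_def indicator_def)
 ultimately show ?thesis by (simp add: f_def)
qed

lemma abel_sum: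
 fixes c B :: "nat => real"
 shows "(\<Sum>i<Suc k. c i * (B (Suc i) - B i)) = c k * B (Suc k) - c 0 * B 0 - (\<Sum>i<k. (c (Suc i) - c i) * B (Suc i))"
 by (induct k) (simp_all add: algebra_simps)

context delay_split begin

definition Kg :: real where "Kg = K * (Cb * exp (kap * r)) + om * cmod gam"

definition g0_var :: "real => real" where
 "g0_var a = 2 * Kg / kap * exp (- kap * a / 2) + (if a < 0 then 2 * Cb * exp (kap * r / 2) else 0)"

lemma Kg_nonneg: "0 <= Kg" using K_nonneg Cb_nonneg om_pos by (simp add: Kg_def)

lemma g0_var_nonneg: "0 <= g0_var a" using Kg_nonneg kappa_pos Cb_nonneg by (simp add: g0_var_def)

lemma g0_increment:
 assumes a: "0 <= a" "a <= b"
 shows "(%s. Lf r m (seg g0 s)) integrable_on {a..b}"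
  "g0 b - g0 a = integral {a..b} (%s. Lf r m (seg g0 s))"
proof -
 have b: "0 <= b" using a by simp
 have i: "(%s. Lf r m (seg X0 s)) integrable_on {0..b}" using X0_equation[OF b] by auto
 have "((%s. Lf r m (seg X0 s)) has_integral (X0 b - X0 a)) {a..b}"
  using Henstock_Kurzweil_Integration.integral_combine[OF a i] X0_equation[OF a(1)] X0_equation[OF b]
   integrable_subinterval_real[OF i, of a b] a by (auto simp: has_integral_iff)
 moreover have "((%s. Lf r m (seg (pw gam) s)) has_integral (pw gam b - pw gam a)) {a..b}"
  unfolding Lf_pw by (rule fundamental_theorem_of_calculus[OF a(2)])
   (auto simp: has_real_derivative_iff_has_vector_derivative[symmetric] intro: pw_deriv)
 ultimately have "((%s. Lf r m (seg X0 s) - Lf r m (seg (pw gam) s)) has_integral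
   ((X0 b - X0 a) - (pw gam b - pw gam a))) {a..b}" by (rule has_integral_diff)
 moreover have "Lf r m (seg X0 s) - Lf r m (seg (pw gam) s) = Lf r m (seg g0 s)" for s
  unfolding g0_def by (rule Lf_diff[symmetric]; rule integrable_Lf_shift) (auto intro: X0_bound pw_bound)
 ultimately have "((%s. Lf r m (seg g0 s)) has_integral (g0 b - g0 a)) {a..b}"
  by (simp add: g0_def algebra_simps)
 then show "(%s. Lf r m (seg g0 s)) integrable_on {a..b}"
  "g0 b - g0 a = integral {a..b} (%s. Lf r m (seg g0 s))" by (auto simp: has_integral_iff)
qed

lemma g0_variation_pos:
 assumes a: "0 <= a" "a <= b"
 shows "abs (g0 a - g0 b) <= Kg / kap * (exp (- kap * a) - exp (- kap * b))"
proof -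
 have e: "((%s. Kg * exp (- kap * s)) has_integral (- Kg / kap * exp (- kap * b) - - Kg / kap * exp (- kap * a))) {a..b}"
  by (rule fundamental_theorem_of_calculus[OF a(2)])
   (use kappa_pos in "auto simp: has_real_derivative_iff_has_vector_derivative[symmetric] intro!: derivative_eq_intros")
 have "norm (g0 b - g0 a) <= integral {a..b} (%s. Kg * exp (- kap * s))"
  unfolding g0_increment(2)[OF a]
 proof (rule integral_norm_bound_integral[OF g0_increment(1)[OF a]])
  show "(%s. Kg * exp (- kap * s)) integrable_on {a..b}" using e by auto
  fix s assume "s \<in> {a..b}"
  have "norm (Lf r m (seg g0 s)) <= K * (Cb * exp (- kap * (s - r)))"
  proof (rule Lf_bound)
   fix th assume "-r <= th"
   then have "Cb * exp (- kap * (s + th)) <= Cb * exp (- kap * (s - r))"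
    using kappa_pos Cb_nonneg by (intro mult_left_mono) auto
   then show "norm (g0 (s + th)) <= Cb * exp (- kap * (s - r))" using g0_bound[of "s + th"] by simp
  qed
  also have "... = K * (Cb * exp (kap * r)) * exp (- kap * s)" by (simp add: exp_add[symmetric] algebra_simps)
  also have "... <= Kg * exp (- kap * s)" using om_pos by (intro mult_right_mono) (auto simp: Kg_def)
  finally show "norm (Lf r m (seg g0 s)) <= Kg * exp (- kap * s)" .
 qed
 also have "... = Kg / kap * (exp (- kap * a) - exp (- kap * b))" using e by (simp add: has_integral_iff algebra_simps)
 finally show ?thesis by (simp add: abs_minus_commute)
qed

lemma g0_variation_neg:
 assumes a: "a <= b" "b < 0"
 shows "abs (g0 a - g0 b) <= Kg / kap * (exp (- kap * a) - exp (- kap * b))"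
proof -
 have "norm (pw gam b - pw gam a) <= (om * cmod gam) * norm (b - a)"
 proof (rule field_differentiable_bound[of UNIV "pw gam" "pw (\<i> * of_real om * gam)"])
  show "norm (pw (\<i> * of_real om * gam) z) <= om * cmod gam" for z
   using pw_bound[of "\<i> * of_real om * gam" z] om_pos by (simp add: norm_mult)
 qed (auto intro: pw_deriv)
 then have 1: "abs (g0 a - g0 b) <= om * cmod gam * (b - a)" using a by (simp add: g0_def X0_neg)
 have "1 * (kap * (b - a)) <= exp (- kap * b) * (kap * (b - a))"
  using a kappa_pos by (intro mult_right_mono) (auto simp: mult_le_0_iff)
 also have "... <= exp (- kap * b) * (exp (kap * (b - a)) - 1)"
  using exp_ge_add_one_self[of "kap * (b - a)"] by (intro mult_left_mono) (linarith, simp)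
 also have "... = exp (- kap * a) - exp (- kap * b)" by (simp add: right_diff_distrib exp_add[symmetric])
 finally have 2: "b - a <= (exp (- kap * a) - exp (- kap * b)) / kap" using kappa_pos by (simp add: field_simps)
 have 3: "om * cmod gam <= Kg" using K_nonneg Cb_nonneg by (simp add: Kg_def)
 have "om * cmod gam * (b - a) <= Kg * ((exp (- kap * a) - exp (- kap * b)) / kap)"
  by (rule mult_mono[OF 3 2]) (use Kg_nonneg a in auto)
 with 1 show ?thesis by simp
qed

lemma g0_variation:
 assumes a: "-r <= a" "a <= b"
 shows "abs (g0 a - g0 b) * exp (kap * a / 2) <= g0_var a - g0_var b"
proof (cases "a < 0 \<and> 0 <= b")
 case True
 have e1: "Cb * exp (- kap * a) * exp (kap * a / 2) <= Cb * exp (kap * r / 2)"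
  using a kappa_pos Cb_nonneg mult_left_mono[of "-r" a kap]
  by (simp add: mult.assoc exp_add[symmetric]) (intro mult_left_mono, auto simp: mult.commute)
 have e2: "Cb * exp (- kap * b) * exp (kap * a / 2) <= Cb * exp (kap * r / 2)"
 proof -
  have "- kap * b + kap * a / 2 <= kap * r / 2"
  proof -
   have "0 <= kap * b" "kap * a <= 0" "0 <= kap * r"
    using True kappa_pos r_pos by (auto simp: mult_le_0_iff)
   then show ?thesis by linarith
  qed
  then show ?thesis using Cb_nonneg by (simp add: mult.assoc exp_add[symmetric] mult_left_mono)
 qed
 have "abs (g0 a - g0 b) * exp (kap * a / 2) <= (Cb * exp (- kap * a) + Cb * exp (- kap * b)) * exp (kap * a / 2)"
  using g0_bound[of a] g0_bound[of b] by (intro mult_right_mono) auto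
 also have "... <= 2 * Cb * exp (kap * r / 2)" using e1 e2 by (simp add: distrib_right)
 also have "... <= g0_var a - g0_var b"
 proof -
  have "exp (- kap * b / 2) <= exp (- kap * a / 2)" using a kappa_pos by simp
  then have "2 * Kg / kap * exp (- kap * b / 2) <= 2 * Kg / kap * exp (- kap * a / 2)"
   using Kg_nonneg kappa_pos by (intro mult_left_mono) auto
  then show ?thesis using True by (simp add: g0_var_def)
 qed
 finally show ?thesis .
next
 case False
 define P Q where "P = exp (- kap * a / 2)" and "Q = exp (- kap * b / 2)"
 have PQ: "0 < P" "0 < Q" "Q <= P" using a kappa_pos by (auto simp: P_def Q_def)
 have sq: "exp (- kap * a) = P\<^sup>2" "exp (- kap * b) = Q\<^sup>2" "exp (kap * a / 2) = 1 / P"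
  by (simp_all add: P_def Q_def power2_eq_square exp_add[symmetric] exp_minus inverse_eq_divide)
 have "abs (g0 a - g0 b) <= Kg / kap * (P\<^sup>2 - Q\<^sup>2)"
  using False g0_variation_pos[of a b] g0_variation_neg[of a b] a unfolding sq by linarith
 then have "abs (g0 a - g0 b) * (1/P) <= Kg / kap * (P\<^sup>2 - Q\<^sup>2) * (1/P)" using PQ by (intro mult_right_mono) auto
 also have "... = Kg / kap * ((P\<^sup>2 - Q\<^sup>2) / P)" by simp
 also have "... <= Kg / kap * (2 * (P - Q))"
 proof (intro mult_left_mono)
  have "(P\<^sup>2 - Q\<^sup>2) <= 2 * (P - Q) * P"
   using zero_le_power2[of "P - Q"] by (simp add: power2_eq_square algebra_simps)
  then show "(P\<^sup>2 - Q\<^sup>2) / P <= 2 * (P - Q)" using PQ by (simp add: divide_le_eq)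
 qed (use Kg_nonneg kappa_pos in simp)
 also have "... = g0_var a - g0_var b"
  using False a by (auto simp: g0_var_def P_def Q_def algebra_simps)
 finally show ?thesis unfolding sq .
qed

definition Cz :: real where
 "Cz = (1 + 2/kap) * exp (kap * r / 2) * (Cb * exp (kap * r / 2) + (2 * Kg / kap * exp (kap * r / 2) + 2 * Cb * exp (kap * r / 2)))"

lemma Cz_nonneg: "0 <= Cz" using Kg_nonneg Cb_nonneg kappa_pos by (simp add: Cz_def)

lemma kernel_step_integral_bound:
 assumes eps: "0 < eps" and b: "0 <= be" "be <= 1" and s: "0 <= s" and th: "-r <= th" "th <= 0" and H: "0 <= H"
  and W: "\<And>u. u \<in> {0..s} ==> abs (W u w - W s w) <= H * (s - u) powr be"
 shows "abs (step_integral W (Suc k) (upart s k) (%i. g0 ((s - upart s k i) / eps\<^sup>2 + th) * sig) w)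
  <= Cz * abs sig * H * eps powr (2*be)"
proof -
 define t where "t = upart s k"
 define a where "a i = (s - t i) / eps\<^sup>2 + th" for i
 define B where "B i = W (t i) w - W s w" for i
 define Q where "Q = H * eps powr (2*be) * ((1 + 2/kap) * exp (kap * r / 2))"
 have Q: "0 <= Q" using H kappa_pos by (simp add: Q_def)
 have ts: "t i \<in> {0..s}" if "i <= Suc k" for i using upart_range[OF s that] by (simp add: t_def)
 have ar: "-r <= a i" if "i <= Suc k" for i
  using ts[OF that] th by (auto simp: a_def intro: order_trans[OF th(1)])
 have am: "a (Suc i) <= a i" for i
  using upart_mono[OF s, of i "Suc i" k] eps by (auto simp: a_def t_def intro!: divide_right_mono)
 have Bb: "abs (B i) <= Q * exp (kap * a i / 2)" if "i <= Suc k" for i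
 proof -
  define x where "x = (s - t i) / eps\<^sup>2"
  have x: "0 <= x" using ts[OF that] by (simp add: x_def)
  have "s - t i = eps\<^sup>2 * x" using eps by (simp add: x_def)
  then have "(s - t i) powr be = eps powr (2*be) * x powr be"
   using eps x by (simp add: powr_mult powr_powr[symmetric])
  moreover have "x powr be <= (1 + 2/kap) * (exp (kap * r / 2) * exp (kap * a i / 2))"
  proof -
   have "x powr be <= (1 + x) powr be" using x b by (intro powr_mono2) auto
   also have "... <= (1 + x) powr 1" using x b by (intro powr_mono) auto
   also have "... <= (1 + 2/kap) * (1 + kap * x / 2)" using x kappa_pos by (simp add: field_simps)
   also have "... <= (1 + 2/kap) * exp (kap * x / 2)"
    using kappa_pos exp_ge_add_one_self[of "kap * x / 2"] by (intro mult_left_mono) auto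
   also have "... <= (1 + 2/kap) * exp (kap * r / 2 + kap * a i / 2)"
   proof -
    have "kap * x <= kap * (r + a i)" using th kappa_pos by (intro mult_left_mono) (auto simp: a_def x_def)
    then show ?thesis using kappa_pos by (intro mult_left_mono) (auto simp: distrib_left)
   qed
   finally show ?thesis by (simp add: exp_add)
  qed
  ultimately have "H * (s - t i) powr be <= H * (eps powr (2*be) * ((1 + 2/kap) * (exp (kap * r / 2) * exp (kap * a i / 2))))"
   using H by (simp add: mult_left_mono)
  then show ?thesis using W[OF ts[OF that]] by (simp add: B_def Q_def mult_ac)
 qed
 have "step_integral W (Suc k) t (%i. g0 (a i) * sig) w = (\<Sum>i<Suc k. g0 (a i) * sig * (B (Suc i) - B i))"
  by (simp add: step_integral_def B_def)
 also have "... = - (g0 (a 0) * sig * B 0) - (\<Sum>i<k. (g0 (a (Suc i)) * sig - g0 (a i) * sig) * B (Suc i))"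
 proof -
  have "t (Suc k) = s" using step_partition_upart[OF s] by (simp add: t_def step_partition_def)
  then have "B (Suc k) = 0" by (simp add: B_def)
  then show ?thesis using abel_sum[of "%i. g0 (a i) * sig" B k] by simp
 qed
 finally have eq: "step_integral W (Suc k) t (%i. g0 (a i) * sig) w
  = - (g0 (a 0) * sig * B 0) - (\<Sum>i<k. (g0 (a (Suc i)) * sig - g0 (a i) * sig) * B (Suc i))" .
 have "abs (step_integral W (Suc k) t (%i. g0 (a i) * sig) w) <= abs (g0 (a 0) * sig * B 0) + (\<Sum>i<k. \<bar>(g0 (a (Suc i)) * sig - g0 (a i) * sig) * B (Suc i)\<bar>)"
  unfolding eq by (rule order_trans[OF abs_triangle_ineq4]) (simp only: abs_minus_cancel, intro add_left_mono sum_abs)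
 also have "... <= abs sig * Q * (Cb * exp (kap * r / 2)) + (\<Sum>i<k. \<bar>sig\<bar> * Q * (g0_var (a (Suc i)) - g0_var (a i)))"
 proof (intro add_mono sum_mono)
  have "abs (g0 (a 0)) * abs (B 0) <= (Cb * exp (- kap * a 0)) * (Q * exp (kap * a 0 / 2))"
   by (rule mult_mono[OF g0_bound Bb]) (use Cb_nonneg in auto)
  also have "... = Q * (Cb * (exp (- kap * a 0) * exp (kap * a 0 / 2)))" by (simp only: mult_ac)
  also have "... = Q * (Cb * exp (- (kap * a 0 / 2)))" by (simp add: exp_add[symmetric])
  also have "... <= Q * (Cb * exp (kap * r / 2))"
   using ar[of 0] kappa_pos Q Cb_nonneg mult_left_mono[of "-r" "a 0" kap] by (intro mult_left_mono) auto
  finally have "abs sig * (abs (g0 (a 0)) * abs (B 0)) <= abs sig * (Q * (Cb * exp (kap * r / 2)))" by (rule mult_left_mono) simp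
  then show "abs (g0 (a 0) * sig * B 0) <= abs sig * Q * (Cb * exp (kap * r / 2))" by (simp add: abs_mult mult_ac)
  fix i assume "i \<in> {..<k}"
  then have i: "Suc i <= Suc k" by simp
  have "abs (g0 (a (Suc i)) - g0 (a i)) * abs (B (Suc i)) <= abs (g0 (a (Suc i)) - g0 (a i)) * (Q * exp (kap * a (Suc i) / 2))"
   using Bb[OF i] by (intro mult_left_mono) auto
  also have "... = Q * (abs (g0 (a (Suc i)) - g0 (a i)) * exp (kap * a (Suc i) / 2))" by simp
  also have "... <= Q * (g0_var (a (Suc i)) - g0_var (a i))"
   by (rule mult_left_mono[OF g0_variation[OF ar[OF i] am] Q])
  finally have "abs sig * (abs (g0 (a (Suc i)) - g0 (a i)) * abs (B (Suc i))) <= abs sig * (Q * (g0_var (a (Suc i)) - g0_var (a i)))"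
   by (rule mult_left_mono) simp
  then show "abs ((g0 (a (Suc i)) * sig - g0 (a i) * sig) * B (Suc i)) <= abs sig * Q * (g0_var (a (Suc i)) - g0_var (a i))"
   unfolding mult.commute[of _ sig] right_diff_distrib[symmetric] mult.assoc abs_mult .
 qed
 also have "... = abs sig * Q * (Cb * exp (kap * r / 2) + (g0_var (a k) - g0_var (a 0)))"
  by (simp add: sum_distrib_left[symmetric] sum_lessThan_telescope[of "%i. g0_var (a i)"] distrib_left)
 also have "... <= abs sig * Q * (Cb * exp (kap * r / 2) + (2 * Kg / kap * exp (kap * r / 2) + 2 * Cb * exp (kap * r / 2)))"
 proof (intro mult_left_mono add_left_mono)
  have "2 * Kg / kap * exp (- kap * a k / 2) <= 2 * Kg / kap * exp (kap * r / 2)"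
   using ar[of k] kappa_pos Kg_nonneg mult_left_mono[of "-r" "a k" kap] by (intro mult_left_mono) auto
  then have "g0_var (a k) <= 2 * Kg / kap * exp (kap * r / 2) + 2 * Cb * exp (kap * r / 2)"
   using Cb_nonneg unfolding g0_var_def by (intro add_mono) auto
  then show "g0_var (a k) - g0_var (a 0) <= 2 * Kg / kap * exp (kap * r / 2) + 2 * Cb * exp (kap * r / 2)"
   using g0_var_nonneg[of "a 0"] by linarith
 qed (use Q in simp)
 also have "... = Cz * abs sig * H * eps powr (2*be)" by (simp add: Cz_def Q_def mult_ac)
 finally show ?thesis by (simp add: t_def a_def)
qed

end

definition rat_rect :: "real => real => (real \<times> real) set" where
 "rat_rect T r = ({0<..<T} \<inter> \<rat>) \<times> ({-r<..<0} \<inter> \<rat>)"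

lemma closure_Ioo_Rats: "a < b ==> closure ({a<..<b} \<inter> \<rat>) = {a..b::real}"
 using closure_open_Int_superset[of "{a<..<b}" \<rat>] by (simp add: Rats_closure_real)

lemma rat_rect:
 assumes "0 < T" "0 < r"
 shows "countable (rat_rect T r)" "closure (rat_rect T r) = {0..T} \<times> {-r..0}" "\<And>p. p \<in> rat_rect T r ==> fst p \<in> {0..T} \<and> snd p \<in> {-r..0}"
 using assms by (auto simp: rat_rect_def closure_Times closure_Ioo_Rats countable_rat)

lemma Sup_Upsilon_le_iff:
 assumes T: "0 < T" and r: "0 < r" and c: "continuous_on ({0..T} \<times> {-r..0}) (%(s, th). Z s th w)"
 shows "(SUP s\<in>{0..T}. Upsilon r Z s w) <= b \<longleftrightarrow> (\<forall>p\<in>rat_rect T r. \<bar>Z (fst p) (snd p) w\<bar> <= b)"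
  "0 <= (SUP s\<in>{0..T}. Upsilon r Z s w)"
proof -
 have ca: "continuous_on (closure (rat_rect T r)) (%p. \<bar>Z (fst p) (snd p) w\<bar>)"
  using continuous_on_rabs[OF c] by (simp add: rat_rect[OF T r] split_def)
 have "compact ((%p. \<bar>Z (fst p) (snd p) w\<bar>) ` ({0..T} \<times> {-r..0}))"
  using ca by (intro compact_continuous_image compact_Times) (auto simp: rat_rect[OF T r])
 then have "\<exists>B. \<forall>p\<in>{0..T} \<times> {-r..0}. norm \<bar>Z (fst p) (snd p) w\<bar> <= B"
  using compact_imp_bounded by (force simp: bounded_iff)
 then obtain B where B: "abs (Z s th w) <= B" if "s \<in> {0..T}" "th \<in> {-r..0}" for s th by force
 have 1: "abs (Z s th w) <= Upsilon r Z s w" if "s \<in> {0..T}" "th \<in> {-r..0}" for s th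
  unfolding Upsilon_def by (rule cSUP_upper[OF that(2)], rule bdd_aboveI2, rule B[OF that(1)])
 have U: "Upsilon r Z s w <= x" if "\<And>th. th \<in> {-r..0} ==> abs (Z s th w) <= x" for s x
  unfolding Upsilon_def by (rule cSUP_least) (use that r in auto)
 have bd: "bdd_above ((%s. Upsilon r Z s w) ` {0..T})"
  by (rule bdd_aboveI2, rule U, rule B)
 have 2: "abs (Z s th w) <= (SUP s\<in>{0..T}. Upsilon r Z s w)" if "s \<in> {0..T}" "th \<in> {-r..0}" for s th
  by (rule order_trans[OF 1[OF that] cSUP_upper[OF that(1) bd]])
 show "0 <= (SUP s\<in>{0..T}. Upsilon r Z s w)" using 2[of 0 0] T r by auto
 show "(SUP s\<in>{0..T}. Upsilon r Z s w) <= b \<longleftrightarrow> (\<forall>p\<in>rat_rect T r. \<bar>Z (fst p) (snd p) w\<bar> <= b)"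
 proof
  assume "(SUP s\<in>{0..T}. Upsilon r Z s w) <= b"
  show "\<forall>p\<in>rat_rect T r. \<bar>Z (fst p) (snd p) w\<bar> <= b"
  proof
   fix p assume "p \<in> rat_rect T r"
   then have "fst p \<in> {0..T}" "snd p \<in> {-r..0}" using rat_rect(3)[OF T r] by auto
   from order_trans[OF 2[OF this]] show "abs (Z (fst p) (snd p) w) <= b"
    using \<open>(SUP s\<in>{0..T}. Upsilon r Z s w) <= b\<close> by simp
  qed
 next
  assume a: "\<forall>p\<in>rat_rect T r. \<bar>Z (fst p) (snd p) w\<bar> <= b"
  have "abs (Z s th w) <= b" if "s \<in> {0..T}" "th \<in> {-r..0}" for s th
   using continuous_le_on_closure[OF ca, of "(s, th)" b] a that by (simp add: rat_rect[OF T r])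
  then show "(SUP s\<in>{0..T}. Upsilon r Z s w) <= b"
   using T by (intro cSUP_least U) auto
 qed
qed

context delay_split begin

lemma g0_isCont: assumes "a ~= 0" shows "isCont g0 a"
proof -
 have "isCont X0 a"
 proof (cases "a < 0")
  case True
  have "continuous_on {..<0} X0" using X0_neg by (intro continuous_on_eq[OF continuous_on_const[of _ 0]]) auto
  then show ?thesis using True continuous_on_eq_continuous_at[of "{..<0}" X0] by auto
 next
  case False
  have "continuous_on {0<..} X0" using X0_cont by (rule continuous_on_subset) auto
  then show ?thesis using False assms continuous_on_eq_continuous_at[of "{0<..}" X0] by auto
 qed
 moreover have "isCont (pw gam) a" using pw_cont[of UNIV] by (simp add: continuous_on_eq_continuous_at)
 ultimately show ?thesis unfolding g0_def[abs_def] by (rule continuous_diff)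
qed

lemma convolution_bound:
 assumes wp: "wiener_process M F W" and eps: "0 < eps" and b: "0 <= be" "be <= 1"
  and s: "s \<in> {0..T}" and th: "th \<in> {-r..0}"
  and I: "has_wiener_integral M W
    (%u. That r L ((s - u) / eps\<^sup>2) (one_minus_pihat r L om (indicator {0})) th * sig) s I"
  and H: "\<And>w. 0 <= H w" "AE w in M. \<forall>s\<in>{0..T}. \<forall>t\<in>{0..T}. \<bar>W t w - W s w\<bar> <= H w * abs (t - s) powr be"
 shows "AE w in M. \<bar>I w\<bar> <= Cz * abs sig * H w * eps powr (2*be)"
proof -
 interpret wiener_process M F W by (rule wp)
 define h where "h u = g0 ((s - u) / eps\<^sup>2 + th) * sig" for u
 have hT: "That r L ((s - u) / eps\<^sup>2) (one_minus_pihat r L om (indicator {0})) th * sig = h u" if "u \<in> {0..s}" for u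
  using That_kernel[of "(s - u) / eps\<^sup>2" th] that th by (simp add: h_def)
 have s0: "0 <= s" using s by simp
 show ?thesis
 proof (rule wiener_integral_bound[OF I step_partition_upart[OF s0]])
  have "(%k. \<integral>\<^sup>+u\<in>{0..s}. ennreal ((h u - step_fun (Suc k) (upart s k) (%i. h (upart s k i)) u)\<^sup>2) \<partial>lborel) \<longlonglongrightarrow> 0"
  proof (rule left_step_converges[where S="{s + eps\<^sup>2 * th}" and B="Cb * exp (kap * r) * abs sig", OF s0])
   show "set_borel_measurable lborel {0..s} h"
    unfolding set_borel_measurable_def h_def[abs_def] by measurable
   show "abs (h u) <= Cb * exp (kap * r) * abs sig" if "u \<in> {0..s}" for u
   proof -
    have "-r <= (s - u) / eps\<^sup>2 + th" using that th by (auto intro: order_trans[of "-r" th])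
    then have "Cb * exp (- kap * ((s - u) / eps\<^sup>2 + th)) <= Cb * exp (kap * r)"
     using Cb_nonneg kappa_pos mult_left_mono[of "-r" "(s - u) / eps\<^sup>2 + th" kap] by (intro mult_left_mono) auto
    then show ?thesis using g0_bound[of "(s - u) / eps\<^sup>2 + th"] by (auto simp: h_def abs_mult intro!: mult_right_mono)
   qed
   show "continuous (at u within {0..s}) h" if "u \<in> {0..s} - {s + eps\<^sup>2 * th}" for u
   proof -
    have "(s - u) / eps\<^sup>2 + th ~= 0" using that eps by (auto simp: field_simps)
    then have "isCont (%u. g0 ((s - u) / eps\<^sup>2 + th)) u"
     by (intro isCont_o2[where f="%u. (s - u) / eps\<^sup>2 + th" and g=g0] g0_isCont) (use eps in "auto intro!: continuous_intros")
    then have "isCont h u" unfolding h_def[abs_def] by (intro continuous_intros)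
    then show ?thesis by (rule continuous_at_imp_continuous_at_within)
   qed
  qed simp
  moreover have "(\<integral>\<^sup>+u\<in>{0..s}. ennreal ((That r L ((s - u) / eps\<^sup>2) (one_minus_pihat r L om (indicator {0})) th * sig - f u)\<^sup>2) \<partial>lborel)
    = (\<integral>\<^sup>+u\<in>{0..s}. ennreal ((h u - f u)\<^sup>2) \<partial>lborel)" for f
   by (intro nn_integral_cong) (auto simp: hT indicator_def)
  ultimately show "(%k. \<integral>\<^sup>+u\<in>{0..s}. ennreal ((That r L ((s - u) / eps\<^sup>2) (one_minus_pihat r L om (indicator {0})) th * sig
    - step_fun (Suc k) (upart s k) (%i. h (upart s k i)) u)\<^sup>2) \<partial>lborel) \<longlonglongrightarrow> 0" by simp
  show "AE w in M. \<forall>k. \<bar>step_integral W (Suc k) (upart s k) (%i. h (upart s k i)) w\<bar> <= Cz * abs sig * H w * eps powr (2*be)"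
   using H(2)
  proof eventually_elim
   case (elim w)
   show ?case unfolding h_def
   proof (intro allI kernel_step_integral_bound eps b s0 H(1))
    fix u assume u: "u \<in> {0..s}"
    then show "abs (W u w - W s w) <= H w * (s - u) powr be"
     using bspec[OF bspec[OF elim s], of u] s by (simp add: abs_minus_commute)
   qed (use th in auto)
  qed
 qed
qed

lemma convolution_sup:
 assumes wp: "wiener_process M F W" and eps: "0 < eps" and k: "2 < k" and T: "0 < T"
  and Z: "stochastic_convolution M W r T L om sig eps Z"
 defines "h \<equiv> hoelder_const k T"
 shows "integrable M (%w. SUP s\<in>{0..T}. Upsilon r Z s w)"
  "(LINT w|M. (SUP s\<in>{0..T}. Upsilon r Z s w)) <= Cz * abs sig * h * (1 + h) * eps powr (1 - 2/k)"
proof -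
 interpret wiener_process M F W by (rule wp)
 obtain R where R[measurable]: "R \<in> borel_measurable M" and R0: "\<And>w. 0 <= R w"
  and R1: "(\<integral>\<^sup>+w. ennreal (R w ^ (2*k)) \<partial>M) <= ennreal h"
  and R2: "AE w in M. W 0 w = 0 \<and> continuous_on {0..T} (%t. W t w) \<and>
    (\<forall>s\<in>{0..T}. \<forall>t\<in>{0..T}. \<bar>W t w - W s w\<bar> <= h * R w * abs (t - s) powr (1/2 - 1/k))"
  using hoelder[OF k T] unfolding h_def by blast
 have h0: "0 <= h" unfolding h_def by (rule hoelder_const_ge(3)[OF k T])
 define c where "c = Cz * abs sig * h * eps powr (1 - 2/k)"
 have c0: "0 <= c" using Cz_nonneg h0 by (simp add: c_def)
 have b: "0 <= 1/2 - 1/real k" "1/2 - 1/real k <= 1" "2 * (1/2 - 1/real k) = 1 - 2/k" using k by (auto simp: field_simps)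
 have Zc: "continuous_on ({0..T} \<times> {-r..0}) (%(s, th). Z s th w)" if "w \<in> space M" for w
  using Z that by (simp add: stochastic_convolution_def)
 have Zs: "(SUP s\<in>{0..T}. Upsilon r Z s w) <= b \<longleftrightarrow> (\<forall>p\<in>rat_rect T r. \<bar>Z (fst p) (snd p) w\<bar> <= b)"
  "0 <= (SUP s\<in>{0..T}. Upsilon r Z s w)" if "w \<in> space M" for w b
  by (rule Sup_Upsilon_le_iff[OF T r_pos], rule Zc[OF that])+
 have "AE w in M. \<forall>p\<in>rat_rect T r. \<bar>Z (fst p) (snd p) w\<bar> <= c * R w"
 proof (subst AE_ball_countable[OF rat_rect(1)[OF T r_pos]], intro ballI)
  fix p assume "p \<in> rat_rect T r"
  then have p: "fst p \<in> {0..T}" "snd p \<in> {-r..0}" using rat_rect(3)[OF T r_pos] by auto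
  then have "has_wiener_integral M W (%u. That r L ((fst p - u) / eps\<^sup>2) (one_minus_pihat r L om (indicator {0})) (snd p) * sig) (fst p) (Z (fst p) (snd p))"
   using Z by (simp add: stochastic_convolution_def)
  from convolution_bound[OF wp eps b(1,2) p this, where H="%w. h * R w"] R0 R2 h0
  have "AE w in M. \<bar>Z (fst p) (snd p) w\<bar> <= Cz * abs sig * (h * R w) * eps powr (1 - 2/k)"
   unfolding b(3) by (auto elim: AE_mp)
  then show "AE w in M. \<bar>Z (fst p) (snd p) w\<bar> <= c * R w" by (simp add: c_def mult_ac)
 qed
 then have ub: "AE w in M. (SUP s\<in>{0..T}. Upsilon r Z s w) <= c * R w" by (rule AE_mp) (simp add: Zs(1))
 have [measurable]: "Z (fst p) (snd p) \<in> borel_measurable M" if "p \<in> rat_rect T r" for p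
  using Z rat_rect(3)[OF T r_pos that] by (auto simp: stochastic_convolution_def has_wiener_integral_def)
 have m[measurable]: "(%w. SUP s\<in>{0..T}. Upsilon r Z s w) \<in> borel_measurable M"
 proof (rule borel_measurableI_le)
  fix y
  have "{w \<in> space M. (SUP s\<in>{0..T}. Upsilon r Z s w) <= y} = {w \<in> space M. \<forall>p\<in>rat_rect T r. \<bar>Z (fst p) (snd p) w\<bar> <= y}"
   by (intro Collect_cong conj_cong refl Zs(1))
  also have "... \<in> sets M"
   by (rule sets.sets_Collect_countable_All'[OF _ rat_rect(1)[OF T r_pos]]) measurable
  finally show "{w \<in> space M. (SUP s\<in>{0..T}. Upsilon r Z s w) <= y} \<in> sets M" .
 qed
 have Ri: "integrable M (%w. R w ^ (2*k))"
  using R0 R1 by (intro integrableI_nonneg) (auto intro: le_less_trans)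
 have "ennreal (LINT w|M. R w ^ (2*k)) <= ennreal h"
  using R1 R0 by (subst (asm) nn_integral_eq_integral[OF Ri]) auto
 then have RE: "(LINT w|M. R w ^ (2*k)) <= h" using h0 by (simp add: ennreal_le_iff)
 have R3: "R w <= 1 + R w ^ (2*k)" for w
 proof (cases "R w <= 1")
  case True then show ?thesis using R0[of w] by (intro add_increasing2) auto
 next
  case False
  then have "R w ^ 1 <= R w ^ (2*k)" using k by (intro power_increasing) auto
  then show ?thesis by simp
 qed
 have i: "integrable M (%w. c * (1 + R w ^ (2*k)))" using Ri by simp
 have ub': "AE w in M. (SUP s\<in>{0..T}. Upsilon r Z s w) <= c * (1 + R w ^ (2*k))"
  using ub by eventually_elim (use R3 c0 in "blast intro: order_trans mult_left_mono")
 show int: "integrable M (%w. SUP s\<in>{0..T}. Upsilon r Z s w)"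
 proof (rule Bochner_Integration.integrable_bound[OF i m])
  show "AE w in M. norm (SUP s\<in>{0..T}. Upsilon r Z s w) <= norm (c * (1 + R w ^ (2*k)))"
   using ub' AE_space
  proof eventually_elim
   case (elim w)
   have "norm (SUP s\<in>{0..T}. Upsilon r Z s w) = (SUP s\<in>{0..T}. Upsilon r Z s w)" using Zs(2)[OF elim(2)] by simp
   also have "... <= norm (c * (1 + R w ^ (2*k)))" using elim(1) by (rule order_trans) simp
   finally show ?case .
  qed
 qed
 have "(LINT w|M. (SUP s\<in>{0..T}. Upsilon r Z s w)) <= (LINT w|M. c * (1 + R w ^ (2*k)))"
  by (rule integral_mono_AE[OF int i ub'])
 also have "... = c * (1 + (LINT w|M. R w ^ (2*k)))" using Ri by (simp add: prob_space)
 also have "... <= c * (1 + h)" using RE c0 by (intro mult_left_mono) auto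
 finally show "(LINT w|M. (SUP s\<in>{0..T}. Upsilon r Z s w)) <= Cz * abs sig * h * (1 + h) * eps powr (1 - 2/k)"
  by (simp add: c_def mult_ac)
qed

lemma convolution_expectation:
 assumes T: "0 < T" and \<delta>: "0 < \<delta>" "\<delta> < 2"
 shows "\<exists>e>0. \<forall>eps. 0 < eps \<and> eps < e --> exp 1 <= T / (r * eps powr \<delta>) \<and>
  (\<forall>(M :: 'a measure) F W Z. wiener_process M F W \<and> stochastic_convolution M W r T L om sig eps Z -->
    integrable M (%w. SUP s\<in>{0..T}. Upsilon r Z s w) \<and>
    (LINT w|M. (SUP s\<in>{0..T}. Upsilon r Z s w)) <= sqrt (r * eps powr \<delta> * ln (2 * T / (r * eps powr \<delta>))))"
proof -
 obtain k0 :: nat where k0: "2 / (1 - \<delta>/2) < real k0" using reals_Archimedean2 by blast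
 define k where "k = max k0 3"
 have k: "2 < k" "2 / (1 - \<delta>/2) < real k" using k0 by (auto simp: k_def)
 define eta where "eta = 1 - 2 / real k - \<delta>/2"
 have eta: "0 < eta" using k \<delta> by (simp add: eta_def field_simps)
 define h where "h = hoelder_const k T"
 define D where "D = Cz * abs sig * h * (1 + h)"
 have "((%eps::real. D * eps powr eta) \<longlongrightarrow> D * 0) (at_right 0)" using eta
  by (intro tendsto_mult tendsto_const tendsto_powr'[of _ 0, simplified]) (auto simp: eventually_at_filter)
 then have e1: "\<forall>\<^sub>F eps in at_right 0. D * eps powr eta < sqrt r" by (rule order_tendstoD) (simp add: r_pos)
 have "((%eps::real. exp 1 * r * eps powr \<delta>) \<longlongrightarrow> exp 1 * r * 0) (at_right 0)" using \<delta>
  by (intro tendsto_mult tendsto_const tendsto_powr'[of _ 0, simplified]) (auto simp: eventually_at_filter)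
 then have e2: "\<forall>\<^sub>F eps in at_right 0. exp 1 * r * eps powr \<delta> < T" by (rule order_tendstoD) (simp add: T)
 from eventually_conj[OF e1 e2] obtain e where e: "0 < e"
  "\<And>eps. 0 < eps ==> eps < e ==> D * eps powr eta < sqrt r \<and> exp 1 * r * eps powr \<delta> < T"
  unfolding eventually_at_right[OF zero_less_one] by blast
 have "exp 1 <= T / (r * eps powr \<delta>) \<and>
  (\<forall>(M :: 'a measure) F W Z. wiener_process M F W \<and> stochastic_convolution M W r T L om sig eps Z -->
    integrable M (%w. SUP s\<in>{0..T}. Upsilon r Z s w) \<and>
    (LINT w|M. (SUP s\<in>{0..T}. Upsilon r Z s w)) <= sqrt (r * eps powr \<delta> * ln (2 * T / (r * eps powr \<delta>))))"
  if eps: "0 < eps" "eps < e" for eps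
 proof (intro conjI allI impI)
  have p: "0 < r * eps powr \<delta>" using r_pos eps by simp
  show 1: "exp 1 <= T / (r * eps powr \<delta>)" using e(2)[OF eps] p by (simp add: pos_le_divide_eq mult_ac)
  fix M :: "'a measure" and F W Z
  assume a: "wiener_process M F W \<and> stochastic_convolution M W r T L om sig eps Z"
  show "integrable M (%w. SUP s\<in>{0..T}. Upsilon r Z s w)"
   using convolution_sup(1)[OF _ eps(1) k(1) T] a by blast
  have "(LINT w|M. (SUP s\<in>{0..T}. Upsilon r Z s w)) <= D * eps powr (1 - 2/k)"
   using convolution_sup(2)[OF _ eps(1) k(1) T] a unfolding D_def h_def by blast
  also have "... = D * eps powr eta * eps powr (\<delta>/2)" by (simp add: powr_add[symmetric] eta_def)
  also have "... <= sqrt r * eps powr (\<delta>/2)" using e(2)[OF eps] by (intro mult_right_mono) auto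
  also have "... = sqrt (r * eps powr \<delta>)"
   using eps by (simp add: real_sqrt_mult powr_half_sqrt[symmetric] powr_powr)
  also have "... <= sqrt (r * eps powr \<delta> * ln (2 * T / (r * eps powr \<delta>)))"
  proof (rule real_sqrt_le_mono)
   have 0: "0 < T / (r * eps powr \<delta>)" using p T by simp
   have "1 <= ln (T / (r * eps powr \<delta>))" using 1 0 by (simp add: ln_ge_iff)
   also have "... <= ln (2 * T / (r * eps powr \<delta>))" using 0 p T by (intro ln_mono) (auto intro!: divide_right_mono)
   finally show "r * eps powr \<delta> <= r * eps powr \<delta> * ln (2 * T / (r * eps powr \<delta>))"
    using p mult_left_mono[of 1 "ln (2 * T / (r * eps powr \<delta>))" "r * eps powr \<delta>"] by simp
  qed
  finally show "(LINT w|M. (SUP s\<in>{0..T}. Upsilon r Z s w)) <= sqrt (r * eps powr \<delta> * ln (2 * T / (r * eps powr \<delta>)))" .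
 qed
 with e(1) show ?thesis by blast
qed

end

lemma (in delay) forced_restart:
 assumes phi: "phi \<in> Chat_space r" and F: "forced T phi f x" and a: "0 <= a" "0 <= s" "a + s <= T"
 shows "forced s (seg x a) (%u. f (a + u) - f a) (seg x a)"
 unfolding forced_def
proof (intro conjI ballI refl)
 note F' = F[unfolded forced_def]
 show "continuous_on {0..s} (seg x a)"
  by (rule continuous_on_compose2[of "{0..T}" x]) (use F' a in "auto intro!: continuous_intros")
 fix u assume u: "u \<in> {0..s}"
 let ?l = "%s. Lf r m (seg x s)"
 have e: "x (a + u) = phi 0 + f (a + u) + integral {0..a + u} ?l" "x a = phi 0 + f a + integral {0..a} ?l"
  using F' a u by auto
 have i: "?l integrable_on {0..a + u}"
  by (rule Lf_segment_integrable[OF phi, of _ T]) (use F' a u in auto)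
 have "integral {0..a} ?l + integral {a..a + u} ?l = integral {0..a + u} ?l"
  by (rule Henstock_Kurzweil_Integration.integral_combine[OF _ _ i]) (use a u in auto)
 moreover have "integral {0..u} (%s. ?l (a + s)) = integral {a..a + u} ?l"
  using integral_shift_Icc_real[of 0 u ?l a] by (simp add: o_def add.commute)
 ultimately show "x (a + u) = x (a + 0) + (f (a + u) - f a) + integral {0..u} (%s. Lf r m (%th. x (a + (s + th))))"
  using e by (simp add: add.assoc)
qed

context delay_split begin

lemma zero_Chat: "(%_. 0) \<in> Chat_space r"
 using r_pos by (simp add: Chat_space_def image_constant_conv)

lemma zeta_cong:
 assumes "\<And>th. th \<in> {-r..0} ==> phi th = psi th" shows "zeta phi = zeta psi"
proof -
 have "hist phi = hist psi" using assms by (auto simp: hist_def fun_eq_iff indicator_def)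
 then show ?thesis using assms[of 0] r_pos by (simp add: zeta_def kick_def)
qed

lemma zeta_kick_bound:
 assumes phi: "phi \<in> Chat_space r" and B: "\<And>th. th \<in> {-r..0} ==> abs (phi th) <= B" and s: "0 <= s"
  and z: "\<And>th. th \<in> {-r..0} ==> th < - s ==> phi th = 0"
 shows "cmod (zeta phi - gam * of_real (phi 0)) <= cmod gam * (K * s * B)"
proof -
 interpret lm: pair_sigma_finite lborel m ..
 have B0: "0 <= B" using order_trans[OF abs_ge_zero B[of 0]] r_pos by simp
 have hb: "abs (hist phi t) <= B" for t by (rule hist_bound) (rule B)
 note [measurable] = hist_measurable[OF phi] kick_measurable[OF phi]
 have [measurable]: "fold_loc r \<in> borel_measurable borel" by (simp add: fold_loc_def[abs_def])
 let ?k = "%t. of_real (kick phi t) * exp (- \<i> * of_real (om * t)) :: complex"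
 have n: "norm (?k t) = abs (kick phi t)" for t
  by (simp add: norm_mult flip: of_real_mult)
 have k1: "ennreal (norm (?k t)) <= (\<integral>\<^sup>+u. ennreal \<bar>hist phi (t + fold_loc r u)\<bar> \<partial>m)" for t
 proof -
  have i: "integrable m (%u. fold_sgn u *\<^sub>R hist phi (t + fold_loc r u))"
   by (rule integrable_Lf_shift[where B=B]) (auto intro: hb)
  have "ennreal (norm (?k t)) <= ennreal (norm (LINT u|m. fold_sgn u *\<^sub>R hist phi (t + fold_loc r u)))"
   unfolding n by (rule ennreal_leI) (auto simp: kick_def Lf_def indicator_def)
  also have "... <= (\<integral>\<^sup>+u. ennreal (norm (fold_sgn u *\<^sub>R hist phi (t + fold_loc r u))) \<partial>m)"
   by (rule integral_norm_bound_ennreal[OF i])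
  also have "... <= (\<integral>\<^sup>+u. ennreal \<bar>hist phi (t + fold_loc r u)\<bar> \<partial>m)"
   by (intro nn_integral_mono ennreal_leI) (auto simp: abs_mult intro!: mult_left_le_one_le fold_sgn_bound)
  finally show ?thesis .
 qed
 have h1: "(\<integral>\<^sup>+t. ennreal \<bar>hist phi (t + c)\<bar> \<partial>lborel) <= ennreal (B * s)" for c
 proof -
  have "(\<integral>\<^sup>+t. ennreal \<bar>hist phi (t + c)\<bar> \<partial>lborel) = (\<integral>\<^sup>+t. ennreal \<bar>hist phi t\<bar> \<partial>lborel)"
   using nn_integral_real_affine[of "%t. ennreal \<bar>hist phi t\<bar>" 1 c] by (simp add: add.commute)
  also have "... <= (\<integral>\<^sup>+t. ennreal B * indicator {-s..0} t \<partial>lborel)"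
  proof (intro nn_integral_mono)
   fix t
   show "ennreal \<bar>hist phi t\<bar> <= ennreal B * indicator {-s..0} t"
    using hb[of t] z[of t] by (cases "-s <= t \<and> t <= 0") (auto simp: hist_def indicator_def intro: ennreal_leI)
  qed
  also have "... = ennreal (B * s)" using s B0 by (simp add: nn_integral_cmult_indicator ennreal_mult)
  finally show ?thesis .
 qed
 have "ennreal (norm (LINT t|lborel. ?k t)) <= (\<integral>\<^sup>+t. ennreal (norm (?k t)) \<partial>lborel)"
 proof (cases "integrable lborel ?k")
  case True then show ?thesis by (rule integral_norm_bound_ennreal)
 qed (simp add: not_integrable_integral_eq)
 also have "... <= (\<integral>\<^sup>+t. \<integral>\<^sup>+u. ennreal \<bar>hist phi (t + fold_loc r u)\<bar> \<partial>m \<partial>lborel)"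
  by (intro nn_integral_mono k1)
 also have "... = (\<integral>\<^sup>+u. \<integral>\<^sup>+t. ennreal \<bar>hist phi (t + fold_loc r u)\<bar> \<partial>lborel \<partial>m)"
  by (rule lm.Fubini'[symmetric]) measurable
 also have "... <= (\<integral>\<^sup>+u. ennreal (B * s) \<partial>m)" by (intro nn_integral_mono h1)
 also have "... = ennreal (B * s * K)" using B0 s by (simp add: K_def m.emeasure_eq_measure ennreal_mult)
 finally have "norm (LINT t|lborel. ?k t) <= B * s * K" using B0 s K_nonneg by (simp add: ennreal_le_iff)
 moreover have "zeta phi - gam * of_real (phi 0) = gam * (LINT t|lborel. ?k t)" by (simp add: zeta_def algebra_simps)
 ultimately have "cmod (zeta phi - gam * of_real (phi 0)) <= cmod gam * (B * s * K)"
  by (simp only: norm_mult) (rule mult_left_mono, simp_all)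
 then show ?thesis by (simp add: mult_ac)
qed

definition cz :: real where "cz = cmod gam * (1 + r * K)"

lemma cz_nonneg: "0 <= cz" using r_pos K_nonneg by (simp add: cz_def)

lemma window:
 assumes phi: "phi \<in> Chat_space r" and F: "forced T phi f x" and a: "0 <= a" "0 <= s" "a + s <= T"
  and osc: "\<And>u. 0 <= u ==> u <= s ==> abs (f (a + u) - f a) <= c"
 shows "-r <= th ==> th <= 0 ==> abs (qpart (seg x (a + s)) th)
   <= abs (sol (qpart (seg x a)) (s + th)) + (1 + cz) * (c * exp (K * s))"
  "cmod (zeta (seg x (a + s)) - exp (\<i> * of_real (om * s)) * zeta (seg x a)
    - gam * of_real (f (a + s) - f a)) <= 2 * cmod gam * K * s * (c * exp (K * s))"
proof -
 let ?xa = "%th. x (a + th)"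
 define V where "V u = x (a + u) - 1 * sol ?xa u" for u
 have xa: "?xa \<in> Chat_space r"
  by (rule segment_Chat[OF phi, of _ T]) (use F a in "auto simp: forced_def")
 note z0 = zero_Chat
 have FV: "forced s (%th. x (a + th) - 1 * x (a + th)) (%u. f (a + u) - f a - 1 * 0) V"
  unfolding V_def by (rule forced_combine[OF xa xa forced_restart[OF phi F a] sol_forced[OF xa a(2)]])
 have c0: "0 <= c" using osc[of 0] a by simp
 have Vb: "abs (V u) <= c * exp (K * s)" if "-r <= u" "u <= s" for u
 proof -
  have "abs (V u) <= (c + 0) * exp (K * max 0 u)"
   by (rule forced_bound[OF FV]) (use osc that a in auto)
  also have "... <= c * exp (K * s)"
   using c0 K_nonneg that a by (auto intro!: mult_left_mono)
  finally show ?thesis .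
 qed
 have Vs: "(seg V s) \<in> Chat_space r"
  by (rule segment_Chat[OF z0, of _ s]) (use FV a in "auto simp: forced_def")
 have Vb': "abs (V (s + th)) <= c * exp (K * s)" if "th \<in> {-r..0}" for th
  using Vb[of "s + th"] that a by auto
 have split: "x (a + s + th) = sol ?xa (s + th) - of_real (-1) * V (s + th)" for th
  by (simp add: V_def add.assoc)
 have zs: "zeta (seg x (a + s)) = exp (\<i> * of_real (om * s)) * zeta ?xa + zeta (seg V s)"
  unfolding split zeta_combine[OF sol_segment_Chat[OF xa a(2)] Vs] zeta_shift(1)[OF xa a(2)] by simp
 show "abs (qpart (seg x (a + s)) th)
   <= abs (sol (qpart ?xa) (s + th)) + (1 + cz) * (c * exp (K * s))" if th: "-r <= th" "th <= 0"
 proof -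
  have "qpart (seg x (a + s)) th = (sol ?xa (s + th) - pw (exp (\<i> * of_real (om * s)) * zeta ?xa) th)
    + (V (s + th) - pw (zeta (seg V s)) th)"
   unfolding qpart_def zs by (simp add: split pw_def distrib_right)
  also have "sol ?xa (s + th) - pw (exp (\<i> * of_real (om * s)) * zeta ?xa) th = sol (qpart ?xa) (s + th)"
   using sol_qpart[OF xa, of "s + th"] th a by (simp add: pw_shift)
  finally have "abs (qpart (seg x (a + s)) th) <= abs (sol (qpart ?xa) (s + th))
    + (abs (V (s + th)) + abs (pw (zeta (seg V s)) th))" by linarith
  moreover have "abs (pw (zeta (seg V s)) th) <= cz * (c * exp (K * s))"
   unfolding cz_def by (rule order_trans[OF pw_bound zeta_bound[OF Vs Vb']])
  ultimately show ?thesis using Vb'[of th] th by (simp add: distrib_right)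
 qed
 have "cmod (zeta (seg V s) - gam * of_real (V (s + 0))) <= cmod gam * (K * s * (c * exp (K * s)))"
 proof (rule zeta_kick_bound[OF Vs Vb' a(2)])
  show "V (s + th) = 0" if "th \<in> {-r..0}" "th < - s" for th
   using FV that a unfolding forced_def by auto
 qed
 moreover have "cmod (gam * of_real (V s) - gam * of_real (f (a + s) - f a)) <= cmod gam * (K * s * (c * exp (K * s)))"
 proof -
  have i: "(%u. Lf r m (seg V u)) integrable_on {0..s}"
   by (rule Lf_segment_integrable[OF z0, of _ s]) (use FV a in "auto simp: forced_def")
  have "norm (integral {0..s} (%u. Lf r m (seg V u))) <= K * (c * exp (K * s)) * measure lborel {0..s}"
   by (rule has_integral_bound_real[OF _ finite.emptyI integrable_integral[OF i]])
    (use K_nonneg c0 in "auto intro!: Lf_bound[where 'b=real, unfolded real_norm_def] Vb")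
  then have "abs (V s - (f (a + s) - f a)) <= K * s * (c * exp (K * s))"
   using FV a by (simp add: forced_def mult_ac)
  then show ?thesis by (simp add: norm_mult mult_left_mono flip: right_diff_distrib of_real_diff)
 qed
 ultimately have "cmod ((zeta (seg V s) - gam * of_real (V s)) + (gam * of_real (V s) - gam * of_real (f (a + s) - f a)))
   <= cmod gam * (K * s * (c * exp (K * s))) + cmod gam * (K * s * (c * exp (K * s)))"
  by (intro order_trans[OF norm_triangle_ineq] add_mono) auto
 then show "cmod (zeta (seg x (a + s)) - exp (\<i> * of_real (om * s)) * zeta ?xa
    - gam * of_real (f (a + s) - f a)) <= 2 * cmod gam * K * s * (c * exp (K * s))"
  unfolding zs by (simp add: mult_ac)
qed

lemma qpart_forced_bound:
 assumes F: "forced T (%_. 0) f U" and N: "r <= N" "M0 * exp (- kap * (N - r)) <= 1/2"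
  and osc: "\<And>a b. 0 <= a ==> a <= b ==> b <= T ==> b - a <= N ==> abs (f b - f a) <= c"
  and tau: "0 <= tau" "tau <= T" and th: "th \<in> {-r..0}"
 shows "abs (qpart (seg U tau) th) <= 2 * ((1 + cz) * (c * exp (K * N)))"
proof -
 define D where "D = (1 + cz) * (c * exp (K * N))"
 note z0 = zero_Chat
 have c0: "0 <= c" using osc[of 0 0] tau N r_pos by simp
 have D: "(1 + cz) * (c * exp (K * s)) <= D" if "s <= N" for s
  unfolding D_def using cz_nonneg c0 K_nonneg that by (intro mult_left_mono) (auto intro: mult_left_mono)
 have D0: "0 <= D" using cz_nonneg c0 by (simp add: D_def)
 have Ua: "(seg U a) \<in> Chat_space r" if "0 <= a" "a <= T" for a
  by (rule segment_Chat[OF z0, of _ T]) (use F that in "auto simp: forced_def")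
 have decay: "abs (sol (qpart (seg U a)) t) <= M0 * B * exp (- kap * t)"
  if "0 <= a" "a <= T" "0 <= t" "\<And>th. th \<in> {-r..0} ==> abs (qpart (seg U a) th) <= B" for a t B
  using sol_decay[OF qpart_Chat[OF Ua[OF that(1,2)]] that(4,3)] zeta_qpart[OF Ua[OF that(1,2)]] by (simp add: pw_def)
 have base: "abs (qpart (seg U tau) th) <= D" if t: "0 <= tau" "tau <= T" "tau <= N" and th: "th \<in> {-r..0}" for tau th
 proof -
  have q0: "qpart (seg U 0) th = 0" if "th \<in> {-r..0}" for th
  proof -
   have "zeta (seg U 0) = zeta (pw 0)" by (rule zeta_cong) (use F in "auto simp: forced_def pw_def")
   then show ?thesis using F that by (simp add: qpart_def forced_def zeta_pw) (simp add: pw_def)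
  qed
  have "sol (qpart (seg U 0)) (tau + th) = 0"
  proof (cases "0 <= tau + th")
   case True
   then show ?thesis using decay[of 0 "tau + th" 0] q0 t by auto
  next
   case False
   then show ?thesis using sol_hist[of "tau + th"] q0[of "tau + th"] t th by auto
  qed
  moreover have "abs (qpart (seg U (0 + tau)) th) <= abs (sol (qpart (seg U 0)) (tau + th)) + (1 + cz) * (c * exp (K * tau))"
   by (rule window(1)[OF z0 F]) (use t th osc in auto)
  ultimately show ?thesis using D[OF t(3)] by simp
 qed
 have "\<forall>tau th. 0 <= tau \<and> tau <= T \<and> tau <= N * real (Suc n) \<and> th \<in> {-r..0} --> abs (qpart (seg U tau) th) <= 2 * D" for n
 proof (induct n)
  case 0
  show ?case
  proof (intro allI impI)
   fix tau th assume "0 <= tau \<and> tau <= T \<and> tau <= N * real (Suc 0) \<and> th \<in> {-r..0}"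
   then show "abs (qpart (seg U tau) th) <= 2 * D" using base[of tau th] D0 by auto
  qed
 next
  case (Suc n)
  show ?case
  proof (intro allI impI)
   fix tau th assume t: "0 <= tau \<and> tau <= T \<and> tau <= N * real (Suc (Suc n)) \<and> th \<in> {-r..0}"
   show "abs (qpart (seg U tau) th) <= 2 * D"
   proof (cases "tau <= N")
    case True
    then show ?thesis using base[of tau th] D0 t by auto
   next
    case False
    define a where "a = tau - N"
    have a: "0 <= a" "a + N <= T" "a <= T" "a <= N * real (Suc n)" using False t N r_pos by (auto simp: a_def algebra_simps)
    have q: "abs (qpart (seg U a) th) <= 2 * D" if "th \<in> {-r..0}" for th using Suc a that by auto
    have "abs (sol (qpart (seg U a)) (N + th)) <= M0 * (2 * D) * exp (- kap * (N + th))"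
     by (rule decay[OF a(1,3) _ q]) (use t N in auto)
    also have "... <= M0 * (2 * D) * exp (- kap * (N - r))"
     using M0_nonneg D0 kappa_pos t by (intro mult_left_mono) auto
    also have "... <= D" using mult_right_mono[OF N(2), of "2 * D"] D0 by (simp add: mult_ac)
    finally have 1: "abs (sol (qpart (seg U a)) (N + th)) <= D" .
    have "abs (qpart (seg U (a + N)) th) <= abs (sol (qpart (seg U a)) (N + th)) + (1 + cz) * (c * exp (K * N))"
     by (rule window(1)[OF z0 F]) (use t a N r_pos osc in auto)
    then show ?thesis using 1 by (simp add: a_def D_def)
   qed
  qed
 qed
 moreover obtain n where "tau < real n * N" using reals_Archimedean3[of N] N r_pos by auto
 then have "tau <= N * real (Suc n)" using N r_pos by (simp add: algebra_simps)
 ultimately show ?thesis using tau th unfolding D_def by blast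
qed

end

lemma gronwall:
 fixes u :: "real => real"
 assumes u: "continuous_on {0..b} u" and le: "\<And>t. t \<in> {0..b} ==> u t <= A + c * integral {0..t} u"
  and c: "0 <= c" and b: "0 <= b"
 shows "u b <= A * exp (c * b)"
proof -
 define I where "I t = A + c * integral {0..t} u" for t
 define D where "D t = c * u t * exp (- c * t) - c * exp (- c * t) * I t" for t
 have d: "((%t. I t * exp (- c * t)) has_real_derivative D t) (at t within {0..b})" if "t \<in> {0..b}" for t
  unfolding I_def D_def using integral_has_real_derivative[OF u that] by (auto intro!: derivative_eq_intros)
 have "I b * exp (- c * b) <= I 0 * exp (- c * 0)"
 proof (rule DERIV_nonpos_imp_decreasing_open[OF b])
  show "continuous_on {0..b} (%t. I t * exp (- c * t))"
   unfolding continuous_on_eq_continuous_within by (intro ballI DERIV_continuous[OF d])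
  fix t assume t: "0 < t" "t < b"
  have "c * exp (- c * t) * u t <= c * exp (- c * t) * I t"
   by (rule mult_left_mono) (use le[of t] t c in "auto simp: I_def")
  then show "\<exists>y. ((%t. I t * exp (- c * t)) has_real_derivative y) (at t) \<and> y <= 0"
   using d[of t] t by (intro exI[of _ "D t"]) (auto simp: D_def at_within_Icc_at mult_ac)
 qed
 then have "I b <= A * exp (c * b)" by (simp add: I_def exp_minus field_simps)
 then show ?thesis using le[of b] b by (simp add: I_def)
qed

lemma bootstrap:
 fixes f :: "real => real"
 assumes f: "continuous_on {0..b} f"
  and step: "\<And>t. t \<in> {0..b} ==> (\<And>s. s \<in> {0..<t} ==> f s <= 1) ==> f t <= 1 ==> f t <= 1/2"
  and f0: "f 0 <= 1" and t: "t \<in> {0..b}"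
 shows "f t <= 1"
proof (rule ccontr)
 assume ft: "\<not> f t <= 1"
 define S where "S = {0..b} \<inter> f -` {1..}"
 have S: "closed S" "t \<in> S" "bdd_below S"
  using continuous_closed_preimage[OF f, of "{1..}"] ft t by (auto simp: S_def bdd_below_def)
 define t1 where "t1 = Inf S"
 have t1: "t1 \<in> S" unfolding t1_def using S by (intro closed_contains_Inf) auto
 have less: "f s <= 1" if "s \<in> {0..<t1}" for s
 proof (rule ccontr)
  assume "\<not> f s <= 1"
  then have "s \<in> S" using that t1 by (auto simp: S_def)
  then show False using cInf_lower[OF _ S(3), of s] that by (simp add: t1_def)
 qed
 have "\<exists>u\<ge>0. u <= t1 \<and> f u = 1"
  by (rule IVT') (use t1 f0 in "auto simp: S_def intro: continuous_on_subset[OF f]")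
 then obtain u where u: "0 <= u" "u <= t1" "f u = 1" by blast
 then have "u \<in> S" using t1 by (auto simp: S_def)
 then have "u = t1" using cInf_lower[OF _ S(3), of u] u by (simp add: t1_def)
 then show False using step[OF _ less, of t1] u t1 by (auto simp: S_def)
qed

context delay_split begin

lemma exp_tB_cvec: "exp_tB om t *v cvec z = cvec (exp (\<i> * of_real (om * t)) * z)"
proof -
 define c where "c = \<i> * complex_of_real (om * t)"
 define A where "A = t *\<^sub>R Bmat om"
 define An where "An n = ((%M. A ** M) ^^ n) (mat 1)" for n
 define e :: "2 => complex" where "e j = (if j = 1 then 1 else - \<i>)" for j
 define E :: "real^2^2" where "E = (\<chi> i j. cvec (exp c * e j) $ i)"
 have Az: "A *v cvec z = cvec (c * z)" for z
  by (simp add: vec_eq_iff forall_2 matrix_vector_mult_def sum_2 A_def Bmat_def c_def)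
 have Anz: "An n *v cvec z = cvec (c ^ n * z)" for n z
 proof (induct n)
  case (Suc n)
  have "An (Suc n) *v cvec z = A *v (An n *v cvec z)" by (simp add: An_def matrix_vector_mul_assoc)
  then show ?case using Suc Az by (simp add: mult_ac)
 qed (simp add: An_def)
 have ax: "axis j 1 = cvec (e j)" for j :: 2
  using exhaust_2[of j] by (auto simp: vec_eq_iff forall_2 axis_def e_def)
 have comp: "An n $ i $ j = cvec (c ^ n * e j) $ i" for n i j
  using Anz[of n "e j"] unfolding ax[symmetric] matrix_vector_mult_basis by (simp add: column_def vec_eq_iff)
 have "(%n. (1 / fact n) *\<^sub>R An n) sums E"
  unfolding sums_def
 proof (intro vec_tendstoI)
  fix i j :: 2
  have "(%n. (c ^ n /\<^sub>R fact n) * e j) sums (exp c * e j)" by (rule sums_mult2[OF exp_converges])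
  from sums_Re[OF this] sums_minus[OF sums_Im[OF this]]
  have "(%n. (1 / fact n) * cvec (c ^ n * e j) $ i) sums (cvec (exp c * e j) $ i)"
   using exhaust_2[of i] by (auto simp: divide_inverse algebra_simps)
  then show "(%n. (\<Sum>n<n. (1 / fact n) *\<^sub>R An n) $ i $ j) \<longlonglongrightarrow> E $ i $ j"
   by (simp add: sums_def E_def comp)
 qed
 then have "exp_tB om t = E" unfolding exp_tB_def mat_exp_def A_def[symmetric] An_def[symmetric] by (rule sums_unique[symmetric])
 then show ?thesis
  by (simp add: vec_eq_iff forall_2 matrix_vector_mult_def sum_2 E_def e_def c_def)
qed

lemma norm_cvec: "norm (cvec z) = cmod z"
 by (simp add: norm_vec_def L2_set_def sum_2 cmod_def)

lemma cvec_linear: "cvec (a + b) = cvec a + cvec b" "cvec (a - b) = cvec a - cvec b"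
  "cvec (of_real t * a) = t *\<^sub>R cvec a" "cvec (t *\<^sub>R a) = t *\<^sub>R cvec a"
 by (auto simp: vec_eq_iff forall_2)

lemma bounded_linear_cvec: "bounded_linear cvec"
 by (rule bounded_linear_intro[where K=1]) (simp_all add: cvec_linear norm_cvec)

lemma segment_functional_continuous:
 fixes \<Psi> :: "real => 'b::metric_space"
 assumes Y: "continuous_on {-r..T} Y" and c: "0 <= c"
  and lip: "\<And>s t e. s \<in> {0..T} ==> t \<in> {0..T} ==> (\<And>th. th \<in> {-r..0} ==> abs (Y (s + th) - Y (t + th)) <= e) ==> dist (\<Psi> s) (\<Psi> t) <= c * e"
 shows "continuous_on {0..T} \<Psi>"
 unfolding continuous_on_iff
proof (intro ballI allI impI)
 fix t eta :: real assume t: "t \<in> {0..T}" and eta: "0 < eta"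
 have "uniformly_continuous_on {-r..T} Y" by (rule compact_uniformly_continuous[OF Y]) simp
 moreover have "0 < eta / (c + 1)" using c eta by simp
 ultimately obtain d where d: "0 < d" "\<And>u v. u \<in> {-r..T} ==> v \<in> {-r..T} ==> dist v u < d ==> dist (Y v) (Y u) < eta / (c + 1)"
  unfolding uniformly_continuous_on_def by metis
 have "dist (\<Psi> s) (\<Psi> t) < eta" if s: "s \<in> {0..T}" "dist s t < d" for s
 proof -
  have "dist (\<Psi> s) (\<Psi> t) <= c * (eta / (c + 1))"
  proof (rule lip[OF s(1) t])
   fix th assume "th \<in> {-r..0}"
   then show "abs (Y (s + th) - Y (t + th)) <= eta / (c + 1)"
    using d(2)[of "t + th" "s + th"] s t by (auto simp: dist_real_def less_imp_le)
  qed
  also have "... < eta" using c eta by (simp add: field_simps)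
  finally show ?thesis .
 qed
 with d(1) show "\<exists>d>0. \<forall>s\<in>{0..T}. dist s t < d --> dist (\<Psi> s) (\<Psi> t) < eta" by blast
qed

lemma zeta_diff_bound:
 assumes "phi \<in> Chat_space r" "psi \<in> Chat_space r" "\<And>th. th \<in> {-r..0} ==> abs (phi th - psi th) <= e"
 shows "cmod (zeta phi - zeta psi) <= cz * e"
 using zeta_bound[OF Chat_combine[OF assms(1,2), of 1], of e] zeta_combine[OF assms(1,2), of 1] assms(3)
 by (simp add: cz_def)

lemma zeta_segment_continuous:
 assumes Y: "continuous_on {-r..T} Y" shows "continuous_on {0..T} (%t. zeta (seg Y t))"
proof (rule segment_functional_continuous[OF Y cz_nonneg])
 have C: "(seg Y t) \<in> Chat_space r" if "t \<in> {0..T}" for t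
  using Cspace_sub_Chat that unfolding Cspace_def
  by (auto intro!: subsetD[OF Cspace_sub_Chat] continuous_on_compose2[OF Y] continuous_intros simp: Cspace_def)
 fix s t e assume "s \<in> {0..T}" "t \<in> {0..T}" "\<And>th. th \<in> {-r..0} ==> abs (Y (s + th) - Y (t + th)) <= e"
 then show "dist (zeta (seg Y s)) (zeta (seg Y t)) <= cz * e"
  unfolding dist_norm by (intro zeta_diff_bound C)
qed

lemma qpart_sup_continuous:
 assumes Y: "continuous_on {-r..T} Y" shows "continuous_on {0..T} (%t. sup_norm r (qpart (seg Y t)))"
proof (rule segment_functional_continuous[OF Y, of "1 + cz"])
 show "0 <= 1 + cz" using cz_nonneg by simp
 have C: "(seg Y t) \<in> Chat_space r" if "t \<in> {0..T}" for t
  using that by (auto intro!: subsetD[OF Cspace_sub_Chat] continuous_on_compose2[OF Y] continuous_intros simp: Cspace_def)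
 have b: "bounded (qpart (seg Y t) ` {-r..0})" if "t \<in> {0..T}" for t
  using qpart_Chat[OF C[OF that]] by (simp add: Chat_space_def)
 have half: "sup_norm r (qpart (seg Y s)) <= sup_norm r (qpart (seg Y t)) + (1 + cz) * e"
  if st: "s \<in> {0..T}" "t \<in> {0..T}" and e: "\<And>th. th \<in> {-r..0} ==> abs (Y (s + th) - Y (t + th)) <= e" for s t e
 proof (rule sup_norm_le[OF r_pos])
  fix th assume th: "th \<in> {-r..0}"
  have "abs (pw (zeta (seg Y s)) th - pw (zeta (seg Y t)) th) <= cz * e"
   using order_trans[OF pw_bound zeta_diff_bound[OF C[OF st(1)] C[OF st(2)] e]] by (simp add: pw_def left_diff_distrib)
  then show "abs (qpart (seg Y s) th) <= sup_norm r (qpart (seg Y t)) + (1 + cz) * e"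
   using abs_le_sup_norm[OF b[OF st(2)] th] e[OF th] unfolding qpart_def distrib_right by linarith
 qed
 fix s t e assume st: "s \<in> {0..T}" "t \<in> {0..T}" and e: "\<And>th. th \<in> {-r..0} ==> abs (Y (s + th) - Y (t + th)) <= e"
 have e': "\<And>th. th \<in> {-r..0} ==> abs (Y (t + th) - Y (s + th)) <= e" using e by (simp add: abs_minus_commute)
 show "dist (sup_norm r (qpart (seg Y s))) (sup_norm r (qpart (seg Y t))) <= (1 + cz) * e"
  using half[OF st e] half[OF st(2,1) e'] unfolding dist_real_def by linarith
qed

end

lemma iexp_lipschitz: "cmod (iexp x - iexp y) <= abs (x - y)"
proof -
 have "iexp x - iexp y = iexp y * (iexp (x - y) - 1)" by (simp add: right_diff_distrib exp_add[symmetric])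
 then show ?thesis using iexp_approx1[of "x - y" 0] by (simp add: norm_mult)
qed

locale slow_path = delay_split +
 fixes \<nu>1 \<nu>3 \<xi> x wp :: "real => real" and eps T sig V :: real
 assumes eps: "0 < eps" and T: "0 < T" and xi: "\<xi> \<in> Cspace r" and V: "0 <= V"
  and Gfun_0: "Gfun r \<nu>1 \<nu>3 (%_. 0) = 0"
  and Gfun_lip: "\<And>eta \<zeta> M e. eta \<in> Cspace r ==> \<zeta> \<in> Cspace r ==>
   (\<And>th. th \<in> {-r..0} ==> abs (eta th) <= M \<and> abs (\<zeta> th) <= M \<and> abs (eta th - \<zeta> th) <= e) ==>
   \<bar>Gfun r \<nu>1 \<nu>3 eta - Gfun r \<nu>1 \<nu>3 \<zeta>\<bar> <= V * (1 + M\<^sup>2) * e"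
  and x_cont: "continuous_on {-(eps\<^sup>2 * r)..T} x"
  and x_init: "\<And>t. t \<in> {-(eps\<^sup>2 * r)..0} ==> x t = \<xi> (t / eps\<^sup>2)"
  and x_eq: "\<And>t. t \<in> {0..T} ==> ((%s. (1 / eps\<^sup>2) * L (Pi_seg eps s x) + Gfun r \<nu>1 \<nu>3 (Pi_seg eps s x))
       has_integral (x t - x 0 - sig * wp t)) {0..t}"
  and wp_cont: "continuous_on {0..T} wp"
begin

definition xs :: "real => real" where "xs tau = x (eps\<^sup>2 * tau)"
definition G :: "real => real" where "G t = Gfun r \<nu>1 \<nu>3 (seg xs (t / eps\<^sup>2))"
definition mu :: "real => real" where "mu t = integral {0..t} G + sig * wp t"
definition Z :: "real => complex" where "Z t = zeta (seg xs (t / eps\<^sup>2))"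
definition ph :: "real => complex" where "ph t = iexp (- (om * t / eps\<^sup>2))"
definition E :: "real => complex" where "E t = ph t * Z t - integral {0..t} (%s. ph s * gam * of_real (G s))"

lemma seg_eq: "Pi_seg eps t x = (seg xs (t / eps\<^sup>2))"
 using eps by (simp add: Pi_seg_def xs_def fun_eq_iff distrib_left)

lemma xi_Chat: "\<xi> \<in> Chat_space r" using xi Cspace_sub_Chat by blast

lemma scale: "t \<in> {0..T} \<longleftrightarrow> t / eps\<^sup>2 \<in> {0..T / eps\<^sup>2}" using eps by (simp add: divide_le_cancel zero_le_divide_iff)

lemma xs_cont: "continuous_on {-r..T / eps\<^sup>2} xs"
 unfolding xs_def
proof (rule continuous_on_compose2[OF x_cont])
 show "(%tau. eps\<^sup>2 * tau) ` {-r..T / eps\<^sup>2} \<subseteq> {-(eps\<^sup>2 * r)..T}"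
  using eps mult_left_mono[of "-r" _ "eps\<^sup>2"] mult_left_mono[of _ "T / eps\<^sup>2" "eps\<^sup>2"] by fastforce
qed (intro continuous_intros)

lemma seg_Cspace:
 assumes "tau \<in> {0..T / eps\<^sup>2}" shows "(seg xs tau) \<in> Cspace r"
 unfolding Cspace_def using assms
 by (auto intro!: continuous_on_compose2[OF xs_cont] continuous_intros)

lemma seg_Chat: "tau \<in> {0..T / eps\<^sup>2} ==> (seg xs tau) \<in> Chat_space r"
 using seg_Cspace Cspace_sub_Chat by blast

lemma slow_cont: "continuous_on {0..T / eps\<^sup>2} f ==> continuous_on {0..T} (%t. f (t / eps\<^sup>2))"
 by (rule continuous_on_compose2[of "{0..T / eps\<^sup>2}"]) (use eps scale in "auto intro!: continuous_intros")

lemma Z_cont: "continuous_on {0..T} Z"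
 unfolding Z_def by (rule slow_cont[OF zeta_segment_continuous[OF xs_cont]])

lemma G_cont: "continuous_on {0..T} G"
 unfolding G_def
proof (rule slow_cont)
 have "bounded (xs ` {-r..T / eps\<^sup>2})" by (intro compact_imp_bounded compact_continuous_image xs_cont) simp
 then obtain M where M: "\<forall>u\<in>{-r..T / eps\<^sup>2}. \<bar>xs u\<bar> <= M" by (auto simp: bounded_iff)
 show "continuous_on {0..T / eps\<^sup>2} (%tau. Gfun r \<nu>1 \<nu>3 (seg xs tau))"
 proof (rule segment_functional_continuous[OF xs_cont, of "V * (1 + M\<^sup>2)"])
  fix s t e assume st: "s \<in> {0..T / eps\<^sup>2}" "t \<in> {0..T / eps\<^sup>2}" "\<And>th. th \<in> {-r..0} ==> abs (xs (s + th) - xs (t + th)) <= e"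
  show "dist (Gfun r \<nu>1 \<nu>3 (seg xs s)) (Gfun r \<nu>1 \<nu>3 (seg xs t)) <= V * (1 + M\<^sup>2) * e"
   unfolding dist_real_def by (rule Gfun_lip[OF seg_Cspace[OF st(1)] seg_Cspace[OF st(2)]]) (use M st in auto)
 qed (use V in simp)
qed

lemma mu_cont: "continuous_on {0..T} mu"
 unfolding mu_def by (intro continuous_intros indefinite_integral_continuous_1 integrable_continuous_interval G_cont wp_cont)

lemma forced_xs: "forced (T / eps\<^sup>2) \<xi> (%tau. mu (eps\<^sup>2 * tau)) xs"
 unfolding forced_def
proof (intro conjI ballI)
 have h: "xs th = \<xi> th" if "th \<in> {-r..0}" for th
  using x_init[of "eps\<^sup>2 * th"] that eps mult_left_mono[of "-r" th "eps\<^sup>2"] by (simp add: xs_def mult_le_0_iff)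
 then show "xs th = \<xi> th" if "th \<in> {-r..0}" for th using that .
 show c: "continuous_on {0..T / eps\<^sup>2} xs" by (rule continuous_on_subset[OF xs_cont]) (use r_pos in auto)
 fix tau assume tau: "tau \<in> {0..T / eps\<^sup>2}"
 define t where "t = eps\<^sup>2 * tau"
 have t: "t \<in> {0..T}" "tau = t / eps\<^sup>2" using tau eps by (auto simp: t_def field_simps)
 let ?l = "%s. Lf r m (seg xs s)"
 have "?l integrable_on {0..tau}" by (rule Lf_segment_integrable[OF xi_Chat h c]) (use tau in auto)
 then have "(?l has_integral integral {0..tau} ?l) (cbox 0 tau)" by (simp add: has_integral_integral)
 from has_integral_affinity'[OF this, of "1 / eps\<^sup>2" 0] eps
 have "((%s. ?l (s / eps\<^sup>2)) has_integral (eps\<^sup>2 * integral {0..tau} ?l)) {0..t}" by (simp add: t_def mult.commute)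
 from has_integral_mult_right[OF this, of "1 / eps\<^sup>2"] eps
 have "((%s. 1 / eps\<^sup>2 * ?l (s / eps\<^sup>2)) has_integral integral {0..tau} ?l) {0..t}" by simp
 moreover have "(G has_integral integral {0..t} G) {0..t}"
  by (intro integrable_integral integrable_continuous_interval continuous_on_subset[OF G_cont]) (use t in auto)
 ultimately have "((%s. 1 / eps\<^sup>2 * ?l (s / eps\<^sup>2) + G s) has_integral (integral {0..tau} ?l + integral {0..t} G)) {0..t}"
  by (rule has_integral_add)
 moreover have "1 / eps\<^sup>2 * ?l (s / eps\<^sup>2) + G s = (1 / eps\<^sup>2) * L (Pi_seg eps s x) + Gfun r \<nu>1 \<nu>3 (Pi_seg eps s x)" if "s \<in> {0..t}" for s
  using L_eq[OF seg_Cspace, of "s / eps\<^sup>2"] scale[of s] that t unfolding seg_eq G_def by auto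
 ultimately have "((%s. (1 / eps\<^sup>2) * L (Pi_seg eps s x) + Gfun r \<nu>1 \<nu>3 (Pi_seg eps s x)) has_integral (integral {0..tau} ?l + integral {0..t} G)) {0..t}"
  by (rule has_integral_eq[rotated])
 from has_integral_unique[OF this x_eq[OF t(1)]] h[of 0] r_pos
 show "xs tau = \<xi> 0 + mu (eps\<^sup>2 * tau) + integral {0..tau} ?l" by (simp add: mu_def t_def xs_def)
qed

lemma norm_ph[simp]: "cmod (ph t) = 1" by (simp add: ph_def)

lemma ph_lipschitz: "cmod (ph s - ph t) <= om / eps\<^sup>2 * abs (s - t)"
 using iexp_lipschitz[of "- (om * s / eps\<^sup>2)" "- (om * t / eps\<^sup>2)"] om_pos
 by (simp add: ph_def abs_mult abs_minus_commute flip: diff_divide_distrib right_diff_distrib)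

lemma ph_cont: "continuous_on A ph" unfolding ph_def using eps by (auto intro!: continuous_intros)

lemma phG_cont: "continuous_on {0..T} (%s. ph s * gam * of_real (G s))"
 by (intro continuous_intros ph_cont G_cont)

lemma E_increment:
 assumes ab: "0 <= a" "a <= b" "b <= T" and osc: "\<And>u. u \<in> {a..b} ==> abs (mu u - mu a) <= c"
  and GB: "\<And>u. u \<in> {0..T} ==> abs (G u) <= GB"
 shows "cmod (E b - E a - ph a * gam * of_real (sig * (wp b - wp a)))
  <= cmod gam * (2 * K * exp (K * (T / eps\<^sup>2)) + om) / eps\<^sup>2 * (b - a) * (c + (b - a) * GB)"
proof -
 define s where "s = (b - a) / eps\<^sup>2"
 have s: "0 <= s" "s <= T / eps\<^sup>2" "a / eps\<^sup>2 + s = b / eps\<^sup>2" "eps\<^sup>2 * (a / eps\<^sup>2 + s) = b"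
  using ab eps divide_right_mono[of "b - a" T "eps\<^sup>2"] divide_right_mono[of a b "eps\<^sup>2"] by (auto simp: s_def diff_divide_distrib right_diff_distrib)
 have c0: "0 <= c" using osc[of a] ab by simp
 have GB0: "0 <= GB" using GB[of 0] T by force
 have W: "cmod (Z b - exp (\<i> * of_real (om * s)) * Z a - gam * of_real (mu b - mu a)) <= 2 * cmod gam * K * s * (c * exp (K * s))"
 proof -
  have o: "abs (mu (eps\<^sup>2 * (a / eps\<^sup>2 + u)) - mu (eps\<^sup>2 * (a / eps\<^sup>2))) <= c" if "0 <= u" "u <= s" for u
  proof -
   have "eps\<^sup>2 * u <= b - a" using that eps by (simp add: s_def field_simps)
   then show ?thesis using osc[of "a + eps\<^sup>2 * u"] that eps by (simp add: distrib_left)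
  qed
  have "a / eps\<^sup>2 + s <= T / eps\<^sup>2" using s ab eps by (simp add: divide_right_mono)
  from window(2)[OF xi_Chat forced_xs _ s(1) this o] show ?thesis
   using ab eps s(3,4) by (simp add: Z_def)
 qed
 have phs: "ph b * exp (\<i> * of_real (om * s)) = ph a"
  by (simp add: ph_def s_def exp_add[symmetric] diff_divide_distrib algebra_simps)
 define I where "I = integral {a..b} (%s. ph s * gam * of_real (G s))"
 have Ii: "(%s. ph s * gam * of_real (G s)) integrable_on {0..b}" "G integrable_on {0..b}"
  "(%s. ph s * gam * of_real (G s)) integrable_on {a..b}" "G integrable_on {a..b}"
  by (intro integrable_continuous_interval continuous_on_subset[OF phG_cont] continuous_on_subset[OF G_cont]; use ab in force)+
 have EE: "E b - E a = ph b * Z b - ph a * Z a - I"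
  unfolding E_def I_def using Henstock_Kurzweil_Integration.integral_combine[OF ab(1,2) Ii(1)] by (simp add: algebra_simps)
 have mm: "mu b - mu a = integral {a..b} G + sig * (wp b - wp a)"
  unfolding mu_def using Henstock_Kurzweil_Integration.integral_combine[OF ab(1,2) Ii(2)] by (simp add: algebra_simps)
 have P1: "cmod (ph b * Z b - ph a * Z a - ph b * gam * of_real (mu b - mu a)) <= 2 * cmod gam * K * s * (c * exp (K * (T / eps\<^sup>2)))"
 proof -
  have "ph b * Z b - ph a * Z a - ph b * gam * of_real (mu b - mu a)
    = ph b * (Z b - exp (\<i> * of_real (om * s)) * Z a - gam * of_real (mu b - mu a))"
   unfolding phs[symmetric] by (simp only: right_diff_distrib mult.assoc)
  then have "cmod (ph b * Z b - ph a * Z a - ph b * gam * of_real (mu b - mu a)) <= 2 * cmod gam * K * s * (c * exp (K * s))"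
   using W by (simp only: norm_mult norm_ph mult_1)
  also have "... <= 2 * cmod gam * K * s * (c * exp (K * (T / eps\<^sup>2)))"
   using s c0 K_nonneg mult_left_mono[OF s(2) K_nonneg]
   by (intro mult_left_mono exp_le_cancel_iff[THEN iffD2] mult_nonneg_nonneg) auto
  finally show ?thesis .
 qed
 have pl: "cmod (ph u - ph a) <= om * s" if "u \<in> {a..b}" for u
 proof -
  have "om / eps\<^sup>2 * abs (u - a) <= om / eps\<^sup>2 * (b - a)" using that om_pos by (intro mult_left_mono) auto
  then show ?thesis using ph_lipschitz[of u a] by (simp add: s_def)
 qed
 have P2: "cmod (ph b * gam * of_real (mu b - mu a) - ph a * gam * of_real (mu b - mu a)) <= om * s * (cmod gam * c)"
 proof -
  have "ph b * gam * of_real (mu b - mu a) - ph a * gam * of_real (mu b - mu a) = (ph b - ph a) * (gam * of_real (mu b - mu a))"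
   by (simp only: left_diff_distrib mult.assoc)
  also have "cmod ... <= (om * s) * (cmod gam * c)"
   unfolding norm_mult norm_of_real by (intro mult_mono pl osc) (use ab om_pos s in auto)
  finally show ?thesis .
 qed
 have P3: "cmod (ph a * gam * of_real (integral {a..b} G) - I) <= om * s * (cmod gam * GB) * (b - a)"
 proof -
  have h: "((%u. ph a * gam * of_real (G u) - ph u * gam * of_real (G u)) has_integral (ph a * gam * of_real (integral {a..b} G) - I)) {a..b}"
   unfolding I_def by (intro has_integral_diff integrable_integral Ii has_integral_mult_right has_integral_of_real)
  have "norm (ph a * gam * of_real (integral {a..b} G) - I) <= (om * s * (cmod gam * GB)) * measure lborel {a..b}"
  proof (rule has_integral_bound_real[OF _ finite.emptyI h])
   show "0 <= om * s * (cmod gam * GB)" using om_pos s GB0 by simp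
   fix u assume u: "u \<in> {a..b} - {}"
   have "ph a * gam * of_real (G u) - ph u * gam * of_real (G u) = (ph a - ph u) * (gam * of_real (G u))"
    by (simp only: left_diff_distrib mult.assoc)
   also have "cmod ... <= (om * s) * (cmod gam * GB)"
    unfolding norm_mult norm_of_real norm_minus_commute[of "ph a"] by (intro mult_mono pl GB) (use u ab om_pos s in auto)
   finally show "norm (ph a * gam * of_real (G u) - ph u * gam * of_real (G u)) <= om * s * (cmod gam * GB)" .
  qed
  then show ?thesis using ab by simp
 qed
 have "E b - E a - ph a * gam * of_real (sig * (wp b - wp a))
   = (ph b * Z b - ph a * Z a - ph b * gam * of_real (mu b - mu a))
   + (ph b * gam * of_real (mu b - mu a) - ph a * gam * of_real (mu b - mu a))
   + (ph a * gam * of_real (integral {a..b} G) - I)"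
  unfolding EE mm by (simp add: algebra_simps)
 then have "cmod (E b - E a - ph a * gam * of_real (sig * (wp b - wp a)))
  <= 2 * cmod gam * K * s * (c * exp (K * (T / eps\<^sup>2))) + om * s * (cmod gam * c) + om * s * (cmod gam * GB) * (b - a)"
  by (simp only:) (intro order_trans[OF norm_triangle_ineq] add_mono P1 P2 P3)
 also have "... <= cmod gam * (2 * K * exp (K * (T / eps\<^sup>2)) + om) * s * (c + (b - a) * GB)"
 proof -
  have "cmod gam * (2 * K * exp (K * (T / eps\<^sup>2)) + om) * s * (c + (b - a) * GB)
   = (2 * cmod gam * K * s * (c * exp (K * (T / eps\<^sup>2))) + om * s * (cmod gam * c) + om * s * (cmod gam * GB) * (b - a))
    + 2 * cmod gam * K * exp (K * (T / eps\<^sup>2)) * s * ((b - a) * GB)" by (simp add: algebra_simps)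
  moreover have "0 <= 2 * cmod gam * K * exp (K * (T / eps\<^sup>2)) * s * ((b - a) * GB)"
   using K_nonneg s GB0 ab by (intro mult_nonneg_nonneg) auto
  ultimately show ?thesis by (metis le_add_same_cancel1)
 qed
 finally show ?thesis by (simp add: s_def)
qed

lemma E_limit:
 assumes t: "t \<in> {0..T}"
 shows "(%k. \<Sum>i<Suc k. ph (upart t k i) * gam * of_real (sig * (wp (upart t k (Suc i)) - wp (upart t k i)))) \<longlonglongrightarrow> E t - E 0"
proof (rule tendstoI)
 fix e :: real assume e: "0 < e"
 have t0: "0 <= t" using t by simp
 have "bounded (G ` {0..T})" by (intro compact_imp_bounded compact_continuous_image G_cont) simp
 then obtain GB where GB: "\<forall>u\<in>{0..T}. \<bar>G u\<bar> <= GB" by (auto simp: bounded_iff)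
 define Cc where "Cc = cmod gam * (2 * K * exp (K * (T / eps\<^sup>2)) + om) / eps\<^sup>2"
 have Cc: "0 <= Cc" using K_nonneg om_pos by (simp add: Cc_def)
 define c where "c = e / (2 * (Cc * t + 1))"
 have Ct: "0 < Cc * t + 1" using Cc t0 by (simp add: add_nonneg_pos)
 have c: "0 < c" using e Ct by (simp add: c_def)
 have "uniformly_continuous_on {0..T} mu" by (rule compact_uniformly_continuous[OF mu_cont]) simp
 then obtain d where d: "0 < d" "\<And>u v. u \<in> {0..T} ==> v \<in> {0..T} ==> dist v u < d ==> dist (mu v) (mu u) < c"
  unfolding uniformly_continuous_on_def using c by metis
 have h: "(%k. t / real (Suc k)) \<longlonglongrightarrow> 0" by (rule LIMSEQ_Suc[OF lim_const_over_n])
 have "(%k. t / real (Suc k) * GB) \<longlonglongrightarrow> 0 * GB" by (rule tendsto_mult_right[OF h])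
 then have "\<forall>\<^sub>F k in sequentially. t / real (Suc k) < d \<and> t / real (Suc k) * GB < c"
  using order_tendstoD(2)[OF h d(1)] order_tendstoD(2)[of "%k. t / real (Suc k) * GB" 0 _ c] c by (auto intro: eventually_conj)
 then show "\<forall>\<^sub>F k in sequentially. dist (\<Sum>i<Suc k. ph (upart t k i) * gam * of_real (sig * (wp (upart t k (Suc i)) - wp (upart t k i)))) (E t - E 0) < e"
 proof eventually_elim
  case (elim k)
  let ?u = "upart t k" and ?h = "t / real (Suc k)"
  have hS: "?u (Suc i) = ?u i + ?h" for i by (simp add: upart_def distrib_left add_divide_distrib)
  have h0: "0 <= ?h" using t0 by simp
  have st: "cmod (E (?u (Suc i)) - E (?u i) - ph (?u i) * gam * of_real (sig * (wp (?u (Suc i)) - wp (?u i)))) <= Cc * ?h * (c + c)"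
   if i: "i < Suc k" for i
  proof -
   have u: "0 <= ?u i" "?u i <= ?u (Suc i)" "?u (Suc i) <= T"
    using upart_range[OF t0, of i k] upart_range[OF t0, of "Suc i" k] i t hS[of i] h0 by auto
   have "cmod (E (?u (Suc i)) - E (?u i) - ph (?u i) * gam * of_real (sig * (wp (?u (Suc i)) - wp (?u i))))
    <= Cc * (?u (Suc i) - ?u i) * (c + (?u (Suc i) - ?u i) * GB)"
    unfolding Cc_def
   proof (rule E_increment[OF u _ bspec[OF GB]])
    fix v assume "v \<in> {?u i..?u (Suc i)}"
    then show "abs (mu v - mu (?u i)) <= c"
     using d(2)[of "?u i" v] u elim hS[of i] by (auto simp: dist_real_def less_imp_le)
   qed
   also have "?u (Suc i) - ?u i = ?h" using hS by simp
   also have "Cc * ?h * (c + ?h * GB) <= Cc * ?h * (c + c)"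
    by (rule mult_left_mono[OF add_left_mono mult_nonneg_nonneg[OF Cc h0]]) (use elim in simp)
   finally show ?thesis .
  qed
  have ee: "E t - E 0 = (\<Sum>i<Suc k. E (?u (Suc i)) - E (?u i))"
   using sum_lessThan_telescope[of "%i. E (?u i)" "Suc k"] by (simp add: upart_def)
  have "dist (\<Sum>i<Suc k. ph (?u i) * gam * of_real (sig * (wp (?u (Suc i)) - wp (?u i)))) (E t - E 0)
    = cmod (\<Sum>i<Suc k. E (?u (Suc i)) - E (?u i) - ph (?u i) * gam * of_real (sig * (wp (?u (Suc i)) - wp (?u i))))"
   unfolding ee dist_norm sum_subtractf by (rule norm_minus_commute)
  also have "... <= (\<Sum>i<Suc k. Cc * ?h * (c + c))" by (intro sum_norm_le st) simp
  also have "... = Cc * t * (2 * c)" by simp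
  also have "... < (Cc * t + 1) * (2 * c)" using c by simp
  also have "... = e" using Ct by (simp add: c_def field_simps)
  finally show ?case .
 qed
qed

end

context slow_path begin

definition Yf :: "real => real => real" where "Yf t th = sol (qpart \<xi>) (t / eps\<^sup>2 + th)"
definition U :: "real => real" where "U tau = xs tau - 1 * sol \<xi> tau"
definition Qs :: "real => real" where "Qs t = sup_norm r (qpart (seg U (t / eps\<^sup>2)))"

lemma forced_U: "forced (T / eps\<^sup>2) (%_. 0) (%tau. mu (eps\<^sup>2 * tau)) U"
proof -
 have "0 <= T / eps\<^sup>2" using T by simp
 from forced_combine[OF xi_Chat xi_Chat forced_xs sol_forced[OF xi_Chat this], of 1]
 show ?thesis unfolding U_def by simp
qed

lemma U_cont: "continuous_on {-r..T / eps\<^sup>2} U"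
proof -
 have "continuous_on {-r..0} U"
  by (rule continuous_on_eq[OF continuous_on_const[of _ 0]]) (use forced_U in "auto simp: forced_def")
 then have "continuous_on ({-r..0} \<union> {0..T / eps\<^sup>2}) U"
  using forced_U by (intro continuous_on_closed_Un) (auto simp: forced_def)
 moreover have "{-r..0} \<union> {0..T / eps\<^sup>2} = {-r..T / eps\<^sup>2}" using r_pos T by (intro ivl_disj_un) auto
 ultimately show ?thesis by simp
qed

lemma U_Chat: "tau \<in> {0..T / eps\<^sup>2} ==> (seg U tau) \<in> Chat_space r"
 by (rule subsetD[OF Cspace_sub_Chat]) (auto intro!: continuous_on_compose2[OF U_cont] continuous_intros simp: Cspace_def)

lemma Yf_Cspace: assumes "t \<in> {0..T}" shows "Yf t \<in> Cspace r"
proof -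
 have q: "qpart \<xi> \<in> Cspace r" using xi unfolding Cspace_def qpart_def[abs_def] by (auto intro!: continuous_intros pw_cont)
 then have "continuous_on {-r..0} (sol (qpart \<xi>))"
  using sol_hist[of _ "qpart \<xi>"] unfolding Cspace_def by (auto intro: continuous_on_eq)
 then have "continuous_on ({-r..0} \<union> {0..}) (sol (qpart \<xi>))"
  using sol_cont[OF subsetD[OF Cspace_sub_Chat q]] by (intro continuous_on_closed_Un) auto
 then have "continuous_on {-r..0} (%th. sol (qpart \<xi>) (t / eps\<^sup>2 + th))"
 proof (rule continuous_on_compose2, goal_cases)
  case 2
  show ?case
  proof (rule image_subsetI)
  fix th assume th: "th \<in> {-r..0}"
  have "0 <= t / eps\<^sup>2" using assms by simp
  then have "-r <= t / eps\<^sup>2 + th" using th by auto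
  then show "t / eps\<^sup>2 + th \<in> {-r..0} \<union> {0..}" by auto
  qed
 qed (intro continuous_intros)
 then show ?thesis by (simp add: Cspace_def Yf_def[abs_def])
qed

lemma decomposition:
 assumes t: "t \<in> {0..T}" and th: "th \<in> {-r..0}"
 shows "xs (t / eps\<^sup>2 + th) = pw (Z t) th + qpart (seg U (t / eps\<^sup>2)) th + Yf t th"
proof -
 let ?tau = "t / eps\<^sup>2"
 have tau: "?tau \<in> {0..T / eps\<^sup>2}" "0 <= ?tau" using t scale by auto
 have "zeta (seg U ?tau) = Z t - zeta (%th. sol \<xi> (?tau + th))"
  using zeta_combine[OF seg_Chat[OF tau(1)] sol_segment_Chat[OF xi_Chat tau(2)], of 1] by (simp add: U_def Z_def)
 moreover have "Yf t th = sol \<xi> (?tau + th) - pw (zeta (%th. sol \<xi> (?tau + th))) th"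
  using sol_qpart[OF xi_Chat, of "?tau + th"] th tau(2) unfolding zeta_shift(1)[OF xi_Chat tau(2)] Yf_def
  by (simp add: pw_shift)
 ultimately show ?thesis by (simp add: qpart_def U_def pw_def left_diff_distrib)
qed

lemma Qs_cont: "continuous_on {0..T} Qs"
 unfolding Qs_def by (rule slow_cont[OF qpart_sup_continuous[OF U_cont]])

lemma qpart_le_Qs:
 assumes "t \<in> {0..T}" "th \<in> {-r..0}" shows "abs (qpart (seg U (t / eps\<^sup>2)) th) <= Qs t"
 unfolding Qs_def
 by (rule abs_le_sup_norm[OF _ assms(2)]) (use qpart_Chat[OF U_Chat, of "t / eps\<^sup>2"] assms(1) scale in "auto simp: Chat_space_def")

lemma Qs_le:
 assumes t: "t \<in> {0..T}" and N: "r <= N" "M0 * exp (- kap * (N - r)) <= 1/2"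
  and osc: "\<And>a b. 0 <= a ==> a <= b ==> b <= t ==> b - a <= eps\<^sup>2 * N ==> abs (mu b - mu a) <= c"
 shows "Qs t <= 2 * ((1 + cz) * (c * exp (K * N)))"
 unfolding Qs_def
proof (rule sup_norm_le[OF r_pos], rule qpart_forced_bound[OF _ N])
 have tT: "t / eps\<^sup>2 \<in> {0..T / eps\<^sup>2}" using t scale by simp
 show "forced (t / eps\<^sup>2) (%_. 0) (%tau. mu (eps\<^sup>2 * tau)) U"
  using forced_U tT unfolding forced_def by (auto intro: continuous_on_subset)
 fix a b assume ab: "0 <= a" "a <= b" "b <= t / eps\<^sup>2" "b - a <= N"
 have "eps\<^sup>2 * b <= t" "eps\<^sup>2 * b - eps\<^sup>2 * a <= eps\<^sup>2 * N"
  using ab eps mult_left_mono[of b "t / eps\<^sup>2" "eps\<^sup>2"] by (auto simp flip: right_diff_distrib)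
 then show "abs (mu (eps\<^sup>2 * b) - mu (eps\<^sup>2 * a)) <= c" using ab by (intro osc) (auto intro: mult_left_mono)
qed (use t in auto)

lemma core_estimate:
 assumes zc: "continuous_on {0..T} zh"
  and zeq: "\<And>t. t \<in> {0..T} ==> ((%s. ph s * gam * of_real (Gfun r \<nu>1 \<nu>3 (%th. pw (iexp (om * s / eps\<^sup>2) * zh s) th + Yf s th)))
    has_integral (zh t - zh 0 - (E t - E 0))) {0..t}"
  and z0: "zh 0 = Z 0"
  and t0: "t0 \<in> {0..T}" and C: "\<And>s th. s \<in> {0..t0} ==> th \<in> {-r..0} ==> abs (pw (Z s) th) <= C"
  and Y0: "\<And>u. -r <= u ==> abs (sol (qpart \<xi>) u) <= Y0" and M: "M = C + Y0 + 1"
  and H: "0 <= H" "\<And>a b. a \<in> {0..T} ==> b \<in> {0..T} ==> abs (wp b - wp a) <= H * abs (b - a) powr be" "0 <= be"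
  and N: "r <= N" "M0 * exp (- kap * (N - r)) <= 1/2"
  and c: "c = V * (1 + M\<^sup>2) * M * (eps\<^sup>2 * N) + abs sig * (H * (eps\<^sup>2 * N) powr be)"
  and Q: "Q = 2 * ((1 + cz) * (c * exp (K * N)))" and small: "Q * exp (cmod gam * (V * (1 + M\<^sup>2)) * T) <= 1/2"
  and t: "t \<in> {0..t0}"
 shows "cmod (ph t * Z t - zh t) <= Q * exp (cmod gam * (V * (1 + M\<^sup>2)) * T)"
proof -
 define Lam where "Lam = V * (1 + M\<^sup>2)"
 have Lam: "0 <= Lam" using V by (simp add: Lam_def)
 define d where "d s = cmod (ph s * Z s - zh s)" for s
 define Gh where "Gh s = Gfun r \<nu>1 \<nu>3 (%th. pw (iexp (om * s / eps\<^sup>2) * zh s) th + Yf s th)" for s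
 have dc: "continuous_on {0..T} d" unfolding d_def by (intro continuous_intros ph_cont Z_cont zc)
 define f where "f s = max (Qs s) (d s)" for s
 have M0': "0 <= M" using order_trans[OF abs_ge_zero C[of 0 0]] order_trans[OF abs_ge_zero Y0[of 0]] t0 r_pos by (simp add: M)
 have Yb: "abs (Yf s th) <= Y0" if "0 <= s" "th \<in> {-r..0}" for s th
  unfolding Yf_def by (rule Y0) (use that in \<open>auto intro: order_trans[of "-r" th]\<close>)
 have Q0: "0 <= Q" unfolding Q c using cz_nonneg V M0' H(1) N r_pos by (intro mult_nonneg_nonneg add_nonneg_nonneg) auto
 have inner: "Qs u <= Q \<and> d u <= Q * exp (cmod gam * Lam * T)"
  if u: "u \<in> {0..t0}" and f1: "\<And>s. s \<in> {0..u} ==> f s <= 1" for u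
 proof -
  have sT: "s \<in> {0..T}" if "s \<in> {0..u}" for s using that u t0 by auto
  have q1: "abs (qpart (seg U (s / eps\<^sup>2)) th) <= 1" if "s \<in> {0..u}" "th \<in> {-r..0}" for s th
   using qpart_le_Qs[OF sT[OF that(1)] that(2)] f1[OF that(1)] by (simp add: f_def)
  have seg: "abs (xs (s / eps\<^sup>2 + th)) <= M" if "s \<in> {0..u}" "th \<in> {-r..0}" for s th
   using decomposition[OF sT[OF that(1)] that(2)] q1[OF that] C[of s th] Yb[of s th] that u unfolding M by auto
  have GM: "abs (G s) <= Lam * M" if "s \<in> {0..u}" for s
   using Gfun_lip[OF seg_Cspace[of "s / eps\<^sup>2"], of "%_. 0" M M] sT[OF that] scale[of s] seg[OF that] M0' Gfun_0
   by (simp add: G_def Lam_def Cspace_def)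
  have osc: "abs (mu b - mu a) <= c" if ab: "0 <= a" "a <= b" "b <= u" "b - a <= eps\<^sup>2 * N" for a b
  proof -
   have Ti: "a \<in> {0..T}" "b \<in> {0..T}" using ab sT by auto
   have i: "G integrable_on {0..b}" "G integrable_on {a..b}"
    by (intro integrable_continuous_interval continuous_on_subset[OF G_cont]; use Ti in force)+
   have "mu b - mu a = integral {a..b} G + sig * (wp b - wp a)"
    unfolding mu_def using Henstock_Kurzweil_Integration.integral_combine[OF ab(1,2) i(1)] by (simp add: algebra_simps)
   moreover have "norm (integral {a..b} G) <= Lam * M * measure lborel {a..b}"
    by (rule has_integral_bound_real[OF _ finite.emptyI integrable_integral[OF i(2)]]) (use GM Lam M0' ab in auto)
   then have "abs (integral {a..b} G) <= Lam * M * (eps\<^sup>2 * N)"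
    using ab mult_left_mono[OF ab(4) mult_nonneg_nonneg[OF Lam M0']] by simp
   moreover have "abs (sig * (wp b - wp a)) <= abs sig * (H * (eps\<^sup>2 * N) powr be)"
   proof -
    have "H * abs (b - a) powr be <= H * (eps\<^sup>2 * N) powr be" using H ab by (intro mult_left_mono powr_mono2) auto
    then show ?thesis unfolding abs_mult using H(2)[OF Ti] by (intro mult_left_mono) auto
   qed
   ultimately show ?thesis unfolding c Lam_def[symmetric] by linarith
  qed
  have Qb: "Qs s <= Q" if "s \<in> {0..u}" for s
   unfolding Q by (rule Qs_le[OF sT[OF that] N]) (use that osc in auto)
  have GG: "abs (G s - Gh s) <= Lam * (d s + Q)" if s: "s \<in> {0..u}" for s
   unfolding G_def Gh_def Lam_def
  proof (rule Gfun_lip)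
   show "(seg xs (s / eps\<^sup>2)) \<in> Cspace r" by (rule seg_Cspace) (use sT[OF s] scale in auto)
   show "(%th. pw (iexp (om * s / eps\<^sup>2) * zh s) th + Yf s th) \<in> Cspace r"
    using Yf_Cspace[OF sT[OF s]] pw_cont unfolding Cspace_def by (auto intro!: continuous_on_add)
   fix th assume th: "th \<in> {-r..0}"
   have "Z s - iexp (om * s / eps\<^sup>2) * zh s = iexp (om * s / eps\<^sup>2) * (ph s * Z s - zh s)"
    by (simp add: ph_def right_diff_distrib mult.assoc[symmetric] exp_add[symmetric])
   then have "cmod (Z s - iexp (om * s / eps\<^sup>2) * zh s) = d s" by (simp add: d_def norm_mult)
   then have 1: "abs (pw (Z s) th - pw (iexp (om * s / eps\<^sup>2) * zh s) th) <= d s"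
    using pw_bound[of "Z s - iexp (om * s / eps\<^sup>2) * zh s" th] by (simp add: pw_def left_diff_distrib)
   have 2: "abs (qpart (seg U (s / eps\<^sup>2)) th) <= Q"
    using qpart_le_Qs[OF sT[OF s] th] Qb[OF s] by linarith
   have "d s <= 1" using f1[OF s] by (simp add: f_def)
   then show "abs (xs (s / eps\<^sup>2 + th)) <= M \<and> abs (pw (iexp (om * s / eps\<^sup>2) * zh s) th + Yf s th) <= M \<and>
     \<bar>xs (s / eps\<^sup>2 + th) - (pw (iexp (om * s / eps\<^sup>2) * zh s) th + Yf s th)\<bar> <= d s + Q"
    using seg[OF s th] decomposition[OF sT[OF s] th] C[of s th] Yb[of s th] 1 2 s u th unfolding M by auto
  qed
  have key: "d s <= cmod gam * Lam * integral {0..s} (%v. d v + Q)" if s: "s \<in> {0..u}" for s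
  proof -
   have dci: "(%v. d v + Q) integrable_on {0..s}"
    by (intro integrable_continuous_interval continuous_intros continuous_on_subset[OF dc]) (use sT[OF s] in auto)
   have "((%v. ph v * gam * of_real (G v)) has_integral (ph s * Z s - E s)) {0..s}"
    using integrable_integral[OF integrable_continuous_interval[OF continuous_on_subset[OF phG_cont, of "{0..s}"]]] sT[OF s]
    by (simp add: E_def)
   from has_integral_diff[OF this zeq[OF sT[OF s]]] z0
   have h: "((%v. ph v * gam * of_real (G v) - ph v * gam * of_real (Gh v)) has_integral (ph s * Z s - zh s)) {0..s}"
    by (simp add: E_def ph_def Gh_def algebra_simps)
   have "norm (integral {0..s} (%v. ph v * gam * of_real (G v) - ph v * gam * of_real (Gh v))) <= integral {0..s} (%v. cmod gam * Lam * (d v + Q))"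
   proof (rule integral_norm_bound_integral)
    fix v assume v: "v \<in> {0..s}"
    have "cmod (ph v * gam * of_real (G v) - ph v * gam * of_real (Gh v)) = cmod gam * abs (G v - Gh v)"
     by (simp add: norm_mult flip: right_diff_distrib of_real_diff)
    then show "norm (ph v * gam * of_real (G v) - ph v * gam * of_real (Gh v)) <= cmod gam * Lam * (d v + Q)"
     using GG[of v] v s by (simp add: mult.assoc mult_left_mono)
   qed (use h integrable_on_mult_right[OF dci] in auto)
   then show ?thesis using h by (simp add: d_def has_integral_iff)
  qed
  have "d u + Q <= Q * exp (cmod gam * Lam * u)"
  proof (rule gronwall[of u "%v. d v + Q"])
   show "continuous_on {0..u} (%v. d v + Q)"
    by (intro continuous_intros continuous_on_subset[OF dc]) (use sT in auto)
  qed (use key Lam u in "auto simp: add.commute")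
  also have "... <= Q * exp (cmod gam * Lam * T)"
   using Q0 u t0 Lam by (intro mult_left_mono) (auto intro!: mult_left_mono)
  finally show ?thesis using Q0 Qb[of u] u by auto
 qed
 have f1: "f s <= 1" if "s \<in> {0..t0}" for s
 proof (rule bootstrap[OF _ _ _ that])
  show "continuous_on {0..t0} f"
   unfolding f_def using t0 by (intro continuous_on_max continuous_on_subset[OF Qs_cont] continuous_on_subset[OF dc]) auto
  show "f 0 <= 1"
  proof -
   have "Qs 0 <= 2 * ((1 + cz) * (0 * exp (K * N)))"
   proof (rule Qs_le[OF _ N])
    fix a b :: real assume "0 <= a" "a <= b" "b <= 0"
    then have "a = b" by simp
    then show "abs (mu b - mu a) <= 0" by simp
   qed (use T in auto)
   moreover have "d 0 = 0" using z0 by (simp add: d_def ph_def)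
   ultimately show ?thesis by (simp add: f_def)
  qed
  fix v assume v: "v \<in> {0..t0}" and l: "\<And>s. s \<in> {0..<v} ==> f s <= 1" "f v <= 1"
  have "f s <= 1" if "s \<in> {0..v}" for s using l that by (cases "s = v") auto
  from inner[OF v this] have "Qs v <= Q" "d v <= 1/2" using small unfolding Lam_def by auto
  moreover have "Q <= 1/2"
   using small mult_left_mono[of 1 "exp (cmod gam * Lam * T)" Q] Q0 Lam T by (simp add: Lam_def)
  ultimately show "f v <= 1/2" by (simp add: f_def)
 qed
 show ?thesis using inner[OF t f1] t unfolding d_def Lam_def by auto
qed

end

lemma continuous_process_jointly_measurable:
 fixes Y :: "real => 'a => real"
 assumes Y: "\<And>th. th \<in> {-r..0} ==> Y th \<in> borel_measurable M" and r: "0 < r"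
  and c: "\<And>w. w \<in> space M ==> continuous_on {-r..0} (%th. Y th w)"
 shows "(%p. indicator {-r..0} (snd p) * Y (snd p) (fst p)) \<in> borel_measurable (M \<Otimes>\<^sub>M borel)"
proof (rule borel_measurable_LIMSEQ_real)
 define v where "v n i = max (-r) (min 0 (of_int i / real (Suc n)))" for n i
 have v: "v n i \<in> {-r..0}" for n i using r by (simp add: v_def)
 define J where "J n p = indicator {-r..0} (snd p) * Y (v n \<lceil>real (Suc n) * snd p\<rceil>) (fst p)" for n and p :: "'a \<times> real"
 show "J n \<in> borel_measurable (M \<Otimes>\<^sub>M borel)" for n
 proof -
  have [measurable]: "(%p. Y (v n i) (fst p)) \<in> borel_measurable (M \<Otimes>\<^sub>M borel)" for i
   by (rule measurable_compose[OF measurable_fst Y[OF v]])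
  have "(%p. Y (v n \<lceil>real (Suc n) * snd p\<rceil>) (fst p)) \<in> borel_measurable (M \<Otimes>\<^sub>M borel)"
   by (rule measurable_compose_countable[of "%i p. Y (v n i) (fst p)"]) measurable
  then show ?thesis unfolding J_def by measurable
 qed
 fix p :: "'a \<times> real" assume "p \<in> space (M \<Otimes>\<^sub>M borel)"
 then have w: "fst p \<in> space M" by (auto simp: space_pair_measure)
 show "(%n. J n p) \<longlonglongrightarrow> indicator {-r..0} (snd p) * Y (snd p) (fst p)"
 proof (cases "snd p \<in> {-r..0}")
  case True
  let ?t = "snd p"
  have b: "?t <= v n \<lceil>real (Suc n) * ?t\<rceil> \<and> v n \<lceil>real (Suc n) * ?t\<rceil> <= ?t + 1 / real (Suc n)" for n
  proof -
   have "real (Suc n) * ?t <= of_int \<lceil>real (Suc n) * ?t\<rceil>" "of_int \<lceil>real (Suc n) * ?t\<rceil> <= real (Suc n) * ?t + 1"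
    by linarith+
   from divide_right_mono[OF this(1), of "real (Suc n)"] divide_right_mono[OF this(2), of "real (Suc n)"]
   have "?t <= of_int \<lceil>real (Suc n) * ?t\<rceil> / real (Suc n)" "of_int \<lceil>real (Suc n) * ?t\<rceil> / real (Suc n) <= ?t + 1 / real (Suc n)"
    by (simp_all add: add_divide_distrib del: of_nat_Suc)
   then show ?thesis using True by (auto simp: v_def intro: add_increasing2 order_trans)
  qed
  have "(%n. ?t + 1 / real (Suc n)) \<longlonglongrightarrow> ?t + 0"
   by (rule tendsto_add[OF tendsto_const LIMSEQ_Suc[OF lim_const_over_n]])
  then have "(%n. v n \<lceil>real (Suc n) * ?t\<rceil>) \<longlonglongrightarrow> ?t"
   using tendsto_sandwich[of "%_. ?t" "%n. v n \<lceil>real (Suc n) * ?t\<rceil>" sequentially "%n. ?t + 1 / real (Suc n)" ?t]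
    b by simp
  then have "(%n. Y (v n \<lceil>real (Suc n) * ?t\<rceil>) (fst p)) \<longlonglongrightarrow> Y ?t (fst p)"
   by (rule continuous_on_tendsto_compose[OF c[OF w] _ True]) (use v in simp)
  then show ?thesis using True by (simp add: J_def)
 qed (simp add: J_def)
qed

lemma exit_event_iff:
 fixes pp :: "real => real => real" and \<alpha> :: "real => real" and T r C b :: real
 assumes T: "0 < T" and r: "0 < r" and \<alpha>: "continuous_on {0..T} \<alpha>"
  and pc: "continuous_on ({0..T} \<times> {-r..0}) (%(s, th). pp s th)"
 defines "e \<equiv> Inf (ereal ` {t \<in> {0..T}. C <= sup_norm r (pp t)})"
 shows "(SUP t\<in>{t. 0 <= t \<and> ereal t <= min (ereal T) e}. \<alpha> t) <= b \<longleftrightarrow>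
  \<alpha> 0 <= b \<and> (\<forall>q\<in>{0<..<T} \<inter> \<rat>. (\<forall>k::nat. \<exists>p\<in>rat_rect q r. C - 1 / real (Suc k) < abs (pp (fst p) (snd p))) \<or> \<alpha> q <= b)"
proof -
 let ?S = "{t. 0 <= t \<and> ereal t <= min (ereal T) e}"
 have ca: "continuous_on ({0..q} \<times> {-r..0}) (%p. \<bar>pp (fst p) (snd p)\<bar>)" if "q <= T" for q
  by (rule continuous_on_subset[OF continuous_on_rabs[OF pc, unfolded split_def]]) (use that in auto)
 have ps: "bounded (pp t ` {-r..0})" if "t \<in> {0..T}" for t
  by (intro compact_imp_bounded compact_continuous_image continuous_on_compose2[OF pc, of _ "%th. (t, th)", simplified] continuous_intros)
   (use that in auto)
 have ex: "(\<exists>s\<in>{0..q}. C <= sup_norm r (pp s)) \<longleftrightarrow> (\<forall>k::nat. \<exists>p\<in>rat_rect q r. C - 1 / real (Suc k) < abs (pp (fst p) (snd p)))"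
  if q: "0 < q" "q < T" for q
 proof
  assume "\<exists>s\<in>{0..q}. C <= sup_norm r (pp s)"
  then obtain s where s: "s \<in> {0..q}" "C <= sup_norm r (pp s)" by blast
  show "\<forall>k::nat. \<exists>p\<in>rat_rect q r. C - 1 / real (Suc k) < abs (pp (fst p) (snd p))"
  proof (rule ccontr)
   assume "\<not> ?thesis"
   then obtain k :: nat where k: "\<forall>p\<in>rat_rect q r. \<bar>pp (fst p) (snd p)\<bar> <= C - 1 / real (Suc k)" by (auto simp: not_less)
   have "abs (pp s th) <= C - 1 / real (Suc k)" if "th \<in> {-r..0}" for th
    using continuous_le_on_closure[of "rat_rect q r" "%p. \<bar>pp (fst p) (snd p)\<bar>" "(s, th)" "C - 1 / real (Suc k)"]
     ca[of q] k s(1) that q by (simp add: rat_rect(2)[OF q(1) r])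
   then have "sup_norm r (pp s) <= C - 1 / real (Suc k)" by (rule sup_norm_le[OF r])
   moreover have "0 < 1 / real (Suc k)" by simp
   ultimately show False using s(2) by linarith
  qed
 next
  assume k: "\<forall>k::nat. \<exists>p\<in>rat_rect q r. C - 1 / real (Suc k) < abs (pp (fst p) (snd p))"
  have "\<exists>p\<in>{0..q} \<times> {-r..0}. \<forall>p'\<in>{0..q} \<times> {-r..0}. \<bar>pp (fst p') (snd p')\<bar> <= abs (pp (fst p) (snd p))"
   by (rule continuous_attains_sup) (use ca[of q] q r in "auto intro: compact_Times")
  then obtain p where p: "p \<in> {0..q} \<times> {-r..0}"
   "\<forall>p'\<in>{0..q} \<times> {-r..0}. \<bar>pp (fst p') (snd p')\<bar> <= abs (pp (fst p) (snd p))" by blast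
  have "C <= abs (pp (fst p) (snd p))"
  proof (rule ccontr)
   assume "\<not> ?thesis"
   then obtain k :: nat where "inverse (real (Suc k)) < C - abs (pp (fst p) (snd p))" using reals_Archimedean[of "C - abs (pp (fst p) (snd p))"] by auto
   moreover obtain p' where "p' \<in> rat_rect q r" "C - 1 / real (Suc k) < abs (pp (fst p') (snd p'))" using k by blast
   moreover have "abs (pp (fst p') (snd p')) <= abs (pp (fst p) (snd p))"
    using p(2) rat_rect(3)[OF q(1) r calculation(2)] by (simp add: mem_Times_iff)
   ultimately show False unfolding inverse_eq_divide by linarith
  qed
  also have "... <= sup_norm r (pp (fst p))" by (rule abs_le_sup_norm[OF ps]) (use p q in "auto simp: mem_Times_iff")
  finally show "\<exists>s\<in>{0..q}. C <= sup_norm r (pp s)" using p(1) by (auto simp: mem_Times_iff)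
 qed
 have e0: "0 <= e" unfolding e_def by (rule Inf_greatest) auto
 have before: "\<not> C <= sup_norm r (pp s)" if "s \<in> {0..T}" "ereal s < e" for s
 proof
  assume "C <= sup_norm r (pp s)"
  then have "e <= ereal s" unfolding e_def using that by (intro Inf_lower) auto
  then show False using that by simp
 qed
 have after: "q \<in> ?S" if q: "0 < q" "q < T" "\<not> (\<exists>s\<in>{0..q}. C <= sup_norm r (pp s))" for q
 proof -
  have "ereal q <= e" unfolding e_def
  proof (rule Inf_greatest)
   fix z assume "z \<in> ereal ` {t \<in> {0..T}. C <= sup_norm r (pp t)}"
   then obtain t where t: "t \<in> {0..T}" "C <= sup_norm r (pp t)" "z = ereal t" by auto
   have "\<not> t <= q" using t q(3) by auto
   then show "ereal q <= z" using t by simp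
  qed
  then show ?thesis using q by simp
 qed
 have S0: "0 \<in> ?S" using e0 T by (simp add: zero_ereal_def)
 have SsT: "?S \<subseteq> {0..T}" by auto
 have "bounded (\<alpha> ` {0..T})" by (intro compact_imp_bounded compact_continuous_image \<alpha>) simp
 then have bd: "bdd_above (\<alpha> ` ?S)" using SsT by (meson bdd_above_mono bounded_imp_bdd_above image_mono)
 show ?thesis
 proof
  assume le: "(SUP t\<in>?S. \<alpha> t) <= b"
  have l: "\<alpha> t <= b" if "t \<in> ?S" for t using cSUP_upper[OF that bd] le by linarith
  show "\<alpha> 0 <= b \<and> (\<forall>q\<in>{0<..<T} \<inter> \<rat>. (\<forall>k::nat. \<exists>p\<in>rat_rect q r. C - 1 / real (Suc k) < abs (pp (fst p) (snd p))) \<or> \<alpha> q <= b)"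
  proof (intro conjI ballI)
   show "\<alpha> 0 <= b" by (rule l[OF S0])
   fix q assume "q \<in> {0<..<T} \<inter> \<rat>"
   then have q: "0 < q" "q < T" by auto
   show "(\<forall>k::nat. \<exists>p\<in>rat_rect q r. C - 1 / real (Suc k) < abs (pp (fst p) (snd p))) \<or> \<alpha> q <= b"
    using l[OF after[OF q]] ex[OF q] by blast
  qed
 next
  assume R: "\<alpha> 0 <= b \<and> (\<forall>q\<in>{0<..<T} \<inter> \<rat>. (\<forall>k::nat. \<exists>p\<in>rat_rect q r. C - 1 / real (Suc k) < abs (pp (fst p) (snd p))) \<or> \<alpha> q <= b)"
  show "(SUP t\<in>?S. \<alpha> t) <= b"
  proof (rule cSUP_least)
   show "?S ~= {}" using S0 by blast
   fix t assume t: "t \<in> ?S"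
   show "\<alpha> t <= b"
   proof (cases "t = 0")
    case False
    then have t0: "0 < t" using t by simp
    have "\<alpha> q <= b" if "q \<in> {0<..<t} \<inter> \<rat>" for q
    proof -
     have q: "0 < q" "q < t" "q < T" "q \<in> \<rat>" using that t by auto
     have "\<not> (\<exists>s\<in>{0..q}. C <= sup_norm r (pp s))"
     proof
      assume "\<exists>s\<in>{0..q}. C <= sup_norm r (pp s)"
      then obtain s where s: "s \<in> {0..q}" "C <= sup_norm r (pp s)" by blast
      have "ereal s < ereal t" using s q by simp
      also have "ereal t <= e" using t by simp
      finally show False using before[of s] s q by auto
     qed
     then have n: "\<not> (\<forall>k::nat. \<exists>p\<in>rat_rect q r. C - 1 / real (Suc k) < abs (pp (fst p) (snd p)))"
      unfolding ex[OF q(1,3)] .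
     have "q \<in> {0<..<T} \<inter> \<rat>" using q by simp
     from bspec[OF conjunct2[OF R] this] show ?thesis
     proof (rule disjE)
      assume "\<forall>k::nat. \<exists>p\<in>rat_rect q r. C - 1 / real (Suc k) < abs (pp (fst p) (snd p))"
      then show ?thesis using n by contradiction
     qed
    qed
    moreover have "continuous_on (closure ({0<..<t} \<inter> \<rat>)) \<alpha>"
     unfolding closure_Ioo_Rats[OF t0] by (rule continuous_on_subset[OF \<alpha>]) (use t in auto)
    ultimately show ?thesis
     using continuous_le_on_closure[of "{0<..<t} \<inter> \<rat>" \<alpha> t b] t0 by (simp add: closure_Ioo_Rats)
   qed (use R in simp)
  qed
 qed
qed

lemma exit_event_measurable:
 fixes pp :: "real => real => 'a => real" and \<alpha> :: "real => 'a => real"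
 assumes T: "0 < T" and r: "0 < r"
  and \<alpha>: "\<And>w. w \<in> space M ==> continuous_on {0..T} (%t. \<alpha> t w)"
  and pc: "\<And>w. w \<in> space M ==> continuous_on ({0..T} \<times> {-r..0}) (%(s, th). pp s th w)"
  and m: "\<And>t. t \<in> {0..T} ==> \<alpha> t \<in> borel_measurable M" "\<And>t th. t \<in> {0..T} ==> th \<in> {-r..0} ==> pp t th \<in> borel_measurable M"
 shows "{w \<in> space M. (SUP t\<in>{t. 0 <= t \<and> ereal t <= min (ereal T) (Inf (ereal ` {t \<in> {0..T}. C <= sup_norm r (%th. pp t th w)}))}. \<alpha> t w) <= b} \<in> sets M"
proof -
 let ?R = "%w. \<alpha> 0 w <= b \<and> (\<forall>q\<in>{0<..<T} \<inter> \<rat>. (\<forall>k::nat. \<exists>p\<in>rat_rect q r. C - 1 / real (Suc k) < abs (pp (fst p) (snd p) w)) \<or> \<alpha> q w <= b)"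
 have "{w \<in> space M. ?R w} \<in> sets M"
 proof (intro sets.sets_Collect_conj sets.sets_Collect_countable_All' sets.sets_Collect_disj sets.sets_Collect_countable_All sets.sets_Collect_countable_Ex')
  have [measurable]: "\<alpha> 0 \<in> borel_measurable M" using m(1)[of 0] T by simp
  show "{w \<in> space M. \<alpha> 0 w <= b} \<in> sets M" by measurable
  show "countable ({0<..<T} \<inter> \<rat>)" by (simp add: countable_rat)
  fix q assume q: "q \<in> {0<..<T} \<inter> \<rat>"
  then show "countable (rat_rect q r)" using rat_rect(1)[OF _ r] by simp
  have [measurable]: "\<alpha> q \<in> borel_measurable M" using m(1)[of q] q by simp
  show "{w \<in> space M. \<alpha> q w <= b} \<in> sets M" by measurable
  fix k :: nat and p assume p: "p \<in> rat_rect q r"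
  have [measurable]: "pp (fst p) (snd p) \<in> borel_measurable M" by (rule m(2)) (use rat_rect(3)[OF _ r p] q in auto)
  show "{w \<in> space M. C - 1 / real (Suc k) < abs (pp (fst p) (snd p) w)} \<in> sets M" by measurable
 qed
 also have "{w \<in> space M. ?R w} = {w \<in> space M. (SUP t\<in>{t. 0 <= t \<and> ereal t <= min (ereal T) (Inf (ereal ` {t \<in> {0..T}. C <= sup_norm r (%th. pp t th w)}))}. \<alpha> t w) <= b}"
 proof (intro Collect_cong conj_cong refl)
  fix w assume w: "w \<in> space M"
  show "?R w \<longleftrightarrow> (SUP t\<in>{t. 0 <= t \<and> ereal t <= min (ereal T) (Inf (ereal ` {t \<in> {0..T}. C <= sup_norm r (%th. pp t th w)}))}. \<alpha> t w) <= b"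
   using exit_event_iff[OF T r \<alpha>[OF w], of "%s th. pp s th w" C b] pc[OF w] by simp
 qed
 finally show ?thesis .
qed

context delay_split begin

lemma zeta_process_measurable:
 fixes Y :: "real => 'a => real"
 assumes Y: "\<And>th. th \<in> {-r..0} ==> Y th \<in> borel_measurable M"
  and c: "\<And>w. w \<in> space M ==> continuous_on {-r..0} (%th. Y th w)"
 shows "(%w. zeta (%th. Y th w)) \<in> borel_measurable M"
proof -
 define hY where "hY p = indicator {..<0} (snd p) * (indicator {-r..0} (snd p) * Y (snd p) (fst p))" for p :: "'a \<times> real"
 note [measurable] = continuous_process_jointly_measurable[OF Y r_pos c]
 have hm[measurable]: "hY \<in> borel_measurable (M \<Otimes>\<^sub>M borel)" unfolding hY_def by measurable
 have [measurable]: "fold_loc r \<in> borel_measurable borel" "fold_sgn \<in> borel_measurable borel"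
  by (simp_all add: fold_loc_def[abs_def] fold_sgn_def[abs_def])
 have [measurable]: "Y 0 \<in> borel_measurable M" using Y[of 0] r_pos by simp
 have h: "hist (%th. Y th w) t = hY (w, t)" for w t by (auto simp: hist_def hY_def indicator_def)
 have "(%q. (LINT u|m. fold_sgn u *\<^sub>R hY (fst q, snd q + fold_loc r u))) \<in> borel_measurable (M \<Otimes>\<^sub>M lborel)"
  by (rule m.borel_measurable_lebesgue_integral) measurable
 then have [measurable]: "(%(w, s). (LINT u|m. fold_sgn u *\<^sub>R hY (w, s + fold_loc r u))) \<in> borel_measurable (M \<Otimes>\<^sub>M lborel)"
  by (simp add: split_def)
 have "(%w. gam * (of_real (Y 0 w) + (LINT s|lborel. of_real (indicator {0..r} s * (LINT u|m. fold_sgn u *\<^sub>R hY (w, s + fold_loc r u)))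
   * exp (- \<i> * of_real (om * s))))) \<in> borel_measurable M"
  by (intro borel_measurable_times borel_measurable_add borel_measurable_const lborel.borel_measurable_lebesgue_integral) measurable
 then show ?thesis by (simp only: zeta_def kick_def Lf_def h)
qed

lemma Pi_seg_scaled: "0 < eps ==> Pi_seg eps t x = (%th. x (eps\<^sup>2 * (t / eps\<^sup>2 + th)))"
 by (simp add: Pi_seg_def fun_eq_iff distrib_left)

lemma Pi_seg_path:
 assumes eps: "0 < eps" and c: "continuous_on {-(eps\<^sup>2 * r)..T} x"
 shows "t \<in> {0..T} ==> Pi_seg eps t x \<in> Cspace r" "continuous_on {0..T} (%t. zeta (Pi_seg eps t x))"
proof -
 have p: "-(eps\<^sup>2 * r) <= eps\<^sup>2 * th" if "-r <= th" for th using mult_left_mono[OF that, of "eps\<^sup>2"] by simp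
 show "Pi_seg eps t x \<in> Cspace r" if "t \<in> {0..T}"
  unfolding Cspace_def Pi_seg_def mem_Collect_eq
 proof (rule continuous_on_compose2[OF c])
  show "(%th. t + eps\<^sup>2 * th) ` {-r..0} \<subseteq> {-(eps\<^sup>2 * r)..T}"
  proof (rule image_subsetI)
   fix th assume "th \<in> {-r..0}"
   then show "t + eps\<^sup>2 * th \<in> {-(eps\<^sup>2 * r)..T}" using p[of th] that mult_nonneg_nonpos[of "eps\<^sup>2" th] by auto
  qed
 qed (intro continuous_intros)
 have "continuous_on {-r..T / eps\<^sup>2} (%tau. x (eps\<^sup>2 * tau))"
  by (rule continuous_on_compose2[OF c]) (use eps p in "auto intro!: continuous_intros simp: pos_le_divide_eq mult.commute")
 note zc = zeta_segment_continuous[OF this]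
 show "continuous_on {0..T} (%t. zeta (Pi_seg eps t x))"
  unfolding Pi_seg_scaled[OF eps]
  by (rule continuous_on_compose2[OF zc]) (use eps in "auto intro!: continuous_intros divide_right_mono")
qed

lemma sol_cong:
 assumes "\<And>th. th \<in> {-r..0} ==> phi th = psi th" shows "sol phi = sol psi"
proof -
 have h: "hist phi = hist psi" using assms by (auto simp: hist_def fun_eq_iff indicator_def)
 have k: "kick phi = kick psi" unfolding kick_def[abs_def] h ..
 show ?thesis using assms[of 0] r_pos by (intro ext) (simp add: sol_def h k)
qed

end

context delay_split begin

lemma alpha_eq:
 assumes "Pi_seg eps t x \<in> Cspace r"
 shows "alpha r L om eps x zh t = (1/2) * (norm (cvec (iexp (- (om * t / eps\<^sup>2)) * zeta (Pi_seg eps t x)) - zh t))\<^sup>2"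
proof -
 have "P_coords r L om (Pi_seg eps t x) = cvec (zeta (Pi_seg eps t x))"
  by (rule P_coords_eq) (use assms Cspace_sub_Chat in blast)
 then show ?thesis by (simp add: alpha_def z_frak_def z_coord_def exp_tB_cvec)
qed

lemma exit_set_eq:
 assumes "0 < eps" "continuous_on {-(eps\<^sup>2 * r)..T} x"
 shows "exit_time r T L om C eps x = Inf (ereal ` {t \<in> {0..T}. C <= sup_norm r (pw (zeta (Pi_seg eps t x)))})"
proof -
 have "pihat r L om (Pi_seg eps t x) = pw (zeta (Pi_seg eps t x))" if "t \<in> {0..T}" for t
  by (rule pihat_eq) (use Pi_seg_path(1)[OF assms that] Cspace_sub_Chat in blast)
 then show ?thesis unfolding exit_time_def by (intro arg_cong[where f="%S. Inf (ereal ` S)"]) auto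
qed

end

context slow_path begin

lemma E_diff_eq: "E t - E 0 = iexp (- (om * t / eps\<^sup>2)) * zeta (Pi_seg eps t x)
  - integral {0..t} (%s. iexp (- (om * s / eps\<^sup>2)) * gam * of_real (Gfun r \<nu>1 \<nu>3 (Pi_seg eps s x))) - zeta (Pi_seg eps 0 x)"
 by (simp add: E_def Z_def ph_def G_def seg_eq)

lemma E_cont: "continuous_on {0..T} E"
 unfolding E_def
 by (intro continuous_on_diff continuous_on_mult ph_cont Z_cont indefinite_integral_continuous_1
  integrable_continuous_interval phG_cont)

lemma Gfun_cong:
 assumes eta: "eta \<in> Cspace r" and e: "\<And>th. th \<in> {-r..0} ==> eta th = \<zeta> th"
 shows "Gfun r \<nu>1 \<nu>3 eta = Gfun r \<nu>1 \<nu>3 \<zeta>"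
proof -
 have \<zeta>: "\<zeta> \<in> Cspace r" using eta e unfolding Cspace_def by (auto intro: continuous_on_eq)
 have "abs (Gfun r \<nu>1 \<nu>3 eta - Gfun r \<nu>1 \<nu>3 \<zeta>) <= V * (1 + (sup_norm r eta)\<^sup>2) * 0"
  by (rule Gfun_lip[OF eta \<zeta>]) (use abs_le_sup_norm[OF Cspace_bounded[OF eta]] e in force)
 then show ?thesis by simp
qed

lemma Y_frak_eq:
 assumes "t \<in> {0..T}" "th \<in> {-r..0}" shows "Y_frak r L om eps x t th = Yf t th"
proof -
 have s: "Pi_seg eps 0 x \<in> Chat_space r" using seg_Chat[of 0] T by (simp add: seg_eq)
 have e: "Pi_seg eps 0 x th = \<xi> th" if "th \<in> {-r..0}" for th
  using forced_xs that by (simp add: seg_eq forced_def)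
 have "sol (qpart (Pi_seg eps 0 x)) = sol (qpart \<xi>)"
  by (rule sol_cong) (use e zeta_cong[of "Pi_seg eps 0 x" \<xi>] in "simp add: qpart_def")
 then show ?thesis
  using That_sol[OF qpart_Chat[OF s], of "t / eps\<^sup>2" th] assms
  by (simp add: Y_frak_def y_part_def one_minus_pihat_eq[OF s] Yf_def)
qed

lemma path_estimate:
 fixes zh :: "real => real^2"
 assumes zc: "continuous_on {0..T} zh" and z0: "zh 0 = z_coord r L om eps x 0"
  and zeq: "\<And>t. t \<in> {0..T} ==>
    ((%s. Gfun r \<nu>1 \<nu>3 (%th. Phi om (exp_tB om (s / eps\<^sup>2) *v zh s) th + Y_frak r L om eps x s th)
          *\<^sub>R (exp_tB om (- s / eps\<^sup>2) *v Psi_tilde r L om))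
       has_integral (zh t - zh 0 - cvec (E t - E 0))) {0..t}"
  and t: "0 <= t" "ereal t <= min (ereal T) (exit_time r T L om C eps x)"
  and Y0: "\<And>u. -r <= u ==> abs (sol (qpart \<xi>) u) <= Y0" and M: "M = C + Y0 + 1"
  and H: "0 <= H" "\<And>a b. a \<in> {0..T} ==> b \<in> {0..T} ==> abs (wp b - wp a) <= H * abs (b - a) powr be" "0 <= be"
  and N: "r <= N" "M0 * exp (- kap * (N - r)) <= 1/2"
  and c: "c = V * (1 + M\<^sup>2) * M * (eps\<^sup>2 * N) + abs sig * (H * (eps\<^sup>2 * N) powr be)"
  and Q: "Q = 2 * ((1 + cz) * (c * exp (K * N)))" and small: "Q * exp (cmod gam * (V * (1 + M\<^sup>2)) * T) <= 1/2"
 shows "alpha r L om eps x zh t <= (1/2) * (Q * exp (cmod gam * (V * (1 + M\<^sup>2)) * T))\<^sup>2"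
proof -
 let ?G = "%s. Gfun r \<nu>1 \<nu>3 (%th. Phi om (exp_tB om (s / eps\<^sup>2) *v zh s) th + Y_frak r L om eps x s th)"
 let ?v = "%s. exp_tB om (- s / eps\<^sup>2) *v Psi_tilde r L om"
 define zc' where "zc' s = Complex (zh s $ 1) (- zh s $ 2)" for s
 have zz: "zh s = cvec (zc' s)" for s by (simp add: zc'_def cvec_surj)
 have tT: "t \<in> {0..T}" using t by simp
 have seg: "Pi_seg eps s x \<in> Cspace r" if "s \<in> {0..T}" for s using Pi_seg_path(1)[OF eps x_cont that] .
 have al: "alpha r L om eps x zh s = (1/2) * (cmod (ph s * Z s - zc' s))\<^sup>2" if "s \<in> {0..T}" for s
  using alpha_eq[OF seg[OF that], of zh] by (simp add: zz ph_def Z_def seg_eq norm_cvec flip: cvec_linear)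
 have z0': "zc' 0 = Z 0"
 proof (rule cvec_inj)
  have "P_coords r L om (Pi_seg eps 0 x) = cvec (zeta (Pi_seg eps 0 x))"
   by (rule P_coords_eq, rule subsetD[OF Cspace_sub_Chat seg]) (use T in simp)
  then show "cvec (zc' 0) = cvec (Z 0)" using z0 unfolding z_coord_def zz Z_def seg_eq by simp
 qed
 show ?thesis
 proof (cases "t = 0")
  case True
  then show ?thesis using al[OF tT] z0' by (simp add: ph_def)
 next
  case False
  have before: "abs (pw (Z s) th) <= C" if s: "s \<in> {0..<t}" and th: "th \<in> {-r..0}" for s th
  proof -
   have sT: "s \<in> {0..T}" using s tT by auto
   have "\<not> C <= sup_norm r (pw (zeta (Pi_seg eps s x)))"
   proof
    assume "C <= sup_norm r (pw (zeta (Pi_seg eps s x)))"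
    then have "exit_time r T L om C eps x <= ereal s"
     unfolding exit_set_eq[OF eps x_cont] using sT by (intro Inf_lower) auto
    with t(2) have "ereal t <= ereal s" by (meson min.boundedE order_trans)
    then show False using s by simp
   qed
   moreover have "abs (pw (zeta (Pi_seg eps s x)) th) <= sup_norm r (pw (zeta (Pi_seg eps s x)))"
    by (rule abs_le_sup_norm[OF Cspace_bounded[OF pw_Cspace] th])
   ultimately show ?thesis by (simp add: Z_def seg_eq)
  qed
  have C: "abs (pw (Z s) th) <= C" if s: "s \<in> {0..t}" and th: "th \<in> {-r..0}" for s th
  proof -
   have cl: "closure {0..<t} = {0..t}" using t False by (intro closure_atLeastLessThan) simp
   have "continuous_on (closure {0..<t}) (%s. \<bar>pw (Z s) th\<bar>)"
    unfolding pw_def cl using tT by (intro continuous_intros continuous_on_subset[OF Z_cont]) auto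
   from continuous_le_on_closure[OF this, of s C] show ?thesis using before th s cl by auto
  qed
  have "continuous_on {0..T} (%s. complex_of_real (zh s $ 1) - \<i> * complex_of_real (zh s $ 2))"
   using zc by (intro continuous_intros)
  then have zcc: "continuous_on {0..T} zc'"
   by (rule continuous_on_eq) (simp add: zc'_def complex_eq_iff)
  have zeq': "((%s. ph s * gam * of_real (Gfun r \<nu>1 \<nu>3 (%th. pw (iexp (om * s / eps\<^sup>2) * zc' s) th + Yf s th)))
    has_integral (zc' u - zc' 0 - (E u - E 0))) {0..u}" if u: "u \<in> {0..T}" for u
  proof -
   have bl: "bounded_linear (%v :: real^2. Complex (v $ 1) (- v $ 2))"
    by (rule bounded_linearI'[where 'a="real^2"]) (auto simp: complex_eq_iff)
   have ci: "Complex (cvec z $ 1) (- cvec z $ 2) = z" for z by (simp add: complex_eq_iff)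
   from has_integral_linear[OF zeq[OF u] bl]
   have "((%s. Complex ((?G s *\<^sub>R ?v s) $ 1)
      (- (?G s *\<^sub>R ?v s) $ 2))
     has_integral (zc' u - zc' 0 - (E u - E 0))) {0..u}"
    unfolding o_def zz cvec_linear[symmetric] ci .
   then show ?thesis
   proof (rule has_integral_eq[rotated])
    fix s assume s: "s \<in> {0..u}"
    then have sT: "s \<in> {0..T}" using u by auto
    have "(%th. pw (iexp (om * s / eps\<^sup>2) * zc' s) th + Yf s th) \<in> Cspace r"
     using Yf_Cspace[OF sT] pw_cont unfolding Cspace_def by (auto intro!: continuous_on_add)
    then have "Gfun r \<nu>1 \<nu>3 (%th. pw (iexp (om * s / eps\<^sup>2) * zc' s) th + Yf s th)
     = ?G s"
     by (rule Gfun_cong) (use Y_frak_eq[OF sT] in "simp add: zz exp_tB_cvec Phi_cvec")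
    then show "Complex ((?G s *\<^sub>R ?v s) $ 1)
      (- (?G s *\<^sub>R ?v s) $ 2)
     = ph s * gam * of_real (Gfun r \<nu>1 \<nu>3 (%th. pw (iexp (om * s / eps\<^sup>2) * zc' s) th + Yf s th))"
     by (simp add: Psi_tilde_eq exp_tB_cvec ph_def complex_eq_iff mult.commute) (simp add: algebra_simps)
   qed
  qed
  have "cmod (ph t * Z t - zc' t) <= Q * exp (cmod gam * (V * (1 + M\<^sup>2)) * T)"
   by (rule core_estimate[OF zcc zeq' z0' tT C Y0 M H N c Q small]) (use t in auto)
  then show ?thesis unfolding al[OF tT] by (intro mult_left_mono power_mono) auto
 qed
qed

end

context delay_split begin

definition err :: "'a measure => real => real => real => (real => 'a => real) => (real => 'a => real^2) => real => 'a set" where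
 "err M T C eps X zh b = {w \<in> space M. (SUP t\<in>{t. 0 <= t \<and> ereal t <= min (ereal T) (exit_time r T L om C eps (%u. X u w))}.
   alpha r L om eps (%u. X u w) (%u. zh u w) t) <= b}"

lemma event_measurable:
 assumes wp: "wiener_process M F W" and eps: "0 < eps" and T: "0 < T"
  and X: "X_solution M F W r T L \<nu>1 \<nu>3 sig \<xi> eps X" and zh: "zhat_solution M F W r T L om \<nu>1 \<nu>3 sig eps X zh"
 shows "err M T C eps X zh b \<in> sets M"
proof -
 interpret wiener_process M F W by (rule wp)
 have sub: "subalgebra M (F t)" for t by (simp add: subalgebra_def space_F sub_F)
 have Xc: "continuous_on {-(eps\<^sup>2 * r)..T} (%t. X t w)" if "w \<in> space M" for w
  using X that by (simp add: X_solution_def)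
 have Xm: "X t \<in> borel_measurable M" if "t \<in> {-(eps\<^sup>2 * r)..T}" for t
  using X that measurable_from_subalg[OF sub] unfolding X_solution_def by blast
 have zm: "zh t \<in> borel_measurable M" if "t \<in> {0..T}" for t
  using zh that measurable_from_subalg[OF sub] unfolding zhat_solution_def by blast
 have zc: "continuous_on {0..T} (%t. zh t w)" if "w \<in> space M" for w
  using zh that by (simp add: zhat_solution_def)
 let ?z = "%t w. zeta (Pi_seg eps t (%u. X u w))"
 note zp = Pi_seg_path[OF eps Xc]
 have zem: "?z t \<in> borel_measurable M" if t: "t \<in> {0..T}" for t
 proof -
  have "-(eps\<^sup>2 * r) <= t + eps\<^sup>2 * th \<and> t + eps\<^sup>2 * th <= T" if "th \<in> {-r..0}" for th
   using mult_left_mono[of "-r" th "eps\<^sup>2"] mult_nonneg_nonpos[of "eps\<^sup>2" th] that t by auto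
  then have 1: "X (t + eps\<^sup>2 * th) \<in> borel_measurable M" if "th \<in> {-r..0}" for th using Xm that by simp
  show ?thesis unfolding Pi_seg_def
   by (rule zeta_process_measurable[OF 1]) (use zp(1)[OF _ t] in "simp_all add: Cspace_def Pi_seg_def")
 qed
 define al where "al t w = (1/2) * (norm (cvec (iexp (- (om * t / eps\<^sup>2)) * ?z t w) - zh t w))\<^sup>2" for t w
 have ale: "alpha r L om eps (%u. X u w) (%u. zh u w) t = al t w" if "w \<in> space M" "t \<in> {0..T}" for w t
  using alpha_eq[OF zp(1)[OF that]] by (simp add: al_def)
 define pp where "pp t th w = pw (?z t w) th" for t th w
 have cvm: "cvec \<in> borel_measurable borel"
  by (intro borel_measurable_continuous_onI linear_continuous_on bounded_linear_cvec)
 have "{w \<in> space M. (SUP t\<in>{t. 0 <= t \<and> ereal t <= min (ereal T) (Inf (ereal ` {t \<in> {0..T}. C <= sup_norm r (%th. pp t th w)}))}. al t w) <= b} \<in> sets M"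
 proof (rule exit_event_measurable[OF T r_pos])
  fix w assume w: "w \<in> space M"
  show "continuous_on {0..T} (%t. al t w)" unfolding al_def
   by (intro continuous_intros continuous_on_compose2[OF linear_continuous_on[OF bounded_linear_cvec]] zp(2)[OF w] zc[OF w]) (use eps in auto)
  show "continuous_on ({0..T} \<times> {-r..0}) (%(s, th). pp s th w)"
   unfolding pp_def pw_def split_def
   by (intro continuous_intros continuous_on_compose2[OF zp(2)[OF w]]) auto
 next
  fix t assume t: "t \<in> {0..T}"
  note [measurable] = zem[OF t] zm[OF t] measurable_compose[OF _ cvm]
  have "(%w. cvec (iexp (- (om * t / eps\<^sup>2)) * ?z t w)) \<in> borel_measurable M" by measurable
  then show "al t \<in> borel_measurable M" unfolding al_def[abs_def] by measurable
  show "pp t th \<in> borel_measurable M" for th unfolding pp_def[abs_def] pw_def by measurable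
 qed
 moreover have "(SUP t\<in>{t. 0 <= t \<and> ereal t <= min (ereal T) (exit_time r T L om C eps (%u. X u w))}.
         alpha r L om eps (%u. X u w) (%u. zh u w) t)
   = (SUP t\<in>{t. 0 <= t \<and> ereal t <= min (ereal T) (Inf (ereal ` {t \<in> {0..T}. C <= sup_norm r (%th. pp t th w)}))}. al t w)"
  if w: "w \<in> space M" for w
  unfolding exit_set_eq[OF eps Xc[OF w]] pp_def by (intro SUP_cong refl ale[OF w]) auto
 ultimately show ?thesis by (simp add: err_def cong: conj_cong)
qed

lemma event_probability:
 assumes wp: "wiener_process M F W" and eps: "0 < eps" and T: "0 < T" and xi: "\<xi> \<in> Cspace r" and V: "0 <= V"
  and G0: "Gfun r \<nu>1 \<nu>3 (%_. 0) = 0"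
  and GL: "\<forall>eta\<in>Cspace r. \<forall>\<zeta>\<in>Cspace r. \<forall>M e. (\<forall>th\<in>{-r..0}. \<bar>eta th\<bar> <= M \<and> abs (\<zeta> th) <= M \<and> abs (eta th - \<zeta> th) <= e) -->
    \<bar>Gfun r \<nu>1 \<nu>3 eta - Gfun r \<nu>1 \<nu>3 \<zeta>\<bar> <= V * (1 + M\<^sup>2) * e"
  and X: "X_solution M F W r T L \<nu>1 \<nu>3 sig \<xi> eps X" and zh: "zhat_solution M F W r T L om \<nu>1 \<nu>3 sig eps X zh"
  and Y0: "\<And>u. -r <= u ==> abs (sol (qpart \<xi>) u) <= Y0" and MM: "MM = C + Y0 + 1"
  and N: "r <= N" "M0 * exp (- kap * (N - r)) <= 1/2"
  and c: "c = V * (1 + MM\<^sup>2) * MM * (eps\<^sup>2 * N) + abs sig * (hoelder_const 8 T * eps powr (-1/4) * (eps\<^sup>2 * N) powr (3/8))"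
  and Q: "Q = 2 * ((1 + cz) * (c * exp (K * N)))" and small: "Q * exp (cmod gam * (V * (1 + MM\<^sup>2)) * T) <= 1/2"
  and b: "(1/2) * (Q * exp (cmod gam * (V * (1 + MM\<^sup>2)) * T))\<^sup>2 <= b"
 shows "1 - hoelder_const 8 T * eps ^ 4 <= measure M (err M T C eps X zh b)"
proof -
 interpret wiener_process M F W by (rule wp)
 define h where "h = hoelder_const 8 T"
 have h0: "0 <= h" unfolding h_def by (rule hoelder_const_ge(3)[OF _ T]) simp
 obtain R where R[measurable]: "R \<in> borel_measurable M" and R0: "\<And>w. 0 <= R w"
  and R1: "(\<integral>\<^sup>+w. ennreal (R w ^ (2*8)) \<partial>M) <= ennreal h"
  and R2: "AE w in M. W 0 w = 0 \<and> continuous_on {0..T} (%t. W t w) \<and>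
    (\<forall>s\<in>{0..T}. \<forall>t\<in>{0..T}. \<bar>W t w - W s w\<bar> <= h * R w * abs (t - s) powr (1/2 - 1/real 8))"
  using hoelder[of 8 T, OF _ T] unfolding h_def by auto
 have Am: "err M T C eps X zh b \<in> sets M" by (rule event_measurable[OF wp eps T X zh])
 have sp: "AE w in M. slow_path r L m om kap Cx gam \<nu>1 \<nu>3 \<xi> (%u. X u w) (%t. W t w) eps T sig V"
  using R2 conjunct2[OF conjunct2[OF X[unfolded X_solution_def]]] AE_space
 proof eventually_elim
  case (elim w)
  show ?case
   by (intro slow_path.intro delay_split_axioms slow_path_axioms.intro)
    (use elim eps T xi V G0 GL X in "auto simp: X_solution_def")
 qed
 from zh obtain N' :: "real => 'a => real^2" where
  Ni: "\<forall>t\<in>{0..T}. \<forall>i. has_wiener_integral M W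
      (%s. (exp_tB om (- s / eps\<^sup>2) *v (sig *\<^sub>R Psi_tilde r L om)) $ i) t (%w. N' t w $ i)"
  and Neq: "AE w in M. \<forall>t\<in>{0..T}.
      ((%s. Gfun r \<nu>1 \<nu>3 (%th. Phi om (exp_tB om (s / eps\<^sup>2) *v zh s w) th
                  + Y_frak r L om eps (%u. X u w) s th)
          *\<^sub>R (exp_tB om (- s / eps\<^sup>2) *v Psi_tilde r L om))
       has_integral (zh t w - zh 0 w - N' t w)) {0..t}"
  and z0: "AE w in M. zh 0 w = z_coord r L om eps (%u. X u w) 0"
  and zc: "\<And>w. w \<in> space M ==> continuous_on {0..T} (%t. zh t w)"
  unfolding zhat_solution_def by blast
 define J where "J t w = iexp (- (om * t / eps\<^sup>2)) * zeta (Pi_seg eps t (%u. X u w))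
  - integral {0..t} (%s. iexp (- (om * s / eps\<^sup>2)) * gam * of_real (Gfun r \<nu>1 \<nu>3 (Pi_seg eps s (%u. X u w)))) - zeta (Pi_seg eps 0 (%u. X u w))"
  for t w
 have hh: "exp_tB om (- s / eps\<^sup>2) *v (sig *\<^sub>R Psi_tilde r L om) = cvec (iexp (- (om * s / eps\<^sup>2)) * gam * of_real sig)" for s
  unfolding Psi_tilde_eq cvec_linear(4)[symmetric] exp_tB_cvec by (simp add: scaleR_conv_of_real mult_ac)
 have NJ: "AE w in M. N' t w $ i = cvec (J t w) $ i" if t: "t \<in> {0..T}" for t i
 proof -
  have t0: "0 <= t" using t by simp
  define g where "g s = cvec (iexp (- (om * s / eps\<^sup>2)) * gam * of_real sig) $ i" for s
  have I: "has_wiener_integral M W g t (%w. N' t w $ i)" using Ni t unfolding hh g_def by blast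
  have gc: "continuous_on UNIV g" unfolding g_def
   by (intro continuous_intros continuous_on_compose2[OF linear_continuous_on[OF bounded_linear_cvec]]) (use eps in auto)
  show ?thesis
  proof (rule wiener_integral_limit[OF I step_partition_upart[OF t0]])
   show "(%k. \<integral>\<^sup>+u\<in>{0..t}. ennreal ((g u - step_fun (Suc k) (upart t k) (%i. g (upart t k i)) u)\<^sup>2) \<partial>lborel) \<longlonglongrightarrow> 0"
   proof (rule left_step_converges[OF t0 _ _ finite.emptyI, where B="cmod gam * abs sig"])
    show "set_borel_measurable lborel {0..t} g" using I by (simp add: has_wiener_integral_def)
    show "abs (g u) <= cmod gam * abs sig" for u
     using component_le_norm_cart[of "cvec (iexp (- (om * u / eps\<^sup>2)) * gam * of_real sig)" i]
     by (simp add: g_def norm_cvec norm_mult)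
    show "continuous (at u within {0..t}) g" for u
     using gc by (simp add: continuous_on_eq_continuous_at continuous_at_imp_continuous_at_within)
   qed
   show "AE w in M. (%k. step_integral W (Suc k) (upart t k) (%i. g (upart t k i)) w) \<longlonglongrightarrow> cvec (J t w) $ i"
    using sp
   proof eventually_elim
    case (elim w)
    interpret slow_path r L m om kap Cx gam \<nu>1 \<nu>3 \<xi> "%u. X u w" "%t. W t w" eps T sig V by (rule elim)
    have bl: "bounded_linear (%z. cvec z $ i)"
     by (rule bounded_linear_compose[OF bounded_linear_vec_nth bounded_linear_cvec])
    have s: "step_integral W (Suc k) (upart t k) (%i. g (upart t k i)) w = cvec (\<Sum>i<Suc k. ph (upart t k i) * gam *
       of_real (sig * (W (upart t k (Suc i)) w - W (upart t k i) w))) $ i" for k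
     unfolding step_integral_def Real_Vector_Spaces.linear_sum[OF bounded_linear.linear[OF bl]] g_def ph_def
     using exhaust_2[of i] by (intro sum.cong refl) (auto simp: algebra_simps)
    show ?case unfolding s J_def E_diff_eq[symmetric]
     by (rule bounded_linear.tendsto[OF bl E_limit[OF t]])
   qed
  qed
 qed
 have "AE w in M. \<forall>t\<in>{0<..<T} \<inter> \<rat>. N' t w = cvec (J t w)"
 proof (subst AE_ball_countable, simp add: countable_rat, intro ballI)
  fix t assume "t \<in> {0<..<T} \<inter> \<rat>"
  then have t: "t \<in> {0..T}" by auto
  show "AE w in M. N' t w = cvec (J t w)"
   using NJ[OF t, of 1] NJ[OF t, of 2] by eventually_elim (simp add: vec_eq_iff forall_2)
 qed
 with sp Neq z0 R2 AE_space have key: "AE w in M. w \<in> {w \<in> space M. R w <= eps powr (-1/4)} --> w \<in> err M T C eps X zh b"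
 proof eventually_elim
  case (elim w)
  interpret slow_path r L m om kap Cx gam \<nu>1 \<nu>3 \<xi> "%u. X u w" "%t. W t w" eps T sig V by (rule elim(1))
  let ?g = "%s. Gfun r \<nu>1 \<nu>3 (%th. Phi om (exp_tB om (s / eps\<^sup>2) *v zh s w) th + Y_frak r L om eps (%u. X u w) s th)
          *\<^sub>R (exp_tB om (- s / eps\<^sup>2) *v Psi_tilde r L om)"
  have Nc: "N' t w = zh t w - zh 0 w - integral {0..t} ?g" if "t \<in> {0..T}" for t
   using elim(2) that by (auto simp: has_integral_iff)
  have Jc: "J t w = E t - E 0" for t unfolding J_def E_diff_eq ..
  have NE: "N' t w = cvec (E t - E 0)" if t: "t \<in> {0..T}" for t
  proof -
   have gi: "?g integrable_on {0..T}" using elim(2) T by (auto simp: has_integral_iff)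
   have "continuous_on {0..T} (%t. norm ((zh t w - zh 0 w - integral {0..t} ?g) - cvec (E t - E 0)))"
    by (intro continuous_on_norm continuous_on_diff zc[OF elim(5)] continuous_on_const indefinite_integral_continuous_1[OF gi]
     continuous_on_compose2[OF linear_continuous_on[OF bounded_linear_cvec], of "{0..T}" "%t. E t - E 0" UNIV] E_cont) auto
   then have "continuous_on (closure ({0<..<T} \<inter> \<rat>)) (%t. norm ((zh t w - zh 0 w - integral {0..t} ?g) - cvec (E t - E 0)))"
    by (simp add: closure_Ioo_Rats[OF T])
   from continuous_le_on_closure[OF this, of t 0] t elim(6) Nc
   have "norm ((zh t w - zh 0 w - integral {0..t} ?g) - cvec (E t - E 0)) <= 0"
    by (auto simp: closure_Ioo_Rats[OF T] Jc)
   then show ?thesis using Nc[OF t] by simp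
  qed
  show ?case unfolding err_def
  proof (intro impI CollectI conjI elim(5))
   assume "w \<in> {w \<in> space M. R w <= eps powr (-1/4)}"
   then have Rw: "h * R w <= h * eps powr (-1/4)" using h0 by (auto intro: mult_left_mono)
   have W: "abs (W b w - W a w) <= (h * eps powr (-1/4)) * abs (b - a) powr (3/8)" if "a \<in> {0..T}" "b \<in> {0..T}" for a b
   proof -
    have "abs (W b w - W a w) <= h * R w * abs (b - a) powr (3/8)" using elim(4) that by simp
    also have "... <= (h * eps powr (-1/4)) * abs (b - a) powr (3/8)" by (rule mult_right_mono[OF Rw]) simp
    finally show ?thesis .
   qed
   show "(SUP t\<in>{t. 0 <= t \<and> ereal t <= min (ereal T) (exit_time r T L om C eps (%u. X u w))}.
         alpha r L om eps (%u. X u w) (%u. zh u w) t) <= b"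
   proof (rule cSUP_least)
    have "0 <= exit_time r T L om C eps (%u. X u w)" unfolding exit_time_def by (rule Inf_greatest) auto
    then show "{t. 0 <= t \<and> ereal t <= min (ereal T) (exit_time r T L om C eps (%u. X u w))} ~= {}"
     using T by (auto intro!: exI[of _ 0] simp: zero_ereal_def)
    fix t assume t: "t \<in> {t. 0 <= t \<and> ereal t <= min (ereal T) (exit_time r T L om C eps (%u. X u w))}"
    have zeq: "(?g has_integral (zh t w - zh 0 w - cvec (E t - E 0))) {0..t}" if "t \<in> {0..T}" for t
     using bspec[OF elim(2) that] unfolding NE[OF that] .
    have "alpha r L om eps (%u. X u w) (%u. zh u w) t <= (1/2) * (Q * exp (cmod gam * (V * (1 + MM\<^sup>2)) * T))\<^sup>2"
     by (rule path_estimate[OF zc[OF elim(5)] elim(3) zeq _ _ Y0 MM _ W _ N c[folded h_def] Q small]) (use t h0 in auto)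
    then show "alpha r L om eps (%u. X u w) (%u. zh u w) t <= b" using b by linarith
   qed
  qed
 qed
 have "emeasure M {w \<in> space M. \<not> R w <= eps powr (-1/4)} <= (\<integral>\<^sup>+w. ennreal (eps^4) * ennreal (R w ^ (2*8)) \<partial>M)"
 proof (subst nn_integral_indicator[symmetric], measurable, intro nn_integral_mono)
  fix w
  show "indicator {w \<in> space M. \<not> R w <= eps powr (-1/4)} w <= ennreal (eps^4) * ennreal (R w ^ (2*8))"
  proof (cases "R w <= eps powr (-1/4)")
   case False
   have "(eps powr (-1/4)) ^ (2*8) = eps powr (- real 4)"
    using eps by (simp add: powr_realpow[symmetric] powr_powr)
   then have "1 = eps^4 * (eps powr (-1/4)) ^ (2*8)"
    using eps by (simp only: powr_minus powr_realpow) simp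
   also have "... <= eps^4 * R w ^ (2*8)" using False by (intro mult_left_mono power_mono) auto
   finally show ?thesis using eps R0 by (auto simp: indicator_def ennreal_mult[symmetric])
  qed (simp add: indicator_def)
 qed
 also have "... <= ennreal (eps^4) * ennreal h" using R1 by (subst nn_integral_cmult) (auto intro: mult_left_mono)
 also have "... = ennreal (h * eps^4)" using eps h0 by (simp add: ennreal_mult mult.commute)
 finally have "measure M {w \<in> space M. \<not> R w <= eps powr (-1/4)} <= h * eps^4"
  using h0 by (simp add: emeasure_eq_measure)
 then have "1 - h * eps^4 <= measure M {w \<in> space M. R w <= eps powr (-1/4)}"
  using prob_neg[of "%w. R w <= eps powr (-1/4)"] by simp
 also have "... <= measure M (err M T C eps X zh b)" by (rule finite_measure_mono_AE[OF key Am])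
 finally show ?thesis by (simp add: h_def)
qed

lemma averaging_estimate:
 assumes T: "0 < T" and xi: "\<xi> \<in> Cspace r" and V: "0 <= V" and C: "0 < C"
  and G0: "Gfun r \<nu>1 \<nu>3 (%_. 0) = 0"
  and GL: "\<forall>eta\<in>Cspace r. \<forall>\<zeta>\<in>Cspace r. \<forall>M e. (\<forall>th\<in>{-r..0}. \<bar>eta th\<bar> <= M \<and> abs (\<zeta> th) <= M \<and> abs (eta th - \<zeta> th) <= e) -->
    \<bar>Gfun r \<nu>1 \<nu>3 eta - Gfun r \<nu>1 \<nu>3 \<zeta>\<bar> <= V * (1 + M\<^sup>2) * e"
 shows "\<exists>e>0. \<forall>eps. 0 < eps \<and> eps < e --> eps <= 1 \<and>
  (\<forall>(M :: 'a measure) F W X zh a. 0 <= a \<and> a < 1 \<and> wiener_process M F W \<and> X_solution M F W r T L \<nu>1 \<nu>3 sig \<xi> eps X \<and>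
    zhat_solution M F W r T L om \<nu>1 \<nu>3 sig eps X zh -->
    1 - sqrt r * eps <= measure M (err M T C eps X zh (eps powr (a / 2))))"
proof -
 note xC = subsetD[OF Cspace_sub_Chat xi]
 note q = qpart_Chat[OF xC]
 then have "bounded (qpart \<xi> ` {-r..0})" by (simp add: Chat_space_def)
 then obtain B where B: "\<forall>th\<in>{-r..0}. \<bar>qpart \<xi> th\<bar> <= B" by (auto simp: bounded_iff)
 have B0: "0 <= B" using order_trans[OF abs_ge_zero bspec[OF B, of 0]] r_pos by simp
 define Y0 where "Y0 = M0 * B + B"
 have Y0: "abs (sol (qpart \<xi>) u) <= Y0" if "-r <= u" for u
 proof (cases "0 <= u")
  case True
  have "abs (sol (qpart \<xi>) u - pw (zeta (qpart \<xi>)) u) <= M0 * B * exp (- kap * u)"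
   by (rule sol_decay[OF q _ True]) (rule bspec[OF B])
  also have "... <= M0 * B * 1" using True kappa_pos M0_nonneg B0 by (intro mult_left_mono) auto
  finally show ?thesis
   unfolding zeta_qpart[OF xC] using B0 by (simp add: Y0_def pw_def)
 next
  case False
  then show ?thesis using sol_hist[of u "qpart \<xi>"] B that M0_nonneg B0 by (auto simp: Y0_def intro: add_increasing)
 qed
 have Y00: "0 <= Y0" using M0_nonneg B0 by (simp add: Y0_def)
 define MM where "MM = C + Y0 + 1"
 have MM: "0 <= MM" using C Y00 by (simp add: MM_def)
 define N where "N = r + ln (2 * M0 + 2) / kap"
 have N: "r <= N" "M0 * exp (- kap * (N - r)) <= 1/2"
  using M0_nonneg kappa_pos by (auto simp: N_def exp_minus field_simps)
 have N0: "0 <= N" using N r_pos by simp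
 define h where "h = hoelder_const 8 T"
 have h0: "0 <= h" unfolding h_def by (rule hoelder_const_ge(3)[OF _ T]) simp
 define eG where "eG = exp (cmod gam * (V * (1 + MM\<^sup>2)) * T)"
 define Bc where "Bc = V * (1 + MM\<^sup>2) * MM * N + abs sig * (h * N powr (3/8))"
 have Bc: "0 <= Bc" unfolding Bc_def using V MM N0 h0 by (intro add_nonneg_nonneg mult_nonneg_nonneg) auto
 define D where "D = 2 * ((1 + cz) * (Bc * exp (K * N))) * eG"
 have D: "0 <= D" unfolding D_def eG_def using Bc cz_nonneg by simp
 define e where "e = min 1 (min ((1 / (2 * (D + 1)\<^sup>2))\<^sup>2) (sqrt r / (h + 1)))"
 have e: "0 < e" using D h0 r_pos by (auto simp: e_def intro!: divide_pos_pos zero_less_power)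
 have e1: "eps <= 1" if "eps < e" for eps using that by (simp add: e_def)
 show ?thesis
 proof (rule exI[of _ e], rule conjI[OF e], intro allI impI conjI; elim conjE)
  fix eps a :: real and M :: "'a measure" and F W X zh
  assume eps: "0 < eps" "eps < e" and A: "0 <= a" "a < 1" "wiener_process M F W"
   "X_solution M F W r T L \<nu>1 \<nu>3 sig \<xi> eps X" "zhat_solution M F W r T L om \<nu>1 \<nu>3 sig eps X zh"
  note e1 = e1[OF eps(2)]
  define c where "c = V * (1 + MM\<^sup>2) * MM * (eps\<^sup>2 * N) + abs sig * (h * eps powr (-1/4) * (eps\<^sup>2 * N) powr (3/8))"
  define Q where "Q = 2 * ((1 + cz) * (c * exp (K * N)))"
  have "eps * eps <= eps * 1" by (rule mult_left_mono[OF e1]) (rule less_imp_le[OF eps(1)])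
  then have e2: "eps\<^sup>2 <= eps" unfolding power2_eq_square by simp
  then have sq: "eps <= sqrt eps" by (rule real_le_rsqrt)
  have "eps powr (-1/4) * (eps\<^sup>2 * N) powr (3/8) = sqrt eps * N powr (3/8)"
  proof -
   have "eps\<^sup>2 = eps powr 2" using eps(1) by (simp add: powr_numeral)
   then have 1: "(eps\<^sup>2) powr (3/8) = eps powr (3/4)" by (simp only: powr_powr) simp
   have "eps powr (-1/4) * eps powr (3/4) = eps powr (1/2)" by (simp only: powr_add[symmetric]) simp
   also have "... = sqrt eps" using eps(1) by (simp only: powr_half_sqrt less_imp_le)
   finally show ?thesis unfolding powr_mult 1 by (simp only: mult.assoc[symmetric])
  qed
  then have "c = V * (1 + MM\<^sup>2) * MM * N * eps\<^sup>2 + abs sig * (h * N powr (3/8)) * sqrt eps"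
   unfolding c_def by (simp add: mult_ac)
  also have "... <= V * (1 + MM\<^sup>2) * MM * N * sqrt eps + abs sig * (h * N powr (3/8)) * sqrt eps"
  proof (intro add_right_mono mult_left_mono)
   show "eps\<^sup>2 <= sqrt eps" using e2 sq by linarith
  qed (use V MM N0 in simp)
  finally have cB: "c <= Bc * sqrt eps" by (simp add: Bc_def distrib_right)
  have c0: "0 <= c" unfolding c_def using V MM N0 h0 by (intro add_nonneg_nonneg mult_nonneg_nonneg) auto
  have "Q * eG <= 2 * ((1 + cz) * (Bc * sqrt eps * exp (K * N))) * eG"
   unfolding Q_def eG_def using cB cz_nonneg by (intro mult_right_mono mult_left_mono) auto
  then have QD: "Q * eG <= D * sqrt eps" by (simp add: D_def mult_ac)
  have Q0: "0 <= Q * eG" unfolding Q_def eG_def using c0 cz_nonneg by simp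
  have "sqrt eps <= sqrt ((1 / (2 * (D + 1)\<^sup>2))\<^sup>2)" using eps by (intro real_sqrt_le_mono) (simp add: e_def)
  then have "sqrt eps <= 1 / (2 * (D + 1)\<^sup>2)" using D by simp
  then have sD: "(D + 1)\<^sup>2 * sqrt eps <= 1/2" using D by (simp add: field_simps)
  have D2: "D <= (D + 1)\<^sup>2" "D\<^sup>2 <= (D + 1)\<^sup>2" using D by (simp_all add: power2_eq_square algebra_simps)
  have s0: "0 <= sqrt eps" using eps by simp
  have small: "Q * eG <= 1/2"
   using QD sD mult_right_mono[OF D2(1) s0] by linarith
  have bb: "(1/2) * (Q * eG)\<^sup>2 <= eps powr (a/2)"
  proof -
   have "(Q * eG)\<^sup>2 <= (D * sqrt eps)\<^sup>2" by (rule power_mono[OF QD Q0])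
   also have "... = D\<^sup>2 * sqrt eps * sqrt eps" using eps by (simp add: power_mult_distrib)
   also have "... <= 1/2 * sqrt eps"
    by (rule mult_right_mono[OF order_trans[OF mult_right_mono[OF D2(2) s0] sD] s0])
   finally have "(1/2) * (Q * eG)\<^sup>2 <= sqrt eps" using s0 by linarith
   also have "... = eps powr (1/2)" using eps by (simp add: powr_half_sqrt)
   also have "... <= eps powr (a/2)" using eps e1 A by (intro powr_mono') auto
   finally show ?thesis .
  qed
  have "h * eps^4 <= (h + 1) * eps * eps"
  proof -
   have "eps^4 <= eps^2" using eps e1 by (intro power_decreasing) auto
   then have "h * eps^4 <= (h + 1) * eps^2" using h0 eps by (intro mult_mono) auto
   then show ?thesis by (simp add: power2_eq_square mult.assoc)
  qed
  also have "... <= sqrt r * eps"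
  proof (rule mult_right_mono)
   have "eps <= sqrt r / (h + 1)" using eps by (simp add: e_def)
   then show "(h + 1) * eps <= sqrt r" using h0 by (simp add: pos_le_divide_eq mult.commute)
  qed (use eps in simp)
  finally have "1 - sqrt r * eps <= 1 - hoelder_const 8 T * eps^4" by (simp add: h_def)
  also have "... <= measure M (err M T C eps X zh (eps powr (a / 2)))"
   by (rule event_probability[OF A(3) eps(1) T xi V G0 GL A(4,5) Y0 MM_def N c_def[unfolded h_def] Q_def small[unfolded eG_def] bb[unfolded eG_def]])
  finally show "1 - sqrt r * eps <= measure M (err M T C eps X zh (eps powr (a / 2)))" .
 qed (rule e1)
qed

end

lemma p_eps_tendsto:
 assumes "0 < T" "0 < r" "0 <= a" "2 * a < \<delta>"
 shows "((%eps. p_eps r T K a \<delta> eps) \<longlongrightarrow> 1) (at_right 0)"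
proof -
 define be where "be = \<delta> - 2 * a"
 have be: "0 < be" using assms by (simp add: be_def)
 have \<delta>: "0 < \<delta>" using assms by simp
 have "((%eps. eps powr be * ln (T / (r * eps powr \<delta>))) \<longlongrightarrow> 0) (at_right 0)"
  using be \<delta> assms(1,2) by real_asymp
 then have "((%eps. 1 - K * sqrt (r * (eps powr be * ln (T / (r * eps powr \<delta>))))) \<longlongrightarrow> 1 - K * sqrt (r * 0)) (at_right 0)"
  by (intro tendsto_intros)
 moreover have "\<forall>\<^sub>F eps in at_right 0. 1 - K * sqrt (r * (eps powr be * ln (T / (r * eps powr \<delta>)))) = p_eps r T K a \<delta> eps"
  using eventually_at_right_less[of 0]
 proof eventually_elim
  case (elim eps)
  have "eps powr be = (eps powr (-a))\<^sup>2 * eps powr \<delta>"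
   by (simp add: be_def power2_eq_square powr_add[symmetric])
  then have "sqrt (r * (eps powr be * ln (T / (r * eps powr \<delta>)))) = sqrt ((eps powr (-a))\<^sup>2 * (r * eps powr \<delta> * ln (T / (r * eps powr \<delta>))))"
   by (simp add: mult_ac)
  also have "... = eps powr (-a) * sqrt (r * eps powr \<delta> * ln (T / (r * eps powr \<delta>)))"
   unfolding real_sqrt_mult[of "(eps powr (-a))\<^sup>2"] by simp
  finally show ?case by (simp add: p_eps_def mult.assoc)
 qed
 ultimately show ?thesis by (simp add: tendsto_cong)
qed

lemma p_eps_le:
 assumes "0 < r" "0 < eps" "eps <= 1" "exp 1 <= T / (r * eps powr \<delta>)" "0 <= a" "\<delta> <= 2"
 shows "p_eps r T 1 a \<delta> eps <= 1 - sqrt r * eps"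
proof -
 have p: "0 < r * eps powr \<delta>" using assms by simp
 have "0 < T / (r * eps powr \<delta>)" by (rule less_le_trans[OF exp_gt_zero assms(4)])
 then have ln: "1 <= ln (T / (r * eps powr \<delta>))" using assms(4) by (simp add: ln_ge_iff)
 have "eps powr 2 <= eps powr \<delta>" using assms by (intro powr_mono') auto
 then have "r * eps\<^sup>2 <= r * eps powr \<delta> * 1" using assms by (simp add: powr_numeral)
 also have "... <= r * eps powr \<delta> * ln (T / (r * eps powr \<delta>))" by (rule mult_left_mono[OF ln less_imp_le[OF p]])
 finally have "sqrt (r * eps\<^sup>2) <= sqrt (r * eps powr \<delta> * ln (T / (r * eps powr \<delta>)))" by (rule real_sqrt_le_mono)
 then have s: "sqrt r * eps <= sqrt (r * eps powr \<delta> * ln (T / (r * eps powr \<delta>)))"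
  using assms by (simp add: real_sqrt_mult)
 have "eps powr 0 <= eps powr (-a)" using assms by (intro powr_mono') auto
 then have "1 * (sqrt r * eps) <= eps powr (-a) * sqrt (r * eps powr \<delta> * ln (T / (r * eps powr \<delta>)))"
  using assms by (intro mult_mono s) auto
 then show ?thesis by (simp add: p_eps_def)
qed

theorem proposition3p4:
  fixes r T \<omega> \<sigma> :: real
    and L :: "(real \<Rightarrow> real) \<Rightarrow> real"
    and \<nu>1 \<nu>3 \<xi> :: "real \<Rightarrow> real"
  assumes "r > 0" and "T > 0"
    and "bounded_linear_on_C r L"
    and "\<omega> > 0" and "char_condition L \<omega>"
    and "integrator r \<nu>1" and "integrator r \<nu>3"
    and "\<xi> \<in> Cspace r"
  shows "\<exists>K>0. \<exists>\<epsilon>hat :: real \<Rightarrow> real.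
    (\<forall>\<delta>\<in>{0<..<2}. \<epsilon>hat \<delta> > 0) \<and>
    (\<forall>\<delta>\<in>{0<..<2}. \<forall>\<epsilon>. 0 < \<epsilon> \<and> \<epsilon> < \<epsilon>hat \<delta> \<longrightarrow>
      (\<forall>(M :: 'a measure) F W Z.
        wiener_process M F W \<and> stochastic_convolution M W r T L \<omega> \<sigma> \<epsilon> Z \<longrightarrow>
        integrable M (\<lambda>w. SUP s\<in>{0..T}. Upsilon r Z s w) \<and>
        (LINT w|M. (SUP s\<in>{0..T}. Upsilon r Z s w))
          \<le> K * sqrt (r * \<epsilon> powr \<delta> * ln (2 * T / (r * \<epsilon> powr \<delta>))))) \<and>
    (\<exists>\<epsilon>1 \<epsilon>2 :: real \<Rightarrow> real \<Rightarrow> real.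
      (\<forall>a\<in>{0..<1}. \<forall>C>0. \<epsilon>1 a C > 0 \<and> \<epsilon>2 a C > 0) \<and>
      (\<forall>C>0. \<forall>a\<in>{0..<1}. \<forall>\<delta>\<in>{2 * a<..<2}.
        (\<forall>\<epsilon>. 0 < \<epsilon> \<and> \<epsilon> < Min {\<epsilon>hat \<delta>, \<epsilon>1 a C, \<epsilon>2 a C} \<longrightarrow>
          (\<forall>(M :: 'a measure) F W X zh.
            wiener_process M F W \<and>
            X_solution M F W r T L \<nu>1 \<nu>3 \<sigma> \<xi> \<epsilon> X \<and>
            zhat_solution M F W r T L \<omega> \<nu>1 \<nu>3 \<sigma> \<epsilon> X zh \<longrightarrow>
            measure M {w \<in> space M.
              (SUP t\<in>{t. 0 \<le> t \<and> ereal t \<le> min (ereal T) (exit_time r T L \<omega> C \<epsilon> (\<lambda>u. X u w))}.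
                 alpha r L \<omega> \<epsilon> (\<lambda>u. X u w) (\<lambda>u. zh u w) t) \<le> \<epsilon> powr (a / 2)}
            \<ge> p_eps r T K a \<delta> \<epsilon>)) \<and>
        ((\<lambda>\<epsilon>. p_eps r T K a \<delta> \<epsilon>) \<longlongrightarrow> 1) (at_right 0)) \<and>
      (\<forall>a\<in>{0<..<1}.
        (\<lambda>C. \<epsilon>1 a C) \<in> O[at_top](\<lambda>C. min (C powr (- 3 / (2 - a))) (C powr (- 3 / (2 * a)))) \<and>
        (\<lambda>C. \<epsilon>2 a C) \<in> O[at_top](\<lambda>C. exp (- 30 * C\<^sup>2 * T / a))))"
proof -
 obtain m where m: "folded_rep r L m"
  using riesz_folded[OF assms(1,3)] unfolding folded_rep_def by blast
 interpret d: delay r L m by standard (use assms m in auto)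
 interpret dc: delay_char r L m \<omega> by standard (use assms in auto)
 obtain \<kappa> Cx \<gamma> where kap: "0 < \<kappa>" "0 <= Cx"
  "\<forall>t\<ge>0. \<bar>dc.X0 t - Re (\<gamma> * exp (\<i> * of_real (\<omega> * t)))\<bar> <= Cx * exp (- \<kappa> * t)"
  using dc.X0_decay by blast
 interpret s: delay_split r L m \<omega> \<kappa> Cx \<gamma> by standard (use kap in auto)
 obtain V where V: "0 <= V" and G0: "Gfun r \<nu>1 \<nu>3 (%_. 0) = 0"
  and GL: "\<forall>\<eta>\<in>Cspace r. \<forall>\<zeta>\<in>Cspace r. \<forall>M e. (\<forall>\<theta>\<in>{-r..0}. \<bar>\<eta> \<theta>\<bar> <= M \<and> \<bar>\<zeta> \<theta>\<bar> <= M \<and> \<bar>\<eta> \<theta> - \<zeta> \<theta>\<bar> <= e) -->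
    \<bar>Gfun r \<nu>1 \<nu>3 \<eta> - Gfun r \<nu>1 \<nu>3 \<zeta>\<bar> <= V * (1 + M\<^sup>2) * e"
  using Gfun_lipschitz[OF assms(6,7,1)] by blast
 define P1 where "P1 \<delta> e \<longleftrightarrow> 0 < e \<and> (\<forall>\<epsilon>. 0 < \<epsilon> \<and> \<epsilon> < e --> exp 1 <= T / (r * \<epsilon> powr \<delta>) \<and>
  (\<forall>(M :: 'a measure) F W Z. wiener_process M F W \<and> stochastic_convolution M W r T L \<omega> \<sigma> \<epsilon> Z -->
    integrable M (%w. SUP s\<in>{0..T}. Upsilon r Z s w) \<and>
    (LINT w|M. (SUP s\<in>{0..T}. Upsilon r Z s w)) <= sqrt (r * \<epsilon> powr \<delta> * ln (2 * T / (r * \<epsilon> powr \<delta>)))))" for \<delta> e :: real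
 define P2 where "P2 C e \<longleftrightarrow> 0 < e \<and> (\<forall>\<epsilon>. 0 < \<epsilon> \<and> \<epsilon> < e --> \<epsilon> <= 1 \<and>
  (\<forall>(M :: 'a measure) F W X zh a. 0 <= a \<and> a < 1 \<and> wiener_process M F W \<and> X_solution M F W r T L \<nu>1 \<nu>3 \<sigma> \<xi> \<epsilon> X \<and>
    zhat_solution M F W r T L \<omega> \<nu>1 \<nu>3 \<sigma> \<epsilon> X zh -->
    1 - sqrt r * \<epsilon> <= measure M (s.err M T C \<epsilon> X zh (\<epsilon> powr (a / 2)))))" for C e :: real
 have "\<forall>\<delta>\<in>{0<..<2}. \<exists>e. P1 \<delta> e"
  using s.convolution_expectation[OF assms(2), where 'a='a] unfolding P1_def by simp
 then obtain h where h: "\<forall>\<delta>\<in>{0<..<2}. P1 \<delta> (h \<delta>)" by (rule bchoice[THEN exE])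
 have "\<forall>C\<in>{0<..}. \<exists>e. P2 C e"
  using s.averaging_estimate[OF assms(2,8) V _ G0 GL, where 'a='a] unfolding P2_def by simp
 then obtain eC where eC: "\<forall>C\<in>{0<..}. P2 C (eC C)" by (rule bchoice[THEN exE])
 define \<epsilon>1 where "\<epsilon>1 a C = min (eC C) (min (C powr (- 3 / (2 - a))) (C powr (- 3 / (2 * a))))" for a C
 define \<epsilon>2 where "\<epsilon>2 a C = exp (- 30 * C\<^sup>2 * T / a)" for a C :: real
 have eC0: "0 < eC C" if "0 < C" for C using eC that by (simp add: P2_def)
 show ?thesis
 proof (rule exI[of _ 1], rule conjI[OF zero_less_one], rule exI[of _ h], intro conjI, goal_cases)
  case 1
  show ?case using h by (simp add: P1_def)
 next
  case 2
  show ?case using h by (simp add: P1_def)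
 next
  case 3
  show ?case
  proof (rule exI[of _ \<epsilon>1], rule exI[of _ \<epsilon>2], intro conjI ballI allI impI, goal_cases)
   case (3 C a \<delta> \<epsilon> M F W X zh)
   then have e: "0 < \<epsilon>" "\<epsilon> < h \<delta>" "\<epsilon> < eC C" by (auto simp: \<epsilon>1_def)
   have "P1 \<delta> (h \<delta>)" using h 3 by simp
   then have 1: "exp 1 <= T / (r * \<epsilon> powr \<delta>)" using e unfolding P1_def by blast
   have P2: "P2 C (eC C)" using eC 3 by simp
   then have le1: "\<epsilon> <= 1" using e unfolding P2_def by blast
   have "p_eps r T 1 a \<delta> \<epsilon> <= 1 - sqrt r * \<epsilon>"
    by (rule p_eps_le[OF assms(1) e(1) le1 1]) (use 3 in auto)
   also have "... <= measure M (s.err M T C \<epsilon> X zh (\<epsilon> powr (a / 2)))"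
    using P2[unfolded P2_def, THEN conjunct2, rule_format, of \<epsilon>] e 3 by simp
   finally show ?case unfolding s.err_def .
  next
   case (4 C a \<delta>)
   then show ?case by (intro p_eps_tendsto[OF assms(2,1)]) auto
  next
   case (5 a)
   show ?case
   proof (rule bigoI[of _ 1], rule eventually_mono[OF eventually_gt_at_top[of 0]])
    fix C :: real assume "0 < C"
    then have "0 < \<epsilon>1 a C" using eC0 by (simp add: \<epsilon>1_def)
    then show "norm (\<epsilon>1 a C) <= 1 * norm (min (C powr (- 3 / (2 - a))) (C powr (- 3 / (2 * a))))"
     by (simp only: real_norm_def abs_of_pos mult_1 \<epsilon>1_def order_trans[OF min.cobounded2 abs_ge_self])
   qed
  qed (use eC0 in "simp_all add: \<epsilon>1_def \<epsilon>2_def")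
 qed
qed

end
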